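(* For every positive integer $n$, $$\omega_x\,\mathrm{ch}(\psi_n)=\sum_{w\in\mathcal{D}^B_n}F_{\mathrm{sDes}(w)}(x,y)=\sum_{w\in\mathcal{E}^B_n}F_{\mathrm{sDes}(w^{-1})}(x,y)=\sum_{(\lambda,\mu)\vdash n}c_{\lambda,\mu}\,s_\lambda(x)s_\mu(y),$$ where $c_{\lambda,\mu}$ is the number of standard Young bitableaux $(P^+,P^-)$ of shape $(\lambda,\mu)$ such that the largest $k$ for which $1,2,\dots,k$ all appear in the first column of $P^+$ is even (possibly zero). In particular, for every $\sigma\in\Sigma^B(n)$ the number of $w\in\mathcal{D}^B_n$ with $\mathrm{sDes}(w)=\sigma$ equals the number of $w\in\mathcal{E}^B_n$ with $\mathrm{sDes}(w^{-1})=\sigma$.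
   Context: $B_n$: signed permutations, i.e. bijections $w$ of $\Omega_n=\{1,\dots,n,\bar1,\dots,\bar n\}$ with $w(\bar a)=\overline{w(a)}$, written $w=(w(1),\dots,w(n))$; $\Omega_n$ ordered by $\bar1<_r\cdots<_r\bar n<_r1<_r\cdots<_rn$. $\mathcal{D}^B_n$ is the set of $w\in B_n$ with no fixed point on $\Omega_n$. $\mathcal{E}^B_n$ is the set of $w\in B_n$ for which the largest $k\ge0$ such that $w(1),\dots,w(k)$ are all unbarred and $w(1)>w(2)>\dots>w(k)$ is even. $\mathcal{I}^B_n$ is the set of words over $\Omega_n$ with no two letters of equal absolute value, partially ordered by the subword order (the empty word is the minimum); it is the face poset of a regular cell complex $\mathcal{K}^B_n$ whose cells are simplices. $B_n$ acts on $\mathcal{I}^B_n$ letterwise, hence on the cellular chain complex of $\mathcal{K}^B_n$; $\psi_n$ is the character of $B_n$ on the top reduced homology $\tilde H_{n-1}(\mathcal{K}^B_n;\mathbb C)$. $\mathrm{ch}(\chi)=\frac{1}{2^nn!}\sum_{w\in B_n}\chi(w)p^+_\alpha(x,y)p^-_\beta(x,y)$ where $(\alpha,\beta)$ is the signed cycle type of $w$ (lengths of positive cycles, i.e. pairs of disjoint cycles $c,\bar c$; and of negative cycles $c=\bar c$, counted as half their length), $p^\pm_k=\sum_i(x_i^k\pm y_i^k)$, $p^\pm_\lambda=\prod_jp^\pm_{\lambda_j}$. $\omega_x$ is the involution of $\Lambda(x)\otimes\Lambda(y)$ acting as the standard involution $\omega$ ($\omega(s_\lambda)=s_{\lambda'}$)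 on $\Lambda(x)$ and as the identity on $\Lambda(y)$. $\mathrm{sDes}(w)=(S,\varepsilon)$: $S$ consists of $n$ and all $s\in[n-1]$ with $w(s)>_rw(s+1)$ or with $w(s)$ barred and $w(s+1)$ unbarred; $\varepsilon(s)=-$ iff $w(s)$ barred. $\Sigma^B(n)$ is the set of pairs $(S,\varepsilon)$, $n\in S\subseteq[n]$. For $\sigma=(S,\varepsilon)$ with $S=\{s_1<\dots<s_k=n\}$, $s_0=0$: sign vector $\tilde\varepsilon(j)=\varepsilon(s_i)$ for $s_{i-1}<j\le s_i$; ${\rm wDes}(\sigma)$ the set of $s_i$, $i<k$, with $\varepsilon(s_i)=\varepsilon(s_{i+1})$ or ($\varepsilon(s_i)=+$, $\varepsilon(s_{i+1})=-$); $F_\sigma(x,y)=\sum z_{i_1}\cdots z_{i_n}$ over $i_1\le\dots\le i_n$ with $i_j<i_{j+1}$ for $j\in{\rm wDes}(\sigma)$, where $z_{i_j}=x_{i_j}$ if $\tilde\varepsilon(j)=+$ and $y_{i_j}$ otherwise. A standard Young bitableau of shape $(\lambda,\mu)$ is a pair of row- and column-strict fillings of shapes $\lambda,\mu$ using each element of $[n]$ once. *)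

theory Defs
  imports
    Complex_Main
    "HOL-Library.Multiset"
    "HOL-Library.Poly_Mapping"
    "HOL-Library.FuncSet"
    "HOL-Combinatorics.Permutations"
    "HOL-Combinatorics.Orbits"
begin

section \<open>Formal power series in arbitrarily many commuting variables\<close>

text \<open>A monomial in variables from \<open>'v\<close> is a finite multiset of variables; a formal power series
  assigns a coefficient to every monomial.\<close>

typedef ('v, 'a) mfps = "UNIV :: ('v multiset \<Rightarrow> 'a) set"
  morphisms mfps_nth Abs_mfps
  by simp

setup_lifting type_definition_mfps

lemma mfps_eqI: "(\<And>M. mfps_nth f M = mfps_nth g M) \<Longrightarrow> f = g"
  by (simp add: mfps_nth_inject[symmetric] fun_eq_iff)

lemma finite_submultisets: "finite {A. A \<subseteq># M}"
proof (induction M)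
  case empty
  then show ?case by simp
next
  case (add x M)
  have "{A. A \<subseteq># add_mset x M} \<subseteq> {A. A \<subseteq># M} \<union> add_mset x ` {A. A \<subseteq># M}"
  proof
    fix A assume "A \<in> {A. A \<subseteq># add_mset x M}"
    then have A: "A \<subseteq># add_mset x M" by simp
    show "A \<in> {A. A \<subseteq># M} \<union> add_mset x ` {A. A \<subseteq># M}"
    proof (cases "x \<in># A")
      case True
      then obtain A' where "A = add_mset x A'" by (metis multi_member_split)
      with A show ?thesis by auto
    next
      case False
      with A have "A \<subseteq># M"
        by (metis diff_single_trivial subset_eq_diff_conv add_mset_add_single)
      then show ?thesis by simp
    qed
  qed
  then show ?case using add finite_subset by blast
qed

instantiation mfps :: (type, comm_ring_1) comm_ring_1
begin

lift_definition zero_mfps :: "('a, 'b) mfps" is "\<lambda>_. 0" .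
lift_definition one_mfps :: "('a, 'b) mfps" is "\<lambda>M. if M = {#} then 1 else 0" .
lift_definition plus_mfps :: "('a, 'b) mfps \<Rightarrow> ('a, 'b) mfps \<Rightarrow> ('a, 'b) mfps"
  is "\<lambda>f g M. f M + g M" .
lift_definition minus_mfps :: "('a, 'b) mfps \<Rightarrow> ('a, 'b) mfps \<Rightarrow> ('a, 'b) mfps"
  is "\<lambda>f g M. f M - g M" .
lift_definition uminus_mfps :: "('a, 'b) mfps \<Rightarrow> ('a, 'b) mfps"
  is "\<lambda>f M. - f M" .
lift_definition times_mfps :: "('a, 'b) mfps \<Rightarrow> ('a, 'b) mfps \<Rightarrow> ('a, 'b) mfps"
  is "\<lambda>f g M. \<Sum>A | A \<subseteq># M. f A * g (M - A)" .

instance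
proof
  fix f g h :: "('a, 'b) mfps"
  show "f * g * h = f * (g * h)"
  proof (rule mfps_eqI)
    fix M
    have "mfps_nth (f * g * h) M = (\<Sum>A | A \<subseteq># M. \<Sum>B | B \<subseteq># A.
        mfps_nth f B * mfps_nth g (A - B) * mfps_nth h (M - A))"
      by (simp add: times_mfps.rep_eq sum_distrib_right)
    also have "\<dots> = (\<Sum>(A, B)\<in>Sigma {A. A \<subseteq># M} (\<lambda>A. {B. B \<subseteq># A}).
        mfps_nth f B * mfps_nth g (A - B) * mfps_nth h (M - A))"
      by (subst sum.Sigma) (auto simp: finite_submultisets)
    also have "\<dots> = (\<Sum>(B, C)\<in>Sigma {B. B \<subseteq># M} (\<lambda>B. {C. C \<subseteq># M - B}).
        mfps_nth f B * (mfps_nth g C * mfps_nth h (M - B - C)))"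
    proof -
      have 1: "B \<subseteq># M" "A - B \<subseteq># M - B" "M - B - (A - B) = M - A" "B + (A - B) = A"
        if "A \<subseteq># M" "B \<subseteq># A" for A B
        using that by (auto simp: subseteq_mset_def multiset_eq_iff diff_le_mono intro: order_trans)
      have 2: "B + C \<subseteq># M" if "B \<subseteq># M" "C \<subseteq># M - B" for B C
        using that by (metis subset_mset.le_diff_conv2 union_commute)
      show ?thesis
        by (rule sum.reindex_bij_witness[where i = "\<lambda>(B, C). (B + C, B)" and j = "\<lambda>(A, B). (B, A - B)"])
          (auto simp: 1 2 mult.assoc)
    qed
    also have "\<dots> = mfps_nth (f * (g * h)) M"
      by (subst sum.Sigma[symmetric]) (auto simp: finite_submultisets times_mfps.rep_eq sum_distrib_left)
    finally show "mfps_nth (f * g * h) M = mfps_nth (f * (g * h)) M" .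
  qed
  show "f * g = g * f"
  proof (rule mfps_eqI)
    fix M :: "'a multiset"
    have 1: "M - (M - A) = A" if "A \<subseteq># M" for A
      using that by (simp add: subseteq_mset_def multiset_eq_iff)
    show "mfps_nth (f * g) M = mfps_nth (g * f) M"
      unfolding times_mfps.rep_eq
      by (rule sum.reindex_bij_witness[where i = "\<lambda>A. M - A" and j = "\<lambda>A. M - A"])
        (auto simp: 1 mult.commute)
  qed
  show "1 * f = f"
  proof (rule mfps_eqI)
    fix M
    have "mfps_nth (1 * f) M = (\<Sum>A\<in>{A. A \<subseteq># M}. if A = {#} then mfps_nth f M else 0)"
      unfolding times_mfps.rep_eq one_mfps.rep_eq by (rule sum.cong) auto
    then show "mfps_nth (1 * f) M = mfps_nth f M"
      by (simp add: finite_submultisets)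
  qed
  show "(f + g) * h = f * h + g * h"
    by (rule mfps_eqI) (simp add: times_mfps.rep_eq plus_mfps.rep_eq sum.distrib distrib_right)
  show "(0 :: ('a, 'b) mfps) \<noteq> 1"
    by (metis zero_mfps.rep_eq one_mfps.rep_eq zero_neq_one)
qed (rule mfps_eqI; simp add: zero_mfps.rep_eq plus_mfps.rep_eq minus_mfps.rep_eq uminus_mfps.rep_eq)+

end

lift_definition mfps_const :: "'a \<Rightarrow> ('v, 'a :: zero) mfps"
  is "\<lambda>c M. if M = {#} then c else 0" .

lift_definition mfps_var :: "'v \<Rightarrow> ('v, 'a :: zero_neq_one) mfps"
  is "\<lambda>v M. if M = {#v#} then 1 else 0" .

text \<open>Sum of a locally finite, possibly infinite family: each monomial must have nonzero
  coefficient in only finitely many members.\<close>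

lift_definition mfps_sum :: "('i \<Rightarrow> ('v, 'a :: comm_monoid_add) mfps) \<Rightarrow> 'i set \<Rightarrow> ('v, 'a) mfps"
  is "\<lambda>f I M. \<Sum>i | i \<in> I \<and> f i M \<noteq> 0. f i M" .

text \<open>The two alphabets \<open>x\<close> and \<open>y\<close>, both indexed by \<^typ>\<open>nat\<close>.\<close>

datatype var = XVar nat | YVar nat

type_synonym series = "(var, complex) mfps"

abbreviation x_var :: "nat \<Rightarrow> series" where "x_var i \<equiv> mfps_var (XVar i)"
abbreviation y_var :: "nat \<Rightarrow> series" where "y_var i \<equiv> mfps_var (YVar i)"


section \<open>Partitions and tableaux\<close>

definition is_partition :: "nat list \<Rightarrow> bool" where
  "is_partition lam \<longleftrightarrow> sorted_wrt (\<ge>) lam \<and> 0 \<notin> set lam"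

definition bipartitions :: "nat \<Rightarrow> (nat list \<times> nat list) set" where
  "bipartitions n =
    {(lam, mu). is_partition lam \<and> is_partition mu \<and> sum_list lam + sum_list mu = n}"

definition conjugate :: "nat list \<Rightarrow> nat list" where
  "conjugate lam = map (\<lambda>j. length (filter (\<lambda>p. j < p) lam)) [0..<(if lam = [] then 0 else hd lam)]"

text \<open>Cells are pairs (row, column), counted from 0.\<close>

definition diagram :: "nat list \<Rightarrow> (nat \<times> nat) set" where
  "diagram lam = {(i, j). i < length lam \<and> j < lam ! i}"

definition ssyt :: "nat list \<Rightarrow> (nat \<times> nat \<Rightarrow> nat) set" where
  "ssyt lam = {T \<in> extensional (diagram lam).
     (\<forall>i j. (i, Suc j) \<in> diagram lam \<longrightarrow> T (i, j) \<le> T (i, Suc j)) \<and>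
     (\<forall>i j. (Suc i, j) \<in> diagram lam \<longrightarrow> T (i, j) < T (Suc i, j))}"

definition schur :: "(nat \<Rightarrow> series) \<Rightarrow> nat list \<Rightarrow> series" where
  "schur z lam = mfps_sum (\<lambda>T. \<Prod>c\<in>diagram lam. z (T c)) (ssyt lam)"

definition increasing_filling :: "nat list \<Rightarrow> (nat \<times> nat \<Rightarrow> nat) \<Rightarrow> bool" where
  "increasing_filling lam P \<longleftrightarrow> P \<in> extensional (diagram lam) \<and>
     (\<forall>i j. (i, Suc j) \<in> diagram lam \<longrightarrow> P (i, j) < P (i, Suc j)) \<and>
     (\<forall>i j. (Suc i, j) \<in> diagram lam \<longrightarrow> P (i, j) < P (Suc i, j))"

definition bitableaux ::
    "nat list \<Rightarrow> nat list \<Rightarrow> ((nat \<times> nat \<Rightarrow> nat) \<times> (nat \<times> nat \<Rightarrow> nat)) set" where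
  "bitableaux lam mu = {(P, Q). increasing_filling lam P \<and> increasing_filling mu Q \<and>
     bij_betw (case_sum P Q) (diagram lam <+> diagram mu) {1..sum_list lam + sum_list mu}}"

definition first_column_run :: "nat list \<Rightarrow> (nat \<times> nat \<Rightarrow> nat) \<Rightarrow> nat" where
  "first_column_run lam P = Max {k. {1..k} \<subseteq> {P (i, 0) | i. (i, 0) \<in> diagram lam}}"

definition c_coeff :: "nat list \<Rightarrow> nat list \<Rightarrow> nat" where
  "c_coeff lam mu = card {(P, Q) \<in> bitableaux lam mu. even (first_column_run lam P)}"

text \<open>The products \<open>s\<^sub>\<lambda>(x) s\<^sub>\<mu>(y)\<close> form a basis of \<open>\<Lambda>(x) \<otimes> \<Lambda>(y)\<close>. The involution \<open>\<omega>\<^sub>x\<close> is the linear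
  map taking \<open>s\<^sub>\<lambda>(x) s\<^sub>\<mu>(y)\<close> to \<open>s\<^sub>\<lambda>\<^sub>'(x) s\<^sub>\<mu>(y)\<close>; it is meaningful only for series that lie in
  \<open>\<Lambda>(x) \<otimes> \<Lambda>(y)\<close>.\<close>

definition schur_expansion :: "series \<Rightarrow> (nat list \<times> nat list \<Rightarrow>\<^sub>0 complex)" where
  "schur_expansion f = (THE c. Poly_Mapping.keys c \<subseteq> Collect is_partition \<times> Collect is_partition \<and>
     f = (\<Sum>(lam, mu)\<in>Poly_Mapping.keys c.
           mfps_const (Poly_Mapping.lookup c (lam, mu)) * (schur x_var lam * schur y_var mu)))"

definition omega_x :: "series \<Rightarrow> series" where
  "omega_x f = (let c = schur_expansion f in
     \<Sum>(lam, mu)\<in>Poly_Mapping.keys c.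
       mfps_const (Poly_Mapping.lookup c (lam, mu)) * (schur x_var (conjugate lam) * schur y_var mu))"


section \<open>Signed permutations\<close>

text \<open>The barred copy of a letter \<open>a\<close> is represented by the negative integer \<open>-a\<close>.\<close>

definition Omega :: "nat \<Rightarrow> int set" where
  "Omega n = {a. a \<noteq> 0 \<and> \<bar>a\<bar> \<le> int n}"

definition B_group :: "nat \<Rightarrow> (int \<Rightarrow> int) set" where
  "B_group n = {w. w permutes Omega n \<and> (\<forall>a\<in>Omega n. w (- a) = - w a)}"

definition less_r :: "int \<Rightarrow> int \<Rightarrow> bool" (infix \<open><\<^sub>r\<close> 50) where
  "a <\<^sub>r b \<longleftrightarrow> (a < 0 \<and> 0 < b) \<or> (a < 0 \<and> b < 0 \<and> \<bar>a\<bar> < \<bar>b\<bar>) \<or> (0 < a \<and> 0 < b \<and> a < b)"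

definition D_set :: "nat \<Rightarrow> (int \<Rightarrow> int) set" where
  "D_set n = {w \<in> B_group n. \<forall>a\<in>Omega n. w a \<noteq> a}"

definition initial_run :: "nat \<Rightarrow> (int \<Rightarrow> int) \<Rightarrow> nat" where
  "initial_run n w = Max {k. k \<le> n \<and> (\<forall>i\<in>{1..k}. 0 < w (int i)) \<and>
     (\<forall>i\<in>{1..<k}. w (int i) > w (int (Suc i)))}"

definition E_set :: "nat \<Rightarrow> (int \<Rightarrow> int) set" where
  "E_set n = {w \<in> B_group n. even (initial_run n w)}"

definition signed_cycles :: "nat \<Rightarrow> (int \<Rightarrow> int) \<Rightarrow> int set set" where
  "signed_cycles n w = orbit w ` Omega n"

text \<open>A positive cycle, i.e. a pair of distinct cycles \<open>c\<close> and \<open>-c\<close>, is recorded by the union of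
  the two, so that its length is half the size of that union.\<close>

definition positive_cycle_type :: "nat \<Rightarrow> (int \<Rightarrow> int) \<Rightarrow> nat multiset" where
  "positive_cycle_type n w = image_mset (\<lambda>b. card b div 2)
     (mset_set {c \<union> uminus ` c | c. c \<in> signed_cycles n w \<and> c \<inter> uminus ` c = {}})"

definition negative_cycle_type :: "nat \<Rightarrow> (int \<Rightarrow> int) \<Rightarrow> nat multiset" where
  "negative_cycle_type n w = image_mset (\<lambda>c. card c div 2)
     (mset_set {c \<in> signed_cycles n w. uminus ` c = c})"

definition p_plus :: "nat \<Rightarrow> series" where
  "p_plus k = mfps_sum (\<lambda>i. x_var i ^ k + y_var i ^ k) UNIV"

definition p_minus :: "nat \<Rightarrow> series" where
  "p_minus k = mfps_sum (\<lambda>i. x_var i ^ k - y_var i ^ k) UNIV"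

definition ch :: "nat \<Rightarrow> ((int \<Rightarrow> int) \<Rightarrow> complex) \<Rightarrow> series" where
  "ch n \<chi> = mfps_const (1 / (2 ^ n * fact n)) *
     (\<Sum>w\<in>B_group n. mfps_const (\<chi> w) *
        ((\<Prod>k\<in>#positive_cycle_type n w. p_plus k) * (\<Prod>k\<in>#negative_cycle_type n w. p_minus k)))"


section \<open>Signed descent sets and signed quasisymmetric functions\<close>

datatype sign = Positive | Negative

text \<open>The sign map of a signed set \<open>(S, \<epsilon>)\<close> is \<^const>\<open>undefined\<close> outside \<open>S\<close>, which makes equality
  of signed sets the intended one.\<close>

definition Sigma_B :: "nat \<Rightarrow> (nat set \<times> (nat \<Rightarrow> sign)) set" where
  "Sigma_B n = {(S, \<epsilon>). n \<in> S \<and> S \<subseteq> {1..n} \<and> \<epsilon> \<in> extensional S}"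

definition sDes :: "nat \<Rightarrow> (int \<Rightarrow> int) \<Rightarrow> nat set \<times> (nat \<Rightarrow> sign)" where
  "sDes n w = (let S = insert n {s \<in> {1..<n}. w (int (Suc s)) <\<^sub>r w (int s) \<or>
                                  (w (int s) < 0 \<and> 0 < w (int (Suc s)))}
     in (S, \<lambda>s\<in>S. if w (int s) < 0 then Negative else Positive))"

fun sign_vector :: "nat set \<times> (nat \<Rightarrow> sign) \<Rightarrow> nat \<Rightarrow> sign" where
  "sign_vector (S, \<epsilon>) j = \<epsilon> (LEAST s. s \<in> S \<and> j \<le> s)"

fun wDes :: "nat set \<times> (nat \<Rightarrow> sign) \<Rightarrow> nat set" where
  "wDes (S, \<epsilon>) = {s \<in> S. s \<noteq> Max S \<and>
     (let t = (LEAST t. t \<in> S \<and> s < t) in \<epsilon> s = \<epsilon> t \<or> (\<epsilon> s = Positive \<and> \<epsilon> t = Negative))}"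

definition F_sig :: "nat \<Rightarrow> nat set \<times> (nat \<Rightarrow> sign) \<Rightarrow> series" where
  "F_sig n \<sigma> = mfps_sum
     (\<lambda>i. \<Prod>j\<in>{1..n}. if sign_vector \<sigma> j = Positive then x_var (i j) else y_var (i j))
     {i \<in> extensional {1..n}. \<forall>j\<in>{1..<n}. i j \<le> i (Suc j) \<and> (j \<in> wDes \<sigma> \<longrightarrow> i j < i (Suc j))}"


section \<open>The complex of signed injective words and its top homology\<close>

definition inj_words :: "nat \<Rightarrow> int list set" where
  "inj_words n = {u. set u \<subseteq> Omega n \<and> distinct (map abs u)}"

type_synonym chain = "int list \<Rightarrow>\<^sub>0 complex"

definition chain_scale :: "complex \<Rightarrow> chain \<Rightarrow> chain" where
  "chain_scale a = Poly_Mapping.map ((*) a)"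

lemma lookup_chain_scale:
  "Poly_Mapping.lookup (chain_scale a c) u = a * Poly_Mapping.lookup c u"
  by (simp add: chain_scale_def map.rep_eq when_def)

text \<open>\<open>U \<subseteq> Z\<close> are finite-dimensional subspaces invariant under the linear map \<open>T\<close>; this is the trace
  of the map induced by \<open>T\<close> on the quotient \<open>Z / U\<close>: if a basis \<open>B\<^sub>0\<close> of \<open>U\<close> is extended to a basis \<open>B\<close> of
  \<open>Z\<close>, then the classes of the elements of \<open>B - B\<^sub>0\<close> form a basis of \<open>Z / U\<close>.\<close>

definition (in vector_space) quotient_trace :: "('b \<Rightarrow> 'b) \<Rightarrow> 'b set \<Rightarrow> 'b set \<Rightarrow> 'a" where
  "quotient_trace T Z U =
     (let (B\<^sub>0, B) = (SOME (B\<^sub>0, B). B\<^sub>0 \<subseteq> B \<and> independent B \<and> span B\<^sub>0 = U \<and> span B = Z)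
      in \<Sum>b\<in>B - B\<^sub>0. representation B (T b) b)"

global_interpretation chain: vector_space chain_scale
  by unfold_locales
    (auto intro!: poly_mapping_eqI simp: lookup_chain_scale lookup_add algebra_simps)

text \<open>\<open>chain_space n k\<close> is the cellular chain group in degree \<open>k - 1\<close>, spanned by the words with \<open>k\<close>
  letters; the empty word spans degree \<open>-1\<close>, so that the complex is the augmented one. Each cell is
  a simplex with the letters of the word as vertices, oriented by their order in the word.\<close>

definition chain_space :: "nat \<Rightarrow> nat \<Rightarrow> chain set" where
  "chain_space n k = {c. Poly_Mapping.keys c \<subseteq> {u \<in> inj_words n. length u = k}}"

definition boundary :: "chain \<Rightarrow> chain" where
  "boundary c = (\<Sum>u\<in>Poly_Mapping.keys c. chain_scale (Poly_Mapping.lookup c u)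
     (\<Sum>i<length u. Poly_Mapping.single (take i u @ drop (Suc i) u) ((-1) ^ i)))"

definition word_action :: "(int \<Rightarrow> int) \<Rightarrow> chain \<Rightarrow> chain" where
  "word_action w c =
     (\<Sum>u\<in>Poly_Mapping.keys c. Poly_Mapping.single (map w u) (Poly_Mapping.lookup c u))"

definition cycle_space :: "nat \<Rightarrow> nat \<Rightarrow> chain set" where
  "cycle_space n k = {c \<in> chain_space n k. boundary c = 0}"

definition boundary_space :: "nat \<Rightarrow> nat \<Rightarrow> chain set" where
  "boundary_space n k = boundary ` chain_space n (Suc k)"

definition homology_character :: "nat \<Rightarrow> nat \<Rightarrow> (int \<Rightarrow> int) \<Rightarrow> complex" where
  "homology_character n k w =
     chain.quotient_trace (word_action w) (cycle_space n k) (boundary_space n k)"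

text \<open>Homology in degree \<open>n - 1\<close> lives on words of length \<open>n\<close>.\<close>

definition psi :: "nat \<Rightarrow> (int \<Rightarrow> int) \<Rightarrow> complex" where
  "psi n = homology_character n n"

end

theory Submission
  imports Defs
begin

text \<open>
  Put \<open>G\<^sub>n = \<Sum>\<^sub>k (-1)\<^sup>k e\<^sub>k(x) p\<^sub>1\<^sup>n\<^sup>-\<^sup>k\<close> with \<open>p\<^sub>1 = \<Sum>\<^sub>i (x\<^sub>i + y\<^sub>i)\<close>. All four expressions are shown to equal \<open>G\<^sub>n\<close>.

  The indicator of an even maximal run is \<open>\<Sum>\<^sub>k (-1)\<^sup>k [run of length at least k]\<close>. For bitableaux, the terms
  of this sum are expanded by iterating the Pieri rule for \<open>p\<^sub>1\<close>, starting from the column \<open>e\<^sub>k(x)\<close>. For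
  \<open>w \<in> E\<^sub>n\<close>, standardization turns the sum of \<open>F\<close> over inverses of signed permutations into the sum of
  all words over the letters \<open>x\<^sub>i, y\<^sub>i\<close>, and the condition on the run into a strictly decreasing
  prefix in the \<open>x\<^sub>i\<close>, which contributes \<open>e\<^sub>k(x)\<close>.

  For derangements, pairs consisting of a signed permutation and a compatible labelling are considered.
  Deleting the first fixed point carrying a given label \<open>x\<^sub>i\<close> is a bijection, so that forbidding this label on fixed points
  multiplies the generating function \<open>\<Sum>\<^sub>n p\<^sub>1\<^sup>n\<close> by \<open>1 - x\<^sub>i\<close>.

  The complex of injective words is acyclic below the top degree, so by the Hopf trace formula \<open>\<psi>\<^sub>n(w)\<close>
  is an alternating sum of numbers of words fixed by \<open>w\<close>. Interchanging the sums over words and over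
  group elements leaves averages over parabolic subgroups \<open>B\<^sub>m\<close>, which give
  \<open>ch(\<psi>\<^sub>n) = \<Sum>\<^sub>k (-1)\<^sup>k h\<^sub>k(x) p\<^sub>1\<^sup>n\<^sup>-\<^sup>k\<close>. The involution \<open>\<omega>\<^sub>x\<close> is evaluated on the Schur expansion of this series.
\<close>

section \<open>Power series agreeing in finitely many variables\<close>

text \<open>Graded by degree, the \<open>G\<^sub>n\<close> are the components of \<Prod>(1 - x_i) /
  (1 - p_1): a decreasing prefix followed by a free word, or one factor 1 - x_i for each forbidden
  label. On the side of homology, the words of length k carry the permutation character induced from
  the trivial character of B_(n-k), with characteristic p_1^k h_(n-k)(x); the y disappear from h
  because sign changes cancel them. So h_k stands where e_k is wanted, and \<omega>_x exchanges the
  two.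

  By definition \<omega>_x is linear only. Instead of multiplicativity, the tableau expansion is
  proved for an arbitrary symmetry of Young's lattice, and conjugation yields the Schur expansion of
  the h version.

  The series are infinite, while every bijection is between finite sets; hence identities are proved
  in the variables of index below N, for all N.

  The last claim would follow from linear independence of the F. The proof instead compares single
  coefficients of the sums over D_n and E_n with one independent variable per letter.\<close>

lemma nth_0 [simp]: "mfps_nth 0 M = 0"
  by (simp add: zero_mfps.rep_eq)

lemma nth_add [simp]: "mfps_nth (f + g) M = mfps_nth f M + mfps_nth g M"
  by (simp add: plus_mfps.rep_eq)

lemma nth_diff [simp]: "mfps_nth (f - g) M = mfps_nth f M - mfps_nth g M"
  by (simp add: minus_mfps.rep_eq)

lemma nth_uminus [simp]: "mfps_nth (- f) M = - mfps_nth f M"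
  by (simp add: uminus_mfps.rep_eq)

lemma nth_one: "mfps_nth 1 M = (if M = {#} then 1 else 0)"
  by (simp add: one_mfps.rep_eq)

lemma nth_sum: "mfps_nth (sum f I) M = (\<Sum>i\<in>I. mfps_nth (f i) M)"
  by (induction I rule: infinite_finite_induct) auto

lemma nth_const_mult: "mfps_nth (mfps_const a * f) M = a * mfps_nth f M"
proof -
  have "mfps_nth (mfps_const a * f) M = (\<Sum>A | A \<subseteq># M. if A = {#} then a * mfps_nth f M else 0)"
    unfolding times_mfps.rep_eq mfps_const.rep_eq by (rule sum.cong) auto
  then show ?thesis by (simp add: finite_submultisets)
qed

lemma const_0 [simp]: "mfps_const 0 = 0"
  by (rule mfps_eqI) (simp add: mfps_const.rep_eq)

lemma const_1 [simp]: "mfps_const 1 = 1"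
  by (rule mfps_eqI) (simp add: mfps_const.rep_eq nth_one)

lemma const_add: "mfps_const (a + b) = mfps_const a + mfps_const (b :: 'a :: comm_ring_1)"
  by (rule mfps_eqI) (simp add: mfps_const.rep_eq)

lemma const_uminus: "mfps_const (- a) = - mfps_const (a :: 'a :: comm_ring_1)"
  by (rule mfps_eqI) (simp add: mfps_const.rep_eq)

lemma const_mult: "mfps_const (a * b) = mfps_const a * mfps_const (b :: 'a :: comm_ring_1)"
  by (rule mfps_eqI) (simp add: mfps_const.rep_eq nth_const_mult)

lemma const_sum: "mfps_const (sum f A) = (\<Sum>i\<in>A. mfps_const (f i :: 'a :: comm_ring_1))"
  by (induction A rule: infinite_finite_induct) (auto simp: const_add)

lemma const_of_nat: "mfps_const (of_nat k) = (of_nat k :: ('v, 'a :: comm_ring_1) mfps)"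
  by (induction k) (auto simp: const_add)

lemma const_power: "mfps_const (a ^ k) = mfps_const (a :: 'a :: comm_ring_1) ^ k"
  by (induction k) (auto simp: const_mult)

lemma nth_mult_var:
  "mfps_nth (mfps_var v * f) M =
    (if v \<in># M then mfps_nth f (M - {#v#}) else (0 :: 'a :: comm_ring_1))"
proof -
  have "mfps_nth (mfps_var v * f) M =
      (\<Sum>A | A \<subseteq># M. if A = {#v#} then mfps_nth f (M - {#v#}) else 0)"
    unfolding times_mfps.rep_eq mfps_var.rep_eq by (rule sum.cong) auto
  then show ?thesis by (simp add: finite_submultisets)
qed

lemma nth_prod_var:
  assumes "finite A"
  shows "mfps_nth (\<Prod>a\<in>A. mfps_var (v a)) M =
    (if M = image_mset v (mset_set A) then 1 else (0 :: 'a :: comm_ring_1))"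
  using assms
proof (induction A arbitrary: M)
  case (insert a A)
  have "v a \<in># M \<and> M - {#v a#} = image_mset v (mset_set A) \<longleftrightarrow>
      M = add_mset (v a) (image_mset v (mset_set A))"
    by (metis add_mset_remove_trivial insert_DiffM union_single_eq_member)
  with insert show ?case by (auto simp: nth_mult_var)
qed (simp add: nth_one)

primrec var_index :: "var \<Rightarrow> nat" where
  "var_index (XVar i) = i"
| "var_index (YVar i) = i"

text \<open>Congruence modulo the series all of whose monomials contain a variable of index at least
  N, that is, equality after setting those variables to zero. It respects sums and products, and
  modulo it the locally finite sums become finite ones.\<close>

definition agree :: "nat \<Rightarrow> series \<Rightarrow> series \<Rightarrow> bool" where
  "agree N f g \<longleftrightarrow> (\<forall>M. (\<forall>v\<in>#M. var_index v < N) \<longrightarrow> mfps_nth f M = mfps_nth g M)"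

lemma agreeI: "(\<And>M. (\<And>v. v \<in># M \<Longrightarrow> var_index v < N) \<Longrightarrow> mfps_nth f M = mfps_nth g M) \<Longrightarrow> agree N f g"
  by (simp add: agree_def)

lemma agreeD: "agree N f g \<Longrightarrow> (\<And>v. v \<in># M \<Longrightarrow> var_index v < N) \<Longrightarrow> mfps_nth f M = mfps_nth g M"
  by (simp add: agree_def)

lemma agree_refl [simp, intro]: "agree N f f"
  by (simp add: agree_def)

lemma agree_sym: "agree N f g \<Longrightarrow> agree N g f"
  by (simp add: agree_def)

lemma agree_trans [trans]: "agree N f g \<Longrightarrow> agree N g h \<Longrightarrow> agree N f h"
  by (simp add: agree_def)

text \<open>A monomial involves finitely many variables, so some N exceeds all their
  indices.\<close>

lemma series_eqI_agree:
  assumes "\<And>N. agree N f g"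
  shows "f = g"
proof (rule mfps_eqI)
  fix M
  have "var_index v < Suc (Max (var_index ` set_mset M))" if "v \<in># M" for v
    using that by (simp add: less_Suc_eq_le)
  then show "mfps_nth f M = mfps_nth g M"
    using agreeD[OF assms] by blast
qed

lemma agree_add: "agree N f f' \<Longrightarrow> agree N g g' \<Longrightarrow> agree N (f + g) (f' + g')"
  by (simp add: agree_def)

lemma agree_mult: "agree N f f' \<Longrightarrow> agree N g g' \<Longrightarrow> agree N (f * g) (f' * g')"
  unfolding agree_def times_mfps.rep_eq
  by (intro allI impI sum.cong refl arg_cong2[where f = "(*)"])
    (auto dest: mset_subset_eqD in_diffD)

lemma agree_sum: "(\<And>i. i \<in> I \<Longrightarrow> agree N (f i) (g i)) \<Longrightarrow> agree N (sum f I) (sum g I)"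
  by (auto simp: agree_def nth_sum intro!: sum.cong)

lemma agree_prod: "(\<And>i. i \<in> I \<Longrightarrow> agree N (f i) (g i)) \<Longrightarrow> agree N (prod f I) (prod g I)"
  by (induction I rule: infinite_finite_induct) (auto intro: agree_mult)

lemma agree_power: "agree N f g \<Longrightarrow> agree N (f ^ k) (g ^ k)"
  by (induction k) (auto intro: agree_mult)

lemma agree_mfps_sum:
  assumes "finite J" "J \<subseteq> I"
    and "\<And>i M. i \<in> I - J \<Longrightarrow> (\<And>v. v \<in># M \<Longrightarrow> var_index v < N) \<Longrightarrow> mfps_nth (f i) M = 0"
  shows "agree N (mfps_sum f I) (sum f J)"
proof (rule agreeI)
  fix M assume M: "\<And>v. v \<in># M \<Longrightarrow> var_index v < N"
  have "(\<Sum>i | i \<in> I \<and> mfps_nth (f i) M \<noteq> 0. mfps_nth (f i) M) = (\<Sum>i\<in>J. mfps_nth (f i) M)"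
    by (rule sum.mono_neutral_left) (use assms M in auto)
  then show "mfps_nth (mfps_sum f I) M = mfps_nth (sum f J) M"
    by (simp add: mfps_sum.rep_eq nth_sum)
qed

lemma agree_mfps_sum_prod_var:
  assumes "finite A" "finite {i\<in>I. \<forall>a\<in>A. var_index (v i a) < N}"
  shows "agree N (mfps_sum (\<lambda>i. \<Prod>a\<in>A. mfps_var (v i a)) I)
    (\<Sum>i\<in>{i\<in>I. \<forall>a\<in>A. var_index (v i a) < N}. \<Prod>a\<in>A. mfps_var (v i a))"
  by (rule agree_mfps_sum) (use assms in \<open>auto simp: nth_prod_var\<close>)

section \<open>Partitions and horizontal strips\<close>

text \<open>Rows beyond the last have length zero, so that a partition becomes a weakly decreasing
  function on all of \<nat>: adding a cell is a function update, and lengths of lists need no case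
  distinctions.\<close>

definition row :: "nat list \<Rightarrow> nat \<Rightarrow> nat" where
  "row lam i = (if i < length lam then lam ! i else 0)"

lemma row_pos_iff: "is_partition lam \<Longrightarrow> 0 < row lam i \<longleftrightarrow> i < length lam"
  by (auto simp: row_def is_partition_def in_set_conv_nth)

lemma row_antimono: "is_partition lam \<Longrightarrow> i \<le> j \<Longrightarrow> row lam j \<le> row lam i"
  by (cases "i = j") (auto simp: row_def is_partition_def sorted_wrt_iff_nth_less)

lemma row_inject:
  assumes "is_partition lam" "is_partition mu" "row lam = row mu"
  shows "lam = mu"
proof -
  have "i < length lam \<longleftrightarrow> i < length mu" for i
    using assms by (metis row_pos_iff)
  then have "length lam = length mu"
    by (meson linorder_less_linear order_less_irrefl)
  then show ?thesis
    using assms(3) by (intro nth_equalityI) (auto simp: row_def fun_eq_iff split: if_splits)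
qed

lemma ex_partition_row:
  assumes "\<And>i. r (Suc i) \<le> r i" and "r k = (0 :: nat)"
  shows "\<exists>lam. is_partition lam \<and> row lam = r"
proof -
  define m where "m = (LEAST i. r i = 0)"
  have anti: "r j \<le> r i" if "i \<le> j" for i j
    using that assms(1) by (rule lift_Suc_antimono_le[rotated])
  have m: "r m = 0" "\<And>i. i < m \<Longrightarrow> r i \<noteq> 0"
    unfolding m_def using assms(2) by (auto intro: LeastI dest: not_less_Least)
  have m': "r i = 0" if "m \<le> i" for i
    using anti[OF that] m(1) by simp
  have "is_partition (map r [0..<m])"
    using m(2) by (auto simp: is_partition_def sorted_wrt_iff_nth_less anti image_iff)
  moreover have "row (map r [0..<m]) = r"
    using m' by (auto simp: row_def fun_eq_iff)
  ultimately show ?thesis by blast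
qed

definition part :: "(nat \<Rightarrow> nat) \<Rightarrow> nat list" where
  "part r = (THE lam. is_partition lam \<and> row lam = r)"

lemma part_row: "is_partition lam \<Longrightarrow> part (row lam) = lam"
  unfolding part_def by (rule the_equality) (auto intro: row_inject)

lemma
  assumes "\<And>i. r (Suc i) \<le> r i" and "r k = (0 :: nat)"
  shows is_partition_part: "is_partition (part r)" and row_part: "row (part r) = r"
  using ex_partition_row[OF assms] part_row by auto

lemma diagram_row: "diagram lam = {(i, j). j < row lam i}"
  by (auto simp: diagram_def row_def split: if_splits)

lemma mem_diagram [simp]: "(i, j) \<in> diagram lam \<longleftrightarrow> j < row lam i"
  by (simp add: diagram_row)

lemma diagram_Sigma: "diagram lam = Sigma {..<length lam} (\<lambda>i. {..<lam ! i})"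
  by (auto simp: diagram_def)

lemma finite_diagram [simp, intro]: "finite (diagram lam)"
  by (simp add: diagram_Sigma)

lemma card_diagram: "card (diagram lam) = sum_list lam"
  by (simp add: diagram_Sigma sum_list_sum_nth atLeast0LessThan)

lemma diagram_inject:
  assumes "is_partition lam" "is_partition mu" "diagram lam = diagram mu"
  shows "lam = mu"
proof (rule row_inject[OF assms(1,2)], rule ext)
  fix i
  have "j < row lam i \<longleftrightarrow> j < row mu i" for j
    using assms(3) by (metis mem_diagram)
  then show "row lam i = row mu i"
    by (meson linorder_less_linear order_less_irrefl)
qed

lemma finite_sub_partitions: "finite {kap. is_partition kap \<and> diagram kap \<subseteq> D}" if "finite D"
proof (rule finite_imageD)
  show "finite (diagram ` {kap. is_partition kap \<and> diagram kap \<subseteq> D})"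
    by (rule finite_subset[of _ "Pow D"]) (use that in auto)
  show "inj_on diagram {kap. is_partition kap \<and> diagram kap \<subseteq> D}"
    by (auto intro: inj_onI diagram_inject)
qed

section \<open>Covers in Young's lattice and horizontal strips\<close>

definition covers :: "nat list \<Rightarrow> nat list \<Rightarrow> bool" where
  "covers lam kap \<longleftrightarrow> is_partition lam \<and> is_partition kap \<and>
     (\<exists>r. row kap = (row lam)(r := Suc (row lam r)))"

text \<open>Interlacing of row lengths; it says that the skew shape between p and q has at most one
  cell in each column.\<close>

definition hstrip_fun :: "(nat \<Rightarrow> nat) \<Rightarrow> (nat \<Rightarrow> nat) \<Rightarrow> bool" where
  "hstrip_fun p q \<longleftrightarrow> (\<forall>i. p i \<le> q i \<and> q (Suc i) \<le> p i)"

definition hstrip :: "nat list \<Rightarrow> nat list \<Rightarrow> bool" where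
  "hstrip kap lam \<longleftrightarrow> is_partition kap \<and> is_partition lam \<and> hstrip_fun (row kap) (row lam)"

text \<open>Both descriptions of a cover are used: rows for the count behind the Pieri rule, cells
  for tableaux and for conjugation, which does not preserve rows.\<close>

lemma covers_diagram:
  "covers lam kap \<longleftrightarrow> is_partition lam \<and> is_partition kap \<and>
     (\<exists>c. c \<notin> diagram lam \<and> diagram kap = insert c (diagram lam))" (is "_ \<longleftrightarrow> ?R")
proof
  assume "covers lam kap"
  then obtain r where r: "row kap = (row lam)(r := Suc (row lam r))"
    and "is_partition lam" "is_partition kap"
    by (auto simp: covers_def)
  moreover have "diagram kap = insert (r, row lam r) (diagram lam)"
    unfolding diagram_row r by (auto split: if_splits)
  ultimately show ?R
    by (auto intro!: exI[of _ "(r, row lam r)"])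
next
  assume ?R
  then obtain r j where *: "is_partition lam" "is_partition kap" "\<not> j < row lam r"
      "diagram kap = insert (r, j) (diagram lam)"
    by auto
  have eq: "b < row kap a \<longleftrightarrow> (a, b) = (r, j) \<or> b < row lam a" for a b
    using *(4) by (metis insert_iff mem_diagram)
  have ls: "x = y" if "\<And>b. b < x \<longleftrightarrow> b < y" for x y :: nat
    using that by (meson linorder_less_linear order_less_irrefl)
  have "row kap i = row lam i" if "i \<noteq> r" for i
    using eq[of _ i] that by (intro ls) auto
  moreover have "row kap r = Suc (row lam r)"
  proof -
    have "row lam r < row kap r"
      using eq[of j r] *(3) by auto
    then have "j = row lam r"
      using eq[of "row lam r" r] by auto
    then show ?thesis
      using eq[of _ r] by (intro ls) (auto simp: less_Suc_eq)
  qed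
  ultimately show "covers lam kap"
    using * by (auto simp: covers_def fun_eq_iff)
qed

lemma covers_card: "covers lam kap \<Longrightarrow> card (diagram kap) = Suc (card (diagram lam))"
  by (auto simp: covers_diagram)

lemma covers_subset: "covers lam kap \<Longrightarrow> diagram lam \<subseteq> diagram kap"
  by (auto simp: covers_diagram)

lemma hstrip_subset: "hstrip kap lam \<Longrightarrow> diagram kap \<subseteq> diagram lam"
  unfolding hstrip_def hstrip_fun_def diagram_row using less_le_trans by blast

lemma finite_hstrip: "finite {kap. hstrip kap lam}"
  by (rule finite_subset[OF _ finite_sub_partitions[OF finite_diagram[of lam]]])
    (use hstrip_subset in \<open>auto simp: hstrip_def\<close>)

lemma finite_covers_below: "finite {lam. covers lam kap}"
  by (rule finite_subset[OF _ finite_sub_partitions[OF finite_diagram[of kap]]])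
    (use covers_subset in \<open>auto simp: covers_def\<close>)

lemma finite_covers_above: "finite {kap. covers lam kap}"
proof -
  have "{kap. covers lam kap} \<subseteq> (\<lambda>r. part ((row lam)(r := Suc (row lam r)))) ` {..length lam}"
  proof
    fix kap assume "kap \<in> {kap. covers lam kap}"
    then obtain r where r: "row kap = (row lam)(r := Suc (row lam r))"
      and p: "is_partition lam" "is_partition kap"
      by (auto simp: covers_def)
    have "r \<le> length lam"
    proof (rule ccontr)
      assume "\<not> r \<le> length lam"
      then have "row lam (length lam) < row kap r" "length lam < r"
        using r by (auto simp: row_def)
      then show False
        using row_antimono[OF p(2), of "length lam" r] r by (auto simp: row_def)
    qed
    moreover have "kap = part ((row lam)(r := Suc (row lam r)))"
      using part_row[OF p(2)] r by simp
    ultimately show "kap \<in> (\<lambda>r. part ((row lam)(r := Suc (row lam r)))) ` {..length lam}"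
      by blast
  qed
  then show ?thesis
    by (rule finite_subset) simp
qed

text \<open>The added cell is determined by its row. Interlacing with \<open>mu\<close> already
  forces the enlarged row function to be weakly decreasing and eventually zero, so every admissible
  row index gives a partition.\<close>

lemma card_covers_hstrip:
  assumes lam: "is_partition lam" and mu: "is_partition mu"
  shows "card {kap. covers lam kap \<and> hstrip mu kap} =
    card {r. hstrip_fun (row mu) ((row lam)(r := Suc (row lam r)))}" (is "card ?A = card ?B")
proof -
  have "bij_betw (\<lambda>r. part ((row lam)(r := Suc (row lam r)))) ?B ?A"
  proof -
    have B: "is_partition (part q) \<and> row (part q) = q"
      if "hstrip_fun (row mu) q" for q
    proof -
      have "q (Suc i) \<le> q i" for i
        using that le_trans unfolding hstrip_fun_def by blast
      moreover have "q (Suc (length mu)) = 0"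
        using that by (auto simp: hstrip_fun_def row_def dest: spec[of _ "length mu"])
      ultimately show ?thesis
        using is_partition_part row_part by metis
    qed
    show ?thesis
      unfolding bij_betw_def
    proof
      show "inj_on (\<lambda>r. part ((row lam)(r := Suc (row lam r)))) ?B"
      proof (rule inj_onI)
        fix r s assume "r \<in> ?B" "s \<in> ?B"
          "part ((row lam)(r := Suc (row lam r))) = part ((row lam)(s := Suc (row lam s)))"
        then have "(row lam)(r := Suc (row lam r)) = (row lam)(s := Suc (row lam s))"
          using B by (metis mem_Collect_eq)
        then show "r = s"
          by (metis fun_upd_apply n_not_Suc_n)
      qed
      show "(\<lambda>r. part ((row lam)(r := Suc (row lam r)))) ` ?B = ?A"
      proof (intro equalityI subsetI)
        fix kap assume "kap \<in> ?A"
        then obtain r where r: "row kap = (row lam)(r := Suc (row lam r))" "is_partition kap"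
            "hstrip_fun (row mu) (row kap)"
          by (auto simp: covers_def hstrip_def)
        then have "r \<in> ?B" "kap = part ((row lam)(r := Suc (row lam r)))"
          using part_row[of kap] by auto
        then show "kap \<in> (\<lambda>r. part ((row lam)(r := Suc (row lam r)))) ` ?B"
          by blast
      qed (use B lam mu in \<open>auto simp: covers_def hstrip_def\<close>)
    qed
  qed
  then show ?thesis
    by (simp add: bij_betw_same_card)
qed

lemma card_hstrip_covers:
  assumes lam: "is_partition lam" and mu: "is_partition mu"
  shows "card {nu. covers nu mu \<and> hstrip nu lam} =
    card {r. 0 < row mu r \<and> hstrip_fun ((row mu)(r := row mu r - 1)) (row lam)}" (is "card ?A = card ?B")
proof -
  let ?f = "\<lambda>r. part ((row mu)(r := row mu r - 1))"
  have B: "is_partition (part p) \<and> row (part p) = p"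
    if "hstrip_fun p (row lam)" for p
  proof -
    have "p (Suc i) \<le> p i" for i
      using that le_trans unfolding hstrip_fun_def by blast
    moreover have "p (length lam) = 0"
      using that by (auto simp: hstrip_fun_def row_def dest: spec[of _ "length lam"])
    ultimately show ?thesis
      using is_partition_part row_part by metis
  qed
  have "bij_betw ?f ?B ?A"
    unfolding bij_betw_def
  proof
    show "inj_on ?f ?B"
    proof (rule inj_onI)
      fix r s assume rs: "r \<in> ?B" "s \<in> ?B" "?f r = ?f s"
      then have "(row mu)(r := row mu r - 1) = (row mu)(s := row mu s - 1)"
        using B by (metis (lifting) mem_Collect_eq)
      then show "r = s"
        using rs(1) by (auto simp: fun_eq_iff split: if_splits dest!: spec[of _ r])
    qed
    show "?f ` ?B = ?A"
    proof (intro equalityI subsetI)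
      fix nu assume "nu \<in> ?A"
      then obtain r where r: "row mu = (row nu)(r := Suc (row nu r))" "is_partition nu"
          "hstrip_fun (row nu) (row lam)"
        by (auto simp: covers_def hstrip_def)
      then have "(row mu)(r := row mu r - 1) = row nu"
        by auto
      then have "r \<in> ?B" "nu = ?f r"
        using r part_row[of nu] by auto
      then show "nu \<in> ?f ` ?B"
        by blast
    next
      fix nu assume "nu \<in> ?f ` ?B"
      then obtain r where r: "0 < row mu r" "hstrip_fun ((row mu)(r := row mu r - 1)) (row lam)" "nu = ?f r"
        by auto
      then have "is_partition nu" "row nu = (row mu)(r := row mu r - 1)"
        using B by auto
      then show "nu \<in> ?A"
        using r lam mu by (auto simp: covers_def hstrip_def intro!: exI[of _ r])
    qed
  qed
  then show ?thesis
    by (simp add: bij_betw_same_card)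
qed

text \<open>Adding a cell commutes with removing a horizontal strip, up to the last summand, which
  will account for the new variable in the Pieri rule. Both counts are counts of row indices, and
  these are matched directly.\<close>

lemma hstrip_commutation:
  assumes lam: "is_partition lam" and mu: "is_partition mu"
  shows "card {kap. covers lam kap \<and> hstrip mu kap} =
    card {nu. covers nu mu \<and> hstrip nu lam} + (if hstrip mu lam then 1 else 0)"
proof -
  define l m where "l = row lam" and "m = row mu"
  have l: "l (Suc i) \<le> l i" and m: "m (Suc i) \<le> m i" for i
    using lam mu by (simp_all add: l_def m_def row_antimono)
  define R1 where "R1 = {r. hstrip_fun m (l(r := Suc (l r)))}"
  define R2 where "R2 = {r. 0 < m r \<and> hstrip_fun (m(r := m r - 1)) l}"
  have "card R1 = card R2 + (if hstrip_fun m l then 1 else 0)"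
  proof (cases "hstrip_fun m l")
    case True
    then have ml: "m i \<le> l i" "l (Suc i) \<le> m i" for i
      by (auto simp: hstrip_fun_def)
    \<comment> \<open>For an interlacing pair, row r of \<open>m\<close> can lose a cell exactly if
      row \<open>Suc r\<close> of \<open>l\<close> can gain one: both need
      \<open>l (Suc r) < m r\<close>. Row 0 of \<open>l\<close> can always grow, hence one more
      element in \<open>R1\<close>.\<close>
    have 2: "R2 = {r. l (Suc r) < m r}"
    proof (intro set_eqI iffI)
      fix r assume "r \<in> R2"
      then have "0 < m r" "l (Suc r) \<le> m r - 1"
        by (auto simp: R2_def hstrip_fun_def dest!: spec[of _ r])
      then show "r \<in> {r. l (Suc r) < m r}" by auto
    next
      fix r assume "r \<in> {r. l (Suc r) < m r}"
      then show "r \<in> R2"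
        using ml by (auto simp: R2_def hstrip_fun_def intro: le_trans[OF diff_le_self])
    qed
    have 1: "R1 = insert 0 (Suc ` R2)"
    proof (intro set_eqI iffI)
      fix r assume r: "r \<in> R1"
      show "r \<in> insert 0 (Suc ` R2)"
      proof (cases r)
        case (Suc s)
        then have "Suc (l (Suc s)) \<le> m s"
          using r by (auto simp: R1_def hstrip_fun_def dest!: spec[of _ s])
        then show ?thesis using Suc 2 by auto
      qed simp
    next
      fix r assume "r \<in> insert 0 (Suc ` R2)"
      then show "r \<in> R1"
        using ml unfolding 2 by (auto simp: R1_def hstrip_fun_def le_SucI)
    qed
    have "R2 \<subseteq> {..<length mu}"
      using mu by (auto simp: 2 m_def row_pos_iff[symmetric] dest: le_less_trans[OF le0])
    then have "finite R2"
      by (rule finite_subset) simp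
    then show ?thesis
      using True by (simp add: 1 card_image)
  next
    case False
    \<comment> \<open>Without interlacing, a change in row r repairs the pair only if the single
      violation is \<open>m r = Suc (l r)\<close>; lengthening that row of \<open>l\<close> and
      shortening that row of \<open>m\<close> then work equally well.\<close>
    have "r \<in> R1 \<longleftrightarrow> r \<in> R2" for r
    proof
      assume "r \<in> R1"
      then have h: "m i \<le> (l(r := Suc (l r))) i" "(l(r := Suc (l r))) (Suc i) \<le> m i" for i
        by (auto simp: R1_def hstrip_fun_def)
      have 1: "m i \<le> l i" if "i \<noteq> r" for i
        using h(1)[of i] that by simp
      have 2: "l (Suc i) \<le> m i" for i
        using h(2)[of i] by (cases "Suc i = r") auto
      have 3: "m r = Suc (l r)"
      proof (rule ccontr)
        assume "m r \<noteq> Suc (l r)"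
        then have "m r \<le> l r" using h(1)[of r] by simp
        with 1 2 have "hstrip_fun m l" by (auto simp: hstrip_fun_def) (metis)
        with False show False by simp
      qed
      show "r \<in> R2"
        using 1 2 3 l by (auto simp: R2_def hstrip_fun_def)
    next
      assume "r \<in> R2"
      then have h: "(m(r := m r - 1)) i \<le> l i" "l (Suc i) \<le> (m(r := m r - 1)) i" "0 < m r" for i
        by (auto simp: R2_def hstrip_fun_def)
      have 1: "m i \<le> l i" if "i \<noteq> r" for i
        using h(1)[of i] that by simp
      have 2: "l (Suc i) \<le> m i" for i
        using h(2)[of i] by (cases "i = r") auto
      have 3: "m r = Suc (l r)"
      proof (rule ccontr)
        assume "m r \<noteq> Suc (l r)"
        then have "m r \<le> l r" using h(1)[of r] h(3) by simp
        with 1 2 have "hstrip_fun m l" by (auto simp: hstrip_fun_def) (metis)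
        with False show False by simp
      qed
      have "Suc (l r) \<le> m i" if "Suc i = r" for i
        using m[of i] 3 that by simp
      then show "r \<in> R1"
        using 1 2 3 by (auto simp: R1_def hstrip_fun_def)
    qed
    then have "R1 = R2" by blast
    then show ?thesis using False by simp
  qed
  then show ?thesis
    using card_covers_hstrip[OF lam mu] card_hstrip_covers[OF lam mu] lam mu
    by (simp add: R1_def R2_def l_def m_def hstrip_def)
qed

section \<open>The Pieri rule\<close>

definition ssytN :: "nat \<Rightarrow> nat list \<Rightarrow> (nat \<times> nat \<Rightarrow> nat) set" where
  "ssytN N lam = {T \<in> ssyt lam. \<forall>c\<in>diagram lam. T c < N}"

definition schurN :: "nat \<Rightarrow> (nat \<Rightarrow> 'a :: comm_ring_1) \<Rightarrow> nat list \<Rightarrow> 'a" where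
  "schurN N z lam = (\<Sum>T\<in>ssytN N lam. \<Prod>c\<in>diagram lam. z (T c))"

lemma finite_ssytN: "finite (ssytN N lam)"
proof (rule finite_subset)
  show "ssytN N lam \<subseteq> diagram lam \<rightarrow>\<^sub>E {..<N}"
    by (auto simp: ssytN_def ssyt_def PiE_def)
qed (simp add: finite_PiE)

lemma ssyt_row_mono:
  assumes "T \<in> ssyt lam" "j \<le> k" "k < row lam i"
  shows "T (i, j) \<le> T (i, k)"
  using assms(2,3)
proof (induction k rule: dec_induct)
  case (step k)
  then show ?case
    using assms(1) by (fastforce simp: ssyt_def)
qed simp

lemma downset_eq_lessThan:
  assumes "finite A" "\<And>i j. i \<le> j \<Longrightarrow> j \<in> A \<Longrightarrow> i \<in> (A :: nat set)"
  shows "A = {..<card A}"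
proof (rule card_seteq[symmetric, OF assms(1)])
  show "{..<card A} \<subseteq> A"
  proof
    fix i assume i: "i \<in> {..<card A}"
    show "i \<in> A"
    proof (rule ccontr)
      assume "i \<notin> A"
      then have "A \<subseteq> {..<i}"
        using assms(2) by (meson lessThan_iff not_le_imp_less subsetI)
      then show False
        using i card_mono[of "{..<i}" A] by simp
    qed
  qed
qed simp

text \<open>Branching rule: the cells with entries below N form a partition, and those with entry N,
  at most one per column by strictness, form a horizontal strip.\<close>

lemma schurN_Suc:
  assumes lam: "is_partition lam"
  shows "schurN (Suc N) z lam =
    (\<Sum>kap | hstrip kap lam. z N ^ (card (diagram lam) - card (diagram kap)) * schurN N z kap)"
proof -
  \<comment> \<open>Rows increase weakly, so the entries below N in a row form an initial segment,
    and counting them gives the row lengths of the smaller shape.\<close>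
  define sh where "sh T = part (\<lambda>i. card {j. j < row lam i \<and> T (i, j) < N})" for T
  have sh: "hstrip (sh T) lam \<and> (\<forall>i j. j < row (sh T) i \<longleftrightarrow> j < row lam i \<and> T (i, j) < N)"
    if T: "T \<in> ssytN (Suc N) lam" for T
  proof -
    define A where "A i = {j. j < row lam i \<and> T (i, j) < N}" for i
    have T': "T \<in> ssyt lam" "\<And>i j. j < row lam i \<Longrightarrow> T (i, j) \<le> N"
      using T by (auto simp: ssytN_def less_Suc_eq_le)
    have A: "A i = {..<card (A i)}" for i
      by (rule downset_eq_lessThan)
        (use ssyt_row_mono[OF T'(1)] in \<open>auto simp: A_def intro: le_less_trans\<close>)
    have 1: "card (A i) \<le> row lam i" for i
      using card_mono[of "{..<row lam i}" "A i"] by (auto simp: A_def)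
    have 2: "row lam (Suc i) \<le> card (A i)" for i
    proof -
      have "{..<row lam (Suc i)} \<subseteq> A i"
      proof
        fix j assume j: "j \<in> {..<row lam (Suc i)}"
        then have "T (i, j) < T (Suc i, j)" "T (Suc i, j) \<le> N" "j < row lam i"
          using T' row_antimono[OF lam, of i "Suc i"] by (auto simp: ssyt_def)
        then show "j \<in> A i" by (simp add: A_def)
      qed
      from card_mono[OF _ this] show ?thesis by (simp add: A_def)
    qed
    have 3: "is_partition (sh T) \<and> row (sh T) = (\<lambda>i. card (A i))"
    proof -
      have "card (A (Suc i)) \<le> card (A i)" for i
        using 1 2 le_trans by blast
      moreover have "card (A (length lam)) = 0"
        using 1[of "length lam"] by (simp add: row_def)
      ultimately show ?thesis
        unfolding sh_def A_def[symmetric] by (metis is_partition_part row_part)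
    qed
    have "j < card (A i) \<longleftrightarrow> j \<in> A i" for i j
      using A[of i] by blast
    then show ?thesis
      using 1 2 3 lam by (auto simp: hstrip_def hstrip_fun_def A_def)
  qed
  define ex where "ex kap T = (\<lambda>c\<in>diagram lam. if c \<in> diagram kap then T c else N)"
    for kap and T :: "nat \<times> nat \<Rightarrow> nat"
  have ex: "ex kap T \<in> ssytN (Suc N) lam" if k: "hstrip kap lam" and T: "T \<in> ssytN N kap" for kap T
  proof -
    have T': "\<And>i j. j < row kap i \<Longrightarrow> T (i, j) < N"
        "\<And>i j. Suc j < row kap i \<Longrightarrow> T (i, j) \<le> T (i, Suc j)"
        "\<And>i j. j < row kap (Suc i) \<Longrightarrow> T (i, j) < T (Suc i, j)"
      using T by (auto simp: ssytN_def ssyt_def)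
    have k': "row kap i \<le> row lam i" "row lam (Suc i) \<le> row kap i" for i
      using k by (auto simp: hstrip_def hstrip_fun_def)
    have "ex kap T (i, j) < Suc N" if "j < row lam i" for i j
      using T'(1) that by (auto simp: ex_def less_Suc_eq)
    moreover have "ex kap T (i, j) \<le> ex kap T (i, Suc j)" if "Suc j < row lam i" for i j
      using T'(1,2) that by (auto simp: ex_def less_imp_le)
    moreover have "ex kap T (i, j) < ex kap T (Suc i, j)" if "j < row lam (Suc i)" for i j
    proof -
      have "j < row kap i" "j < row lam i"
        using that k'[of i] by auto
      then show ?thesis
        using T'(1,3) that by (auto simp: ex_def)
    qed
    ultimately show ?thesis
      by (auto simp: ssytN_def ssyt_def) (simp add: ex_def)
  qed
  have exN: "ex kap T (i, j) < N \<longleftrightarrow> j < row kap i"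
    if k: "hstrip kap lam" and T: "T \<in> ssytN N kap" and "j < row lam i" for kap T i j
    using that by (auto simp: ex_def ssytN_def)
  have re: "restrict T (diagram (sh T)) \<in> ssytN N (sh T)" if T: "T \<in> ssytN (Suc N) lam" for T
  proof -
    have s: "\<And>i j. j < row (sh T) i \<longleftrightarrow> j < row lam i \<and> T (i, j) < N" "is_partition (sh T)"
      using sh[OF T] by (auto simp: hstrip_def)
    have T': "\<And>i j. Suc j < row lam i \<Longrightarrow> T (i, j) \<le> T (i, Suc j)"
        "\<And>i j. j < row lam (Suc i) \<Longrightarrow> T (i, j) < T (Suc i, j)"
      using T by (auto simp: ssytN_def ssyt_def)
    have "restrict T (diagram (sh T)) (i, j) \<le> restrict T (diagram (sh T)) (i, Suc j)"
      if "Suc j < row (sh T) i" for i j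
      using T'(1) that s(1)[of "Suc j" i] by auto
    moreover have "restrict T (diagram (sh T)) (i, j) < restrict T (diagram (sh T)) (Suc i, j)"
      if "j < row (sh T) (Suc i)" for i j
      using T'(2) that s(1)[of j "Suc i"] row_antimono[OF s(2), of i "Suc i"] by auto
    ultimately show ?thesis
      using s(1) by (auto simp: ssytN_def ssyt_def)
  qed
  have "schurN (Suc N) z lam = (\<Sum>(kap, T)\<in>Sigma {kap. hstrip kap lam} (ssytN N).
      z N ^ (card (diagram lam) - card (diagram kap)) * (\<Prod>c\<in>diagram kap. z (T c)))"
    unfolding schurN_def
  proof (rule sum.reindex_bij_witness[where i = "\<lambda>(kap, T). ex kap T" and
        j = "\<lambda>T. (sh T, restrict T (diagram (sh T)))"])
    fix T assume T: "T \<in> ssytN (Suc N) lam"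
    have s: "\<And>i j. j < row (sh T) i \<longleftrightarrow> j < row lam i \<and> T (i, j) < N" "hstrip (sh T) lam"
      using sh[OF T] by auto
    have T': "\<And>i j. j < row lam i \<Longrightarrow> T (i, j) < Suc N" "T \<in> extensional (diagram lam)"
      using T by (auto simp: ssytN_def ssyt_def)
    have "ex (sh T) (restrict T (diagram (sh T))) c = T c" for c
    proof (cases "c \<in> diagram lam")
      case True
      then show ?thesis
        using T'(1) s(1) by (cases c) (auto simp: ex_def less_Suc_eq)
    next
      case False
      then show ?thesis
        using extensional_arb[OF T'(2)] by (simp add: ex_def)
    qed
    then show "(case (sh T, restrict T (diagram (sh T))) of (kap, T) \<Rightarrow> ex kap T) = T"
      by auto
    show "(sh T, restrict T (diagram (sh T))) \<in> Sigma {kap. hstrip kap lam} (ssytN N)"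
      using s re[OF T] by auto
    have sub: "diagram (sh T) \<subseteq> diagram lam"
      using hstrip_subset s(2) by blast
    have "(\<Prod>c\<in>diagram lam. z (T c)) =
        (\<Prod>c\<in>diagram lam - diagram (sh T). z (T c)) * (\<Prod>c\<in>diagram (sh T). z (T c))"
      by (rule prod.subset_diff[OF sub]) simp
    also have "(\<Prod>c\<in>diagram lam - diagram (sh T). z (T c)) = (\<Prod>c\<in>diagram lam - diagram (sh T). z N)"
    proof (rule prod.cong[OF refl])
      fix c assume c: "c \<in> diagram lam - diagram (sh T)"
      obtain i j where ij: "c = (i, j)" by (cases c)
      have "T (i, j) < Suc N" "\<not> T (i, j) < N"
        using c s(1)[of j i] T'(1)[of j i] by (auto simp: ij)
      then show "z (T c) = z N"
        by (simp add: ij less_Suc_eq)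
    qed
    finally show "(case (sh T, restrict T (diagram (sh T))) of (kap, T) \<Rightarrow>
         z N ^ (card (diagram lam) - card (diagram kap)) * (\<Prod>c\<in>diagram kap. z (T c))) =
        (\<Prod>c\<in>diagram lam. z (T c))"
      by (simp add: card_Diff_subset[OF _ sub] cong: prod.cong)
  next
    fix x assume "x \<in> Sigma {kap. hstrip kap lam} (ssytN N)"
    then obtain kap T where x: "x = (kap, T)" and k: "hstrip kap lam" and T: "T \<in> ssytN N kap"
      by auto
    have "{j. j < row lam i \<and> ex kap T (i, j) < N} = {..<row kap i}" for i
      using exN[OF k T] hstrip_subset[OF k] by (auto simp: subset_iff)
    then have "sh (ex kap T) = kap"
      using k by (simp add: sh_def part_row hstrip_def)
    moreover have "restrict (ex kap T) (diagram kap) = T"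
    proof
      fix c
      have "T \<in> extensional (diagram kap)"
        using T by (simp add: ssytN_def ssyt_def)
      from extensional_arb[OF this, of c] show "restrict (ex kap T) (diagram kap) c = T c"
        using hstrip_subset[OF k] by (auto simp: ex_def restrict_def)
    qed
    ultimately show "(sh (case x of (kap, T) \<Rightarrow> ex kap T),
        restrict (case x of (kap, T) \<Rightarrow> ex kap T) (diagram (sh (case x of (kap, T) \<Rightarrow> ex kap T)))) = x"
      by (simp add: x)
    show "(case x of (kap, T) \<Rightarrow> ex kap T) \<in> ssytN (Suc N) lam"
      using ex[OF k T] by (simp add: x)
  qed
  also have "\<dots> = (\<Sum>kap | hstrip kap lam.
      z N ^ (card (diagram lam) - card (diagram kap)) * schurN N z kap)"
    by (subst sum.Sigma[symmetric]) (auto simp: schurN_def sum_distrib_left finite_hstrip finite_ssytN)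
  finally show ?thesis .
qed

lemma schurN_0_nonempty: "diagram lam \<noteq> {} \<Longrightarrow> schurN 0 z lam = 0"
  by (auto simp: schurN_def ssytN_def intro!: sum.neutral)

text \<open>Induction on the number of variables by the branching rule. The commutation relation
  moves the added cell past the strip: the ordinary terms fall under the induction hypothesis, the
  extra ones give the product with the new variable \<open>z N\<close>.\<close>

lemma pieriN:
  assumes "is_partition lam"
  shows "(\<Sum>i<N. z i) * schurN N z lam = (\<Sum>kap | covers lam kap. schurN N z kap)"
  using assms
proof (induction N arbitrary: lam)
  case 0
  have "schurN 0 z kap = 0" if "covers lam kap" for kap
    using that by (intro schurN_0_nonempty) (auto simp: covers_diagram)
  then show ?case by simp
next
  case (Suc N)
  define d where "d lam = card (diagram lam)" for lam
  \<comment> \<open>The weight of \<open>mu\<close> inside a cover of \<open>lam\<close>, whose size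
    is \<open>Suc (d lam)\<close>.\<close>
  define t where "t mu = z N ^ (Suc (d lam) - d mu) * schurN N z mu" for mu
  \<comment> \<open>A finite set containing every \<open>mu\<close> that is reached in either order,
    so that both double sums range over it and can be interchanged.\<close>
  define U where "U = (\<Union>kap\<in>{kap. covers lam kap}. {mu. hstrip mu kap}) \<union>
    (\<Union>nu\<in>{nu. hstrip nu lam}. {mu. covers nu mu}) \<union> {mu. hstrip mu lam}"
  have finU: "finite U"
    by (simp add: U_def finite_covers_above finite_hstrip)
  have pU: "is_partition mu" if "mu \<in> U" for mu
    using that by (auto simp: U_def covers_def hstrip_def)
  have "(\<Sum>kap | covers lam kap. schurN (Suc N) z kap) =
      (\<Sum>kap | covers lam kap. \<Sum>mu\<in>{mu. mu \<in> U \<and> hstrip mu kap}. t mu)"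
  proof (rule sum.cong[OF refl])
    fix kap assume "kap \<in> {kap. covers lam kap}"
    then have k: "covers lam kap" by simp
    then have "{mu. mu \<in> U \<and> hstrip mu kap} = {mu. hstrip mu kap}"
      by (auto simp: U_def)
    then show "schurN (Suc N) z kap = (\<Sum>mu\<in>{mu. mu \<in> U \<and> hstrip mu kap}. t mu)"
      using k covers_card[OF k] schurN_Suc[of kap N z] by (simp add: covers_def t_def d_def)
  qed
  also have "\<dots> = (\<Sum>mu\<in>U. \<Sum>kap | kap \<in> {kap. covers lam kap} \<and> hstrip mu kap. t mu)"
    by (rule sum.swap_restrict) (simp_all add: finU finite_covers_above)
  also have "\<dots> = (\<Sum>mu\<in>U. of_nat (card {kap. covers lam kap \<and> hstrip mu kap}) * t mu)"
    by simp
  also have "\<dots> = (\<Sum>mu\<in>U. of_nat (card {nu. hstrip nu lam \<and> covers nu mu}) * t mu) +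
      (\<Sum>mu\<in>U. if hstrip mu lam then t mu else 0)"
    unfolding sum.distrib[symmetric]
    by (rule sum.cong) (auto simp: hstrip_commutation[OF Suc.prems pU] algebra_simps conj_commute)
  also have "(\<Sum>mu\<in>U. if hstrip mu lam then t mu else 0) = (\<Sum>mu | hstrip mu lam. t mu)"
    by (rule sum.mono_neutral_cong_right[OF finU]) (auto simp: U_def)
  also have "\<dots> = z N * schurN (Suc N) z lam"
  proof -
    have "t mu = z N * (z N ^ (d lam - d mu) * schurN N z mu)" if "hstrip mu lam" for mu
    proof -
      have "d mu \<le> d lam"
        unfolding d_def by (intro card_mono hstrip_subset that) simp
      then show ?thesis by (simp add: t_def Suc_diff_le mult.assoc)
    qed
    then show ?thesis
      by (simp add: schurN_Suc[OF Suc.prems] d_def sum_distrib_left)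
  qed
  also have "(\<Sum>mu\<in>U. of_nat (card {nu. hstrip nu lam \<and> covers nu mu}) * t mu) =
      (\<Sum>mu\<in>U. \<Sum>nu | nu \<in> {nu. hstrip nu lam} \<and> covers nu mu. t mu)"
    by simp
  also have "\<dots> = (\<Sum>nu | hstrip nu lam. \<Sum>mu | mu \<in> U \<and> covers nu mu. t mu)"
    by (rule sum.swap_restrict[symmetric]) (simp_all add: finU finite_hstrip)
  also have "\<dots> = (\<Sum>nu | hstrip nu lam. z N ^ (d lam - d nu) * ((\<Sum>i<N. z i) * schurN N z nu))"
  proof (rule sum.cong[OF refl])
    fix nu assume "nu \<in> {nu. hstrip nu lam}"
    then have k: "hstrip nu lam" by simp
    then have "{mu. mu \<in> U \<and> covers nu mu} = {mu. covers nu mu}"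
      by (auto simp: U_def)
    moreover have "(\<Sum>i<N. z i) * schurN N z nu = (\<Sum>mu | covers nu mu. schurN N z mu)"
      using k by (intro Suc.IH) (simp add: hstrip_def)
    ultimately show "(\<Sum>mu | mu \<in> U \<and> covers nu mu. t mu) =
        z N ^ (d lam - d nu) * ((\<Sum>i<N. z i) * schurN N z nu)"
      by (simp add: t_def d_def covers_card sum_distrib_left)
  qed
  also have "\<dots> = (\<Sum>i<N. z i) * schurN (Suc N) z lam"
    by (simp add: schurN_Suc[OF Suc.prems] d_def sum_distrib_left mult.left_commute)
  finally show ?case
    by (simp add: algebra_simps)
qed

section \<open>Passage to infinitely many variables\<close>

lemma agree_schur:
  assumes "\<And>i. var_index (v i) = i"
  shows "agree N (schur (\<lambda>i. mfps_var (v i)) lam) (schurN N (\<lambda>i. mfps_var (v i)) lam)"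
proof -
  have "agree N (schur (\<lambda>i. mfps_var (v i)) lam)
      (\<Sum>T\<in>{T \<in> ssyt lam. \<forall>c\<in>diagram lam. var_index (v (T c)) < N}. \<Prod>c\<in>diagram lam. mfps_var (v (T c)))"
    unfolding schur_def
    by (rule agree_mfps_sum_prod_var) (use finite_ssytN[of N lam] in \<open>simp_all add: assms ssytN_def\<close>)
  then show ?thesis
    by (simp add: schurN_def ssytN_def assms)
qed

lemmas agree_schur_x = agree_schur[of XVar, simplified] and agree_schur_y = agree_schur[of YVar, simplified]

lemma agree_p_plus:
  "k > 0 \<Longrightarrow> agree N (p_plus k) (\<Sum>i<N. x_var i ^ k + y_var i ^ k)"
  and agree_p_minus:
  "k > 0 \<Longrightarrow> agree N (p_minus k) (\<Sum>i<N. x_var i ^ k - y_var i ^ k)"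
proof -
  have 1: "mfps_nth (mfps_var v ^ k) M = 0"
    if "k > 0" "\<not> var_index v < N" "\<And>v. v \<in># M \<Longrightarrow> var_index v < N" for v :: var and M k
    using that by (cases k) (auto simp: nth_mult_var)
  have 2: "mfps_nth (x_var i ^ k) M = 0" "mfps_nth (y_var i ^ k) M = 0"
    if "k > 0" "i \<in> UNIV - {..<N}" "\<And>v. v \<in># M \<Longrightarrow> var_index v < N" for i M k
    by (rule 1; use that in simp)+
  show "agree N (p_plus k) (\<Sum>i<N. x_var i ^ k + y_var i ^ k)" if "k > 0"
    unfolding p_plus_def by (rule agree_mfps_sum) (use that in \<open>simp_all only: nth_add 2\<close>, simp_all)
  show "agree N (p_minus k) (\<Sum>i<N. x_var i ^ k - y_var i ^ k)" if "k > 0"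
    unfolding p_minus_def by (rule agree_mfps_sum) (use that in \<open>simp_all only: nth_diff 2\<close>, simp_all)
qed

lemma pieri:
  assumes "is_partition lam" "is_partition mu"
  shows "p_plus 1 * (schur x_var lam * schur y_var mu) =
    (\<Sum>kap | covers lam kap. schur x_var kap * schur y_var mu) +
    (\<Sum>kap | covers mu kap. schur x_var lam * schur y_var kap)" (is "?L = ?R")
proof (rule series_eqI_agree)
  fix N
  let ?x = "schurN N x_var" and ?y = "schurN N y_var"
  have "agree N ?L ((\<Sum>i<N. x_var i ^ 1 + y_var i ^ 1) * (?x lam * ?y mu))"
    by (intro agree_mult agree_p_plus agree_schur_x agree_schur_y) simp
  also have "(\<Sum>i<N. x_var i ^ 1 + y_var i ^ 1) * (?x lam * ?y mu) =
      ((\<Sum>i<N. x_var i) * ?x lam) * ?y mu + ?x lam * ((\<Sum>i<N. y_var i) * ?y mu)"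
    by (simp add: sum.distrib algebra_simps)
  also have "\<dots> = (\<Sum>kap | covers lam kap. ?x kap * ?y mu) + (\<Sum>kap | covers mu kap. ?x lam * ?y kap)"
    unfolding pieriN[OF assms(1)] pieriN[OF assms(2)] by (simp only: sum_distrib_left sum_distrib_right)
  also have "agree N \<dots> ?R"
    by (intro agree_add agree_sum agree_mult agree_sym[OF agree_schur_x] agree_sym[OF agree_schur_y])
  finally show "agree N ?L ?R" .
qed

section \<open>Standard bitableaux\<close>

text \<open>The entry set V is arbitrary because the entries of a bitableau are distributed over its
  two components, so that one component alone rarely has an initial segment as its entries.\<close>

definition filling :: "nat \<Rightarrow> nat list \<Rightarrow> nat set \<Rightarrow> (nat \<times> nat \<Rightarrow> nat) set" where
  "filling k lam V = {P. increasing_filling lam P \<and> bij_betw P (diagram lam) V \<and>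
     {1..k} \<subseteq> {P (i, 0) | i. (i, 0) \<in> diagram lam}}"

lemma finite_filling: "finite V \<Longrightarrow> finite (filling k lam V)"
  by (rule finite_subset[OF _ finite_PiE[OF finite_diagram, of lam "\<lambda>_. V"]])
    (auto simp: filling_def increasing_filling_def PiE_def bij_betw_def)

text \<open>The largest entry lies at the end of its row and of its column, so removing its cell
  leaves a partition. As m exceeds k, the entries 1, ..., k stay in the first column.\<close>

lemma filling_remove_max:
  assumes P: "P \<in> filling k lam V" and lam: "is_partition lam"
    and m: "m \<in> V" "\<And>v. v \<in> V \<Longrightarrow> v \<le> m" "k < m"
  shows "\<exists>lam' c. covers lam' lam \<and> diagram lam = insert c (diagram lam') \<and> c \<notin> diagram lam' \<and> P c = m \<and>
    restrict P (diagram lam') \<in> filling k lam' (V - {m})"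
proof -
  have P': "increasing_filling lam P" "bij_betw P (diagram lam) V"
    "\<And>x. x \<in> {1..k} \<Longrightarrow> \<exists>i. x = P (i, 0) \<and> 0 < row lam i"
    using P by (auto simp: filling_def)
  have inc: "\<And>i j. Suc j < row lam i \<Longrightarrow> P (i, j) < P (i, Suc j)"
    "\<And>i j. j < row lam (Suc i) \<Longrightarrow> P (i, j) < P (Suc i, j)" "P \<in> extensional (diagram lam)"
    using P'(1) by (auto simp: increasing_filling_def)
  obtain i j where ij: "(i, j) \<in> diagram lam" "P (i, j) = m"
    using P'(2) m(1) by (metis bij_betw_imp_surj_on imageE surj_pair)
  have le: "P c \<le> m" if "c \<in> diagram lam" for c
    using that P'(2) m(2) by (meson bij_betwE)
  have j: "row lam i = Suc j"
  proof (rule ccontr)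
    assume "row lam i \<noteq> Suc j"
    then have "Suc j < row lam i" using ij(1) by simp
    then show False
      using inc(1) le[of "(i, Suc j)"] ij(2) by fastforce
  qed
  have j': "row lam (Suc i) \<le> j"
  proof (rule ccontr)
    assume "\<not> row lam (Suc i) \<le> j"
    then have "j < row lam (Suc i)" by simp
    then show False
      using inc(2) le[of "(Suc i, j)"] ij(2) by fastforce
  qed
  define r where "r = (row lam)(i := j)"
  define lam' where "lam' = part r"
  have "r (Suc a) \<le> r a" for a
    using row_antimono[OF lam, of a "Suc a"] j j' by (auto simp: r_def)
  moreover have "r (Suc (length lam)) = 0"
    using ij(1) lam by (auto simp: r_def row_def)
  ultimately have lam': "is_partition lam'" "row lam' = r"
    unfolding lam'_def by (auto intro: is_partition_part row_part)
  have ins: "diagram lam = insert (i, j) (diagram lam')" "(i, j) \<notin> diagram lam'"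
    unfolding diagram_row lam' by (auto simp: r_def j split: if_splits)
  have cov: "covers lam' lam"
    using ins lam lam'(1) by (auto simp: covers_diagram)
  have bij: "bij_betw P (diagram lam') (V - {m})"
  proof -
    have inj: "inj_on P (insert (i, j) (diagram lam'))" and V: "V = insert m (P ` diagram lam')"
      using P'(2) ij(2) unfolding ins(1) bij_betw_def by auto
    have "m \<notin> P ` diagram lam'"
    proof
      assume "m \<in> P ` diagram lam'"
      then obtain d where d: "d \<in> diagram lam'" "P d = P (i, j)"
        unfolding ij(2) by (metis imageE)
      then have "d = (i, j)"
        by (intro inj_onD[OF inj]) simp_all
      then show False
        using d(1) ins(2) by simp
    qed
    then show ?thesis
      using inj by (simp add: bij_betw_def V)
  qed
  have "x \<in> {restrict P (diagram lam') (a, 0) | a. (a, 0) \<in> diagram lam'}" if x: "x \<in> {1..k}" for x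
  proof -
    obtain a where a: "x = P (a, 0)" "0 < row lam a"
      using P'(3)[OF x] by blast
    then have "(a, 0) \<noteq> (i, j)"
      using ij(2) m(3) x a(1) by (metis atLeastAtMost_iff leD)
    then have "(a, 0) \<in> diagram lam'"
      using ins a by (metis insertE mem_diagram)
    then show ?thesis using a by auto
  qed
  moreover have "increasing_filling lam' (restrict P (diagram lam'))"
  proof -
    have "(a, b) \<in> diagram lam" if "(a, b) \<in> diagram lam'" for a b
      using that ins by simp
    moreover have "b < row lam' a" if "b < row lam' (Suc a)" for a b
      using that row_antimono[OF lam'(1), of a "Suc a"] by simp
    ultimately show ?thesis
      unfolding increasing_filling_def using inc(1,2) by auto
  qed
  moreover have "bij_betw (restrict P (diagram lam')) (diagram lam') (V - {m})"
    using bij by (simp cong: bij_betw_cong)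
  ultimately have "restrict P (diagram lam') \<in> filling k lam' (V - {m})"
    unfolding filling_def by blast
  then show ?thesis
    using cov ins ij(2) by blast
qed

lemma filling_insert_max:
  assumes P: "P \<in> filling k lam' (V - {m})" and cov: "covers lam' lam"
    and c: "diagram lam = insert c (diagram lam')" "c \<notin> diagram lam'"
    and m: "m \<in> V" "\<And>v. v \<in> V \<Longrightarrow> v \<le> m"
  shows "P(c := m) \<in> filling k lam V"
proof -
  have P': "increasing_filling lam' P" "bij_betw P (diagram lam') (V - {m})"
    "\<And>x. x \<in> {1..k} \<Longrightarrow> \<exists>i. x = P (i, 0) \<and> 0 < row lam' i"
    using P by (auto simp: filling_def)
  have inc: "\<And>i j. Suc j < row lam' i \<Longrightarrow> P (i, j) < P (i, Suc j)"
    "\<And>i j. j < row lam' (Suc i) \<Longrightarrow> P (i, j) < P (Suc i, j)" "P \<in> extensional (diagram lam')"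
    using P'(1) by (auto simp: increasing_filling_def)
  have part: "is_partition lam" "is_partition lam'"
    using cov by (auto simp: covers_def)
  have lt: "P d < m" if "d \<in> diagram lam'" for d
    using that P'(2) m(2) bij_betwE by fastforce
  have "bij_betw (P(c := m)) (diagram lam) V"
  proof -
    have "bij_betw (P(c := m)) (diagram lam' \<union> {c}) ((V - {m}) \<union> {m})"
    proof (intro bij_betw_combine)
      show "bij_betw (P(c := m)) (diagram lam') (V - {m})"
        using P'(2) c(2) by (subst bij_betw_cong[of _ _ P]) auto
    qed (auto simp: bij_betw_def)
    moreover have "V - {m} \<union> {m} = V" using m(1) by auto
    ultimately show ?thesis using c(1) by simp
  qed
  moreover have "{1..k} \<subseteq> {(P(c := m)) (i, 0) | i. (i, 0) \<in> diagram lam}"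
  proof
    fix x assume "x \<in> {1..k}"
    then obtain a where "x = P (a, 0)" "(a, 0) \<in> diagram lam'"
      using P'(3) by auto
    then show "x \<in> {(P(c := m)) (i, 0) | i. (i, 0) \<in> diagram lam}"
      using c by (auto intro!: exI[of _ a])
  qed
  moreover have "increasing_filling lam (P(c := m))"
    unfolding increasing_filling_def
  proof (intro conjI allI impI)
    show "P(c := m) \<in> extensional (diagram lam)"
      using inc(3) c by (auto simp: extensional_def)
    fix i j
    show "(P(c := m)) (i, j) < (P(c := m)) (i, Suc j)" if ij: "(i, Suc j) \<in> diagram lam"
    proof (cases "(i, Suc j) = c")
      case True
      have "(i, j) \<in> diagram lam" "(i, j) \<noteq> c"
        using ij True by auto
      then show ?thesis
        using True lt c(1) by auto
    next
      case False
      then have "(i, Suc j) \<in> diagram lam'" using ij c(1) by blast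
      moreover from this have "(i, j) \<in> diagram lam'" by simp
      ultimately show ?thesis
        using False inc(1) c(2) by (metis fun_upd_apply mem_diagram)
    qed
    show "(P(c := m)) (i, j) < (P(c := m)) (Suc i, j)" if ij: "(Suc i, j) \<in> diagram lam"
    proof (cases "(Suc i, j) = c")
      case True
      have "(i, j) \<in> diagram lam" "(i, j) \<noteq> c"
        using ij True row_antimono[OF part(1), of i "Suc i"] by auto
      then show ?thesis
        using True lt c(1) by auto
    next
      case False
      then have "(Suc i, j) \<in> diagram lam'" using ij c(1) by blast
      moreover from this have "(i, j) \<in> diagram lam'"
        using row_antimono[OF part(2), of i "Suc i"] by simp
      ultimately show ?thesis
        using False inc(2) c(2) by (metis fun_upd_apply mem_diagram)
    qed
  qed
  ultimately show ?thesis
    by (auto simp: filling_def)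
qed

lemma card_filling_rec:
  assumes lam: "is_partition lam" and V: "finite V" "m \<in> V" "\<And>v. v \<in> V \<Longrightarrow> v \<le> m" "k < m"
  shows "card (filling k lam V) = (\<Sum>lam' | covers lam' lam. card (filling k lam' (V - {m})))"
proof -
  define cell where "cell lam' = (THE c. c \<in> diagram lam - diagram lam')" for lam'
  have cell: "cell lam' = c" if "diagram lam = insert c (diagram lam')" "c \<notin> diagram lam'" for lam' c
    unfolding cell_def using that by (auto intro!: the_equality)
  \<comment> \<open>The chosen shape is in fact unique, because a filling takes the value m in one
    cell only; this is what makes the two maps below inverse to each other.\<close>
  define shp where "shp P = (SOME lam'. covers lam' lam \<and> (\<exists>c. diagram lam = insert c (diagram lam') \<and>
    c \<notin> diagram lam' \<and> P c = m \<and> restrict P (diagram lam') \<in> filling k lam' (V - {m})))" for P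
  have shp: "covers (shp P) lam \<and> (\<exists>c. diagram lam = insert c (diagram (shp P)) \<and>
    c \<notin> diagram (shp P) \<and> P c = m \<and> restrict P (diagram (shp P)) \<in> filling k (shp P) (V - {m}))"
    if "P \<in> filling k lam V" for P
    unfolding shp_def by (rule someI_ex) (use filling_remove_max[OF that lam V(2-4)] in blast)
  have "card (filling k lam V) = card (Sigma {lam'. covers lam' lam} (\<lambda>lam'. filling k lam' (V - {m})))"
  proof (rule bij_betw_same_card, rule bij_betw_byWitness[where f = "\<lambda>P. (shp P, restrict P (diagram (shp P)))"
        and f' = "\<lambda>(lam', P). P(cell lam' := m)"])
    show "\<forall>P\<in>filling k lam V. (case (shp P, restrict P (diagram (shp P))) of (lam', P) \<Rightarrow> P(cell lam' := m)) = P"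
    proof
      fix P assume P: "P \<in> filling k lam V"
      then obtain c where c: "diagram lam = insert c (diagram (shp P))" "c \<notin> diagram (shp P)" "P c = m"
        using shp by blast
      have "P \<in> extensional (diagram lam)"
        using P by (auto simp: filling_def increasing_filling_def)
      then have "(restrict P (diagram (shp P)))(c := m) = P"
        using c by (auto simp: fun_eq_iff restrict_def extensional_def)
      then show "(case (shp P, restrict P (diagram (shp P))) of (lam', P) \<Rightarrow> P(cell lam' := m)) = P"
        using cell[OF c(1,2)] by simp
    qed
    show "\<forall>x\<in>Sigma {lam'. covers lam' lam} (\<lambda>lam'. filling k lam' (V - {m})).
        (shp (case x of (lam', P) \<Rightarrow> P(cell lam' := m)),
         restrict (case x of (lam', P) \<Rightarrow> P(cell lam' := m)) (diagram (shp (case x of (lam', P) \<Rightarrow> P(cell lam' := m))))) = x"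
    proof
      fix x assume "x \<in> Sigma {lam'. covers lam' lam} (\<lambda>lam'. filling k lam' (V - {m}))"
      then obtain lam' P where x: "x = (lam', P)" "covers lam' lam" "P \<in> filling k lam' (V - {m})"
        by auto
      obtain c where c: "diagram lam = insert c (diagram lam')" "c \<notin> diagram lam'"
        using x(2) by (auto simp: covers_diagram)
      have P': "P(c := m) \<in> filling k lam V"
        by (rule filling_insert_max[OF x(3,2) c V(2,3)])
      obtain d where d: "diagram lam = insert d (diagram (shp (P(c := m))))" "d \<notin> diagram (shp (P(c := m)))"
          "(P(c := m)) d = m" "covers (shp (P(c := m))) lam"
        using shp[OF P'] by blast
      have "inj_on (P(c := m)) (diagram lam)"
        using P' by (auto simp: filling_def bij_betw_def)
      then have "d = c"
        using c(1) d(1,3) by (auto dest: inj_onD)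
      then have "diagram (shp (P(c := m))) = diagram lam'"
        using c d(1,2) by (metis Diff_insert_absorb)
      then have e: "shp (P(c := m)) = lam'"
        using d(4) x(2) by (intro diagram_inject) (auto simp: covers_def)
      have "P \<in> extensional (diagram lam')"
        using x(3) by (auto simp: filling_def increasing_filling_def)
      then have "restrict (P(c := m)) (diagram lam') = P"
        using c by (auto simp: fun_eq_iff restrict_def extensional_def)
      then show "(shp (case x of (lam', P) \<Rightarrow> P(cell lam' := m)),
         restrict (case x of (lam', P) \<Rightarrow> P(cell lam' := m)) (diagram (shp (case x of (lam', P) \<Rightarrow> P(cell lam' := m))))) = x"
        using e cell[OF c] x(1) by simp
    qed
    show "(\<lambda>P. (shp P, restrict P (diagram (shp P)))) ` filling k lam V \<subseteq>
        Sigma {lam'. covers lam' lam} (\<lambda>lam'. filling k lam' (V - {m}))"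
      using shp by auto
    show "(\<lambda>(lam', P). P(cell lam' := m)) ` Sigma {lam'. covers lam' lam} (\<lambda>lam'. filling k lam' (V - {m})) \<subseteq>
        filling k lam V"
    proof clarify
      fix lam' P assume x: "covers lam' lam" "P \<in> filling k lam' (V - {m})"
      obtain c where c: "diagram lam = insert c (diagram lam')" "c \<notin> diagram lam'"
        using x(1) by (auto simp: covers_diagram)
      show "P(cell lam' := m) \<in> filling k lam V"
        using filling_insert_max[OF x(2,1) c V(2,3)] cell[OF c] by simp
    qed
  qed
  also have "\<dots> = (\<Sum>lam' | covers lam' lam. card (filling k lam' (V - {m})))"
    by (rule card_SigmaI) (auto simp: finite_covers_below finite_filling V(1))
  finally show ?thesis .
qed

section \<open>Bitableaux with a prescribed initial part of the first column\<close>

definition run_bitableaux :: "nat \<Rightarrow> nat list \<Rightarrow> nat list \<Rightarrow> ((nat \<times> nat \<Rightarrow> nat) \<times> (nat \<times> nat \<Rightarrow> nat)) set" where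
  "run_bitableaux k lam mu = {(P, Q) \<in> bitableaux lam mu. {1..k} \<subseteq> {P (i, 0) | i. (i, 0) \<in> diagram lam}}"

text \<open>Used to split the bitableaux by the entry set V of the first tableau, the second one
  then having exactly the complement of V.\<close>

lemma bij_betw_case_sum:
  "bij_betw (case_sum P Q) (A <+> B) W \<longleftrightarrow>
    bij_betw P A (P ` A) \<and> P ` A \<subseteq> W \<and> bij_betw Q B (W - P ` A)"
proof -
  have 1: "case_sum P Q ` (A <+> B) = P ` A \<union> Q ` B"
    by (auto simp: image_iff) (metis old.sum.simps(5,6) InlI InrI)+
  have 2: "inj_on (case_sum P Q) (A <+> B) \<longleftrightarrow> inj_on P A \<and> inj_on Q B \<and> P ` A \<inter> Q ` B = {}"
  proof -
    have "inj_on (case_sum P Q) (Inl ` A) \<longleftrightarrow> inj_on P A" "inj_on (case_sum P Q) (Inr ` B) \<longleftrightarrow> inj_on Q B"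
      by (auto simp: inj_on_def)
    moreover have "Inl ` A - Inr ` B = Inl ` A" "Inr ` B - Inl ` A = Inr ` B"
      "case_sum P Q ` Inl ` A = P ` A" "case_sum P Q ` Inr ` B = Q ` B"
      by (auto simp: image_iff)
    ultimately show ?thesis
      unfolding Plus_def inj_on_Un by simp
  qed
  show ?thesis
    unfolding bij_betw_def 1 2 by auto
qed

lemma card_run_bitableaux:
  "card (run_bitableaux k lam mu) =
    (\<Sum>V\<in>Pow {1..sum_list lam + sum_list mu}.
      card (filling k lam V) * card (filling 0 mu ({1..sum_list lam + sum_list mu} - V)))"
proof -
  let ?W = "{1..sum_list lam + sum_list mu}"
  have "run_bitableaux k lam mu = (\<Union>V\<in>Pow ?W. filling k lam V \<times> filling 0 mu (?W - V))"
    unfolding run_bitableaux_def bitableaux_def bij_betw_case_sum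
    by (auto simp: filling_def bij_betw_def) (blast+)?
  also have "card \<dots> = (\<Sum>V\<in>Pow ?W. card (filling k lam V \<times> filling 0 mu (?W - V)))"
  proof (rule card_UN_disjoint)
    show "\<forall>V\<in>Pow ?W. finite (filling k lam V \<times> filling 0 mu (?W - V))"
      by (auto intro!: finite_cartesian_product finite_filling intro: finite_subset)
    show "\<forall>V\<in>Pow ?W. \<forall>V'\<in>Pow ?W. V \<noteq> V' \<longrightarrow>
        filling k lam V \<times> filling 0 mu (?W - V) \<inter> filling k lam V' \<times> filling 0 mu (?W - V') = {}"
      by (auto simp: filling_def bij_betw_def)
  qed simp
  finally show ?thesis
    by (simp add: card_cartesian_product)
qed

text \<open>The largest entry \<open>Suc n\<close> belongs to one of the two tableaux and is removed
  from there; as k is at most n, it is not among the entries required in the first column.\<close>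

lemma card_run_bitableaux_rec:
  assumes lam: "is_partition lam" and mu: "is_partition mu"
    and n: "sum_list lam + sum_list mu = Suc n" "k \<le> n"
  shows "card (run_bitableaux k lam mu) =
    (\<Sum>lam' | covers lam' lam. card (run_bitableaux k lam' mu)) +
    (\<Sum>mu' | covers mu' mu. card (run_bitableaux k lam mu'))"
proof -
  have Pow: "Pow {1..Suc n} = Pow {1..n} \<union> insert (Suc n) ` Pow {1..n}"
    by (simp add: atLeastAtMostSuc_conv Pow_insert)
  have disj: "Pow {1..n} \<inter> insert (Suc n) ` Pow {1..n} = {}"
    by auto
  have inj: "inj_on (insert (Suc n)) (Pow {1..n})"
    by (rule inj_onI) (metis PowD Diff_insert_absorb Suc_n_not_le_n atLeastAtMost_iff subsetD)
  have "card (run_bitableaux k lam mu) =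
      (\<Sum>V\<in>Pow {1..n}. card (filling k lam V) * card (filling 0 mu ({1..Suc n} - V))) +
      (\<Sum>V\<in>Pow {1..n}. card (filling k lam (insert (Suc n) V)) * card (filling 0 mu ({1..Suc n} - insert (Suc n) V)))"
    unfolding card_run_bitableaux n(1) Pow
    by (subst sum.union_disjoint) (use disj sum.reindex[OF inj] in \<open>auto simp: o_def\<close>)
  also have "(\<Sum>V\<in>Pow {1..n}. card (filling k lam V) * card (filling 0 mu ({1..Suc n} - V))) =
      (\<Sum>V\<in>Pow {1..n}. card (filling k lam V) * (\<Sum>mu' | covers mu' mu. card (filling 0 mu' ({1..n} - V))))"
  proof (rule sum.cong[OF refl])
    fix V assume V: "V \<in> Pow {1..n}"
    then have "{1..Suc n} - V - {Suc n} = {1..n} - V"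
      by auto
    moreover have "Suc n \<notin> V" using V by auto
    ultimately show "card (filling k lam V) * card (filling 0 mu ({1..Suc n} - V)) =
        card (filling k lam V) * (\<Sum>mu' | covers mu' mu. card (filling 0 mu' ({1..n} - V)))"
      by (subst card_filling_rec[OF mu, where m = "Suc n"]) auto
  qed
  also have "\<dots> = (\<Sum>mu' | covers mu' mu. \<Sum>V\<in>Pow {1..n}. card (filling k lam V) * card (filling 0 mu' ({1..n} - V)))"
    by (simp add: sum_distrib_left sum.swap[of _ _ "Pow _"])
  also have "\<dots> = (\<Sum>mu' | covers mu' mu. card (run_bitableaux k lam mu'))"
  proof (rule sum.cong[OF refl])
    fix mu' assume "mu' \<in> {mu'. covers mu' mu}"
    then have "sum_list lam + sum_list mu' = n"
      using n(1) covers_card[of mu' mu] by (simp add: card_diagram)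
    then show "(\<Sum>V\<in>Pow {1..n}. card (filling k lam V) * card (filling 0 mu' ({1..n} - V))) =
        card (run_bitableaux k lam mu')"
      by (simp add: card_run_bitableaux)
  qed
  also have "(\<Sum>V\<in>Pow {1..n}. card (filling k lam (insert (Suc n) V)) * card (filling 0 mu ({1..Suc n} - insert (Suc n) V))) =
      (\<Sum>V\<in>Pow {1..n}. (\<Sum>lam' | covers lam' lam. card (filling k lam' V)) * card (filling 0 mu ({1..n} - V)))"
  proof (rule sum.cong[OF refl])
    fix V assume V: "V \<in> Pow {1..n}"
    then have "{1..Suc n} - insert (Suc n) V = {1..n} - V"
      by auto
    moreover have "insert (Suc n) V - {Suc n} = V" "finite V"
      using V by (auto intro: finite_subset)
    ultimately show "card (filling k lam (insert (Suc n) V)) * card (filling 0 mu ({1..Suc n} - insert (Suc n) V)) =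
        (\<Sum>lam' | covers lam' lam. card (filling k lam' V)) * card (filling 0 mu ({1..n} - V))"
      using V n(2) by (subst card_filling_rec[OF lam, where m = "Suc n"]) auto
  qed
  also have "\<dots> = (\<Sum>lam' | covers lam' lam. \<Sum>V\<in>Pow {1..n}. card (filling k lam' V) * card (filling 0 mu ({1..n} - V)))"
    by (simp add: sum_distrib_right sum.swap[of _ _ "Pow _"])
  also have "\<dots> = (\<Sum>lam' | covers lam' lam. card (run_bitableaux k lam' mu))"
  proof (rule sum.cong[OF refl])
    fix lam' assume "lam' \<in> {lam'. covers lam' lam}"
    then have "sum_list lam' + sum_list mu = n"
      using n(1) covers_card[of lam' lam] by (simp add: card_diagram)
    then show "(\<Sum>V\<in>Pow {1..n}. card (filling k lam' V) * card (filling 0 mu ({1..n} - V))) =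
        card (run_bitableaux k lam' mu)"
      by (simp add: card_run_bitableaux)
  qed
  finally show ?thesis by simp
qed

text \<open>The values grow by at least 1 at each step. Counted from the start this bounds
  \<open>f i\<close> from below by \<open>Suc i\<close>, and counted back from the last value, which
  is at most k, it bounds \<open>f i\<close> from above by the same number.\<close>

lemma strict_inc_onto_eq:
  assumes "\<And>i. Suc i < k \<Longrightarrow> f i < f (Suc i)" "\<And>i. i < k \<Longrightarrow> f i \<in> {1..k}" "i < k"
  shows "f i = Suc i"
proof -
  have 1: "i < k \<Longrightarrow> Suc i \<le> f i" for i
    by (induction i) (use assms in \<open>force+\<close>)
  have 2: "d \<le> i \<Longrightarrow> i < k \<Longrightarrow> f (i - d) + d \<le> f i" for d i
  proof (induction d)
    case (Suc d)
    have "f (i - Suc d) < f (Suc (i - Suc d))"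
      using Suc.prems by (intro assms(1)) auto
    moreover have "Suc (i - Suc d) = i - d" using Suc.prems by simp
    ultimately show ?case using Suc by simp
  qed simp
  have "f i + (k - 1 - i) \<le> f (k - 1)"
    using 2[of "k - 1 - i" "k - 1"] assms(3) by simp
  moreover have "f (k - 1) \<le> k"
    using assms(2)[of "k - 1"] assms(3) by simp
  ultimately show ?thesis
    using 1[OF assms(3)] assms(3) by simp
qed

lemma is_partition_column: "is_partition (replicate k (Suc 0))"
  by (auto simp: is_partition_def sorted_wrt_iff_nth_less)

lemma row_column: "row (replicate k (Suc 0)) i = (if i < k then 1 else 0)"
  by (simp add: row_def)

lemma diagram_column: "diagram (replicate k (Suc 0)) = {..<k} \<times> {0}"
  by (auto simp: diagram_row row_column split: if_splits)

lemma bitableaux_column: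
  "run_bitableaux k (replicate k (Suc 0)) [] = {(\<lambda>c\<in>{..<k} \<times> {0}. Suc (fst c), \<lambda>_. undefined)}"
proof (rule set_eqI, clarify)
  fix P Q :: "nat \<times> nat \<Rightarrow> nat"
  let ?P = "\<lambda>c\<in>{..<k} \<times> {0::nat}. Suc (fst c)"
  have "P = ?P \<and> Q = (\<lambda>_. undefined)" if "(P, Q) \<in> run_bitableaux k (replicate k (Suc 0)) []"
  proof -
    have "(P, Q) \<in> bitableaux (replicate k (Suc 0)) []"
      using that by (simp add: run_bitableaux_def)
    then have P: "P \<in> extensional ({..<k} \<times> {0})" "\<And>i. Suc i < k \<Longrightarrow> P (i, 0) < P (Suc i, 0)"
      "bij_betw (case_sum P Q) (({..<k} \<times> {0}) <+> {}) {1..k}" "Q \<in> extensional {}"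
      by (auto simp: bitableaux_def increasing_filling_def diagram_column row_column sum_list_replicate
          diagram_row[of "[]"] row_def[of "[]"])
    have "P (i, 0) \<in> {1..k}" if "i < k" for i
      using bij_betwE[OF P(3)] that by force
    then have "P (i, 0) = Suc i" if "i < k" for i
      using strict_inc_onto_eq[of k "\<lambda>i. P (i, 0)"] P(2) that by blast
    then show ?thesis
      using P(1,4) by (auto simp: fun_eq_iff restrict_def extensional_def)
  qed
  moreover have "(?P, \<lambda>_. undefined) \<in> run_bitableaux k (replicate k (Suc 0)) []"
  proof -
    have "bij_betw (case_sum ?P (\<lambda>_. undefined)) (({..<k} \<times> {0}) <+> {}) {1..k}"
      unfolding bij_betw_case_sum
      by (auto simp: bij_betw_def inj_on_def image_iff) (metis Suc_le_D Suc_le_eq lessThan_iff)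
    then have "(?P, \<lambda>_. undefined) \<in> bitableaux (replicate k (Suc 0)) []"
      by (auto simp: bitableaux_def increasing_filling_def diagram_column row_column
          sum_list_replicate diagram_row[of "[]"] row_def[of "[]"] split: if_splits)
    moreover have "x \<in> {?P (i, 0) | i. (i, 0) \<in> diagram (replicate k (Suc 0))}" if "x \<in> {1..k}" for x
      using that by (auto simp: row_column intro!: exI[of _ "x - 1"])
    ultimately show ?thesis
      unfolding run_bitableaux_def by blast
  qed
  ultimately show "(P, Q) \<in> run_bitableaux k (replicate k (Suc 0)) [] \<longleftrightarrow> (P, Q) \<in> {(?P, \<lambda>_. undefined)}"
    by auto
qed

text \<open>When k is the total number of cells, the k required entries already fill as many cells
  of the first column of \<open>lam\<close>, so there are no others: \<open>lam\<close> is a single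
  column and \<open>mu\<close> is empty.\<close>

lemma card_run_bitableaux_base:
  assumes lam: "is_partition lam" and mu: "is_partition mu"
    and n: "sum_list lam + sum_list mu = k"
  shows "card (run_bitableaux k lam mu) = (if lam = replicate k (Suc 0) \<and> mu = [] then 1 else 0)"
proof (cases "lam = replicate k (Suc 0) \<and> mu = []")
  case False
  have "run_bitableaux k lam mu = {}"
  proof (rule ccontr)
    assume "run_bitableaux k lam mu \<noteq> {}"
    then obtain P Q where "(P, Q) \<in> run_bitableaux k lam mu"
      by auto
    then have P: "{1..k} \<subseteq> {P (i, 0) | i. (i, 0) \<in> diagram lam}"
      by (simp add: run_bitableaux_def)
    define C where "C = diagram lam \<inter> UNIV \<times> {0}"
    have "{1..k} \<subseteq> P ` C"
      using P by (force simp: C_def)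
    moreover have "finite C"
      by (simp add: C_def)
    ultimately have kC: "k \<le> card C"
      using card_mono[of "P ` C" "{1..k}"] card_image_le[of C P] by auto
    have "card C \<le> card (diagram lam)"
      by (intro card_mono) (auto simp: C_def)
    then have m0: "sum_list mu = 0" "card C = card (diagram lam)" "sum_list lam = k"
      using kC n unfolding card_diagram by linarith+
    then have "mu = []"
      using mu by (cases mu) (auto simp: is_partition_def)
    have "C = diagram lam"
      using m0(2) by (intro card_subset_eq) (auto simp: C_def)
    then have one: "row lam i \<le> 1" for i
    proof -
      have "(i, 1) \<notin> diagram lam"
        using \<open>C = diagram lam\<close> by (auto simp: C_def set_eq_iff dest: spec[of _ i])
      then show ?thesis by simp
    qed
    have A: "lam = replicate (length lam) (Suc 0)"
    proof (rule nth_equalityI)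
      fix i assume i: "i < length lam"
      then show "lam ! i = replicate (length lam) (Suc 0) ! i"
        using one[of i] row_pos_iff[OF lam, of i] by (simp add: row_def)
    qed simp
    have "sum_list lam = sum_list (replicate (length lam) (Suc 0))"
      by (rule arg_cong[OF A])
    then have B: "length lam = k"
      using m0(3) by (simp add: sum_list_replicate)
    have "lam = replicate k (Suc 0) \<and> mu = []"
      using A[unfolded B] \<open>mu = []\<close> by (rule conjI)
    with False show False
      by (rule notE)
  qed
  then show ?thesis using False by simp
qed (simp add: bitableaux_column)

section \<open>Even runs as alternating sums\<close>

lemma alternating_run_sum:
  assumes "Q 0" "\<And>j k. j \<le> k \<Longrightarrow> Q k \<Longrightarrow> Q j" "\<And>k. Q k \<Longrightarrow> k \<le> n"
  shows "(\<Sum>k\<le>n. if Q k then (-1) ^ k else 0) = (if even (Max {k. Q k}) then 1 else (0 :: 'a :: comm_ring_1))"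
proof -
  have fin: "finite {k. Q k}"
    by (rule finite_subset[of _ "{..n}"]) (use assms(3) in auto)
  define m where "m = Max {k. Q k}"
  have m: "Q m" "m \<le> n"
    using Max_in[OF fin] assms(1,3) by (auto simp: m_def)
  have "Q k \<longleftrightarrow> k \<le> m" for k
    using Max_ge[OF fin] m(1) assms(2) by (auto simp: m_def)
  then have "(\<Sum>k\<le>n. if Q k then (-1) ^ k else (0::'a)) = (\<Sum>k\<le>m. (-1) ^ k)"
    using m(2) by (intro sum.mono_neutral_cong_right) auto
  also have "\<dots> = (if even m then 1 else 0)"
    by (induction m) auto
  finally show ?thesis by (simp add: m_def)
qed

lemma finite_bitableaux: "finite (bitableaux lam mu)"
proof -
  have "bitableaux lam mu = run_bitableaux 0 lam mu"
    by (auto simp: run_bitableaux_def)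
  moreover have "run_bitableaux 0 lam mu \<subseteq> (\<Union>V\<in>Pow {1..sum_list lam + sum_list mu}.
      filling 0 lam V \<times> filling 0 mu ({1..sum_list lam + sum_list mu} - V))"
    unfolding run_bitableaux_def bitableaux_def bij_betw_case_sum
    by (auto simp: filling_def) 
  moreover have "finite (\<Union>V\<in>Pow {1..sum_list lam + sum_list mu}.
      filling 0 lam V \<times> filling 0 mu ({1..sum_list lam + sum_list mu} - V))"
    by (auto intro!: finite_cartesian_product finite_filling intro: finite_subset)
  ultimately show ?thesis by (simp add: finite_subset)
qed

lemma c_coeff_alternating:
  "(of_nat (c_coeff lam mu) :: 'a :: comm_ring_1) =
    (\<Sum>k\<le>sum_list lam + sum_list mu. (-1) ^ k * of_nat (card (run_bitableaux k lam mu)))"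
proof -
  let ?n = "sum_list lam + sum_list mu"
  let ?Q = "\<lambda>P k. {1..k} \<subseteq> {P (i, 0) | i. (i, 0) \<in> diagram lam}"
  have "(\<Sum>k\<le>?n. (-1) ^ k * of_nat (card (run_bitableaux k lam mu))) =
      (\<Sum>k\<le>?n. \<Sum>x\<in>bitableaux lam mu. if ?Q (fst x) k then (-1) ^ k else (0 :: 'a))"
  proof (rule sum.cong[OF refl])
    fix k
    have "{x \<in> bitableaux lam mu. ?Q (fst x) k} = run_bitableaux k lam mu"
      by (simp add: run_bitableaux_def case_prod_beta')
    then show "(-1) ^ k * of_nat (card (run_bitableaux k lam mu)) =
        (\<Sum>x\<in>bitableaux lam mu. if ?Q (fst x) k then (-1) ^ k else (0 :: 'a))"
      by (simp add: sum.If_cases finite_bitableaux Int_def mult.commute)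
  qed
  also have "\<dots> = (\<Sum>x\<in>bitableaux lam mu. \<Sum>k\<le>?n. if ?Q (fst x) k then (-1) ^ k else (0 :: 'a))"
    by (rule sum.swap)
  also have "\<dots> = (\<Sum>x\<in>bitableaux lam mu. if even (first_column_run lam (fst x)) then 1 else 0)"
  proof (rule sum.cong[OF refl])
    fix x assume "x \<in> bitableaux lam mu"
    then have "bij_betw (case_sum (fst x) (snd x)) (diagram lam <+> diagram mu) {1..?n}"
      by (auto simp: bitableaux_def)
    then have sub: "fst x ` diagram lam \<subseteq> {1..?n}"
      by (simp add: bij_betw_case_sum)
    show "(\<Sum>k\<le>?n. if ?Q (fst x) k then (-1) ^ k else (0 :: 'a)) =
        (if even (first_column_run lam (fst x)) then 1 else 0)"
      unfolding first_column_run_def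
    proof (rule alternating_run_sum)
      fix k assume k: "?Q (fst x) k"
      have "{1..k} \<subseteq> fst x ` diagram lam"
        using k by blast
      with sub have "{1..k} \<subseteq> {1..?n}" by blast
      then show "k \<le> ?n" by (cases "k = 0") simp_all
    next
      show "?Q (fst x) j" if "j \<le> k" "?Q (fst x) k" for j k
        using that by (meson atLeastatMost_subset_iff order_refl subset_trans)
    qed simp
  qed
  also have "\<dots> = of_nat (card {x \<in> bitableaux lam mu. even (first_column_run lam (fst x))})"
    by (simp add: sum.If_cases finite_bitableaux Int_def)
  also have "{x \<in> bitableaux lam mu. even (first_column_run lam (fst x))} =
      {(P, Q) \<in> bitableaux lam mu. even (first_column_run lam P)}"
    by auto
  finally show ?thesis
    by (simp add: c_coeff_def)
qed

lemma const_diff: "mfps_const (a - b) = mfps_const a - mfps_const (b :: 'a :: comm_ring_1)"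
  by (rule mfps_eqI) (simp add: mfps_const.rep_eq)

lemma finite_partitions: "finite {lam. is_partition lam \<and> sum_list lam \<le> n}"
proof (rule finite_subset)
  show "{lam. is_partition lam \<and> sum_list lam \<le> n} \<subseteq> {xs. set xs \<subseteq> {..n} \<and> length xs \<le> n}"
  proof clarify
    fix lam assume lam: "is_partition lam" "sum_list lam \<le> n"
    have "length lam \<le> sum_list lam"
      using lam(1) by (induction lam) (auto simp: is_partition_def Suc_le_eq add_mono_thms_linordered_field)
    moreover have "x \<le> sum_list lam" if "x \<in> set lam" for x
      using that by (simp add: member_le_sum_list)
    ultimately show "set lam \<subseteq> {..n} \<and> length lam \<le> n"
      using lam(2) by (auto intro: le_trans)
  qed
qed (simp add: finite_lists_length_le)

lemma finite_bipartitions: "finite (bipartitions n)"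
  by (rule finite_subset[OF _ finite_cartesian_product[OF finite_partitions[of n] finite_partitions[of n]]])
    (auto simp: bipartitions_def)

section \<open>Conjugate partitions\<close>

lemma row_conjugate:
  assumes "is_partition lam"
  shows "i < row (conjugate lam) j \<longleftrightarrow> j < row lam i"
proof -
  define A where "A = {i. j < row lam i}"
  have A': "A = {i. i < length lam \<and> j < lam ! i}"
    by (auto simp: A_def row_def split: if_splits)
  have A: "A = {..<card A}"
  proof (rule downset_eq_lessThan)
    show "finite A" by (simp add: A')
    show "i \<in> A" if "i \<le> i'" "i' \<in> A" for i i'
      using that row_antimono[OF assms, of i i'] by (simp add: A_def)
  qed
  have mem: "i \<in> A \<longleftrightarrow> j < row lam i" for i
    by (simp add: A_def)
  have "row (conjugate lam) j = card A"
  proof (cases "lam \<noteq> [] \<and> j < hd lam")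
    case True
    then show ?thesis
      by (simp add: row_def conjugate_def length_filter_conv_card A')
  next
    case False
    have "\<not> j < row lam i" for i
      using False row_antimono[OF assms, of 0 i] by (cases lam) (auto simp: row_def split: if_splits)
    then have "A = {}" using mem by auto
    then show ?thesis
      using False by (auto simp: row_def conjugate_def)
  qed
  then show ?thesis
    using A mem by (metis lessThan_iff)
qed

lemma is_partition_conjugate:
  assumes "is_partition lam"
  shows "is_partition (conjugate lam)"
proof -
  have "0 \<notin> set (conjugate lam)"
  proof
    assume "0 \<in> set (conjugate lam)"
    then obtain j where "lam \<noteq> []" "j < hd lam" "filter (\<lambda>p. j < p) lam = []"
      by (auto simp: conjugate_def split: if_splits)
    then show False
      by (cases lam) auto
  qed
  moreover have "conjugate lam ! j' \<le> conjugate lam ! j" if "j < j'" "j' < length (conjugate lam)" for j j'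
  proof -
    have "filter (\<lambda>p. j' < p) lam = filter (\<lambda>p. j' < p) (filter (\<lambda>p. j < p) lam)"
      using that(1) by (auto simp: intro: filter_cong)
    then have "length (filter (\<lambda>p. j' < p) lam) \<le> length (filter (\<lambda>p. j < p) lam)"
      by (metis length_filter_le)
    then show ?thesis
      using that by (simp add: conjugate_def)
  qed
  ultimately show ?thesis
    by (simp add: is_partition_def sorted_wrt_iff_nth_less)
qed

lemma diagram_conjugate: "is_partition lam \<Longrightarrow> diagram (conjugate lam) = prod.swap ` diagram lam"
  using row_conjugate[of lam] by (force simp: diagram_row)

lemma conjugate_conjugate: "is_partition lam \<Longrightarrow> conjugate (conjugate lam) = lam"
  by (intro diagram_inject is_partition_conjugate)
    (auto simp: diagram_conjugate is_partition_conjugate image_image)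

lemma sum_list_conjugate: "is_partition lam \<Longrightarrow> sum_list (conjugate lam) = sum_list lam"
  unfolding card_diagram[symmetric] by (simp add: diagram_conjugate card_image)

lemma covers_conjugate: "covers lam kap \<Longrightarrow> covers (conjugate lam) (conjugate kap)"
proof -
  assume "covers lam kap"
  then obtain i j where c: "is_partition lam" "is_partition kap" "(i, j) \<notin> diagram lam"
      "diagram kap = insert (i, j) (diagram lam)"
    unfolding covers_diagram by (metis surj_pair)
  then have "(j, i) \<notin> diagram (conjugate lam)" "diagram (conjugate kap) = insert (j, i) (diagram (conjugate lam))"
    by (auto simp: diagram_conjugate simp del: mem_diagram)
  then show ?thesis
    using c by (auto simp: covers_diagram is_partition_conjugate)
qed

section \<open>Expansion of the alternating sums in products of Schur functions\<close>

abbreviation (input) ss :: "nat list \<Rightarrow> nat list \<Rightarrow> series" where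
  "ss lam mu \<equiv> schur x_var lam * schur y_var mu"

lemma schur_Nil: "schur z [] = 1"
proof (rule mfps_eqI)
  have d: "diagram [] = {}" by (simp add: diagram_row row_def)
  then have s: "ssyt [] = {\<lambda>_. undefined}"
    by (auto simp: ssyt_def)
  fix M show "mfps_nth (schur z []) M = mfps_nth 1 M"
    unfolding schur_def mfps_sum.rep_eq s d
    by (cases "mfps_nth (1::series) M = 0") (auto intro!: sum.neutral simp: Collect_conv_if)
qed

text \<open>The symmetry \<open>\<phi>\<close> is the identity for the direct expansion and
  conjugation for the series on which \<omega>_x acts. In the induction on n, the recursion obtained
  by removing the largest entry mirrors multiplication by \<open>p_plus 1\<close>.\<close>

lemma run_schur_expansion:
  assumes phi: "\<And>lam. is_partition lam \<Longrightarrow> is_partition (\<phi> lam)" "\<And>lam. is_partition lam \<Longrightarrow> \<phi> (\<phi> lam) = lam"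
    "\<And>lam kap. covers lam kap \<Longrightarrow> covers (\<phi> lam) (\<phi> kap)"
    "\<And>lam. is_partition lam \<Longrightarrow> sum_list (\<phi> lam) = sum_list lam"
    and "k \<le> n"
  shows "(\<Sum>(lam, mu)\<in>bipartitions n. of_nat (card (run_bitableaux k (\<phi> lam) mu)) * ss lam mu) =
    schur x_var (\<phi> (replicate k (Suc 0))) * p_plus 1 ^ (n - k)"
  using assms(5)
proof (induction n rule: dec_induct)
  case base
  let ?c = "replicate k (Suc 0)"
  have "(\<Sum>(lam, mu)\<in>bipartitions k. of_nat (card (run_bitableaux k (\<phi> lam) mu)) * ss lam mu) =
      (\<Sum>x\<in>bipartitions k. if x = (\<phi> ?c, []) then ss (\<phi> ?c) [] else 0)"
  proof (rule sum.cong[OF refl])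
    fix x assume "x \<in> bipartitions k"
    then obtain lam mu where x: "x = (lam, mu)" "is_partition lam" "is_partition mu" "sum_list lam + sum_list mu = k"
      by (auto simp: bipartitions_def)
    have "\<phi> lam = ?c \<longleftrightarrow> lam = \<phi> ?c"
      using phi(2)[OF x(2)] phi(2)[OF is_partition_column[of k]] by metis
    then show "(case x of (lam, mu) \<Rightarrow> of_nat (card (run_bitableaux k (\<phi> lam) mu)) * ss lam mu) =
        (if x = (\<phi> ?c, []) then ss (\<phi> ?c) [] else 0)"
      using card_run_bitableaux_base[of "\<phi> lam" mu k] x phi(1,4) by auto
  qed
  also have "\<dots> = ss (\<phi> ?c) []"
  proof -
    have "(\<phi> ?c, []) \<in> bipartitions k"
      using phi(1,4)[OF is_partition_column[of k]]
      by (auto simp: bipartitions_def sum_list_replicate is_partition_def)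
    then show ?thesis by (simp add: finite_bipartitions)
  qed
  finally show ?case by (simp add: schur_Nil)
next
  case (step n)
  define c where "c lam mu = (of_nat (card (run_bitableaux k (\<phi> lam) mu)) :: series)" for lam mu
  have part: "is_partition lam \<and> is_partition mu" if "(lam, mu) \<in> bipartitions m" for lam mu m
    using that by (auto simp: bipartitions_def)
  have "(\<Sum>(lam, mu)\<in>bipartitions (Suc n). c lam mu * ss lam mu) =
      (\<Sum>(lam, mu)\<in>bipartitions (Suc n). (\<Sum>lam' | covers lam' lam. c lam' mu * ss lam mu) +
        (\<Sum>mu' | covers mu' mu. c lam mu' * ss lam mu))"
  proof (rule sum.cong[OF refl], clarify)
    fix lam mu assume x: "(lam, mu) \<in> bipartitions (Suc n)"
    then have lm: "is_partition lam" "is_partition mu" "sum_list lam + sum_list mu = Suc n"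
      by (auto simp: bipartitions_def)
    have inv: "\<phi> (\<phi> l) = l" if "covers l m" for l m
      using that phi(2) by (auto simp: covers_def)
    \<comment> \<open>As an involution preserving covers, \<open>\<phi>\<close> maps the shapes
      below \<open>lam\<close> bijectively to those below \<open>\<phi> lam\<close>.\<close>
    have "(\<Sum>l | covers l (\<phi> lam). card (run_bitableaux k l mu)) =
        (\<Sum>l | covers l lam. card (run_bitableaux k (\<phi> l) mu))"
      by (rule sum.reindex_bij_witness[where i = \<phi> and j = \<phi>])
        (use phi(3) inv phi(2)[OF lm(1)] in \<open>fastforce+\<close>)
    then have "c lam mu = (\<Sum>lam' | covers lam' lam. c lam' mu) + (\<Sum>mu' | covers mu' mu. c lam mu')"
      using card_run_bitableaux_rec[OF phi(1)[OF lm(1)] lm(2), of n k] lm(3) phi(4)[OF lm(1)] step(1)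
      by (simp add: c_def)
    then show "c lam mu * ss lam mu = (\<Sum>lam' | covers lam' lam. c lam' mu * ss lam mu) +
        (\<Sum>mu' | covers mu' mu. c lam mu' * ss lam mu)"
      by (simp only: distrib_right sum_distrib_right)
  qed
  also have "\<dots> = (\<Sum>(lam, mu)\<in>bipartitions (Suc n). \<Sum>lam' | covers lam' lam. c lam' mu * ss lam mu) +
      (\<Sum>(lam, mu)\<in>bipartitions (Suc n). \<Sum>mu' | covers mu' mu. c lam mu' * ss lam mu)"
    by (simp add: case_prod_beta sum.distrib)
  \<comment> \<open>The same cover pairs, listed first by the larger and then by the smaller shape;
    in the new order the inner sum is one half of the Pieri rule.\<close>
  also have "(\<Sum>(lam, mu)\<in>bipartitions (Suc n). \<Sum>lam' | covers lam' lam. c lam' mu * ss lam mu) =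
      (\<Sum>(lam', mu)\<in>bipartitions n. \<Sum>lam | covers lam' lam. c lam' mu * ss lam mu)"
  proof -
    have "(\<Sum>((lam, mu), lam')\<in>Sigma (bipartitions (Suc n)) (\<lambda>(lam, mu). {lam'. covers lam' lam}). c lam' mu * ss lam mu) =
        (\<Sum>((lam', mu), lam)\<in>Sigma (bipartitions n) (\<lambda>(lam', mu). {lam. covers lam' lam}). c lam' mu * ss lam mu)"
      by (rule sum.reindex_bij_witness[where i = "\<lambda>((lam', mu), lam). ((lam, mu), lam')" and
            j = "\<lambda>((lam, mu), lam'). ((lam', mu), lam)"])
        (auto simp: bipartitions_def card_diagram[symmetric] covers_card, auto simp: covers_def)
    then show ?thesis
      by (subst (asm) (1 2) sum.Sigma[symmetric])
        (auto simp: finite_bipartitions finite_covers_below finite_covers_above case_prod_beta)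
  qed
  also have "(\<Sum>(lam, mu)\<in>bipartitions (Suc n). \<Sum>mu' | covers mu' mu. c lam mu' * ss lam mu) =
      (\<Sum>(lam, mu')\<in>bipartitions n. \<Sum>mu | covers mu' mu. c lam mu' * ss lam mu)"
  proof -
    have "(\<Sum>((lam, mu), mu')\<in>Sigma (bipartitions (Suc n)) (\<lambda>(lam, mu). {mu'. covers mu' mu}). c lam mu' * ss lam mu) =
        (\<Sum>((lam, mu'), mu)\<in>Sigma (bipartitions n) (\<lambda>(lam, mu'). {mu. covers mu' mu}). c lam mu' * ss lam mu)"
      by (rule sum.reindex_bij_witness[where i = "\<lambda>((lam, mu'), mu). ((lam, mu), mu')" and
            j = "\<lambda>((lam, mu), mu'). ((lam, mu'), mu)"])
        (auto simp: bipartitions_def card_diagram[symmetric] covers_card, auto simp: covers_def)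
    then show ?thesis
      by (subst (asm) (1 2) sum.Sigma[symmetric])
        (auto simp: finite_bipartitions finite_covers_below finite_covers_above case_prod_beta)
  qed
  also have "(\<Sum>(lam', mu)\<in>bipartitions n. \<Sum>lam | covers lam' lam. c lam' mu * ss lam mu) +
      (\<Sum>(lam, mu')\<in>bipartitions n. \<Sum>mu | covers mu' mu. c lam mu' * ss lam mu) =
      (\<Sum>(lam, mu)\<in>bipartitions n. p_plus 1 * (c lam mu * ss lam mu))"
    unfolding sum.distrib[symmetric] case_prod_beta
  proof (rule sum.cong[OF refl])
    fix x assume x: "x \<in> bipartitions n"
    obtain lam mu where xx: "x = (lam, mu)" by (cases x)
    have "p_plus 1 * (c lam mu * ss lam mu) = c lam mu * (p_plus 1 * ss lam mu)"
      by (simp add: mult_ac)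
    also have "p_plus 1 * ss lam mu = (\<Sum>kap | covers lam kap. ss kap mu) + (\<Sum>kap | covers mu kap. ss lam kap)"
      by (rule pieri) (use part[of lam mu n] x in \<open>simp_all add: xx\<close>)
    finally show "(\<Sum>kap | covers (fst x) kap. c (fst x) (snd x) * ss kap (snd x)) +
        (\<Sum>kap | covers (snd x) kap. c (fst x) (snd x) * ss (fst x) kap) = p_plus 1 * (c (fst x) (snd x) * ss (fst x) (snd x))"
      by (simp only: xx fst_conv snd_conv distrib_left sum_distrib_left)
  qed
  also have "\<dots> = p_plus 1 * (\<Sum>(lam, mu)\<in>bipartitions n. c lam mu * ss lam mu)"
    by (simp add: case_prod_beta sum_distrib_left)
  also have "\<dots> = schur x_var (\<phi> (replicate k (Suc 0))) * p_plus 1 ^ (Suc n - k)"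
    using step by (simp add: c_def Suc_diff_le mult_ac)
  finally show ?case by (simp only: c_def)
qed

lemma c_coeff_expansion:
  assumes phi: "\<And>lam. is_partition lam \<Longrightarrow> is_partition (\<phi> lam)" "\<And>lam. is_partition lam \<Longrightarrow> \<phi> (\<phi> lam) = lam"
    "\<And>lam kap. covers lam kap \<Longrightarrow> covers (\<phi> lam) (\<phi> kap)"
    "\<And>lam. is_partition lam \<Longrightarrow> sum_list (\<phi> lam) = sum_list lam"
  shows "(\<Sum>(lam, mu)\<in>bipartitions n. of_nat (c_coeff (\<phi> lam) mu) * ss lam mu) =
    (\<Sum>k\<le>n. (-1) ^ k * (schur x_var (\<phi> (replicate k (Suc 0))) * p_plus 1 ^ (n - k)))"
proof -
  have "(\<Sum>(lam, mu)\<in>bipartitions n. of_nat (c_coeff (\<phi> lam) mu) * ss lam mu) =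
      (\<Sum>(lam, mu)\<in>bipartitions n. \<Sum>k\<le>n. (-1) ^ k * (of_nat (card (run_bitableaux k (\<phi> lam) mu)) * ss lam mu))"
  proof (rule sum.cong[OF refl], clarify)
    fix lam mu assume "(lam, mu) \<in> bipartitions n"
    then have "sum_list (\<phi> lam) + sum_list mu = n"
      using phi(4) by (auto simp: bipartitions_def)
    then show "of_nat (c_coeff (\<phi> lam) mu) * ss lam mu =
        (\<Sum>k\<le>n. (-1) ^ k * (of_nat (card (run_bitableaux k (\<phi> lam) mu)) * ss lam mu))"
      by (simp add: c_coeff_alternating sum_distrib_right mult.assoc)
  qed
  also have "\<dots> = (\<Sum>k\<le>n. (-1) ^ k * (\<Sum>(lam, mu)\<in>bipartitions n. of_nat (card (run_bitableaux k (\<phi> lam) mu)) * ss lam mu))"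
    unfolding case_prod_beta sum_distrib_left by (rule sum.swap)
  also have "\<dots> = (\<Sum>k\<le>n. (-1) ^ k * (schur x_var (\<phi> (replicate k (Suc 0))) * p_plus 1 ^ (n - k)))"
    by (rule sum.cong) (use run_schur_expansion[OF phi] in auto)
  finally show ?thesis .
qed

section \<open>Independence of the products of Schur functions\<close>

lemma nth_prod_mset_var:
  "mfps_nth (\<Prod>v\<in>#M. mfps_var v) M' = (if M' = M then 1 else (0 :: 'a :: comm_ring_1))"
proof (induction M arbitrary: M')
  case (add v M)
  have "v \<in># M' \<and> M' - {#v#} = M \<longleftrightarrow> M' = add_mset v M"
    by (metis add_mset_remove_trivial insert_DiffM union_single_eq_member)
  with add show ?case by (auto simp: nth_mult_var)
qed (simp add: nth_one)

lemma prod_var_mset: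
  "(\<Prod>a\<in>A. mfps_var (v a)) = (\<Prod>u\<in>#image_mset v (mset_set A). mfps_var u)"
  by (simp add: prod_unfold_prod_mset image_mset.compositionality o_def)

definition content :: "nat list \<Rightarrow> (nat \<times> nat \<Rightarrow> nat) \<Rightarrow> nat multiset" where
  "content lam T = image_mset T (mset_set (diagram lam))"

text \<open>The coefficients are products of two Kostka numbers, one for the x part and one for the
  y part of the monomial.\<close>

lemma nth_ss:
  assumes "\<And>v. v \<in># M \<Longrightarrow> var_index v < N"
  shows "mfps_nth (ss lam mu) M = of_nat (card {(T, S) \<in> ssytN N lam \<times> ssytN N mu.
    image_mset XVar (content lam T) + image_mset YVar (content mu S) = M})"
proof -
  have "mfps_nth (ss lam mu) M = mfps_nth (schurN N x_var lam * schurN N y_var mu) M"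
    by (rule agreeD[OF agree_mult[OF agree_schur_x agree_schur_y]]) (rule assms)
  also have "schurN N x_var lam * schurN N y_var mu = (\<Sum>(T, S)\<in>ssytN N lam \<times> ssytN N mu.
      \<Prod>u\<in># image_mset XVar (content lam T) + image_mset YVar (content mu S). mfps_var u)"
    unfolding schurN_def sum_product sum.cartesian_product prod_var_mset
    by (simp add: content_def image_mset.compositionality o_def)
  also have "mfps_nth \<dots> M = (\<Sum>x\<in>ssytN N lam \<times> ssytN N mu.
      if M = image_mset XVar (content lam (fst x)) + image_mset YVar (content mu (snd x)) then 1 else 0)"
    by (simp add: nth_sum case_prod_beta nth_prod_mset_var del: image_mset_union prod_mset.union)
  also have "\<dots> = of_nat (card {x \<in> ssytN N lam \<times> ssytN N mu.
      M = image_mset XVar (content lam (fst x)) + image_mset YVar (content mu (snd x))})"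
    by (simp add: sum.If_cases finite_ssytN Int_def)
  also have "{x \<in> ssytN N lam \<times> ssytN N mu.
      M = image_mset XVar (content lam (fst x)) + image_mset YVar (content mu (snd x))} =
      {(T, S) \<in> ssytN N lam \<times> ssytN N mu. image_mset XVar (content lam T) + image_mset YVar (content mu S) = M}"
    by auto
  finally show ?thesis .
qed

lemma ssyt_ge_row:
  assumes "T \<in> ssyt lam" "is_partition lam" "(i, j) \<in> diagram lam"
  shows "i \<le> T (i, j)"
  using assms(3)
proof (induction i)
  case (Suc i)
  have "j < row lam i"
    using Suc.prems row_antimono[OF assms(2), of i "Suc i"] by simp
  moreover have "T (i, j) < T (Suc i, j)"
    using assms(1) Suc.prems by (auto simp: ssyt_def)
  ultimately show ?case using Suc.IH by auto
qed simp

text \<open>The statistic n(\<lambda>) = \<Sum> i \<lambda>_i with rows counted from 0. Along it the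
  Kostka matrix will be seen to be triangular.\<close>

definition row_weight :: "nat list \<Rightarrow> nat" where
  "row_weight lam = (\<Sum>c\<in>diagram lam. fst c)"

text \<open>In the filling by row indices, the entry i occurs once for each cell of row i, so its
  content lists the row lengths.\<close>

lemma content_inject:
  assumes "is_partition lam" "is_partition mu" "content lam fst = content mu fst"
  shows "lam = mu"
proof (rule row_inject[OF assms(1,2)], rule ext)
  fix i
  have c: "count (content lam fst) i = row lam i" for lam
  proof -
    have "{c \<in> diagram lam. i = fst c} = Pair i ` {..<row lam i}"
      by auto
    then have "card {c \<in> diagram lam. i = fst c} = row lam i"
      by (simp add: card_image inj_on_def)
    then show ?thesis
      unfolding content_def count_image_mset
      by (simp add: sum.If_cases Int_def vimage_def conj_commute eq_commute)
  qed
  show "row lam i = row mu i"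
    using c[of lam] c[of mu] assms(3) by simp
qed

text \<open>Among all fillings of a given shape, the one whose \<open>i\<close>-th row is constantly \<open>i\<close> has the least
  sum of entries; this makes the Kostka matrix triangular.\<close>

lemma content_row_weight:
  assumes "T \<in> ssyt al" "is_partition al" "is_partition lam" "content al T = content lam fst"
  shows "row_weight al \<le> row_weight lam" "row_weight al = row_weight lam \<Longrightarrow> al = lam"
proof -
  have ge: "fst c \<le> T c" if "c \<in> diagram al" for c
    using ssyt_ge_row[OF assms(1,2), of "fst c" "snd c"] that by simp
  have "row_weight lam = sum_mset (content lam fst)"
    by (simp add: row_weight_def content_def sum_unfold_sum_mset)
  also have "\<dots> = (\<Sum>c\<in>diagram al. T c)"
    unfolding assms(4)[symmetric] by (simp add: content_def sum_unfold_sum_mset)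
  finally have w: "row_weight lam = (\<Sum>c\<in>diagram al. T c)" .
  then show "row_weight al \<le> row_weight lam"
    unfolding row_weight_def[of al] using ge by (auto intro: sum_mono)
  assume "row_weight al = row_weight lam"
  then have "(\<Sum>c\<in>diagram al. fst c) = (\<Sum>c\<in>diagram al. T c)"
    using w by (simp add: row_weight_def)
  then have "\<forall>c\<in>diagram al. fst c = T c"
    using ge by (intro ballI sum_mono_inv[of fst "diagram al" T]) auto
  then have c: "content al T = content al fst"
    unfolding content_def by (intro image_mset_cong) simp
  show "al = lam"
    by (rule content_inject[OF assms(2,3) trans[OF c[symmetric] assms(4)]])
qed

lemma row_filling_ssyt:
  assumes "is_partition lam" "\<And>i. i < length lam \<Longrightarrow> i < N"
  shows "restrict fst (diagram lam) \<in> ssytN N lam"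
proof -
  have "j < row lam i" if "j < row lam (Suc i)" for i j
    using that row_antimono[OF assms(1), of i "Suc i"] by simp
  moreover have "i < N" if "j < row lam i" for i j
    using that assms row_pos_iff[OF assms(1), of i] by auto
  ultimately show ?thesis
    by (auto simp: ssytN_def ssyt_def)
qed

text \<open>Among the terms with nonzero coefficient one of least total weight is taken, and the
  monomial of its row fillings is tested. Any other term containing this monomial has both weights
  at most those of the chosen one, hence equal by minimality, hence the same shapes.\<close>

lemma schur_products_independent:
  assumes "finite K" "K \<subseteq> Collect is_partition \<times> Collect is_partition"
    and "(\<Sum>(lam, mu)\<in>K. mfps_const (a (lam, mu)) * ss lam mu) = 0" and "k \<in> K"
  shows "a k = 0"
proof (rule ccontr)
  assume "a k \<noteq> 0"
  define w where "w x = row_weight (fst x) + row_weight (snd x)" for x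
  obtain lam mu where lm: "(lam, mu) \<in> K" "a (lam, mu) \<noteq> 0"
    and min: "\<And>x. x \<in> K \<Longrightarrow> a x \<noteq> 0 \<Longrightarrow> w (lam, mu) \<le> w x"
    using ex_has_least_nat[of "\<lambda>x. x \<in> K \<and> a x \<noteq> 0" k w] assms(4) \<open>a k \<noteq> 0\<close> by (metis surj_pair)
  have part: "is_partition l" "is_partition m" if "(l, m) \<in> K" for l m
    using that assms(2) by auto
  define M where "M = image_mset XVar (content lam fst) + image_mset YVar (content mu fst)"
  define N where "N = length lam + length mu"
  have N: "var_index v < N" if "v \<in># M" for v
  proof -
    have "i < N" if "j < row lam i" for i j
      using that row_pos_iff[OF part(1)[OF lm(1)], of i] by (auto simp: N_def)
    moreover have "i < N" if "j < row mu i" for i j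
      using that row_pos_iff[OF part(2)[OF lm(1)], of i] by (auto simp: N_def)
    ultimately show ?thesis
      using that by (auto simp: M_def content_def)
  qed
  have nth: "mfps_nth (ss al be) M = of_nat (card {(T, S) \<in> ssytN N al \<times> ssytN N be.
      image_mset XVar (content al T) + image_mset YVar (content be S) = M})" for al be
    by (rule nth_ss) (rule N)
  have zero: "mfps_nth (ss al be) M = 0" if x: "(al, be) \<in> K" "a (al, be) \<noteq> 0" "(al, be) \<noteq> (lam, mu)" for al be
  proof -
    have "{(T, S) \<in> ssytN N al \<times> ssytN N be. image_mset XVar (content al T) + image_mset YVar (content be S) = M} = {}"
    proof (rule ccontr)
      assume "{(T, S) \<in> ssytN N al \<times> ssytN N be. image_mset XVar (content al T) + image_mset YVar (content be S) = M} \<noteq> {}"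
      then obtain T S where TS: "T \<in> ssyt al" "S \<in> ssyt be"
          "image_mset XVar (content al T) + image_mset YVar (content be S) = M"
        by (auto simp: ssytN_def)
      \<comment> \<open>\<open>xs\<close> and \<open>ys\<close> separate a monomial into its parts
        in the x and in the y, so that equal monomials yield equal contents for both shapes.\<close>
      define xs where "xs A = image_mset var_index (filter_mset (\<lambda>v. v \<in> range XVar) A)" for A
      define ys where "ys A = image_mset var_index (filter_mset (\<lambda>v. v \<in> range YVar) A)" for A
      have xs: "xs (image_mset XVar A + image_mset YVar B) = A" for A B
        by (simp add: xs_def filter_mset_image_mset image_mset.compositionality o_def image_iff)
      have ys: "ys (image_mset XVar A + image_mset YVar B) = B" for A B
        by (simp add: ys_def filter_mset_image_mset image_mset.compositionality o_def image_iff)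
      have c: "content al T = content lam fst" "content be S = content mu fst"
        using arg_cong[OF TS(3), of xs] arg_cong[OF TS(3), of ys] unfolding M_def xs ys by auto
      note c1 = content_row_weight[OF TS(1) part(1)[OF x(1)] part(1)[OF lm(1)] c(1)]
        and c2 = content_row_weight[OF TS(2) part(2)[OF x(1)] part(2)[OF lm(1)] c(2)]
      have "row_weight al = row_weight lam" "row_weight be = row_weight mu"
        using c1(1) c2(1) min[OF x(1,2)] by (auto simp: w_def)
      then show False
        using c1(2) c2(2) x(3) by auto
    qed
    then show ?thesis
      unfolding nth by (simp only: card.empty of_nat_0)
  qed
  have pos: "mfps_nth (ss lam mu) M \<noteq> 0"
  proof -
    let ?A = "{(T, S) \<in> ssytN N lam \<times> ssytN N mu. image_mset XVar (content lam T) + image_mset YVar (content mu S) = M}"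
    have "content lam (restrict fst (diagram lam)) = content lam fst" for lam
      by (auto simp: content_def intro!: image_mset_cong)
    then have "(restrict fst (diagram lam), restrict fst (diagram mu)) \<in> ?A"
      using part[OF lm(1)] by (auto simp: M_def N_def intro!: row_filling_ssyt)
    moreover have "finite ?A"
      by (rule finite_subset[of _ "ssytN N lam \<times> ssytN N mu"]) (auto simp: finite_ssytN)
    ultimately have "card ?A \<noteq> 0"
      unfolding card_eq_0_iff by blast
    then show ?thesis
      unfolding nth by (simp only: of_nat_eq_0_iff not_False_eq_True)
  qed
  have "0 = mfps_nth (\<Sum>(lam, mu)\<in>K. mfps_const (a (lam, mu)) * ss lam mu) M"
    using assms(3) by simp
  also have "\<dots> = (\<Sum>x\<in>K. if x = (lam, mu) then a x * mfps_nth (ss lam mu) M else 0)"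
    unfolding nth_sum
  proof (rule sum.cong[OF refl])
    fix x assume x: "x \<in> K"
    obtain al be where ab: "x = (al, be)" by (cases x)
    show "mfps_nth (case x of (lam, mu) \<Rightarrow> mfps_const (a (lam, mu)) * ss lam mu) M =
        (if x = (lam, mu) then a x * mfps_nth (ss lam mu) M else 0)"
      using zero[of al be] x unfolding ab by (cases "a (al, be) = 0") (auto simp: nth_const_mult)
  qed
  also have "\<dots> = a (lam, mu) * mfps_nth (ss lam mu) M"
    using assms(1) lm(1) by simp
  finally show False
    using lm(2) pos by simp
qed

section \<open>The involution \<omega>_x on Schur expansions\<close>

lemma omega_x_expansion:
  assumes fin: "finite K" and K: "K \<subseteq> Collect is_partition \<times> Collect is_partition"
  shows "omega_x (\<Sum>(lam, mu)\<in>K. mfps_const (a (lam, mu)) * ss lam mu) =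
    (\<Sum>(lam, mu)\<in>K. mfps_const (a (lam, mu)) * ss (conjugate lam) mu)"
proof -
  define f where "f = (\<Sum>(lam, mu)\<in>K. mfps_const (a (lam, mu)) * ss lam mu)"
  define c where "c = Abs_poly_mapping (\<lambda>x. if x \<in> K then a x else 0)"
  have look: "Poly_Mapping.lookup c x = (if x \<in> K then a x else 0)" for x
    unfolding c_def by (subst Abs_poly_mapping_inverse) (use fin in \<open>auto intro: finite_subset[of _ K]\<close>)
  have keys: "Poly_Mapping.keys c = {x \<in> K. a x \<noteq> 0}"
    by (auto simp: in_keys_iff look split: if_splits)
  have ext: "(\<Sum>x\<in>Poly_Mapping.keys d. mfps_const (Poly_Mapping.lookup d x) * g x) =
      (\<Sum>x\<in>L. mfps_const (Poly_Mapping.lookup d x) * g x)"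
    if "finite L" "Poly_Mapping.keys d \<subseteq> L" for d L and g :: "nat list \<times> nat list \<Rightarrow> series"
    using that by (intro sum.mono_neutral_left) (auto simp: in_keys_iff)
  have c: "(\<Sum>(lam, mu)\<in>Poly_Mapping.keys c. mfps_const (Poly_Mapping.lookup c (lam, mu)) * g (lam, mu)) =
      (\<Sum>(lam, mu)\<in>K. mfps_const (a (lam, mu)) * g (lam, mu))" for g :: "nat list \<times> nat list \<Rightarrow> series"
    using ext[OF fin, of c g] by (simp add: keys look case_prod_beta)
  \<comment> \<open>The definite description denotes \<open>c\<close>, because two expansions of f,
    extended by zero to the union of their supports, differ by a vanishing combination of
    independent products.\<close>
  have "schur_expansion f = c"
    unfolding schur_expansion_def
  proof (rule the_equality)
    show "Poly_Mapping.keys c \<subseteq> Collect is_partition \<times> Collect is_partition \<and>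
      f = (\<Sum>(lam, mu)\<in>Poly_Mapping.keys c. mfps_const (Poly_Mapping.lookup c (lam, mu)) * ss lam mu)"
      using K c[of "\<lambda>(lam, mu). ss lam mu"] by (auto simp: keys f_def)
    fix d assume d: "Poly_Mapping.keys d \<subseteq> Collect is_partition \<times> Collect is_partition \<and>
      f = (\<Sum>(lam, mu)\<in>Poly_Mapping.keys d. mfps_const (Poly_Mapping.lookup d (lam, mu)) * ss lam mu)"
    define L where "L = K \<union> Poly_Mapping.keys d"
    have L: "finite L" "L \<subseteq> Collect is_partition \<times> Collect is_partition" "Poly_Mapping.keys c \<subseteq> L" "Poly_Mapping.keys d \<subseteq> L"
      using fin K d by (auto simp: L_def keys)
    let ?g = "\<lambda>x. ss (fst x) (snd x)"
    have "f = (\<Sum>x\<in>L. mfps_const (Poly_Mapping.lookup d x) * ?g x)"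
      using d ext[OF L(1,4), of ?g] by (simp add: case_prod_beta)
    moreover have "f = (\<Sum>x\<in>L. mfps_const (Poly_Mapping.lookup c x) * ?g x)"
      using c[of ?g] ext[OF L(1,3), of ?g] by (simp add: f_def case_prod_beta)
    ultimately have "(\<Sum>(lam, mu)\<in>L. mfps_const (Poly_Mapping.lookup d (lam, mu) - Poly_Mapping.lookup c (lam, mu)) * ss lam mu) = 0"
      by (simp add: case_prod_beta const_diff left_diff_distrib sum_subtractf)
    then have "Poly_Mapping.lookup d x - Poly_Mapping.lookup c x = 0" if "x \<in> L" for x
      using schur_products_independent[OF L(1,2), of "\<lambda>x. Poly_Mapping.lookup d x - Poly_Mapping.lookup c x" x] that
      by simp
    then show "d = c"
      using L(3,4) by (intro poly_mapping_eqI) (metis in_keys_iff right_minus_eq subsetD)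
  qed
  then have "omega_x f = (\<Sum>(lam, mu)\<in>K. mfps_const (a (lam, mu)) * ss (conjugate lam) mu)"
    using c[of "\<lambda>(lam, mu). ss (conjugate lam) mu"] by (simp add: omega_x_def case_prod_beta)
  then show ?thesis
    by (simp only: f_def)
qed

text \<open>Expanded with conjugation as the symmetry, the series has at \<open>(lam, mu)\<close>
  the coefficient belonging to the conjugate of \<open>lam\<close>; \<omega>_x carries this
  coefficient to the conjugate shape, where it is the one for the shape itself.\<close>

lemma omega_x_alternating:
  "omega_x (\<Sum>k\<le>n. (-1) ^ k * (schur x_var (conjugate (replicate k (Suc 0))) * p_plus 1 ^ (n - k))) =
    (\<Sum>(lam, mu)\<in>bipartitions n. of_nat (c_coeff lam mu) * ss lam mu)"
proof -
  let ?a = "\<lambda>(lam, mu). of_nat (c_coeff (conjugate lam) mu) :: complex"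
  have "(\<Sum>k\<le>n. (-1) ^ k * (schur x_var (conjugate (replicate k (Suc 0))) * p_plus 1 ^ (n - k))) =
      (\<Sum>(lam, mu)\<in>bipartitions n. mfps_const (?a (lam, mu)) * ss lam mu)"
    using c_coeff_expansion[of conjugate n]
    by (simp add: is_partition_conjugate conjugate_conjugate covers_conjugate sum_list_conjugate const_of_nat)
  also have "omega_x \<dots> = (\<Sum>(lam, mu)\<in>bipartitions n. mfps_const (?a (lam, mu)) * ss (conjugate lam) mu)"
    by (rule omega_x_expansion[OF finite_bipartitions]) (auto simp: bipartitions_def)
  also have "\<dots> = (\<Sum>(lam, mu)\<in>bipartitions n. of_nat (c_coeff lam mu) * ss lam mu)"
    by (rule sum.reindex_bij_witness[where i = "\<lambda>(lam, mu). (conjugate lam, mu)" and j = "\<lambda>(lam, mu). (conjugate lam, mu)"])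
      (auto simp: bipartitions_def is_partition_conjugate conjugate_conjugate sum_list_conjugate const_of_nat)
  finally show ?thesis .
qed

section \<open>Signed permutations\<close>

lemma Omega_int: "j \<in> {1..n} \<Longrightarrow> int j \<in> Omega n"
  by (auto simp: Omega_def)

lemma Omega_uminus [simp]: "- a \<in> Omega n \<longleftrightarrow> a \<in> Omega n"
  by (auto simp: Omega_def)

lemma Omega_nat_abs: "a \<in> Omega n \<longleftrightarrow> nat \<bar>a\<bar> \<in> {1..n}"
  by (auto simp: Omega_def)

lemma finite_Omega: "finite (Omega n)"
  by (rule finite_subset[of _ "{- int n..int n}"]) (auto simp: Omega_def)

lemma B_group_permutes: "w \<in> B_group n \<Longrightarrow> w permutes Omega n"
  by (simp add: B_group_def)

lemma B_group_mem: "w \<in> B_group n \<Longrightarrow> a \<in> Omega n \<Longrightarrow> w a \<in> Omega n"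
  by (simp add: B_group_def permutes_in_image)

lemma B_group_uminus:
  assumes "w \<in> B_group n"
  shows "w (- a) = - w a"
proof (cases "a \<in> Omega n")
  case False
  then have "w a = a" "w (- a) = - a"
    using assms by (simp_all add: B_group_def permutes_def)
  then show ?thesis by simp
qed (use assms in \<open>simp add: B_group_def\<close>)

lemma B_group_inj: "w \<in> B_group n \<Longrightarrow> w a = w b \<longleftrightarrow> a = b"
  by (meson B_group_permutes injD permutes_inj)

lemma B_group_abs_inj:
  assumes "w \<in> B_group n"
  shows "\<bar>w a\<bar> = \<bar>w b\<bar> \<longleftrightarrow> \<bar>a\<bar> = \<bar>b\<bar>"
proof -
  have "\<bar>w a\<bar> = \<bar>w b\<bar> \<longleftrightarrow> w a = w b \<or> w a = w (- b)"
    by (auto simp: B_group_uminus[OF assms] abs_eq_iff)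
  then show ?thesis
    by (auto simp: B_group_inj[OF assms] abs_eq_iff)
qed

lemma B_group_inv: "w \<in> B_group n \<Longrightarrow> inv w \<in> B_group n"
proof -
  assume w: "w \<in> B_group n"
  have "inv w (- a) = - inv w a" for a
  proof -
    have "w (- inv w a) = - a"
      using B_group_uminus[OF w] permutes_inverses[OF B_group_permutes[OF w]] by simp
    then show ?thesis
      using permutes_inverses[OF B_group_permutes[OF w]] by metis
  qed
  then show ?thesis
    using permutes_inv[OF B_group_permutes[OF w]] by (simp add: B_group_def)
qed

lemma B_group_inv_apply [simp]:
  assumes "w \<in> B_group n"
  shows "inv w (w a) = a" "w (inv w a) = a" "inv (inv w) = w"
  using permutes_inverses[OF B_group_permutes[OF assms]] permutes_inv_inv[OF B_group_permutes[OF assms]]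
  by simp_all

lemma finite_B_group: "finite (B_group n)"
  by (rule finite_subset[OF _ finite_permutations[OF finite_Omega]]) (auto simp: B_group_def)

lemma B_group_eqI:
  assumes "w \<in> B_group n" "w' \<in> B_group n" "\<And>a. a \<in> {1..n} \<Longrightarrow> w (int a) = w' (int a)"
  shows "w = w'"
proof
  fix a :: int
  have pos: "w b = w' b" if "b \<in> Omega n" "0 < b" for b
    using assms(3)[of "nat b"] that by (auto simp: Omega_nat_abs)
  show "w a = w' a"
  proof (cases "a \<in> Omega n")
    case True
    then consider "0 < a" | "0 < - a" by (force simp: Omega_def)
    then show ?thesis
    proof cases
      case 2
      then have "w (- a) = w' (- a)" using pos True by simp
      then show ?thesis
        by (simp add: B_group_uminus[OF assms(1)] B_group_uminus[OF assms(2)])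
    qed (use True pos in simp)
  next
    case False
    then show ?thesis
      using assms(1,2) by (simp add: B_group_def permutes_def)
  qed
qed

text \<open>The image of w under the projection of B_n to the symmetric group.\<close>

definition abs_perm :: "(int \<Rightarrow> int) \<Rightarrow> nat \<Rightarrow> nat" where
  "abs_perm w a = nat \<bar>w (int a)\<bar>"

lemma int_abs_perm [simp]: "int (abs_perm w a) = \<bar>w (int a)\<bar>"
  by (simp add: abs_perm_def)

lemma abs_perm_bij:
  assumes "w \<in> B_group n"
  shows "bij_betw (abs_perm w) {1..n} {1..n}"
proof -
  have "abs_perm w ` {1..n} \<subseteq> {1..n}"
    using B_group_mem[OF assms Omega_int] by (auto simp: abs_perm_def Omega_nat_abs)
  moreover have "inj_on (abs_perm w) {1..n}"
  proof (rule inj_onI)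
    fix a b assume "abs_perm w a = abs_perm w b"
    then have "\<bar>w (int a)\<bar> = \<bar>w (int b)\<bar>"
      by (metis int_abs_perm)
    then show "a = b" using B_group_abs_inj[OF assms] by simp
  qed
  ultimately show ?thesis
    by (simp add: bij_betw_def endo_inj_surj)
qed

lemma abs_perm_mem: "w \<in> B_group n \<Longrightarrow> a \<in> {1..n} \<Longrightarrow> abs_perm w a \<in> {1..n}"
  using abs_perm_bij bij_betwE by blast

lemma abs_perm_inv:
  assumes "w \<in> B_group n"
  shows "abs_perm (inv w) (abs_perm w a) = a" "abs_perm w (abs_perm (inv w) a) = a"
proof -
  have "\<bar>w' \<bar>w (int a)\<bar>\<bar> = \<bar>w' (w (int a))\<bar>" if "w' \<in> B_group n" for w w' :: "int \<Rightarrow> int"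
    by (cases "0 \<le> w (int a)") (auto simp: B_group_uminus[OF that])
  then show "abs_perm (inv w) (abs_perm w a) = a" "abs_perm w (abs_perm (inv w) a) = a"
    using assms B_group_inv[OF assms] by (simp_all add: abs_perm_def)
qed

lemma B_group_nonzero: "w \<in> B_group n \<Longrightarrow> a \<in> {1..n} \<Longrightarrow> w (int a) \<noteq> 0"
  using B_group_mem[OF _ Omega_int] by (fastforce simp: Omega_def)

lemma B_group_sign_inv:
  assumes "w \<in> B_group n" "a \<in> {1..n}"
  shows "0 < inv w (int (abs_perm w a)) \<longleftrightarrow> 0 < w (int a)"
  using B_group_nonzero[OF assms] assms(2) B_group_uminus[OF B_group_inv[OF assms(1)], of "w (int a)"]
    B_group_inv_apply(1)[OF assms(1), of "int a"]
  by (cases "0 < w (int a)") auto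

section \<open>Signed descents and compatible sequences\<close>

text \<open>The alphabet \<open>y\<^sub>0 < x\<^sub>0 < y\<^sub>1 < x\<^sub>1 < \<dots>\<close> is encoded by the natural numbers.\<close>

definition letter :: "nat \<Rightarrow> var" where
  "letter c = (if odd c then XVar (c div 2) else YVar (c div 2))"

text \<open>The condition on the signs and that on forced strict steps merge into one: the labels
  increase weakly in the alphabet and repeat only where the absolute value grows. The parity of a
  label carries the sign.\<close>

definition compat :: "nat \<Rightarrow> (int \<Rightarrow> int) \<Rightarrow> (nat \<Rightarrow> nat) \<Rightarrow> bool" where
  "compat n w \<zeta> \<longleftrightarrow> (\<forall>j\<in>{1..n}. 0 < w (int j) \<longleftrightarrow> odd (\<zeta> j)) \<and>
     (\<forall>j\<in>{1..<n}. \<zeta> j \<le> \<zeta> (Suc j) \<and> (\<zeta> j = \<zeta> (Suc j) \<longrightarrow> \<bar>w (int j)\<bar> < \<bar>w (int (Suc j))\<bar>))"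

definition seqs :: "nat \<Rightarrow> nat \<Rightarrow> (nat \<Rightarrow> nat) set" where
  "seqs n K = {1..n} \<rightarrow>\<^sub>E {..<K}"

lemma finite_seqs: "finite (seqs n K)"
  by (simp add: seqs_def finite_PiE)

lemma fst_sDes:
  "s \<in> fst (sDes n w) \<longleftrightarrow> s = n \<or> s \<in> {1..<n} \<and> (w (int (Suc s)) <\<^sub>r w (int s) \<or> (w (int s) < 0 \<and> 0 < w (int (Suc s))))"
  by (auto simp: sDes_def Let_def)

lemma snd_sDes:
  "s \<in> fst (sDes n w) \<Longrightarrow> snd (sDes n w) s = (if w (int s) < 0 then Negative else Positive)"
  by (auto simp: sDes_def Let_def)

text \<open>A change of sign always occurs at an element of the descent set: from unbarred to barred
  because barred letters are smaller, from barred to unbarred by the extra clause of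
  \<open>sDes\<close>. So the sign is constant up to the next element.\<close>

lemma sDes_next_sign:
  assumes w: "w \<in> B_group n" and j: "j \<in> {1..n}"
  shows "snd (sDes n w) (LEAST s. s \<in> fst (sDes n w) \<and> j \<le> s) = (if w (int j) < 0 then Negative else Positive)"
proof -
  define s where "s = (LEAST s. s \<in> fst (sDes n w) \<and> j \<le> s)"
  have s: "s \<in> fst (sDes n w)" "j \<le> s"
    using LeastI[of "\<lambda>s. s \<in> fst (sDes n w) \<and> j \<le> s" n] j by (auto simp: s_def fst_sDes)
  have sn: "s \<le> n"
    using s(1) by (auto simp: fst_sDes)
  have "w (int t) < 0 \<longleftrightarrow> w (int j) < 0" if "j \<le> t" "t \<le> s" for t
    using that
  proof (induction t rule: dec_induct)
    case (step t)
    then have "t \<notin> fst (sDes n w)"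
      using not_less_Least[of t "\<lambda>s. s \<in> fst (sDes n w) \<and> j \<le> s"] by (auto simp: s_def)
    moreover have "w (int t) \<noteq> 0" "w (int (Suc t)) \<noteq> 0"
      using step j sn by (auto intro!: B_group_nonzero[OF w] simp del: of_nat_Suc)
    ultimately show ?case
      using step j sn by (auto simp: fst_sDes less_r_def)
  qed simp
  from this[OF s(2)] show ?thesis
    using snd_sDes[OF s(1)] by (simp add: s_def[symmetric])
qed

lemma sign_vector_sDes:
  assumes "w \<in> B_group n" "j \<in> {1..n}"
  shows "sign_vector (sDes n w) j = (if w (int j) < 0 then Negative else Positive)"
  using sDes_next_sign[OF assms] by (metis prod.collapse sign_vector.simps)

text \<open>Apart from n, forming \<open>wDes\<close> discards exactly the changes from barred to
  unbarred, and these are what \<open>sDes\<close> adds to the ordinary descents.\<close>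

lemma wDes_sDes:
  assumes w: "w \<in> B_group n" and j: "j \<in> {1..<n}"
  shows "j \<in> wDes (sDes n w) \<longleftrightarrow> w (int (Suc j)) <\<^sub>r w (int j)"
proof -
  let ?S = "fst (sDes n w)" and ?e = "snd (sDes n w)"
  have S: "?S \<subseteq> {1..n}" "n \<in> ?S"
    using j by (auto simp: fst_sDes)
  then have max: "Max ?S = n"
    by (intro Max_eqI) (auto intro: finite_subset)
  have "?e (LEAST t. t \<in> ?S \<and> j < t) = (if w (int (Suc j)) < 0 then Negative else Positive)"
    using sDes_next_sign[OF w, of "Suc j"] j by (simp add: Suc_le_eq)
  moreover have "j \<in> wDes (sDes n w) \<longleftrightarrow> j \<in> ?S \<and> j \<noteq> Max ?S \<and>
      (?e j = ?e (LEAST t. t \<in> ?S \<and> j < t) \<or> (?e j = Positive \<and> ?e (LEAST t. t \<in> ?S \<and> j < t) = Negative))"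
    by (subst prod.collapse[symmetric], subst wDes.simps) (simp add: Let_def)
  moreover have "w (int j) \<noteq> 0" "w (int (Suc j)) \<noteq> 0"
    using j by (auto intro!: B_group_nonzero[OF w] simp del: of_nat_Suc)
  ultimately show ?thesis
    using j snd_sDes[of j n w] unfolding max by (auto simp: fst_sDes less_r_def)
qed

lemma agree_F_sig:
  assumes w: "w \<in> B_group n"
  shows "agree N (F_sig n (sDes n w))
    (\<Sum>\<zeta>\<in>{\<zeta> \<in> seqs n (2 * N). compat n w \<zeta>}. \<Prod>j\<in>{1..n}. mfps_var (letter (\<zeta> j)))"
proof -
  define v where "v i j = (if w (int j) < 0 then YVar (i j) else XVar (i j))" for i :: "nat \<Rightarrow> nat" and j
  define I :: "(nat \<Rightarrow> nat) set" where "I = {i \<in> extensional {1..n}. \<forall>j\<in>{1..<n}. i j \<le> i (Suc j) \<and>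
    (w (int (Suc j)) <\<^sub>r w (int j) \<longrightarrow> i j < i (Suc j))}"
  have vi: "var_index (v i j) = i j" for i j
    by (simp add: v_def)
  have F: "F_sig n (sDes n w) = mfps_sum (\<lambda>i. \<Prod>j\<in>{1..n}. mfps_var (v i j)) I"
  proof -
    have "(\<Prod>j\<in>{1..n}. if sign_vector (sDes n w) j = Positive then x_var (i j) else y_var (i j)) =
        (\<Prod>j\<in>{1..n}. mfps_var (v i j))" for i
      by (rule prod.cong) (auto simp: sign_vector_sDes[OF w] v_def)
    moreover have "{i \<in> extensional {1..n}. \<forall>j\<in>{1..<n}. i j \<le> i (Suc j) \<and>
        (j \<in> wDes (sDes n w) \<longrightarrow> i j < i (Suc j))} = I"
      unfolding I_def by (intro Collect_cong conj_cong ball_cong refl) (simp only: wDes_sDes[OF w])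
    ultimately show ?thesis
      unfolding F_sig_def by (simp only:)
  qed
  let ?I = "{i \<in> I. \<forall>j\<in>{1..n}. var_index (v i j) < N}"
  have fin: "finite ?I"
    by (rule finite_subset[OF _ finite_PiE[of "{1..n}" "\<lambda>_. {..<N}"]]) (auto simp: I_def vi PiE_def)
  have ag: "agree N (F_sig n (sDes n w)) (\<Sum>i\<in>?I. \<Prod>j\<in>{1..n}. mfps_var (v i j))"
    unfolding F by (rule agree_mfps_sum_prod_var[OF _ fin]) simp
  \<comment> \<open>Index and sign are merged into one code, 2i for y_i and 2i + 1 for x_i.\<close>
  define e where "e i = (\<lambda>j\<in>{1..n}. 2 * i j + (if 0 < w (int j) then 1 else 0))" for i :: "nat \<Rightarrow> nat"
  \<comment> \<open>For equal indices, unbarred followed by barred lowers the code and barred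
    followed by unbarred raises it. A tie of codes remains only for equal signs, and there the order
    of the letters is that of their absolute values.\<close>
  have step: "(i \<le> i' \<and> (b <\<^sub>r a \<longrightarrow> i < i')) \<longleftrightarrow>
      (2 * i + (if 0 < a then 1 else 0) \<le> 2 * i' + (if 0 < b then 1 else 0) \<and>
       (2 * i + (if 0 < a then 1 else 0) = 2 * i' + (if 0 < b then 1 else 0) \<longrightarrow> \<bar>a\<bar> < \<bar>b\<bar>))"
    if "a \<noteq> 0" "b \<noteq> 0" "\<bar>a\<bar> \<noteq> \<bar>b\<bar>" for a b :: int and i i' :: nat
    using that by (cases "0 < a"; cases "0 < b") (auto simp: less_r_def)
  have step': "(i j \<le> i (Suc j) \<and> (w (int (Suc j)) <\<^sub>r w (int j) \<longrightarrow> i j < i (Suc j))) \<longleftrightarrow>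
      (e i j \<le> e i (Suc j) \<and> (e i j = e i (Suc j) \<longrightarrow> \<bar>w (int j)\<bar> < \<bar>w (int (Suc j))\<bar>))"
    if "j \<in> {1..<n}" for i j
  proof -
    have "w (int j) \<noteq> 0" "w (int (Suc j)) \<noteq> 0" "\<bar>w (int j)\<bar> \<noteq> \<bar>w (int (Suc j))\<bar>"
      using that by (auto intro!: B_group_nonzero[OF w] simp: B_group_abs_inj[OF w] simp del: of_nat_Suc)
    from step[OF this] show ?thesis
      using that by (simp add: e_def)
  qed
  have ediv: "e i j div 2 = i j" "odd (e i j) \<longleftrightarrow> 0 < w (int j)" if "j \<in> {1..n}" for i j
    using that by (auto simp: e_def)
  have "(\<Sum>i\<in>?I. \<Prod>j\<in>{1..n}. mfps_var (v i j) :: series) =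
      (\<Sum>\<zeta>\<in>{\<zeta> \<in> seqs n (2 * N). compat n w \<zeta>}. \<Prod>j\<in>{1..n}. mfps_var (letter (\<zeta> j)))"
  proof (rule sum.reindex_bij_witness[where i = "\<lambda>\<zeta>. \<lambda>j\<in>{1..n}. \<zeta> j div 2" and j = e])
    fix i assume i: "i \<in> ?I"
    show "(\<lambda>j\<in>{1..n}. e i j div 2) = i"
      using i ediv(1) by (auto simp: I_def restrict_def extensional_def fun_eq_iff)
    show "e i \<in> {\<zeta> \<in> seqs n (2 * N). compat n w \<zeta>}"
    proof -
      have "i j < N" if "j \<in> {1..n}" for j
        using i that by (auto simp: vi)
      then have "e i j < 2 * N" if "j \<in> {1..n}" for j
        using ediv(1)[OF that, of i] that by (metis less_mult_imp_div_less div_less_iff_less_mult mult.commute zero_less_numeral)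
      then have "e i \<in> seqs n (2 * N)"
        by (auto simp: seqs_def e_def)
      moreover have "compat n w (e i)"
        using i step' ediv(2) by (auto simp: compat_def I_def)
      ultimately show ?thesis by simp
    qed
    show "(\<Prod>j\<in>{1..n}. mfps_var (letter (e i j))) = (\<Prod>j\<in>{1..n}. mfps_var (v i j) :: series)"
    proof (rule prod.cong[OF refl])
      fix j assume j: "j \<in> {1..n}"
      have "letter (e i j) = v i j"
        using ediv[OF j, of i] B_group_nonzero[OF w j] by (auto simp: letter_def v_def)
      then show "mfps_var (letter (e i j)) = (mfps_var (v i j) :: series)" by simp
    qed
  next
    fix \<zeta> assume z: "\<zeta> \<in> {\<zeta> \<in> seqs n (2 * N). compat n w \<zeta>}"
    define i where "i = (\<lambda>j\<in>{1..n}. \<zeta> j div 2)"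
    have ei: "e i = \<zeta>"
    proof
      fix j show "e i j = \<zeta> j"
      proof (cases "j \<in> {1..n}")
        case True
        then have "0 < w (int j) \<longleftrightarrow> odd (\<zeta> j)"
          using z by (auto simp: compat_def)
        then show ?thesis
          using True by (auto simp: e_def i_def)
      next
        case False
        moreover have "\<zeta> j = undefined"
          using z False by (auto simp: seqs_def PiE_def extensional_def)
        ultimately show ?thesis
          unfolding e_def restrict_def by (simp only: if_False)
      qed
    qed
    then show "e (\<lambda>j\<in>{1..n}. \<zeta> j div 2) = \<zeta>" by (simp add: i_def)
    have lt: "\<zeta> j < 2 * N" if "j \<in> {1..n}" for j
      using z that by (auto simp: seqs_def)
    have "i j < N" if "j \<in> {1..n}" for j
      using lt[OF that] that by (simp add: i_def)
    moreover have "i \<in> I"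
    proof -
      have "i \<in> extensional {1..n}" by (simp add: i_def)
      moreover have "i j \<le> i (Suc j) \<and> (w (int (Suc j)) <\<^sub>r w (int j) \<longrightarrow> i j < i (Suc j))" if "j \<in> {1..<n}" for j
        using step'[OF that, of i] z that unfolding ei compat_def by blast
      ultimately show ?thesis
        unfolding I_def by blast
    qed
    ultimately show "(\<lambda>j\<in>{1..n}. \<zeta> j div 2) \<in> ?I"
      unfolding vi i_def[symmetric] by blast
  qed
  with ag show ?thesis by simp
qed

section \<open>Words and their standardization\<close>

text \<open>Ties are broken by position, so that the ranks below are those of a stable sort.\<close>

definition word_le :: "(nat \<Rightarrow> nat) \<Rightarrow> nat \<Rightarrow> nat \<Rightarrow> bool" where
  "word_le v b a \<longleftrightarrow> v b < v a \<or> (v b = v a \<and> b \<le> a)"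

definition word_rank :: "nat \<Rightarrow> (nat \<Rightarrow> nat) \<Rightarrow> nat \<Rightarrow> nat" where
  "word_rank n v a = card {b \<in> {1..n}. word_le v b a}"

lemma word_rank_le_iff:
  assumes "a \<in> {1..n}" "b \<in> {1..n}"
  shows "word_rank n v a \<le> word_rank n v b \<longleftrightarrow> word_le v a b"
proof
  assume "word_le v a b"
  then show "word_rank n v a \<le> word_rank n v b"
    unfolding word_rank_def by (intro card_mono) (auto simp: word_le_def)
next
  assume le: "word_rank n v a \<le> word_rank n v b"
  show "word_le v a b"
  proof (rule ccontr)
    assume n: "\<not> word_le v a b"
    have "{c \<in> {1..n}. word_le v c b} \<subset> {c \<in> {1..n}. word_le v c a}"
      using n assms by (auto simp: word_le_def)
    then have "word_rank n v b < word_rank n v a"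
      unfolding word_rank_def by (intro psubset_card_mono) auto
    with le show False by simp
  qed
qed

lemma word_rank_bij: "bij_betw (word_rank n v) {1..n} {1..n}"
proof -
  have "word_rank n v a \<in> {1..n}" if "a \<in> {1..n}" for a
  proof -
    have "word_rank n v a \<le> card {1..n}"
      unfolding word_rank_def by (intro card_mono) auto
    moreover have "a \<in> {b \<in> {1..n}. word_le v b a}"
      using that by (auto simp: word_le_def)
    then have "0 < word_rank n v a"
      unfolding word_rank_def card_gt_0_iff by auto
    ultimately show ?thesis by simp
  qed
  moreover have "inj_on (word_rank n v) {1..n}"
  proof (rule inj_onI)
    fix a b assume *: "a \<in> {1..n}" "b \<in> {1..n}" "word_rank n v a = word_rank n v b"
    then have "word_le v a b" "word_le v b a"
      using word_rank_le_iff by (metis order_refl)+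
    then show "a = b" by (auto simp: word_le_def)
  qed
  ultimately show ?thesis
    unfolding bij_betw_def using endo_inj_surj[of "{1..n}" "word_rank n v"] by blast
qed

lemma word_rank_mem: "a \<in> {1..n} \<Longrightarrow> word_rank n v a \<in> {1..n}"
  using word_rank_bij bij_betwE by blast

definition standardize :: "nat \<Rightarrow> (nat \<Rightarrow> nat) \<Rightarrow> int \<Rightarrow> int" where
  "standardize n v x = (if x \<in> Omega n
     then sgn x * (if odd (v (nat \<bar>x\<bar>)) then 1 else -1) * int (word_rank n v (nat \<bar>x\<bar>)) else x)"

lemma abs_standardize: "x \<in> Omega n \<Longrightarrow> \<bar>standardize n v x\<bar> = int (word_rank n v (nat \<bar>x\<bar>))"
  by (auto simp: standardize_def abs_mult Omega_def abs_sgn_eq)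

lemma standardize_B_group: "standardize n v \<in> B_group n"
proof -
  have mem: "standardize n v x \<in> Omega n" if "x \<in> Omega n" for x
    using word_rank_mem[of "nat \<bar>x\<bar>" n v] that
    by (simp add: Omega_nat_abs abs_standardize)
  have "x = y" if xy: "x \<in> Omega n" "y \<in> Omega n" "standardize n v x = standardize n v y" for x y
  proof -
    have "word_rank n v (nat \<bar>x\<bar>) = word_rank n v (nat \<bar>y\<bar>)"
      using xy abs_standardize by (metis of_nat_eq_iff)
    then have "nat \<bar>x\<bar> = nat \<bar>y\<bar>"
      using xy(1,2) unfolding Omega_nat_abs by (rule inj_onD[OF bij_betw_imp_inj_on[OF word_rank_bij]])
    then have "x = y \<or> x = - y" by linarith
    moreover have "standardize n v y \<noteq> - standardize n v y"
      using mem[OF xy(2)] by (auto simp: Omega_def)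
    moreover have "standardize n v (- y) = - standardize n v y"
      using xy(2) by (simp add: standardize_def)
    ultimately show ?thesis
      using xy(3) by auto
  qed
  then have "inj_on (standardize n v) (Omega n)"
    by (auto intro: inj_onI)
  then have "bij_betw (standardize n v) (Omega n) (Omega n)"
    unfolding bij_betw_def using endo_inj_surj[OF finite_Omega] mem by blast
  then have "standardize n v permutes Omega n"
    by (rule bij_imp_permutes) (simp add: standardize_def)
  then show ?thesis
    by (auto simp: B_group_def) (simp add: standardize_def)
qed

lemma abs_perm_standardize: "a \<in> {1..n} \<Longrightarrow> abs_perm (standardize n v) a = word_rank n v a"
  using abs_standardize[OF Omega_int, of a n v] by (simp add: abs_perm_def)

lemma standardize_pos: "a \<in> {1..n} \<Longrightarrow> 0 < standardize n v (int a) \<longleftrightarrow> odd (v a)"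
  using word_rank_mem[of a n v] Omega_int[of a n] by (auto simp: standardize_def)

lemma compat_less:
  assumes "compat n u \<zeta>" "1 \<le> j" "j < j'" "j' \<le> n"
  shows "\<zeta> j < \<zeta> j' \<or> (\<zeta> j = \<zeta> j' \<and> \<bar>u (int j)\<bar> < \<bar>u (int j')\<bar>)"
proof -
  have adj: "\<zeta> i < \<zeta> (Suc i) \<or> (\<zeta> i = \<zeta> (Suc i) \<and> \<bar>u (int i)\<bar> < \<bar>u (int (Suc i))\<bar>)"
    if "1 \<le> i" "i < n" for i
    using assms(1) that by (auto simp: compat_def le_less)
  have "Suc j \<le> j'" using assms(3) by simp
  then show ?thesis
    using assms(4)
  proof (induction j' rule: dec_induct)
    case base
    then show ?case using adj[of j] assms(2) by auto
  next
    case (step k)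
    then show ?case using adj[of k] assms(2) by (auto simp del: of_nat_Suc)
  qed
qed

text \<open>Compatibility of \<open>\<zeta>\<close> with the inverse of w says that along
  \<open>\<zeta>\<close> the letters increase, equal ones being taken from increasing positions of
  v. Hence w sends each position of v to its rank in the stable sort.\<close>

lemma compat_word_rank:
  assumes w: "w \<in> B_group n" and c: "compat n (inv w) \<zeta>" and v: "\<And>a. a \<in> {1..n} \<Longrightarrow> v a = \<zeta> (abs_perm w a)"
    and a: "a \<in> {1..n}"
  shows "abs_perm w a = word_rank n v a" "0 < w (int a) \<longleftrightarrow> odd (v a)"
proof -
  let ?p = "abs_perm w"
  have less: "word_le v b a \<and> b \<noteq> a" if "?p b < ?p a" "a \<in> {1..n}" "b \<in> {1..n}" for a b
  proof -
    have "abs_perm (inv w) (?p b) = b" "abs_perm (inv w) (?p a) = a"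
      using abs_perm_inv[OF w] by simp_all
    then have "\<bar>inv w (int (?p b))\<bar> = int b" "\<bar>inv w (int (?p a))\<bar> = int a"
      by (metis int_abs_perm)+
    moreover have "\<zeta> (?p b) < \<zeta> (?p a) \<or> (\<zeta> (?p b) = \<zeta> (?p a) \<and> \<bar>inv w (int (?p b))\<bar> < \<bar>inv w (int (?p a))\<bar>)"
      using abs_perm_mem[OF w] that by (intro compat_less[OF c]) auto
    ultimately show ?thesis
      using that v by (auto simp: word_le_def)
  qed
  have iff: "word_le v b a \<longleftrightarrow> ?p b \<le> ?p a" if "b \<in> {1..n}" for b
  proof
    assume "word_le v b a"
    then show "?p b \<le> ?p a"
      using less[of a b] a that by (force simp: word_le_def)
  next
    assume le: "?p b \<le> ?p a"
    show "word_le v b a"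
    proof (cases "b = a")
      case False
      then have "?p b \<noteq> ?p a"
        using abs_perm_bij[OF w] a that by (auto simp: bij_betw_def dest: inj_onD)
      then show ?thesis using le less[of b a] a that by auto
    qed (simp add: word_le_def)
  qed
  have "word_rank n v a = card {b \<in> {1..n}. ?p b \<le> ?p a}"
    unfolding word_rank_def using iff by (intro arg_cong[of _ _ card]) auto
  also have "\<dots> = card (?p ` {b \<in> {1..n}. ?p b \<le> ?p a})"
    by (intro card_image[symmetric] inj_on_subset[OF bij_betw_imp_inj_on[OF abs_perm_bij[OF w]]]) auto
  also have "?p ` {b \<in> {1..n}. ?p b \<le> ?p a} = {1..?p a}"
  proof (intro equalityI subsetI)
    fix j assume "j \<in> {1..?p a}"
    moreover from this have "j \<in> ?p ` {1..n}"
      using abs_perm_mem[OF w a] abs_perm_bij[OF w] by (auto simp: bij_betw_def)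
    ultimately show "j \<in> ?p ` {b \<in> {1..n}. ?p b \<le> ?p a}" by auto
  qed (use abs_perm_mem[OF w] in auto)
  finally show "?p a = word_rank n v a" by simp
  show "0 < w (int a) \<longleftrightarrow> odd (v a)"
    using c abs_perm_mem[OF w a] B_group_sign_inv[OF w a] v[OF a] by (auto simp: compat_def simp del: int_abs_perm)
qed

section \<open>Decreasing runs of signed permutations and of words\<close>

definition run_ge :: "nat \<Rightarrow> (int \<Rightarrow> int) \<Rightarrow> bool" where
  "run_ge k w \<longleftrightarrow> (\<forall>i\<in>{1..k}. 0 < w (int i)) \<and> (\<forall>i\<in>{1..<k}. w (int i) > w (int (Suc i)))"

definition dec_prefix :: "nat \<Rightarrow> (nat \<Rightarrow> nat) \<Rightarrow> bool" where
  "dec_prefix k v \<longleftrightarrow> (\<forall>i\<in>{1..k}. odd (v i)) \<and> (\<forall>i\<in>{1..<k}. v i > v (Suc i))"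

text \<open>Equal letters receive increasing ranks from left to right, so a descent of ranks is
  always a strict descent of letters.\<close>

lemma run_ge_iff_dec_prefix:
  assumes "w \<in> B_group n" "k \<le> n" "\<And>a. a \<in> {1..n} \<Longrightarrow> abs_perm w a = word_rank n v a"
    "\<And>a. a \<in> {1..n} \<Longrightarrow> 0 < w (int a) \<longleftrightarrow> odd (v a)"
  shows "run_ge k w \<longleftrightarrow> dec_prefix k v"
proof -
  have "w (int (Suc i)) < w (int i) \<longleftrightarrow> v (Suc i) < v i"
    if "0 < w (int i)" "0 < w (int (Suc i))" "i \<in> {1..<k}" for i
  proof -
    have i: "i \<in> {1..n}" "Suc i \<in> {1..n}" using that assms(2) by auto
    have "w (int (Suc i)) < w (int i) \<longleftrightarrow> abs_perm w (Suc i) < abs_perm w i"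
      using that by (auto simp: abs_perm_def nat_less_eq_zless simp del: of_nat_Suc)
    also have "\<dots> \<longleftrightarrow> \<not> word_le v i (Suc i)"
      using assms(3)[OF i(1)] assms(3)[OF i(2)] word_rank_le_iff[OF i, of v] by auto
    also have "\<dots> \<longleftrightarrow> v (Suc i) < v i"
      by (auto simp: word_le_def)
    finally show ?thesis .
  qed
  moreover have "0 < w (int i) \<longleftrightarrow> odd (v i)" if "i \<in> {1..k}" for i
    using assms(2,4) that by auto
  ultimately show ?thesis
    unfolding run_ge_def dec_prefix_def by (auto simp del: of_nat_Suc)
qed

text \<open>Bijection between pairs of w and \<open>\<zeta>\<close> and words v: sorting v gives
  \<open>\<zeta>\<close>, standardizing v gives w, and v is recovered by reading
  \<open>\<zeta>\<close> along w.\<close>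

lemma sum_run_ge:
  fixes z :: "nat \<Rightarrow> 'a :: comm_ring_1"
  assumes "k \<le> n"
  shows "(\<Sum>w\<in>{w \<in> B_group n. run_ge k w}. \<Sum>\<zeta>\<in>{\<zeta> \<in> seqs n K. compat n (inv w) \<zeta>}. \<Prod>j\<in>{1..n}. z (\<zeta> j)) =
    (\<Sum>v\<in>{v \<in> seqs n K. dec_prefix k v}. \<Prod>a\<in>{1..n}. z (v a))"
proof -
  define dec where "dec w \<zeta> = (\<lambda>a\<in>{1..n}. \<zeta> (abs_perm w a))" for w and \<zeta> :: "nat \<Rightarrow> nat"
  have dec_seqs: "dec w \<zeta> \<in> seqs n K" if "w \<in> B_group n" "\<zeta> \<in> seqs n K" for w \<zeta>
    using that abs_perm_mem[OF that(1)] by (fastforce simp: seqs_def dec_def)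
  have key: "abs_perm w a = word_rank n (dec w \<zeta>) a \<and> (0 < w (int a) \<longleftrightarrow> odd (dec w \<zeta> a))"
    if "w \<in> B_group n" "compat n (inv w) \<zeta>" "a \<in> {1..n}" for w \<zeta> a
    using compat_word_rank[OF that(1,2), of "dec w \<zeta>"] that(3) by (simp add: dec_def)
  have std: "standardize n (dec w \<zeta>) = w" if "w \<in> B_group n" "compat n (inv w) \<zeta>" for w \<zeta>
  proof (rule B_group_eqI[OF standardize_B_group that(1)])
    fix a assume a: "a \<in> {1..n}"
    have "\<bar>standardize n (dec w \<zeta>) (int a)\<bar> = \<bar>w (int a)\<bar>"
      using abs_standardize[OF Omega_int[OF a], of "dec w \<zeta>"] key[OF that a] by (metis int_abs_perm nat_abs_int_diff nat_int abs_of_nat)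
    moreover have "0 < standardize n (dec w \<zeta>) (int a) \<longleftrightarrow> 0 < w (int a)"
      using standardize_pos[OF a] key[OF that a] by simp
    ultimately show "standardize n (dec w \<zeta>) (int a) = w (int a)"
      by linarith
  qed
  define enc where "enc v = (standardize n v, \<lambda>j\<in>{1..n}. v (abs_perm (inv (standardize n v)) j))" for v :: "nat \<Rightarrow> nat"
  have "(\<Sum>(w, \<zeta>)\<in>Sigma {w \<in> B_group n. run_ge k w} (\<lambda>w. {\<zeta> \<in> seqs n K. compat n (inv w) \<zeta>}). \<Prod>j\<in>{1..n}. z (\<zeta> j)) =
    (\<Sum>v\<in>{v \<in> seqs n K. dec_prefix k v}. \<Prod>a\<in>{1..n}. z (v a))"
  proof (rule sum.reindex_bij_witness[where i = enc and j = "\<lambda>(w, \<zeta>). dec w \<zeta>"])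
    fix x assume "x \<in> Sigma {w \<in> B_group n. run_ge k w} (\<lambda>w. {\<zeta> \<in> seqs n K. compat n (inv w) \<zeta>})"
    then obtain w \<zeta> where x: "x = (w, \<zeta>)" "w \<in> B_group n" "run_ge k w" "\<zeta> \<in> seqs n K" "compat n (inv w) \<zeta>"
      by auto
    have "(\<lambda>j\<in>{1..n}. dec w \<zeta> (abs_perm (inv w) j)) = \<zeta>"
      using x(4) abs_perm_inv[OF x(2)] abs_perm_mem[OF B_group_inv[OF x(2)]]
      by (auto simp: dec_def fun_eq_iff seqs_def PiE_def extensional_def restrict_def)
    then show "enc (case x of (w, \<zeta>) \<Rightarrow> dec w \<zeta>) = x"
      using std[OF x(2,5)] by (simp add: enc_def x(1))
    have "dec_prefix k (dec w \<zeta>)"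
      using run_ge_iff_dec_prefix[OF x(2) assms, of "dec w \<zeta>"] key[OF x(2,5)] x(3) by auto
    then show "(case x of (w, \<zeta>) \<Rightarrow> dec w \<zeta>) \<in> {v \<in> seqs n K. dec_prefix k v}"
      using dec_seqs[OF x(2,4)] by (simp add: x(1))
    have "(\<Prod>a\<in>{1..n}. z (dec w \<zeta> a)) = (\<Prod>a\<in>{1..n}. z (\<zeta> (abs_perm w a)))"
      by (rule prod.cong) (auto simp: dec_def)
    also have "\<dots> = (\<Prod>j\<in>{1..n}. z (\<zeta> j))"
      by (rule prod.reindex_bij_betw[OF abs_perm_bij[OF x(2)]])
    finally show "(\<Prod>a\<in>{1..n}. z ((case x of (w, \<zeta>) \<Rightarrow> dec w \<zeta>) a)) = (case x of (w, \<zeta>) \<Rightarrow> \<Prod>j\<in>{1..n}. z (\<zeta> j))"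
      by (simp add: x(1))
  next
    fix v assume "v \<in> {v \<in> seqs n K. dec_prefix k v}"
    then have v: "v \<in> seqs n K" "dec_prefix k v" by auto
    define w where "w = standardize n v"
    have w: "w \<in> B_group n" "inv w \<in> B_group n"
      by (simp_all add: w_def standardize_B_group B_group_inv)
    define \<zeta> where "\<zeta> = (\<lambda>j\<in>{1..n}. v (abs_perm (inv w) j))"
    have "dec w \<zeta> = v"
      using v(1) abs_perm_inv[OF w(1)] abs_perm_mem[OF w(1)]
      by (auto simp: dec_def \<zeta>_def fun_eq_iff seqs_def PiE_def extensional_def restrict_def)
    then show "(case enc v of (w, \<zeta>) \<Rightarrow> dec w \<zeta>) = v"
      by (simp add: enc_def w_def \<zeta>_def)
    have "run_ge k w"
      using run_ge_iff_dec_prefix[OF w(1) assms, of v] abs_perm_standardize standardize_pos v(2)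
      by (auto simp: w_def)
    moreover have "\<zeta> \<in> seqs n K"
      using v(1) abs_perm_mem[OF w(2)] by (fastforce simp: seqs_def \<zeta>_def)
    moreover have "compat n (inv w) \<zeta>"
      unfolding compat_def
    proof (intro conjI ballI)
      fix j assume j: "j \<in> {1..n}"
      let ?a = "abs_perm (inv w) j"
      have a: "?a \<in> {1..n}" using abs_perm_mem[OF w(2) j] .
      have "0 < inv w (int j) \<longleftrightarrow> 0 < w (int ?a)"
        using B_group_sign_inv[OF w(2) j] w(1) by simp
      also have "\<dots> \<longleftrightarrow> odd (v ?a)"
        unfolding w_def using a w_def by (intro standardize_pos) simp
      finally show "0 < inv w (int j) \<longleftrightarrow> odd (\<zeta> j)"
        using j by (simp add: \<zeta>_def)
    next
      fix j assume j: "j \<in> {1..<n}"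
      let ?a = "abs_perm (inv w) j" and ?b = "abs_perm (inv w) (Suc j)"
      have ab: "?a \<in> {1..n}" "?b \<in> {1..n}"
        using abs_perm_mem[OF w(2)] j by auto
      have "word_rank n v ?a = j" "word_rank n v ?b = Suc j"
        using abs_perm_inv[OF w(1)] abs_perm_standardize[OF ab(1), of v] abs_perm_standardize[OF ab(2), of v]
        by (simp_all add: w_def)
      then have le: "word_le v ?a ?b" "\<not> word_le v ?b ?a"
        using word_rank_le_iff[OF ab, of v] word_rank_le_iff[OF ab(2,1), of v] by auto
      have ints: "\<bar>inv w (int j)\<bar> = int ?a" "\<bar>inv w (int (Suc j))\<bar> = int ?b"
        by (simp_all del: of_nat_Suc)
      have z: "\<zeta> j = v ?a" "\<zeta> (Suc j) = v ?b"
        using j by (auto simp: \<zeta>_def)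
      show "\<zeta> j \<le> \<zeta> (Suc j)" 
        using le unfolding z by (auto simp: word_le_def)
      show "\<zeta> j = \<zeta> (Suc j) \<longrightarrow> \<bar>inv w (int j)\<bar> < \<bar>inv w (int (Suc j))\<bar>"
        using le unfolding z ints by (auto simp: word_le_def simp del: int_abs_perm)
    qed
    ultimately show "enc v \<in> Sigma {w \<in> B_group n. run_ge k w} (\<lambda>w. {\<zeta> \<in> seqs n K. compat n (inv w) \<zeta>})"
      using w(1) by (simp add: enc_def w_def \<zeta>_def)
  qed
  then show ?thesis
    by (subst sum.Sigma) (auto simp: finite_B_group finite_seqs)
qed

lemma sum_dec_prefix:
  fixes z :: "nat \<Rightarrow> 'a :: comm_ring_1"
  assumes "k \<le> n"
  shows "(\<Sum>v\<in>{v \<in> seqs n K. dec_prefix k v}. \<Prod>a\<in>{1..n}. z (v a)) =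
    (\<Sum>v\<in>{v \<in> seqs k K. dec_prefix k v}. \<Prod>a\<in>{1..k}. z (v a)) * (\<Sum>c<K. z c) ^ (n - k)"
  using assms
proof (induction n rule: dec_induct)
  case (step n)
  have "(\<Sum>v\<in>{v \<in> seqs (Suc n) K. dec_prefix k v}. \<Prod>a\<in>{1..Suc n}. z (v a)) =
      (\<Sum>(v, c)\<in>{v \<in> seqs n K. dec_prefix k v} \<times> {..<K}. (\<Prod>a\<in>{1..n}. z (v a)) * z c)"
  proof (rule sum.reindex_bij_witness[where i = "\<lambda>(v, c). v(Suc n := c)" and j = "\<lambda>v. (restrict v {1..n}, v (Suc n))"])
    fix v assume "v \<in> {v \<in> seqs (Suc n) K. dec_prefix k v}"
    then have v: "v \<in> seqs (Suc n) K" "dec_prefix k v" by auto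
    show "(case (restrict v {1..n}, v (Suc n)) of (v, c) \<Rightarrow> v(Suc n := c)) = v"
      using v(1) by (auto simp: fun_eq_iff seqs_def PiE_def extensional_def restrict_def le_Suc_eq)
    have "dec_prefix k (restrict v {1..n})"
      using v(2) step(1) by (auto simp: dec_prefix_def)
    then show "(restrict v {1..n}, v (Suc n)) \<in> {v \<in> seqs n K. dec_prefix k v} \<times> {..<K}"
      using v(1) by (auto simp: seqs_def PiE_def)
    show "(case (restrict v {1..n}, v (Suc n)) of (v, c) \<Rightarrow> (\<Prod>a\<in>{1..n}. z (v a)) * z c) = (\<Prod>a\<in>{1..Suc n}. z (v a))"
      by (simp add: atLeastAtMostSuc_conv mult.commute)
  next
    fix x assume "x \<in> {v \<in> seqs n K. dec_prefix k v} \<times> {..<K}"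
    then obtain v c where x: "x = (v, c)" "v \<in> seqs n K" "dec_prefix k v" "c < K" by auto
    show "(restrict (case x of (v, c) \<Rightarrow> v(Suc n := c)) {1..n}, (case x of (v, c) \<Rightarrow> v(Suc n := c)) (Suc n)) = x"
      using x(2) by (auto simp: x(1) fun_eq_iff seqs_def PiE_def extensional_def restrict_def)
    have "dec_prefix k (v(Suc n := c))"
      using x(3) step(1) by (auto simp: dec_prefix_def)
    then show "(case x of (v, c) \<Rightarrow> v(Suc n := c)) \<in> {v \<in> seqs (Suc n) K. dec_prefix k v}"
      using x(2,4) by (auto simp: x(1) seqs_def PiE_def extensional_def le_Suc_eq)
  qed
  also have "\<dots> = (\<Sum>v\<in>{v \<in> seqs n K. dec_prefix k v}. \<Prod>a\<in>{1..n}. z (v a)) * (\<Sum>c<K. z c)"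
    by (simp add: sum.cartesian_product[symmetric] sum_product)
  finally show ?case
    using step by (simp add: Suc_diff_le mult.assoc mult.commute)
qed simp

lemma sum_dec_prefix_schurN:
  fixes z :: "nat \<Rightarrow> 'a :: comm_ring_1"
  shows "(\<Sum>v\<in>{v \<in> seqs k (2 * N). dec_prefix k v}. \<Prod>a\<in>{1..k}. z (v a)) =
    schurN N (\<lambda>i. z (2 * i + 1)) (replicate k (Suc 0))"
  unfolding schurN_def diagram_column
\<comment> \<open>The prefix decreases while columns increase downwards, so position a corresponds
  to row \<open>k - a\<close>; the odd code 2i + 1 becomes the entry i.\<close>
proof (rule sum.reindex_bij_witness[where i = "\<lambda>T. \<lambda>a\<in>{1..k}. 2 * T (k - a, 0) + 1" and
      j = "\<lambda>v. \<lambda>c\<in>{..<k} \<times> {0}. v (k - fst c) div 2"])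
  fix v assume "v \<in> {v \<in> seqs k (2 * N). dec_prefix k v}"
  then have v: "v \<in> extensional {1..k}" "\<And>a. a \<in> {1..k} \<Longrightarrow> v a < 2 * N" "\<And>a. a \<in> {1..k} \<Longrightarrow> odd (v a)"
      "\<And>a. a \<in> {1..<k} \<Longrightarrow> v (Suc a) < v a"
    by (auto simp: seqs_def PiE_def dec_prefix_def)
  let ?T = "\<lambda>c\<in>{..<k} \<times> {0::nat}. v (k - fst c) div 2"
  have odd: "2 * (v a div 2) + 1 = v a" if "a \<in> {1..k}" for a
    using v(3)[OF that] by simp
  show e: "(\<lambda>a\<in>{1..k}. 2 * ?T (k - a, 0) + 1) = v"
  proof
    fix a show "(\<lambda>a\<in>{1..k}. 2 * ?T (k - a, 0) + 1) a = v a"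
      using odd[of a] v(1) by (cases "a \<in> {1..k}") (auto simp: extensional_def)
  qed
  have "?T (i, 0) < ?T (Suc i, 0)" if "Suc i < k" for i
  proof -
    have "v (k - i) < v (k - Suc i)"
      using v(4)[of "k - Suc i"] that by (simp add: Suc_diff_Suc)
    then show ?thesis
      using odd[of "k - i"] odd[of "k - Suc i"] that by simp linarith
  qed
  moreover have "?T (i, 0) < N" if "i < k" for i
  proof -
    have "k - i \<in> {1..k}" using that by auto
    then show ?thesis using v(2)[of "k - i"] that by simp
  qed
  ultimately show "?T \<in> ssytN N (replicate k (Suc 0))"
    by (auto simp: ssytN_def ssyt_def diagram_column row_column split: if_splits)
  have "(\<Prod>c\<in>{..<k} \<times> {0}. z (2 * ?T c + 1)) = (\<Prod>a\<in>{1..k}. z (v a))"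
    by (rule prod.reindex_bij_witness[where i = "\<lambda>a. (k - a, 0)" and j = "\<lambda>c. k - fst c"])
      (use odd in auto)
  then show "(\<Prod>c\<in>{..<k} \<times> {0}. z (2 * ?T c + 1)) = (\<Prod>a\<in>{1..k}. z (v a))" .
next
  fix T assume "T \<in> ssytN N (replicate k (Suc 0))"
  then have T: "T \<in> extensional ({..<k} \<times> {0})" "\<And>i. i < k \<Longrightarrow> T (i, 0) < N"
      "\<And>i. Suc i < k \<Longrightarrow> T (i, 0) < T (Suc i, 0)"
    by (auto simp: ssytN_def ssyt_def diagram_column row_column)
  let ?v = "\<lambda>a\<in>{1..k}. 2 * T (k - a, 0) + 1"
  show "(\<lambda>c\<in>{..<k} \<times> {0}. ?v (k - fst c) div 2) = T"
    using T(1) by (auto simp: fun_eq_iff extensional_def)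
  have "?v (Suc a) < ?v a" if "a \<in> {1..<k}" for a
  proof -
    have "Suc (k - Suc a) = k - a" using that by auto
    then show ?thesis
      using T(3)[of "k - Suc a"] that by auto
  qed
  moreover have "?v a < 2 * N" if "a \<in> {1..k}" for a
    using T(2)[of "k - a"] that by auto
  ultimately show "?v \<in> {v \<in> seqs k (2 * N). dec_prefix k v}"
    by (auto simp: seqs_def dec_prefix_def)
qed

text \<open>The values of z are arbitrary ring elements: they will be the x and y for the symmetric
  functions, and independent variables, one per label, for the count by descent sets.\<close>

definition compat_sum :: "nat \<Rightarrow> nat \<Rightarrow> (nat \<Rightarrow> 'a :: comm_ring_1) \<Rightarrow> (int \<Rightarrow> int) \<Rightarrow> 'a" where
  "compat_sum n K z w = (\<Sum>\<zeta>\<in>{\<zeta> \<in> seqs n K. compat n w \<zeta>}. \<Prod>j\<in>{1..n}. z (\<zeta> j))"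

text \<open>The elementary symmetric polynomial of degree k in the z with odd index below K.\<close>

definition dec_sum :: "nat \<Rightarrow> nat \<Rightarrow> (nat \<Rightarrow> 'a :: comm_ring_1) \<Rightarrow> 'a" where
  "dec_sum k K z = (\<Sum>v\<in>{v \<in> seqs k K. dec_prefix k v}. \<Prod>a\<in>{1..k}. z (v a))"

lemma sum_E_set:
  "(\<Sum>w\<in>E_set n. compat_sum n K z (inv w)) = (\<Sum>k\<le>n. (-1) ^ k * (dec_sum k K z * (\<Sum>c<K. z c) ^ (n - k)))"
proof -
  have "(\<Sum>w\<in>E_set n. compat_sum n K z (inv w)) =
      (\<Sum>w\<in>B_group n. if even (initial_run n w) then compat_sum n K z (inv w) else 0)"
    unfolding E_set_def by (rule sum.inter_filter[OF finite_B_group])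
  also have "\<dots> = (\<Sum>w\<in>B_group n. \<Sum>k\<le>n. if run_ge k w then (-1) ^ k * compat_sum n K z (inv w) else 0)"
  proof (rule sum.cong[OF refl])
    fix w
    have "(\<Sum>k\<le>n. if k \<le> n \<and> run_ge k w then (-1) ^ k else 0) = (if even (Max {k. k \<le> n \<and> run_ge k w}) then 1 else (0 :: 'a))"
      by (rule alternating_run_sum) (auto simp: run_ge_def)
    also have "{k. k \<le> n \<and> run_ge k w} = {k. k \<le> n \<and> (\<forall>i\<in>{1..k}. 0 < w (int i)) \<and> (\<forall>i\<in>{1..<k}. w (int i) > w (int (Suc i)))}"
      by (simp add: run_ge_def)
    finally have e: "(\<Sum>k\<le>n. if run_ge k w then (-1) ^ k else 0) = (if even (initial_run n w) then 1 else (0 :: 'a))"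
      by (simp add: initial_run_def)
    have "(\<Sum>k\<le>n. if run_ge k w then (-1) ^ k * compat_sum n K z (inv w) else 0) =
        (\<Sum>k\<le>n. if run_ge k w then (-1) ^ k else 0) * compat_sum n K z (inv w)"
      by (simp add: sum_distrib_right if_distrib[of "\<lambda>x. x * _"] cong: if_cong)
    then show "(if even (initial_run n w) then compat_sum n K z (inv w) else 0) =
        (\<Sum>k\<le>n. if run_ge k w then (-1) ^ k * compat_sum n K z (inv w) else 0)"
      by (simp add: e)
  qed
  also have "\<dots> = (\<Sum>k\<le>n. \<Sum>w\<in>B_group n. if run_ge k w then (-1) ^ k * compat_sum n K z (inv w) else 0)"
    by (rule sum.swap)
  also have "\<dots> = (\<Sum>k\<le>n. (-1) ^ k * (\<Sum>w\<in>{w \<in> B_group n. run_ge k w}. compat_sum n K z (inv w)))"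
    by (simp add: sum.inter_filter[OF finite_B_group, symmetric] sum_distrib_left)
  also have "\<dots> = (\<Sum>k\<le>n. (-1) ^ k * (dec_sum k K z * (\<Sum>c<K. z c) ^ (n - k)))"
    unfolding compat_sum_def dec_sum_def
  proof (rule sum.cong[OF refl])
    fix k assume "k \<in> {..n}"
    then have k: "k \<le> n" by simp
    show "(-1) ^ k * (\<Sum>w\<in>{w \<in> B_group n. run_ge k w}. \<Sum>\<zeta>\<in>{\<zeta> \<in> seqs n K. compat n (inv w) \<zeta>}. \<Prod>j\<in>{1..n}. z (\<zeta> j)) =
      (-1) ^ k * ((\<Sum>v\<in>{v \<in> seqs k K. dec_prefix k v}. \<Prod>a\<in>{1..k}. z (v a)) * (\<Sum>c<K. z c) ^ (n - k))"
      unfolding sum_run_ge[OF k] sum_dec_prefix[OF k] ..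
  qed
  finally show ?thesis .
qed

text \<open>The case of an empty prefix, after replacing w by its inverse.\<close>

lemma sum_B_group:
  "(\<Sum>w\<in>B_group n. compat_sum n K z w) = (\<Sum>c<K. z c) ^ n"
proof -
  have "(\<Sum>w\<in>B_group n. compat_sum n K z w) = (\<Sum>w\<in>{w \<in> B_group n. run_ge 0 w}. compat_sum n K z (inv w))"
    by (rule sum.reindex_bij_witness[where i = inv and j = inv]) (auto simp: B_group_inv run_ge_def)
  also have "\<dots> = (\<Sum>c<K. z c) ^ n"
    using sum_run_ge[of 0 n z K] sum_dec_prefix[of 0 n z K]
    by (simp add: compat_sum_def seqs_def dec_prefix_def)
  finally show ?thesis .
qed

section \<open>Removing a fixed point\<close>

text \<open>For positive q, renumbers the letters so that q and its negative are left free,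
  preserving signs and the order of absolute values; \<open>dn q\<close> is the inverse.\<close>

definition up :: "nat \<Rightarrow> int \<Rightarrow> int" where
  "up q a = (if \<bar>a\<bar> < int q then a else a + sgn a)"

definition dn :: "nat \<Rightarrow> int \<Rightarrow> int" where
  "dn q a = (if \<bar>a\<bar> < int q then a else a - sgn a)"

definition upn :: "nat \<Rightarrow> nat \<Rightarrow> nat" where
  "upn q j = (if j < q then j else Suc j)"

lemma dn_up: "0 < q \<Longrightarrow> dn q (up q a) = a"
  by (auto simp: dn_def up_def sgn_if abs_if split: if_splits)

lemma up_dn: "0 < q \<Longrightarrow> \<bar>a\<bar> \<noteq> int q \<Longrightarrow> up q (dn q a) = a"
  by (auto simp: dn_def up_def sgn_if abs_if split: if_splits)

lemma abs_up_neq: "0 < q \<Longrightarrow> \<bar>up q a\<bar> \<noteq> int q"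
  by (auto simp: up_def sgn_if abs_if split: if_splits)

lemma up_uminus: "up q (- a) = - up q a"
  by (auto simp: up_def)

lemma dn_uminus: "dn q (- a) = - dn q a"
  by (auto simp: dn_def)

lemma up_pos: "0 < up q a \<longleftrightarrow> 0 < a"
  by (auto simp: up_def sgn_if abs_if split: if_splits)

lemma dn_pos: "0 < q \<Longrightarrow> \<bar>a\<bar> \<noteq> int q \<Longrightarrow> 0 < dn q a \<longleftrightarrow> 0 < a"
  by (auto simp: dn_def sgn_if abs_if split: if_splits)

lemma abs_up_less: "0 < q \<Longrightarrow> \<bar>up q a\<bar> < \<bar>up q b\<bar> \<longleftrightarrow> \<bar>a\<bar> < \<bar>b\<bar>"
  by (auto simp: up_def sgn_if abs_if split: if_splits)

lemma abs_dn_less: "0 < q \<Longrightarrow> \<bar>a\<bar> \<noteq> int q \<Longrightarrow> \<bar>b\<bar> \<noteq> int q \<Longrightarrow> \<bar>dn q a\<bar> < \<bar>dn q b\<bar> \<longleftrightarrow> \<bar>a\<bar> < \<bar>b\<bar>"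
  by (auto simp: dn_def sgn_if abs_if split: if_splits)

lemma up_int: "0 < q \<Longrightarrow> up q (int j) = int (upn q j)"
  by (auto simp: up_def upn_def sgn_if)

lemma up_inj: "0 < q \<Longrightarrow> up q a = up q b \<longleftrightarrow> a = b"
  using dn_up by metis

lemma B_groupI:
  assumes "\<And>x. f (g x) = x" "\<And>x. g (f x) = x" "\<And>x. x \<notin> Omega n \<Longrightarrow> f x = x" "\<And>x. f (- x) = - f x"
  shows "f \<in> B_group n"
proof -
  have "f permutes Omega n"
    unfolding permutes_def using assms(1-3) by metis
  then show ?thesis
    using assms(4) by (simp add: B_group_def)
qed

definition ins_perm :: "nat \<Rightarrow> (int \<Rightarrow> int) \<Rightarrow> int \<Rightarrow> int" where
  "ins_perm q w x = (if \<bar>x\<bar> = int q then x else up q (w (dn q x)))"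

definition del_perm :: "nat \<Rightarrow> (int \<Rightarrow> int) \<Rightarrow> int \<Rightarrow> int" where
  "del_perm q w x = dn q (w (up q x))"

lemma B_group_outside: "w \<in> B_group n \<Longrightarrow> x \<notin> Omega n \<Longrightarrow> w x = x"
  by (simp add: B_group_def permutes_def)

lemma ins_perm_inverse:
  assumes "w \<in> B_group m" "0 < q"
  shows "ins_perm q w (ins_perm q (inv w) x) = x" "ins_perm q (inv w) (ins_perm q w x) = x"
  using assms abs_up_neq[OF assms(2)] by (auto simp: ins_perm_def dn_up up_dn)

lemma ins_perm_B_group:
  assumes w: "w \<in> B_group m" and q: "q \<in> {1..Suc m}"
  shows "ins_perm q w \<in> B_group (Suc m)"
proof (rule B_groupI)
  show "ins_perm q w (ins_perm q (inv w) x) = x" "ins_perm q (inv w) (ins_perm q w x) = x" for x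
    using ins_perm_inverse[OF w] q by auto
  show "ins_perm q w (- x) = - ins_perm q w x" for x
    by (simp add: ins_perm_def dn_uminus up_uminus B_group_uminus[OF w])
  fix x assume x: "x \<notin> Omega (Suc m)"
  then have "dn q x \<notin> Omega m"
    using q by (auto simp: Omega_def dn_def sgn_if abs_if split: if_splits)
  then show "ins_perm q w x = x"
    using q by (auto simp: ins_perm_def B_group_outside[OF w] up_dn)
qed

lemma del_perm_inverse:
  assumes w: "w \<in> B_group n" and q: "0 < q" "w (int q) = int q"
  shows "del_perm q w (del_perm q (inv w) x) = x" "\<bar>w (up q x)\<bar> \<noteq> int q"
proof -
  have "\<bar>w a\<bar> \<noteq> int q" if "\<bar>a\<bar> \<noteq> int q" for a
    using B_group_abs_inj[OF w, of a "int q"] q that by simp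
  then show 1: "\<bar>w (up q x)\<bar> \<noteq> int q" for x
    using abs_up_neq[OF q(1)] by blast
  have "inv w (int q) = int q"
    using B_group_inv_apply(1)[OF w, of "int q"] q by simp
  then have "\<bar>inv w a\<bar> \<noteq> int q" if "\<bar>a\<bar> \<noteq> int q" for a
    using B_group_abs_inj[OF B_group_inv[OF w], of a "int q"] q that by simp
  then have "\<bar>inv w (up q x)\<bar> \<noteq> int q" for x
    using abs_up_neq[OF q(1)] by blast
  then show "del_perm q w (del_perm q (inv w) x) = x"
    using w by (simp add: del_perm_def up_dn[OF q(1)] dn_up[OF q(1)])
qed

lemma del_perm_B_group:
  assumes w: "w \<in> B_group (Suc m)" and q: "q \<in> {1..Suc m}" "w (int q) = int q"
  shows "del_perm q w \<in> B_group m"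
proof (rule B_groupI)
  have "inv w (int q) = int q"
    using B_group_inv_apply(1)[OF w, of "int q"] q by simp
  then show "del_perm q w (del_perm q (inv w) x) = x" "del_perm q (inv w) (del_perm q w x) = x" for x
    using del_perm_inverse(1)[OF w, of q] del_perm_inverse(1)[OF B_group_inv[OF w], of q] q w by auto
  show "del_perm q w (- x) = - del_perm q w x" for x
    by (simp add: del_perm_def dn_uminus up_uminus B_group_uminus[OF w])
  fix x assume x: "x \<notin> Omega m"
  then have "up q x \<notin> Omega (Suc m)"
    using q(1) by (auto simp: Omega_def up_def sgn_if abs_if split: if_splits)
  then show "del_perm q w x = x"
    using q by (auto simp: del_perm_def B_group_outside[OF w] dn_up)
qed

lemma ins_del_perm:
  assumes "w \<in> B_group n" "0 < q" "w (int q) = int q"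
  shows "ins_perm q (del_perm q w) = w"
proof
  fix x
  have "w x = x" if "\<bar>x\<bar> = int q"
  proof -
    have "x = int q \<or> x = - int q" using that by linarith
    then show ?thesis
      using assms(3) B_group_uminus[OF assms(1), of "int q"] by auto
  qed
  moreover have "\<bar>w x\<bar> \<noteq> int q" if "\<bar>x\<bar> \<noteq> int q"
    using B_group_abs_inj[OF assms(1), of x "int q"] assms that by simp
  ultimately show "ins_perm q (del_perm q w) x = w x"
    using assms(2) by (auto simp: ins_perm_def del_perm_def up_dn)
qed

lemma del_ins_perm: "0 < q \<Longrightarrow> del_perm q (ins_perm q w) = w"
  by (auto simp: fun_eq_iff ins_perm_def del_perm_def dn_up abs_up_neq)

lemma ins_perm_upn: "0 < q \<Longrightarrow> ins_perm q w (int (upn q j)) = up q (w (int j))"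
  using abs_up_neq[of q "int j"] by (simp add: ins_perm_def up_int[symmetric] dn_up)

section \<open>Compatible labellings and the insertion of a fixed point\<close>

definition cpairs :: "nat \<Rightarrow> nat \<Rightarrow> ((int \<Rightarrow> int) \<times> (nat \<Rightarrow> nat)) set" where
  "cpairs n K = {(w, \<zeta>). w \<in> B_group n \<and> \<zeta> \<in> seqs n K \<and> compat n w \<zeta>}"

text \<open>The set T of forbidden labels interpolates between all signed permutations, for T empty,
  and derangements, for T the set of all odd labels.\<close>

definition nofix :: "nat \<Rightarrow> nat set \<Rightarrow> (int \<Rightarrow> int) \<Rightarrow> (nat \<Rightarrow> nat) \<Rightarrow> bool" where
  "nofix n T w \<zeta> \<longleftrightarrow> (\<forall>j\<in>{1..n}. w (int j) = int j \<longrightarrow> \<zeta> j \<notin> T)"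

definition ins_seq :: "nat \<Rightarrow> nat \<Rightarrow> nat \<Rightarrow> (nat \<Rightarrow> nat) \<Rightarrow> nat \<Rightarrow> nat" where
  "ins_seq m q b \<zeta> = (\<lambda>j\<in>{1..Suc m}. if j < q then \<zeta> j else if j = q then b else \<zeta> (j - 1))"

definition del_seq :: "nat \<Rightarrow> nat \<Rightarrow> (nat \<Rightarrow> nat) \<Rightarrow> nat \<Rightarrow> nat" where
  "del_seq m q \<zeta> = (\<lambda>j\<in>{1..m}. \<zeta> (upn q j))"

text \<open>Marks the positions that must precede an inserted fixed point labelled b: those with a
  smaller label, and those with label b whose value lies below the diagonal.\<close>

definition low :: "nat \<Rightarrow> (int \<Rightarrow> int) \<Rightarrow> (nat \<Rightarrow> nat) \<Rightarrow> nat \<Rightarrow> bool" where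
  "low b w \<zeta> j \<longleftrightarrow> \<zeta> j < b \<or> (\<zeta> j = b \<and> w (int j) < int j)"

text \<open>The only position at which a fixed point labelled \<open>b\<close> can be inserted so that it becomes the
  first fixed point with that label.\<close>

definition fixpos :: "nat \<Rightarrow> nat \<Rightarrow> (int \<Rightarrow> int) \<Rightarrow> (nat \<Rightarrow> nat) \<Rightarrow> nat" where
  "fixpos m b w \<zeta> = Suc (card {j \<in> {1..m}. low b w \<zeta> j})"

lemma finite_cpairs: "finite (cpairs n K)"
  by (rule finite_subset[OF _ finite_cartesian_product[OF finite_B_group finite_seqs]]) (auto simp: cpairs_def)

lemma compat_mono: "compat n w \<zeta> \<Longrightarrow> 1 \<le> j \<Longrightarrow> j \<le> j' \<Longrightarrow> j' \<le> n \<Longrightarrow> \<zeta> j \<le> \<zeta> j'"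
  using compat_less[of n w \<zeta> j j'] by (cases "j = j'") auto

text \<open>In a block of equal odd labels the values are positive and strictly increasing, so w(t)
  - t increases weakly. A block therefore runs through values below, on and above the diagonal, in
  this order.\<close>

lemma compat_block:
  assumes c: "compat n w \<zeta>" and "1 \<le> t" "t \<le> t'" "t' \<le> n" "\<zeta> t = \<zeta> t'" "odd (\<zeta> t)"
  shows "w (int t) + (int t' - int t) \<le> w (int t')"
  using assms(3-5)
proof (induction t' rule: dec_induct)
  case (step s)
  have "\<zeta> t \<le> \<zeta> s" "\<zeta> s \<le> \<zeta> (Suc s)"
    using compat_mono[OF c, of t s] compat_mono[OF c, of s "Suc s"] step assms(2) by auto
  then have e: "\<zeta> s = \<zeta> t" using step by simp
  have "\<bar>w (int s)\<bar> < \<bar>w (int (Suc s))\<bar>"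
    using compat_less[OF c, of s "Suc s"] step assms(2) e by auto
  moreover have "0 < w (int s)" "0 < w (int (Suc s))"
    using c step assms(2,6) e by (auto simp: compat_def simp del: of_nat_Suc)
  ultimately show ?case
    using step e by auto
qed simp

lemma upn_cases:
  assumes "j \<in> {1..Suc m}" "q \<in> {1..Suc m}"
  obtains "j = q" | i where "i \<in> {1..m}" "j = upn q i"
proof (cases "j = q")
  case False
  then consider "j < q" | "q < j" by linarith
  then show ?thesis
  proof cases
    case 1
    then show ?thesis using assms that(2)[of j] by (simp add: upn_def)
  next
    case 2
    then have "j - 1 \<in> {1..m}" "j = upn q (j - 1)"
      using assms by (auto simp: upn_def)
    then show ?thesis by (rule that(2))
  qed
qed (use that in blast)

lemma upn_mem: "i \<in> {1..m} \<Longrightarrow> upn q i \<in> {1..Suc m}"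
  by (auto simp: upn_def)

lemma upn_mono: "i < i' \<Longrightarrow> upn q i < upn q i'"
  by (auto simp: upn_def)

lemma ins_seq_upn: "i \<in> {1..m} \<Longrightarrow> ins_seq m q b \<zeta> (upn q i) = \<zeta> i"
  by (auto simp: ins_seq_def upn_def)

lemma ins_seq_pos: "q \<in> {1..Suc m} \<Longrightarrow> ins_seq m q b \<zeta> q = b"
  by (auto simp: ins_seq_def)

lemma ins_seq_seqs: "\<zeta> \<in> seqs m K \<Longrightarrow> b < K \<Longrightarrow> q \<in> {1..Suc m} \<Longrightarrow> ins_seq m q b \<zeta> \<in> seqs (Suc m) K"
proof -
  assume a: "\<zeta> \<in> seqs m K" "b < K" and q: "q \<in> {1..Suc m}"
  have "ins_seq m q b \<zeta> j < K" if "j \<in> {1..Suc m}" for j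
    using that q
  proof (cases rule: upn_cases)
    case (2 i)
    then show ?thesis
      using a(1) by (auto simp: ins_seq_upn seqs_def PiE_def Pi_def)
  qed (simp add: ins_seq_pos[OF q] a(2))
  then show ?thesis
    by (simp add: seqs_def PiE_iff) (simp add: ins_seq_def)
qed

lemma del_seq_seqs: "\<zeta> \<in> seqs (Suc m) K \<Longrightarrow> del_seq m q \<zeta> \<in> seqs m K"
proof -
  assume a: "\<zeta> \<in> seqs (Suc m) K"
  have "del_seq m q \<zeta> j < K" if "j \<in> {1..m}" for j
    using PiE_mem[OF a[unfolded seqs_def] upn_mem[OF that]] that by (simp add: del_seq_def)
  then show ?thesis
    by (simp add: seqs_def PiE_iff) (simp add: del_seq_def)
qed

lemma ins_del_seq:
  assumes "\<zeta> \<in> seqs (Suc m) K" "q \<in> {1..Suc m}"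
  shows "ins_seq m q (\<zeta> q) (del_seq m q \<zeta>) = \<zeta>"
proof
  fix j show "ins_seq m q (\<zeta> q) (del_seq m q \<zeta>) j = \<zeta> j"
  proof (cases "j \<in> {1..Suc m}")
    case True
    then show ?thesis
      using assms(2)
    proof (cases rule: upn_cases)
      case (2 i)
      then show ?thesis by (simp add: ins_seq_upn del_seq_def)
    qed (simp add: ins_seq_pos[OF assms(2)])
  next
    case False
    then have "\<zeta> j = undefined"
      using assms(1) by (auto simp: seqs_def PiE_def extensional_def)
    then show ?thesis
      using False unfolding ins_seq_def restrict_def by (simp only: if_False)
  qed
qed

lemma del_ins_seq:
  assumes "\<zeta> \<in> seqs m K"
  shows "del_seq m q (ins_seq m q b \<zeta>) = \<zeta>"
proof
  fix j show "del_seq m q (ins_seq m q b \<zeta>) j = \<zeta> j"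
  proof (cases "j \<in> {1..m}")
    case True
    then show ?thesis
      by (simp add: del_seq_def ins_seq_upn)
  next
    case False
    then have "\<zeta> j = undefined"
      using assms by (auto simp: seqs_def PiE_def extensional_def)
    then show ?thesis
      using False unfolding del_seq_def restrict_def by (simp only: if_False)
  qed
qed

text \<open>Labels increase weakly, and within a block the values below the diagonal come first; so
  the low positions form an initial segment.\<close>

lemma fixpos_iff:
  assumes c: "compat m w \<zeta>" and b: "odd b"
  shows "fixpos m b w \<zeta> \<in> {1..Suc m}" "j \<in> {1..m} \<Longrightarrow> low b w \<zeta> j \<longleftrightarrow> j < fixpos m b w \<zeta>"
proof -
  define A where "A = {j \<in> {1..m}. low b w \<zeta> j}"
  have down: "low b w \<zeta> i" if "1 \<le> i" "i \<le> j" "j \<le> m" "low b w \<zeta> j" for i j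
  proof (cases "\<zeta> i < b")
    case False
    have "\<zeta> i \<le> \<zeta> j"
      using compat_mono[OF c] that by blast
    then have "\<zeta> i = b" "\<zeta> j = b" "w (int j) < int j"
      using that(4) False by (auto simp: low_def)
    then show ?thesis
      using compat_block[OF c that(1,2,3)] b by (auto simp: low_def)
  qed (simp add: low_def)
  have fin: "finite A" by (simp add: A_def)
  have "insert 0 A = {..<card (insert 0 A)}"
  proof (rule downset_eq_lessThan)
    show "i \<in> insert 0 A" if "i \<le> j" "j \<in> insert 0 A" for i j
      using that down[of i j] by (cases "i = 0") (auto simp: A_def)
  qed (simp add: fin)
  moreover have "card (insert 0 A) = Suc (card A)"
    using fin by (subst card_insert_disjoint) (auto simp: A_def)
  ultimately have eq: "insert 0 A = {..<Suc (card A)}" by simp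
  show "low b w \<zeta> j \<longleftrightarrow> j < fixpos m b w \<zeta>" if "j \<in> {1..m}"
  proof -
    have "j \<in> insert 0 A \<longleftrightarrow> j < Suc (card A)"
      unfolding eq by simp
    then show ?thesis
      using that by (auto simp: fixpos_def A_def)
  qed
  have "card A \<le> card {1..m}"
    by (intro card_mono) (auto simp: A_def)
  then show "fixpos m b w \<zeta> \<in> {1..Suc m}"
    by (simp add: fixpos_def A_def)
qed

text \<open>In the block of b, the values before the new point lie below it, and those after it are
  lifted above it by \<open>up\<close>, so compatibility survives. The new point is the first fixed
  point labelled b, since low positions with label b are off the diagonal.\<close>

lemma insert_fixed_point:
  assumes x: "(w, \<zeta>) \<in> cpairs m K" and b: "odd b" "b < K" and q: "q = fixpos m b w \<zeta>"
  shows "(ins_perm q w, ins_seq m q b \<zeta>) \<in> cpairs (Suc m) K"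
    and "j \<in> {1..<q} \<Longrightarrow> \<not> (ins_perm q w (int j) = int j \<and> ins_seq m q b \<zeta> j = b)"
    and "nofix m T w \<zeta> \<Longrightarrow> b \<notin> T \<Longrightarrow> nofix (Suc m) T (ins_perm q w) (ins_seq m q b \<zeta>)"
proof -
  have w: "w \<in> B_group m" and z: "\<zeta> \<in> seqs m K" and c: "compat m w \<zeta>"
    using x by (auto simp: cpairs_def)
  have q1: "q \<in> {1..Suc m}" and low: "\<And>j. j \<in> {1..m} \<Longrightarrow> low b w \<zeta> j \<longleftrightarrow> j < q"
    using fixpos_iff[OF c b(1)] by (auto simp: q)
  then have q0: "0 < q" by simp
  let ?w = "ins_perm q w" and ?z = "ins_seq m q b \<zeta>"
  have wq: "?w (int q) = int q" by (simp add: ins_perm_def)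
  have pos: "0 < w (int i) \<longleftrightarrow> odd (\<zeta> i)" if "i \<in> {1..m}" for i
    using c that by (auto simp: compat_def)
  have "compat (Suc m) ?w ?z"
    unfolding compat_def
  proof (intro conjI ballI)
    fix j assume "j \<in> {1..Suc m}"
    from this q1 show "0 < ?w (int j) \<longleftrightarrow> odd (?z j)"
    proof (cases rule: upn_cases)
      case 1
      then show ?thesis
        using wq ins_seq_pos[OF q1] b(1) q0 by simp
    next
      case (2 i)
      then show ?thesis
        using pos by (simp add: ins_seq_upn ins_perm_upn[OF q0] up_pos)
    qed
  next
    fix j assume j: "j \<in> {1..<Suc m}"
    have adj: "\<zeta> i < \<zeta> i' \<or> (\<zeta> i = \<zeta> i' \<and> \<bar>?w (int (upn q i))\<bar> < \<bar>?w (int (upn q i'))\<bar>)"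
      if "1 \<le> i" "i < i'" "i' \<le> m" for i i'
      using compat_less[OF c that] by (simp add: ins_perm_upn[OF q0] abs_up_less[OF q0])
    have "?z j < ?z (Suc j) \<or> (?z j = ?z (Suc j) \<and> \<bar>?w (int j)\<bar> < \<bar>?w (int (Suc j))\<bar>)"
    proof -
      consider "Suc j < q" | "Suc j = q" | "j = q" | "q < j" by linarith
      then show ?thesis
      proof cases
        case 1
        then have u: "upn q j = j" "upn q (Suc j) = Suc j" "j \<in> {1..m}" "Suc j \<in> {1..m}"
          using j q1 by (auto simp: upn_def)
        then show ?thesis
          using adj[of j "Suc j"] ins_seq_upn[OF u(3), of q b \<zeta>] ins_seq_upn[OF u(4), of q b \<zeta>] by simp
      next
        case 2
        then have u: "upn q j = j" "j \<in> {1..m}"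
          using j by (auto simp: upn_def)
        then have zj: "?z j = \<zeta> j" "?w (int j) = up q (w (int j))"
          using ins_seq_upn[OF u(2), of q b \<zeta>] ins_perm_upn[OF q0, of w j] by simp_all
        have "low b w \<zeta> j"
          using low[OF u(2)] 2 by simp
        then consider "\<zeta> j < b" | "\<zeta> j = b" "w (int j) < int j"
          by (auto simp: low_def)
        then show ?thesis
        proof cases
          case 1
          then show ?thesis
            using zj ins_seq_pos[OF q1] 2 by simp
        next
          case b2: 2
          then have "0 < w (int j)"
            using pos[OF u(2)] b(1) by simp
          then have "up q (w (int j)) = w (int j)" "\<bar>w (int j)\<bar> < int q"
            using b2(2) 2 by (auto simp: up_def)
          then show ?thesis
            using zj b2 ins_seq_pos[OF q1] wq 2 by (simp del: of_nat_Suc)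
        qed
      next
        case 3
        then have u: "upn q q = Suc q" "q \<in> {1..m}"
          using j by (auto simp: upn_def)
        then have zj: "?z (Suc q) = \<zeta> q" "?w (int (Suc q)) = up q (w (int q))"
          using ins_seq_upn[OF u(2), of q b \<zeta>] ins_perm_upn[OF q0, of w q] by simp_all
        have "\<not> low b w \<zeta> q"
          using low[OF u(2)] by simp
        then consider "b < \<zeta> q" | "\<zeta> q = b" "int q \<le> w (int q)"
          by (force simp: low_def)
        then show ?thesis
        proof cases
          case 1
          then show ?thesis
            using zj ins_seq_pos[OF q1] 3 by simp
        next
          case 2
          then have "int q < \<bar>up q (w (int q))\<bar>"
            using q0 by (auto simp: up_def)
          then show ?thesis
            using zj 2 ins_seq_pos[OF q1] wq 3 by (simp del: of_nat_Suc)
        qed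
      next
        case 4
        then have u: "upn q (j - 1) = j" "upn q j = Suc j" "j - 1 \<in> {1..m}" "j \<in> {1..m}"
          using j q1 by (auto simp: upn_def)
        then show ?thesis
          using adj[of "j - 1" j] ins_seq_upn[OF u(3), of q b \<zeta>] ins_seq_upn[OF u(4), of q b \<zeta>] by simp
      qed
    qed
    then show "?z j \<le> ?z (Suc j)" "?z j = ?z (Suc j) \<longrightarrow> \<bar>?w (int j)\<bar> < \<bar>?w (int (Suc j))\<bar>"
      by auto
  qed
  then show "(?w, ?z) \<in> cpairs (Suc m) K"
    using ins_perm_B_group[OF w q1] ins_seq_seqs[OF z b(2) q1] by (simp add: cpairs_def)
  show "\<not> (?w (int j) = int j \<and> ?z j = b)" if j: "j \<in> {1..<q}"
  proof -
    have u: "upn q j = j" "j \<in> {1..m}"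
      using j q1 by (auto simp: upn_def)
    then have zj: "?z j = \<zeta> j" "?w (int j) = up q (w (int j))"
      using ins_seq_upn[OF u(2), of q b \<zeta>] ins_perm_upn[OF q0, of w j] by simp_all
    have "low b w \<zeta> j"
      using low[OF u(2)] j by simp
    moreover have "up q (w (int j)) = int j \<longleftrightarrow> w (int j) = int j"
      using up_inj[OF q0, of "w (int j)" "int j"] up_int[OF q0, of j] u(1) by simp
    ultimately show ?thesis
      using zj by (auto simp: low_def)
  qed
  show "nofix (Suc m) T ?w ?z" if nf: "nofix m T w \<zeta>" "b \<notin> T"
    unfolding nofix_def
  proof (intro ballI impI)
    fix j assume "j \<in> {1..Suc m}" and fx: "?w (int j) = int j"
    from this(1) q1 show "?z j \<notin> T"
    proof (cases rule: upn_cases)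
      case 1
      then show ?thesis
        using ins_seq_pos[OF q1] nf(2) by simp
    next
      case (2 i)
      then have "up q (w (int i)) = up q (int i)"
        using fx by (simp add: ins_perm_upn[OF q0] up_int[OF q0])
      then have "w (int i) = int i"
        by (simp add: up_inj[OF q0])
      then show ?thesis
        using 2 nf(1) by (auto simp: ins_seq_upn nofix_def)
    qed
  qed
qed

text \<open>The converse. The position q is recovered as \<open>fixpos\<close>: in the block of b
  the points before q are not fixed, hence strictly below the diagonal, while those after q are on
  or above it and remain so when renumbered.\<close>

lemma delete_fixed_point:
  assumes x: "(w, \<zeta>) \<in> cpairs (Suc m) K" and q: "q \<in> {1..Suc m}" "w (int q) = int q" "\<zeta> q = b"
    and first: "\<And>j. j \<in> {1..<q} \<Longrightarrow> \<not> (w (int j) = int j \<and> \<zeta> j = b)"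
  shows "(del_perm q w, del_seq m q \<zeta>) \<in> cpairs m K"
    and "fixpos m b (del_perm q w) (del_seq m q \<zeta>) = q"
    and "nofix (Suc m) T w \<zeta> \<Longrightarrow> nofix m T (del_perm q w) (del_seq m q \<zeta>)"
proof -
  have w: "w \<in> B_group (Suc m)" and z: "\<zeta> \<in> seqs (Suc m) K" and c: "compat (Suc m) w \<zeta>"
    using x by (auto simp: cpairs_def)
  have q0: "0 < q" using q by simp
  have b: "odd b" using c q by (auto simp: compat_def)
  let ?w = "del_perm q w" and ?z = "del_seq m q \<zeta>"
  have wi: "?w (int i) = dn q (w (int (upn q i)))" for i
    by (simp add: del_perm_def up_int[OF q0])
  have neq: "\<bar>w (int (upn q i))\<bar> \<noteq> int q" for i
    using del_perm_inverse(2)[OF w q0 q(2), of "int i"] by (simp add: up_int[OF q0])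
  have zi: "?z i = \<zeta> (upn q i)" if "i \<in> {1..m}" for i
    using that by (simp add: del_seq_def)
  have "compat m ?w ?z"
    unfolding compat_def
  proof (intro conjI ballI)
    fix j assume j: "j \<in> {1..m}"
    show "0 < ?w (int j) \<longleftrightarrow> odd (?z j)"
      using c upn_mem[OF j, of q] by (simp add: wi zi[OF j] dn_pos[OF q0 neq] compat_def)
  next
    fix j assume j: "j \<in> {1..<m}"
    then have jj: "j \<in> {1..m}" "Suc j \<in> {1..m}" by auto
    have "\<zeta> (upn q j) < \<zeta> (upn q (Suc j)) \<or> (\<zeta> (upn q j) = \<zeta> (upn q (Suc j)) \<and>
        \<bar>w (int (upn q j))\<bar> < \<bar>w (int (upn q (Suc j)))\<bar>)"
      using upn_mem[OF jj(1), of q] upn_mem[OF jj(2), of q] upn_mono[of j "Suc j" q]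
      by (intro compat_less[OF c]) auto
    then show "?z j \<le> ?z (Suc j)" "?z j = ?z (Suc j) \<longrightarrow> \<bar>?w (int j)\<bar> < \<bar>?w (int (Suc j))\<bar>"
      unfolding wi zi[OF jj(1)] zi[OF jj(2)] abs_dn_less[OF q0 neq neq] by auto
  qed
  then show mem: "(?w, ?z) \<in> cpairs m K"
    using del_perm_B_group[OF w q(1,2)] del_seq_seqs[OF z] by (simp add: cpairs_def)
  have fixp: "?w (int i) = int i \<longleftrightarrow> w (int (upn q i)) = int (upn q i)" for i
    using up_dn[OF q0 neq, of i] dn_up[OF q0, of "int i"] by (metis wi up_int[OF q0])
  have lowq: "low b ?w ?z i \<longleftrightarrow> i < q" if i: "i \<in> {1..m}" for i
  proof (cases "i < q")
    case True
    then have u: "upn q i = i" by (simp add: upn_def)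
    have "low b ?w ?z i"
    proof (cases "\<zeta> i < b")
      case False
      have "\<zeta> i \<le> b"
        using compat_mono[OF c, of i q] True i q by auto
      then have zb: "\<zeta> i = b" using False by simp
      have "w (int i) + (int q - int i) \<le> int q"
        using compat_block[OF c, of i q] True i q zb b by auto
      moreover have "w (int i) \<noteq> int i"
        using first[of i] True i zb by auto
      ultimately have lt: "w (int i) < int i" by simp
      moreover have "0 < w (int i)"
        using c i zb b by (auto simp: compat_def)
      ultimately have "dn q (w (int i)) = w (int i)"
        using True by (simp add: dn_def)
      then show ?thesis
        using lt zb by (simp add: low_def zi[OF i] wi u)
    qed (simp add: low_def zi[OF i] u)
    then show ?thesis using True by simp
  next
    case False
    then have u: "upn q i = Suc i" by (simp add: upn_def)
    have "\<not> low b ?w ?z i"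
    proof (cases "b < \<zeta> (Suc i)")
      case False
      have "b \<le> \<zeta> (Suc i)"
        using compat_mono[OF c, of q "Suc i"] \<open>\<not> i < q\<close> i q by auto
      then have zb: "\<zeta> (Suc i) = b" using False by simp
      have "int q + (int (Suc i) - int q) \<le> w (int (Suc i))"
        using compat_block[OF c, of q "Suc i"] \<open>\<not> i < q\<close> i q zb b by (auto simp del: of_nat_Suc)
      then have "int (Suc i) \<le> w (int (Suc i))" by simp
      then have "int i \<le> dn q (w (int (Suc i)))"
        using \<open>\<not> i < q\<close> by (auto simp: dn_def sgn_if)
      then show ?thesis
        using zb by (simp add: low_def zi[OF i] wi u del: of_nat_Suc)
    qed (simp add: low_def zi[OF i] u)
    then show ?thesis using False by simp
  qed
  have "{j \<in> {1..m}. low b ?w ?z j} = {1..<q}"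
    using lowq q(1) by auto
  then show "fixpos m b ?w ?z = q"
    using q0 by (simp add: fixpos_def)
  show "nofix m T ?w ?z" if "nofix (Suc m) T w \<zeta>"
    unfolding nofix_def
  proof (intro ballI impI)
    fix i assume i: "i \<in> {1..m}" "?w (int i) = int i"
    then have "w (int (upn q i)) = int (upn q i)"
      using fixp by blast
    then show "?z i \<notin> T"
      using that upn_mem[OF i(1), of q] unfolding nofix_def zi[OF i(1)] by blast
  qed
qed

section \<open>Generating functions with forbidden labels at fixed points\<close>

definition nofix_sum :: "nat \<Rightarrow> nat \<Rightarrow> (nat \<Rightarrow> 'a :: comm_ring_1) \<Rightarrow> nat set \<Rightarrow> 'a" where
  "nofix_sum n K z T = (\<Sum>(w, \<zeta>)\<in>{(w, \<zeta>) \<in> cpairs n K. nofix n T w \<zeta>}. \<Prod>j\<in>{1..n}. z (\<zeta> j))"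

text \<open>The pairs having a fixed point labelled b correspond, by deleting the first such point,
  to all pairs of size m allowed for T, including those that still have fixed points labelled b.
  This is why \<open>T\<close> and not \<open>insert b T\<close> appears in the last term.\<close>

lemma nofix_sum_rec:
  assumes b: "odd b" "b < K" "b \<notin> T"
  shows "nofix_sum (Suc m) K z T = nofix_sum (Suc m) K z (insert b T) + z b * nofix_sum m K z T"
proof -
  define A where "A = {(w, \<zeta>) \<in> cpairs (Suc m) K. nofix (Suc m) T w \<zeta>}"
  define A1 where "A1 = {(w, \<zeta>) \<in> cpairs (Suc m) K. nofix (Suc m) (insert b T) w \<zeta>}"
  define A2 where "A2 = {(w, \<zeta>) \<in> A. \<exists>j\<in>{1..Suc m}. w (int j) = int j \<and> \<zeta> j = b}"
  have AA: "A = A1 \<union> A2" "A1 \<inter> A2 = {}"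
    by (auto simp: A_def A1_def A2_def nofix_def)
  have fin: "finite A1" "finite A2"
    by (auto intro!: finite_subset[OF _ finite_cpairs[of "Suc m" K]] simp: A1_def A2_def A_def)
  define fp where "fp w \<zeta> = (LEAST j. 1 \<le> j \<and> w (int j) = int j \<and> \<zeta> j = b)" for w :: "int \<Rightarrow> int" and \<zeta> :: "nat \<Rightarrow> nat"
  have "(\<Sum>(w, \<zeta>)\<in>A2. \<Prod>j\<in>{1..Suc m}. z (\<zeta> j)) =
      (\<Sum>(w, \<zeta>)\<in>{(w, \<zeta>) \<in> cpairs m K. nofix m T w \<zeta>}. z b * (\<Prod>j\<in>{1..m}. z (\<zeta> j)))"
  proof (rule sum.reindex_bij_witness[where
        i = "\<lambda>(w, \<zeta>). (ins_perm (fixpos m b w \<zeta>) w, ins_seq m (fixpos m b w \<zeta>) b \<zeta>)" and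
        j = "\<lambda>(w, \<zeta>). (del_perm (fp w \<zeta>) w, del_seq m (fp w \<zeta>) \<zeta>)"])
    fix x assume "x \<in> A2"
    then obtain w \<zeta> j where x: "x = (w, \<zeta>)" "(w, \<zeta>) \<in> cpairs (Suc m) K" "nofix (Suc m) T w \<zeta>"
        "j \<in> {1..Suc m}" "w (int j) = int j" "\<zeta> j = b"
      by (auto simp: A2_def A_def)
    define q where "q = fp w \<zeta>"
    have q: "1 \<le> q" "w (int q) = int q" "\<zeta> q = b" "q \<le> j"
      using LeastI[of "\<lambda>j. 1 \<le> j \<and> w (int j) = int j \<and> \<zeta> j = b" j]
        Least_le[of "\<lambda>j. 1 \<le> j \<and> w (int j) = int j \<and> \<zeta> j = b" j] x(4-6)
      by (auto simp: q_def fp_def)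
    have first: "\<not> (w (int i) = int i \<and> \<zeta> i = b)" if "i \<in> {1..<q}" for i
      using not_less_Least[of i "\<lambda>j. 1 \<le> j \<and> w (int j) = int j \<and> \<zeta> j = b"] that
      by (auto simp: q_def fp_def)
    have qm: "q \<in> {1..Suc m}" using q x(4) by auto
    have del1: "(del_perm q w, del_seq m q \<zeta>) \<in> cpairs m K"
      by (rule delete_fixed_point(1)[OF x(2) qm q(2,3)]) (rule first)
    have del2: "fixpos m b (del_perm q w) (del_seq m q \<zeta>) = q"
      by (rule delete_fixed_point(2)[OF x(2) qm q(2,3)]) (rule first)
    have del3: "nofix m T (del_perm q w) (del_seq m q \<zeta>)"
      by (rule delete_fixed_point(3)[OF x(2) qm q(2,3)]) (rule first x(3), assumption?)+
    have w: "w \<in> B_group (Suc m)" and zs: "\<zeta> \<in> seqs (Suc m) K"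
      using x(2) by (auto simp: cpairs_def)
    show "(case (case x of (w, \<zeta>) \<Rightarrow> (del_perm (fp w \<zeta>) w, del_seq m (fp w \<zeta>) \<zeta>)) of (w, \<zeta>) \<Rightarrow>
        (ins_perm (fixpos m b w \<zeta>) w, ins_seq m (fixpos m b w \<zeta>) b \<zeta>)) = x"
      using del2 ins_del_perm[OF w _ q(2)] ins_del_seq[OF zs qm] q
      by (simp add: x(1) q_def[symmetric])
    show "(case x of (w, \<zeta>) \<Rightarrow> (del_perm (fp w \<zeta>) w, del_seq m (fp w \<zeta>) \<zeta>)) \<in> {(w, \<zeta>) \<in> cpairs m K. nofix m T w \<zeta>}"
      using del1 del3 by (simp add: x(1) q_def[symmetric])
    have "(\<Prod>j\<in>{1..Suc m}. z (\<zeta> j)) = z (\<zeta> q) * (\<Prod>j\<in>{1..Suc m} - {q}. z (\<zeta> j))"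
      by (rule prod.remove) (use qm in auto)
    also have "(\<Prod>j\<in>{1..Suc m} - {q}. z (\<zeta> j)) = (\<Prod>j\<in>{1..m}. z (del_seq m q \<zeta> j))"
      by (rule prod.reindex_bij_witness[where i = "upn q" and j = "\<lambda>j. if j < q then j else j - 1"])
        (use qm in \<open>auto simp: upn_def del_seq_def split: if_splits\<close>)
    finally show "(case (case x of (w, \<zeta>) \<Rightarrow> (del_perm (fp w \<zeta>) w, del_seq m (fp w \<zeta>) \<zeta>)) of (w, \<zeta>) \<Rightarrow>
        z b * (\<Prod>j\<in>{1..m}. z (\<zeta> j))) = (case x of (w, \<zeta>) \<Rightarrow> \<Prod>j\<in>{1..Suc m}. z (\<zeta> j))"
      using q by (simp add: x(1) q_def[symmetric])
  next
    fix x assume "x \<in> {(w, \<zeta>) \<in> cpairs m K. nofix m T w \<zeta>}"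
    then obtain w \<zeta> where x: "x = (w, \<zeta>)" "(w, \<zeta>) \<in> cpairs m K" "nofix m T w \<zeta>"
      by auto
    define q where "q = fixpos m b w \<zeta>"
    note ins = insert_fixed_point[OF x(2) b(1,2) q_def]
    have zs: "\<zeta> \<in> seqs m K" and c: "compat m w \<zeta>" using x(2) by (auto simp: cpairs_def)
    have qm: "q \<in> {1..Suc m}" using fixpos_iff(1)[OF c b(1)] by (simp add: q_def)
    have fixq: "ins_perm q w (int q) = int q" "ins_seq m q b \<zeta> q = b"
      using ins_seq_pos[OF qm] by (auto simp: ins_perm_def)
    have "fp (ins_perm q w) (ins_seq m q b \<zeta>) = q"
      unfolding fp_def
    proof (rule Least_equality)
      show "1 \<le> q \<and> ins_perm q w (int q) = int q \<and> ins_seq m q b \<zeta> q = b"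
        using qm fixq by auto
      show "q \<le> y" if "1 \<le> y \<and> ins_perm q w (int y) = int y \<and> ins_seq m q b \<zeta> y = b" for y
        using ins(2)[of y] that by (meson atLeastLessThan_iff not_le_imp_less)
    qed
    then show "(case (case x of (w, \<zeta>) \<Rightarrow> (ins_perm (fixpos m b w \<zeta>) w, ins_seq m (fixpos m b w \<zeta>) b \<zeta>)) of
        (w, \<zeta>) \<Rightarrow> (del_perm (fp w \<zeta>) w, del_seq m (fp w \<zeta>) \<zeta>)) = x"
      using qm by (simp add: x(1) q_def[symmetric] del_ins_perm del_ins_seq[OF zs])
    show "(case x of (w, \<zeta>) \<Rightarrow> (ins_perm (fixpos m b w \<zeta>) w, ins_seq m (fixpos m b w \<zeta>) b \<zeta>)) \<in> A2"
      using ins(1) ins(3)[OF x(3) b(3)] qm fixq by (auto simp: x(1) q_def[symmetric] A2_def A_def)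
  qed
  then have "(\<Sum>(w, \<zeta>)\<in>A2. \<Prod>j\<in>{1..Suc m}. z (\<zeta> j)) = z b * nofix_sum m K z T"
    by (simp add: nofix_sum_def case_prod_beta sum_distrib_left)
  moreover have "nofix_sum (Suc m) K z T = (\<Sum>(w, \<zeta>)\<in>A1. \<Prod>j\<in>{1..Suc m}. z (\<zeta> j)) + (\<Sum>(w, \<zeta>)\<in>A2. \<Prod>j\<in>{1..Suc m}. z (\<zeta> j))"
    unfolding nofix_sum_def A_def[symmetric] AA(1) by (rule sum.union_disjoint[OF fin AA(2)])
  ultimately show ?thesis
    by (simp add: nofix_sum_def A1_def)
qed

text \<open>By the recursion, forbidding b multiplies the generating function over all n by
  \<open>1 - z b\<close>; the subsets S arise from expanding the product of these factors. The guard
  excludes the S for which \<open>n - card S\<close> would be a truncated difference.\<close>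

lemma nofix_sum_eq:
  assumes "finite T" "\<And>b. b \<in> T \<Longrightarrow> odd b \<and> b < K"
  shows "nofix_sum n K z T =
    (\<Sum>S\<in>Pow T. if card S \<le> n then (-1) ^ card S * ((\<Prod>b\<in>S. z b) * (\<Sum>c<K. z c) ^ (n - card S)) else 0)"
  using assms
proof (induction T arbitrary: n rule: finite_induct)
  case empty
  have e: "{(w, \<zeta>) \<in> cpairs n K. nofix n {} w \<zeta>} = Sigma (B_group n) (\<lambda>w. {\<zeta> \<in> seqs n K. compat n w \<zeta>})"
    by (auto simp: cpairs_def nofix_def)
  have "nofix_sum n K z {} = (\<Sum>w\<in>B_group n. compat_sum n K z w)"
    unfolding nofix_sum_def e compat_sum_def
    by (rule sum.Sigma[symmetric]) (auto simp: finite_B_group finite_seqs)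
  then show ?case by (simp add: sum_B_group)
next
  case (insert b T)
  define g where "g m S = (if card S \<le> m then (-1) ^ card S * ((\<Prod>b\<in>S. z b) * (\<Sum>c<K. z c) ^ (m - card S)) else 0)"
    for m and S
  have inj: "inj_on (insert b) (Pow T)"
    using insert(2) by (intro inj_onI) (metis PowD Diff_insert_absorb subsetD)
  have disj: "Pow T \<inter> insert b ` Pow T = {}"
    using insert(2) by auto
  have split: "(\<Sum>S\<in>Pow (insert b T). g n S) = (\<Sum>S\<in>Pow T. g n S) + (\<Sum>S\<in>Pow T. g n (insert b S))"
    unfolding Pow_insert using insert(1) disj sum.reindex[OF inj, of "g n"]
    by (subst sum.union_disjoint) (auto simp: o_def)
  have ins: "card (insert b S) = Suc (card S)" "(\<Prod>c\<in>insert b S. z c) = z b * (\<Prod>c\<in>S. z c)" if "S \<in> Pow T" for S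
  proof -
    have "finite S" "b \<notin> S"
      using that insert(1,2) finite_subset by auto
    then show "card (insert b S) = Suc (card S)" "(\<Prod>c\<in>insert b S. z c) = z b * (\<Prod>c\<in>S. z c)"
      by auto
  qed
  have IH: "nofix_sum m K z T = (\<Sum>S\<in>Pow T. g m S)" for m
    unfolding g_def by (rule insert.IH) (use insert.prems in auto)
  show ?case
  proof (cases n)
    case 0
    have "nofix_sum n K z (insert b T) = nofix_sum n K z T"
      by (simp add: nofix_sum_def nofix_def 0)
    moreover have "(\<Sum>S\<in>Pow T. g n (insert b S)) = 0"
      by (rule sum.neutral) (simp add: g_def ins 0)
    ultimately show ?thesis
      using IH[of n] split by (simp add: g_def)
  next
    case (Suc m)
    have "(\<Sum>S\<in>Pow T. g n (insert b S)) = (\<Sum>S\<in>Pow T. - (z b * g m S))"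
      by (rule sum.cong) (auto simp: g_def ins Suc mult_ac)
    then have "(\<Sum>S\<in>Pow T. g n (insert b S)) = - (z b * nofix_sum m K z T)"
      by (simp add: IH sum_negf sum_distrib_left)
    moreover have "nofix_sum n K z T = nofix_sum n K z (insert b T) + z b * nofix_sum m K z T"
      unfolding Suc by (rule nofix_sum_rec) (use insert in auto)
    ultimately show ?thesis
      using IH[of n] split by (simp add: g_def[symmetric] algebra_simps)
  qed
qed

lemma dec_sum_sets:
  "dec_sum k K z = (\<Sum>S | S \<subseteq> {b. odd b \<and> b < K} \<and> card S = k. \<Prod>b\<in>S. z b)"
proof -
  have dec: "v a' < v a" if "dec_prefix k v" "1 \<le> a" "a < a'" "a' \<le> k" for v a a'
  proof -
    have "Suc a \<le> a'" using that by simp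
    then show ?thesis
      using that(4)
    proof (induction a' rule: dec_induct)
      case base
      then show ?case using that by (auto simp: dec_prefix_def)
    next
      case (step c)
      then have "v (Suc c) < v c" using that by (auto simp: dec_prefix_def)
      then show ?case using step by simp
    qed
  qed
  have inj: "inj_on v {1..k}" if "dec_prefix k v" for v
    by (rule inj_onI) (metis atLeastAtMost_iff dec[OF that] linorder_neqE_nat less_irrefl)
  have fin: "finite S" if "S \<subseteq> {b. odd b \<and> b < K}" for S
    by (rule finite_subset[of _ "{..<K}"]) (use that in auto)
  define en where "en S = (\<lambda>a\<in>{1..k}. sorted_list_of_set S ! (k - a))" for S :: "nat set"
  show ?thesis
    unfolding dec_sum_def
  proof (rule sum.reindex_bij_witness[where i = en and j = "\<lambda>v. v ` {1..k}"])
    fix v assume "v \<in> {v \<in> seqs k K. dec_prefix k v}"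
    then have v: "v \<in> seqs k K" "dec_prefix k v" by auto
    have "sorted_list_of_set (v ` {1..k}) = map (\<lambda>i. v (k - i)) [0..<k]"
    proof (rule strict_sorted_equal)
      show "sorted_wrt (<) (map (\<lambda>i. v (k - i)) [0..<k])"
        using dec[OF v(2)] by (auto simp: sorted_wrt_iff_nth_less)
      have "(\<lambda>i. v (k - i)) ` {0..<k} = v ` {1..k}"
      proof (intro equalityI subsetI)
        fix x assume "x \<in> v ` {1..k}"
        then obtain a where "a \<in> {1..k}" "x = v a" by blast
        then show "x \<in> (\<lambda>i. v (k - i)) ` {0..<k}"
          by (intro image_eqI[of _ _ "k - a"]) auto
      qed auto
      then show "set (sorted_list_of_set (v ` {1..k})) = set (map (\<lambda>i. v (k - i)) [0..<k])"
        by simp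
    qed simp
    then show "en (v ` {1..k}) = v"
      using v(1) by (auto simp: en_def fun_eq_iff restrict_def seqs_def PiE_def extensional_def)
    show "v ` {1..k} \<in> {S. S \<subseteq> {b. odd b \<and> b < K} \<and> card S = k}"
      using v card_image[OF inj[OF v(2)]] by (auto simp: seqs_def dec_prefix_def)
    show "(\<Prod>b\<in>v ` {1..k}. z b) = (\<Prod>a\<in>{1..k}. z (v a))"
      using prod.reindex[OF inj[OF v(2)], of z] by simp
  next
    fix S assume S: "S \<in> {S. S \<subseteq> {b. odd b \<and> b < K} \<and> card S = k}"
    let ?l = "sorted_list_of_set S"
    have l: "length ?l = k" "set ?l = S" "sorted_wrt (<) ?l"
      using S fin by auto
    have mem: "?l ! i \<in> S" if "i < k" for i
      using l that by (metis nth_mem)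
    have "en S ` {1..k} = S"
    proof (intro equalityI subsetI)
      fix b assume "b \<in> S"
      then obtain i where "i < k" "b = ?l ! i"
        using l by (metis in_set_conv_nth)
      then show "b \<in> en S ` {1..k}"
        by (intro image_eqI[of _ _ "k - i"]) (auto simp: en_def)
    qed (use mem in \<open>auto simp: en_def\<close>)
    then show "en S ` {1..k} = S" .
    have "en S (Suc a) < en S a" if "a \<in> {1..<k}" for a
      using l(1,3) that by (auto simp: en_def sorted_wrt_iff_nth_less)
    moreover have "en S a \<in> S" if "a \<in> {1..k}" for a
      using mem that by (auto simp: en_def)
    ultimately show "en S \<in> {v \<in> seqs k K. dec_prefix k v}"
      using S by (fastforce simp: seqs_def dec_prefix_def en_def)
  qed
qed

lemma sum_D_set:
  "(\<Sum>w\<in>D_set n. compat_sum n K z w) = (\<Sum>k\<le>n. (-1) ^ k * (dec_sum k K z * (\<Sum>c<K. z c) ^ (n - k)))"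
proof -
  \<comment> \<open>At a fixed point j the value is positive, so its label is odd; forbidding all
    odd labels forbids all fixed points. A fixed barred letter comes with its fixed unbarred
    partner, so positive letters suffice.\<close>
  define T where "T = {b. odd b \<and> b < K}"
  have finT: "finite T" by (simp add: T_def)
  have D: "w \<in> D_set n \<longleftrightarrow> w \<in> B_group n \<and> (\<forall>j\<in>{1..n}. w (int j) \<noteq> int j)" for w
  proof -
    have "\<exists>j\<in>{1..n}. w (int j) = int j" if w: "w \<in> B_group n" and a: "a \<in> Omega n" "w a = a" for a
    proof -
      have "w \<bar>a\<bar> = \<bar>a\<bar>"
        using B_group_uminus[OF w, of a] a(2) by (auto simp: abs_if)
      then show ?thesis
        using a(1) by (intro bexI[of _ "nat \<bar>a\<bar>"]) (auto simp: Omega_nat_abs)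
    qed
    then show ?thesis
      unfolding D_set_def using Omega_int[of _ n] by blast
  qed
  have e: "{(w, \<zeta>) \<in> cpairs n K. nofix n T w \<zeta>} = Sigma (D_set n) (\<lambda>w. {\<zeta> \<in> seqs n K. compat n w \<zeta>})"
  proof (intro set_eqI, clarify)
    fix w \<zeta>
    have "\<zeta> j \<in> T" if "compat n w \<zeta>" "\<zeta> \<in> seqs n K" "j \<in> {1..n}" "w (int j) = int j" for j
    proof -
      have "0 < w (int j)" using that by simp
      then show ?thesis
        using that unfolding compat_def T_def seqs_def by (auto simp: PiE_def Pi_def)
    qed
    then show "(w, \<zeta>) \<in> {(w, \<zeta>) \<in> cpairs n K. nofix n T w \<zeta>} \<longleftrightarrow>
        (w, \<zeta>) \<in> Sigma (D_set n) (\<lambda>w. {\<zeta> \<in> seqs n K. compat n w \<zeta>})"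
      unfolding cpairs_def nofix_def mem_Sigma_iff D by auto
  qed
  have fD: "finite (D_set n)"
    by (rule finite_subset[OF _ finite_B_group]) (auto simp: D_set_def)
  have "(\<Sum>w\<in>D_set n. compat_sum n K z w) = nofix_sum n K z T"
    unfolding nofix_sum_def e compat_sum_def
    by (rule sum.Sigma) (auto simp: fD finite_seqs)
  also have "\<dots> = (\<Sum>S\<in>Pow T. if card S \<le> n then (-1) ^ card S * ((\<Prod>b\<in>S. z b) * (\<Sum>c<K. z c) ^ (n - card S)) else 0)"
    by (rule nofix_sum_eq[OF finT]) (simp add: T_def)
  also have "\<dots> = (\<Sum>S\<in>Pow T. \<Sum>k\<le>n. if card S = k then (-1) ^ k * ((\<Prod>b\<in>S. z b) * (\<Sum>c<K. z c) ^ (n - k)) else 0)"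
    by (rule sum.cong) (auto simp: sum.delta')
  also have "\<dots> = (\<Sum>k\<le>n. \<Sum>S\<in>Pow T. if card S = k then (-1) ^ k * ((\<Prod>b\<in>S. z b) * (\<Sum>c<K. z c) ^ (n - k)) else 0)"
    by (rule sum.swap)
  also have "\<dots> = (\<Sum>k\<le>n. (-1) ^ k * (dec_sum k K z * (\<Sum>c<K. z c) ^ (n - k)))"
  proof (rule sum.cong[OF refl])
    fix k
    have s: "{S \<in> Pow T. card S = k} = {S. S \<subseteq> {b. odd b \<and> b < K} \<and> card S = k}"
      by (auto simp: T_def)
    have "(\<Sum>S\<in>Pow T. if card S = k then (-1) ^ k * ((\<Prod>b\<in>S. z b) * (\<Sum>c<K. z c) ^ (n - k)) else 0) =
        (\<Sum>S\<in>{S \<in> Pow T. card S = k}. (-1) ^ k * ((\<Prod>b\<in>S. z b) * (\<Sum>c<K. z c) ^ (n - k)))"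
      by (rule sum.inter_filter[symmetric]) (simp add: finT)
    then show "(\<Sum>S\<in>Pow T. if card S = k then (-1) ^ k * ((\<Prod>b\<in>S. z b) * (\<Sum>c<K. z c) ^ (n - k)) else 0) =
        (-1) ^ k * (dec_sum k K z * (\<Sum>c<K. z c) ^ (n - k))"
      unfolding s dec_sum_sets by (simp add: sum_distrib_left sum_distrib_right)
  qed
  finally show ?thesis .
qed

lemma agree_alternating:
  assumes "A \<subseteq> B_group n" "(\<Sum>w\<in>A'. compat_sum n (2 * N) (\<lambda>c. mfps_var (letter c) :: series) (f w)) =
      (\<Sum>k\<le>n. (-1) ^ k * (dec_sum k (2 * N) (\<lambda>c. mfps_var (letter c)) * (\<Sum>c<2*N. mfps_var (letter c)) ^ (n - k)))"
    "f ` A' \<subseteq> A"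
  shows "agree N (\<Sum>w\<in>A'. F_sig n (sDes n (f w)))
    (\<Sum>k\<le>n. (-1) ^ k * (schur x_var (replicate k (Suc 0)) * p_plus 1 ^ (n - k)))"
proof -
  have p: "(\<Sum>c<2*N. mfps_var (letter c) :: series) = (\<Sum>i<N. x_var i ^ 1 + y_var i ^ 1)"
    by (induction N) (auto simp: letter_def add_ac)
  have d: "dec_sum k (2 * N) (\<lambda>c. mfps_var (letter c)) = schurN N x_var (replicate k (Suc 0))" for k
  proof -
    have "dec_sum k (2 * N) (\<lambda>c. mfps_var (letter c) :: series) =
        schurN N (\<lambda>i. mfps_var (letter (2 * i + 1))) (replicate k (Suc 0))"
      unfolding dec_sum_def by (rule sum_dec_prefix_schurN)
    then show ?thesis by (simp add: letter_def)
  qed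
  have "agree N (\<Sum>w\<in>A'. F_sig n (sDes n (f w))) (\<Sum>w\<in>A'. compat_sum n (2 * N) (\<lambda>c. mfps_var (letter c)) (f w))"
    unfolding compat_sum_def by (intro agree_sum agree_F_sig) (use assms in blast)
  also note assms(2)
  also have "agree N (\<Sum>k\<le>n. (-1) ^ k * (dec_sum k (2 * N) (\<lambda>c. mfps_var (letter c)) * (\<Sum>c<2*N. mfps_var (letter c)) ^ (n - k)))
      (\<Sum>k\<le>n. (-1) ^ k * (schur x_var (replicate k (Suc 0)) * p_plus 1 ^ (n - k)))"
    unfolding d p
    by (intro agree_sum agree_mult agree_power agree_refl agree_sym[OF agree_schur_x] agree_sym[OF agree_p_plus]) simp
  finally show ?thesis .
qed

lemma sum_F_sig_E_set:
  "(\<Sum>w\<in>E_set n. F_sig n (sDes n (inv w))) =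
    (\<Sum>k\<le>n. (-1) ^ k * (schur x_var (replicate k (Suc 0)) * p_plus 1 ^ (n - k)))"
  by (rule series_eqI_agree, rule agree_alternating[OF subset_refl sum_E_set])
    (auto simp: E_set_def B_group_inv)

lemma sum_F_sig_D_set:
  "(\<Sum>w\<in>D_set n. F_sig n (sDes n w)) =
    (\<Sum>k\<le>n. (-1) ^ k * (schur x_var (replicate k (Suc 0)) * p_plus 1 ^ (n - k)))"
  by (rule series_eqI_agree, rule agree_alternating[OF subset_refl sum_D_set])
    (auto simp: D_set_def)

section \<open>Signed permutations counted by signed descent set\<close>

lemma mono_seq_eqI:
  fixes f g :: "nat \<Rightarrow> nat"
  assumes "\<And>i j. 1 \<le> i \<Longrightarrow> i \<le> j \<Longrightarrow> j \<le> n \<Longrightarrow> f i \<le> f j" "\<And>i j. 1 \<le> i \<Longrightarrow> i \<le> j \<Longrightarrow> j \<le> n \<Longrightarrow> g i \<le> g j"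
    and "image_mset f (mset_set {1..n}) = image_mset g (mset_set {1..n})" "j \<in> {1..n}"
  shows "f j = g j"
proof -
  have m: "mset (map h [1..<Suc n]) = image_mset h (mset_set {1..n})" for h :: "nat \<Rightarrow> nat"
    by (metis mset_map mset_upt atLeastLessThanSuc_atLeastAtMost)
  have s: "sorted (map h [1..<Suc n])" if "\<And>i j. 1 \<le> i \<Longrightarrow> i \<le> j \<Longrightarrow> j \<le> n \<Longrightarrow> h i \<le> h j" for h :: "nat \<Rightarrow> nat"
    unfolding sorted_wrt_iff_nth_less using that by (auto simp del: upt_Suc)
  have "map f [1..<Suc n] = map g [1..<Suc n]"
  proof -
    have "sort (map g [1..<Suc n]) = map f [1..<Suc n]"
      by (rule properties_for_sort) (simp_all only: m s[OF assms(1)] assms(3))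
    moreover have "sort (map g [1..<Suc n]) = map g [1..<Suc n]"
      by (rule properties_for_sort) (simp_all only: s[OF assms(2)])
    ultimately show ?thesis by simp
  qed
  then show ?thesis
    using assms(4) by (auto simp del: upt_Suc)
qed

text \<open>With one independent variable per label, a weakly increasing labelling is determined by
  its monomial. The coefficient of this monomial in the two equal sums counts the signed
  permutations compatible with \<open>\<zeta>\<close>.\<close>

lemma card_compat_D_E:
  assumes "\<And>i j. 1 \<le> i \<Longrightarrow> i \<le> j \<Longrightarrow> j \<le> n \<Longrightarrow> \<zeta> i \<le> \<zeta> j" "\<zeta> \<in> extensional {1..n}"
  shows "card {w \<in> D_set n. compat n w \<zeta>} = card {w \<in> E_set n. compat n (inv w) \<zeta>}"
proof -
  obtain K where K: "\<zeta> \<in> seqs n K"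
  proof
    show "\<zeta> \<in> seqs n (Suc (Max (\<zeta> ` {1..n})))"
      using assms(2) by (auto simp: seqs_def PiE_def less_Suc_eq_le)
  qed
  define z where "z c = (mfps_var c :: (nat, int) mfps)" for c
  define M where "M = image_mset \<zeta> (mset_set {1..n})"
  have co: "mfps_nth (\<Sum>w\<in>A. compat_sum n K z (f w)) M = int (card {w \<in> A. compat n (f w) \<zeta>})"
    if "finite A" for A and f :: "(int \<Rightarrow> int) \<Rightarrow> int \<Rightarrow> int"
  proof -
    have "mfps_nth (compat_sum n K z u) M = (if compat n u \<zeta> then 1 else 0)" for u
    proof -
      have "mfps_nth (compat_sum n K z u) M = (\<Sum>\<xi>\<in>{\<xi> \<in> seqs n K. compat n u \<xi>}. if \<xi> = \<zeta> then 1 else 0)"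
        unfolding compat_sum_def nth_sum
      proof (rule sum.cong[OF refl])
        fix \<xi> assume x: "\<xi> \<in> {\<xi> \<in> seqs n K. compat n u \<xi>}"
        have "\<xi> = \<zeta>" if "image_mset \<xi> (mset_set {1..n}) = image_mset \<zeta> (mset_set {1..n})"
        proof (rule extensionalityI[of _ "{1..n}"])
          show "\<xi> j = \<zeta> j" if j: "j \<in> {1..n}" for j
          proof (rule mono_seq_eqI[OF _ assms(1) \<open>image_mset \<xi> _ = _\<close> j])
            show "\<xi> i \<le> \<xi> j" if "1 \<le> i" "i \<le> j" "j \<le> n" for i j
              using x that compat_mono by blast
          qed
        qed (use x assms(2) in \<open>auto simp: seqs_def PiE_def\<close>)
        then show "mfps_nth (\<Prod>j\<in>{1..n}. z (\<xi> j)) M = (if \<xi> = \<zeta> then 1 else 0)"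
          unfolding z_def by (auto simp: nth_prod_var M_def)
      qed
      then show ?thesis
        using K by (simp add: finite_seqs)
    qed
    then show ?thesis
      using that by (simp add: nth_sum sum.inter_filter[symmetric])
  qed
  have f: "finite (D_set n)" "finite (E_set n)"
    by (auto intro!: finite_subset[OF _ finite_B_group[of n]] simp: D_set_def E_set_def)
  have "mfps_nth (\<Sum>w\<in>D_set n. compat_sum n K z w) M = mfps_nth (\<Sum>w\<in>E_set n. compat_sum n K z (inv w)) M"
    by (simp only: sum_D_set sum_E_set)
  then show ?thesis
    using co[OF f(1), of "\<lambda>w. w"] co[OF f(2), of inv] by simp
qed

text \<open>The even part of the label jumps by 2 after each element of S, which outweighs any
  change of the sign bit; elsewhere the label is constant because \<open>\<eta>\<close> changes only
  after elements of S. Off S, compatibility then demands growing absolute values, that is, no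
  descent.\<close>

lemma compat_block_sequence:
  assumes w: "w \<in> B_group n" and S: "S \<subseteq> {1..n}" "n \<in> S" and \<eta>: "\<And>j. j \<in> {1..<n} \<Longrightarrow> j \<notin> S \<Longrightarrow> \<eta> j = \<eta> (Suc j)"
    and \<zeta>: "\<zeta> = (\<lambda>j\<in>{1..n}. 2 * card {s \<in> S. s < j} + (if \<eta> j then 1 else 0))"
  shows "compat n w \<zeta> \<longleftrightarrow> (\<forall>j\<in>{1..n}. 0 < w (int j) \<longleftrightarrow> \<eta> j) \<and> fst (sDes n w) \<subseteq> S"
proof -
  have fin: "finite S" using S(1) finite_subset by blast
  have sign: "(\<forall>j\<in>{1..n}. 0 < w (int j) \<longleftrightarrow> odd (\<zeta> j)) \<longleftrightarrow> (\<forall>j\<in>{1..n}. 0 < w (int j) \<longleftrightarrow> \<eta> j)"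
    by (auto simp: \<zeta>)
  have step: "\<zeta> j \<le> \<zeta> (Suc j) \<and> (\<zeta> j = \<zeta> (Suc j) \<longleftrightarrow> j \<notin> S)" if j: "j \<in> {1..<n}" for j
  proof (cases "j \<in> S")
    case True
    then have "{s \<in> S. s < Suc j} = insert j {s \<in> S. s < j}" by auto
    then have "card {s \<in> S. s < Suc j} = Suc (card {s \<in> S. s < j})"
      using fin by simp
    then show ?thesis
      using j True by (auto simp: \<zeta>)
  next
    case False
    then have "{s \<in> S. s < Suc j} = {s \<in> S. s < j}"
      by (auto simp: less_Suc_eq)
    then show ?thesis
      using j False \<eta>[OF j False] by (auto simp: \<zeta>)
  qed
  have des: "(j \<notin> S \<longrightarrow> \<bar>w (int j)\<bar> < \<bar>w (int (Suc j))\<bar>) \<longleftrightarrow> (j \<in> fst (sDes n w) \<longrightarrow> j \<in> S)"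
    if sg: "\<forall>j\<in>{1..n}. 0 < w (int j) \<longleftrightarrow> \<eta> j" and j: "j \<in> {1..<n}" for j
  proof -
    have "w (int j) \<noteq> 0" "w (int (Suc j)) \<noteq> 0" "\<bar>w (int j)\<bar> \<noteq> \<bar>w (int (Suc j))\<bar>"
      using j by (auto intro!: B_group_nonzero[OF w] simp: B_group_abs_inj[OF w] simp del: of_nat_Suc)
    moreover have "0 < w (int j) \<longleftrightarrow> 0 < w (int (Suc j))" if "j \<notin> S"
    proof -
      have "j \<in> {1..n}" "Suc j \<in> {1..n}" using j by auto
      then show ?thesis using sg \<eta>[OF j that] by blast
    qed
    ultimately show ?thesis
      using j by (cases "j \<in> S") (auto simp: fst_sDes less_r_def simp del: of_nat_Suc)
  qed
  have sub: "fst (sDes n w) \<subseteq> S \<longleftrightarrow> (\<forall>j\<in>{1..<n}. j \<in> fst (sDes n w) \<longrightarrow> j \<in> S)"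
    using S(2) by (auto simp: fst_sDes)
  show ?thesis
    unfolding compat_def sign sub using step des by blast
qed

lemma sDes_eq_iff:
  assumes w: "w \<in> B_group n" and \<sigma>: "(S, \<epsilon>) \<in> Sigma_B n"
  shows "sDes n w = (S, \<epsilon>) \<longleftrightarrow> fst (sDes n w) = S \<and>
    (\<forall>j\<in>{1..n}. 0 < w (int j) \<longleftrightarrow> sign_vector (S, \<epsilon>) j = Positive)"
proof
  assume e: "sDes n w = (S, \<epsilon>)"
  have "0 < w (int j) \<longleftrightarrow> sign_vector (S, \<epsilon>) j = Positive" if "j \<in> {1..n}" for j
    using sign_vector_sDes[OF w that] B_group_nonzero[OF w that] unfolding e by auto
  then show "fst (sDes n w) = S \<and> (\<forall>j\<in>{1..n}. 0 < w (int j) \<longleftrightarrow> sign_vector (S, \<epsilon>) j = Positive)"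
    using e by auto
next
  assume a: "fst (sDes n w) = S \<and> (\<forall>j\<in>{1..n}. 0 < w (int j) \<longleftrightarrow> sign_vector (S, \<epsilon>) j = Positive)"
  have S: "S \<subseteq> {1..n}" "\<epsilon> \<in> extensional S"
    using \<sigma> by (auto simp: Sigma_B_def)
  have "snd (sDes n w) = \<epsilon>"
  proof (rule extensionalityI[OF _ S(2)])
    show "snd (sDes n w) \<in> extensional S"
      using a by (auto simp: sDes_def Let_def)
    fix s assume s: "s \<in> S"
    have "(LEAST s'. s' \<in> S \<and> s \<le> s') = s"
      using s by (auto intro: Least_equality)
    then have "sign_vector (S, \<epsilon>) s = \<epsilon> s" by simp
    moreover have "w (int s) \<noteq> 0"
      using B_group_nonzero[OF w] s S by blast
    moreover have "0 < w (int s) \<longleftrightarrow> sign_vector (S, \<epsilon>) s = Positive"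
      using a s S(1) by blast
    ultimately show "snd (sDes n w) s = \<epsilon> s"
      using snd_sDes[of s n w] a s by (cases "\<epsilon> s") auto
  qed
  then show "sDes n w = (S, \<epsilon>)"
    using a by (metis prod.collapse)
qed

text \<open>For fixed signs, the coefficient of the monomial whose letter changes exactly at the elements of \<open>R\<close>
  counts the signed permutations with descent set contained in \<open>R\<close>, so that equality of the
  generating functions can be inverted along inclusion.\<close>

lemma card_sDes_D_E:
  assumes n: "0 < n" and \<sigma>: "\<sigma> \<in> Sigma_B n"
  shows "card {w \<in> D_set n. sDes n w = \<sigma>} = card {w \<in> E_set n. sDes n (inv w) = \<sigma>}"
proof -
  obtain S \<epsilon> where se: "\<sigma> = (S, \<epsilon>)" by (cases \<sigma>)
  define \<eta> where "\<eta> j \<longleftrightarrow> sign_vector \<sigma> j = Positive" for j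
  define P where "P R u \<longleftrightarrow> fst (sDes n u) = R \<and> (\<forall>j\<in>{1..n}. 0 < u (int j) \<longleftrightarrow> \<eta> j)" for R and u :: "int \<Rightarrow> int"
  have EB: "inv w \<in> B_group n" if "w \<in> E_set n" for w
    using that by (auto simp: E_set_def B_group_inv)
  have DB: "w \<in> B_group n" if "w \<in> D_set n" for w
    using that by (simp add: D_set_def)
  have f: "finite (D_set n)" "finite (E_set n)"
    by (auto intro!: finite_subset[OF _ finite_B_group[of n]] simp: D_set_def E_set_def)
  have main: "card {w \<in> D_set n. P R w} = card {w \<in> E_set n. P R (inv w)}" if "R \<subseteq> {1..n}" for R
    using that
  proof (induction "card R" arbitrary: R rule: less_induct)
    case less
    have finR: "finite R" using less(2) finite_subset by blast
    show ?case
    \<comment> \<open>If n is missing from R or the prescribed signs change after a position outside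
      R, no signed permutation has descent set R with these signs, and both counts vanish.\<close>
    proof (cases "n \<in> R \<and> (\<forall>j\<in>{1..<n}. j \<notin> R \<longrightarrow> \<eta> j = \<eta> (Suc j))")
      case False
      have "\<not> P R u" if u: "u \<in> B_group n" for u
      proof
        assume p: "P R u"
        have "\<eta> j = \<eta> (Suc j)" if j: "j \<in> {1..<n}" "j \<notin> R" for j
        proof -
          have "u (int j) \<noteq> 0" "u (int (Suc j)) \<noteq> 0"
            using j by (auto intro!: B_group_nonzero[OF u] simp del: of_nat_Suc)
          moreover have "j \<notin> fst (sDes n u)"
            using p j by (simp add: P_def)
          ultimately have "0 < u (int j) \<longleftrightarrow> 0 < u (int (Suc j))"
            using j by (auto simp: fst_sDes less_r_def simp del: of_nat_Suc)
          moreover have "j \<in> {1..n}" "Suc j \<in> {1..n}" using j by auto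
          ultimately show ?thesis
            using p unfolding P_def by blast
        qed
        moreover have "n \<in> R" using p by (auto simp: P_def fst_sDes)
        ultimately show False using False by blast
      qed
      then have "{w \<in> D_set n. P R w} = {}" "{w \<in> E_set n. P R (inv w)} = {}"
        using DB EB by blast+
      then show ?thesis by (simp only:)
    next
      case True
      define \<zeta> where "\<zeta> = (\<lambda>j\<in>{1..n}. 2 * card {s \<in> R. s < j} + (if \<eta> j then 1 else 0))"
      have cb: "compat n u \<zeta> \<longleftrightarrow> (\<exists>Q\<in>Pow R. P Q u)" if "u \<in> B_group n" for u
        using compat_block_sequence[OF that less(2) _ _ \<zeta>_def] True by (auto simp: P_def)
      have mono: "\<zeta> i \<le> \<zeta> j" if "1 \<le> i" "i \<le> j" "j \<le> n" for i j
      proof (cases "card {s \<in> R. s < i} = card {s \<in> R. s < j}")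
        case False
        moreover have "card {s \<in> R. s < i} \<le> card {s \<in> R. s < j}"
          using finR that by (intro card_mono) auto
        ultimately show ?thesis using that by (simp add: \<zeta>_def)
      next
        case eq: True
        have sub: "{s \<in> R. s < i} \<subseteq> {s \<in> R. s < j}" using that by auto
        have E: "{s \<in> R. s < i} = {s \<in> R. s < j}"
          by (rule card_subset_eq[OF _ sub eq]) (simp add: finR)
        have none: "s \<notin> R" if "i \<le> s" "s < j" for s
        proof
          assume "s \<in> R"
          then have "s \<in> {s \<in> R. s < i}"
            unfolding E using that by simp
          then show False using that by simp
        qed
        have "\<eta> j = \<eta> i"
          using \<open>i \<le> j\<close> \<open>j \<le> n\<close> none
        proof (induction j rule: dec_induct)
          case (step k)
          have "\<eta> k = \<eta> (Suc k)"
            using True step \<open>1 \<le> i\<close> by auto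
          then show ?case using step by auto
        qed simp
        then show ?thesis using that eq by (simp add: \<zeta>_def)
      qed
      have cnt: "card {w \<in> A. compat n (g w) \<zeta>} = (\<Sum>Q\<in>Pow R. card {w \<in> A. P Q (g w)})"
        if A: "finite A" "\<And>w. w \<in> A \<Longrightarrow> g w \<in> B_group n" for A and g :: "(int \<Rightarrow> int) \<Rightarrow> int \<Rightarrow> int"
      proof -
        have "{w \<in> A. compat n (g w) \<zeta>} = (\<Union>Q\<in>Pow R. {w \<in> A. P Q (g w)})"
          using cb A(2) by auto
        moreover have "card (\<Union>Q\<in>Pow R. {w \<in> A. P Q (g w)}) = (\<Sum>Q\<in>Pow R. card {w \<in> A. P Q (g w)})"
          by (rule card_UN_disjoint) (use finR A(1) in \<open>auto simp: P_def\<close>)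
        ultimately show ?thesis by simp
      qed
      have "(\<Sum>Q\<in>Pow R. card {w \<in> D_set n. P Q w}) = (\<Sum>Q\<in>Pow R. card {w \<in> E_set n. P Q (inv w)})"
        using card_compat_D_E[of n \<zeta>] mono cnt[OF f(1), of "\<lambda>w. w"] cnt[OF f(2), of inv] DB EB
        by (simp add: \<zeta>_def)
      moreover have "(\<Sum>Q\<in>Pow R - {R}. card {w \<in> D_set n. P Q w}) = (\<Sum>Q\<in>Pow R - {R}. card {w \<in> E_set n. P Q (inv w)})"
      proof (rule sum.cong[OF refl])
        fix Q assume Q: "Q \<in> Pow R - {R}"
        then have "card Q < card R"
          using finR by (intro psubset_card_mono) auto
        then show "card {w \<in> D_set n. P Q w} = card {w \<in> E_set n. P Q (inv w)}"
          using less Q by auto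
      qed
      moreover have "(\<Sum>Q\<in>Pow R. h Q) = h R + (\<Sum>Q\<in>Pow R - {R}. h Q)" for h :: "nat set \<Rightarrow> nat"
        using finR by (intro sum.remove) auto
      ultimately show ?thesis by simp
    qed
  qed
  have S: "S \<subseteq> {1..n}" using \<sigma> by (auto simp: se Sigma_B_def)
  have "sDes n u = \<sigma> \<longleftrightarrow> P S u" if "u \<in> B_group n" for u
    using sDes_eq_iff[OF that \<sigma>[unfolded se]] by (simp add: se P_def \<eta>_def)
  then have "{w \<in> D_set n. sDes n w = \<sigma>} = {w \<in> D_set n. P S w}"
    "{w \<in> E_set n. sDes n (inv w) = \<sigma>} = {w \<in> E_set n. P S (inv w)}"
    using DB EB by auto
  then show ?thesis
    using main[OF S] by simp
qed

section \<open>Traces\<close>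

definition basis_trace :: "('b set \<Rightarrow> 'b \<Rightarrow> 'b \<Rightarrow> 'a :: comm_monoid_add) \<Rightarrow> ('b \<Rightarrow> 'b) \<Rightarrow> 'b set \<Rightarrow> 'a" where
  "basis_trace rep T B = (\<Sum>b\<in>B. rep B (T b) b)"

context vector_space
begin

text \<open>An instance of tr(XY) = tr(YX): X expresses the elements of B in terms of C, and Y
  expresses the images \<open>T c\<close> in terms of B. One product has the trace taken over B, the
  other the trace taken over C.\<close>

lemma basis_trace_unique:
  assumes B: "independent B" "finite B" and C: "independent C" "finite C" and span: "span B = span C"
    and T: "Vector_Spaces.linear scale scale T" "\<And>x. x \<in> span B \<Longrightarrow> T x \<in> span B"
  shows "basis_trace representation T B = basis_trace representation T C"
proof -
  interpret T: Vector_Spaces.linear scale scale T by (rule T(1))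
  have rB: "(\<Sum>b\<in>B. representation B x b *s b) = x" if "x \<in> span B" for x
    using sum_representation_eq[OF B(1) that B(2) subset_refl] .
  have rC: "(\<Sum>c\<in>C. representation C x c *s c) = x" if "x \<in> span B" for x
    using sum_representation_eq[OF C(1) _ C(2) subset_refl] that span by simp
  have Bs: "b \<in> span B" if "b \<in> B" for b using that span_base by blast
  have Cs: "c \<in> span B" if "c \<in> C" for c using that span_base span by blast
  have "representation B (T b) b = (\<Sum>c\<in>C. representation C b c * representation B (T c) b)" if b: "b \<in> B" for b
  proof -
    have "T b = T (\<Sum>c\<in>C. representation C b c *s c)"
      using rC[OF Bs[OF b]] by simp
    also have "\<dots> = (\<Sum>c\<in>C. representation C b c *s T c)"
      by (simp add: T.sum T.scale)
    finally have "representation B (T b) b = representation B (\<Sum>c\<in>C. representation C b c *s T c) b"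
      by simp
    also have "\<dots> = (\<Sum>c\<in>C. representation B (representation C b c *s T c) b)"
      by (subst representation_sum[OF B(1)]) (rule span_scale, rule T(2), erule Cs, rule refl)
    also have "\<dots> = (\<Sum>c\<in>C. representation C b c * representation B (T c) b)"
      by (intro sum.cong refl) (simp add: representation_scale[OF B(1) T(2)[OF Cs]])
    finally show ?thesis .
  qed
  then have "basis_trace representation T B = (\<Sum>b\<in>B. \<Sum>c\<in>C. representation C b c * representation B (T c) b)"
    by (simp add: basis_trace_def)
  also have "\<dots> = (\<Sum>c\<in>C. \<Sum>b\<in>B. representation B (T c) b * representation C b c)"
    by (subst sum.swap) (simp add: mult.commute)
  also have "\<dots> = (\<Sum>c\<in>C. representation C (T c) c)"
  proof (rule sum.cong[OF refl])
    fix c assume c: "c \<in> C"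
    have "representation C (T c) c = representation C (\<Sum>b\<in>B. representation B (T c) b *s b) c"
      using rB[OF T(2)[OF Cs[OF c]]] by simp
    also have "\<dots> = (\<Sum>b\<in>B. representation C (representation B (T c) b *s b) c)"
      by (subst representation_sum[OF C(1)]) (unfold span[symmetric], rule span_scale, erule Bs, rule refl)
    also have "\<dots> = (\<Sum>b\<in>B. representation B (T c) b * representation C b c)"
      by (intro sum.cong refl) (simp add: representation_scale[OF C(1) Bs[unfolded span]])
    finally show "(\<Sum>b\<in>B. representation B (T c) b * representation C b c) = representation C (T c) c"
      by simp
  qed
  finally show ?thesis by (simp add: basis_trace_def)
qed

text \<open>Additivity of the trace along 0 \<rightarrow> ker D \<rightarrow> V \<rightarrow> im D
  \<rightarrow> 0. With B0 a basis of the kernel, D maps the rest of B injectively onto a basis of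
  the image; since D commutes with T, the diagonal coefficients of T at b and at \<open>D b\<close>
  coincide.\<close>

lemma basis_trace_exact:
  assumes B: "independent B" "finite B" "B0 \<subseteq> B"
    and T: "Vector_Spaces.linear scale scale T" "\<And>x. x \<in> span B \<Longrightarrow> T x \<in> span B" "\<And>x. x \<in> span B0 \<Longrightarrow> T x \<in> span B0"
    and D: "Vector_Spaces.linear scale scale D" "\<And>x. D (T x) = T (D x)"
    and ker: "span B0 = {x \<in> span B. D x = 0}"
  shows "basis_trace representation T B = basis_trace representation T B0 + basis_trace representation T (D ` (B - B0))"
    and "independent (D ` (B - B0))" and "span (D ` (B - B0)) = D ` span B"
proof -
  interpret T: Vector_Spaces.linear scale scale T by (rule T(1))
  interpret D: Vector_Spaces.linear scale scale D by (rule D(1))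
  let ?R = "B - B0"
  have finR: "finite ?R" using B by simp
  have indR: "independent ?R" using B(1) independent_mono by blast
  have ker0: "D x = 0" if "x \<in> span B0" for x using that ker by blast
  \<comment> \<open>Such an x lies in the spans of both \<open>B - B0\<close> and \<open>B0\<close>,
    so all its coordinates vanish.\<close>
  have injR: "x = 0" if x: "x \<in> span ?R" "D x = 0" for x
  proof -
    have "x \<in> span B" using x(1) span_mono[of ?R B] by blast
    then have "x \<in> span B0" using x(2) ker by blast
    then have "representation B x = representation B0 x"
      using representation_extend[OF B(1) _ B(3)] by blast
    moreover have "representation B x = representation ?R x"
      using representation_extend[OF B(1) x(1)] by blast
    moreover have "representation B0 x b = 0" if "b \<notin> B0" for b
      using representation_ne_zero that by blast
    moreover have "representation ?R x b = 0" if "b \<notin> ?R" for b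
      using representation_ne_zero that by blast
    ultimately have "representation ?R x b = 0" for b
      by (metis DiffD2)
    then show ?thesis
      using sum_representation_eq[OF indR x(1) finR subset_refl] by simp
  qed
  have inj: "inj_on D (span ?R)"
  proof (rule inj_onI)
    fix x y assume "x \<in> span ?R" "y \<in> span ?R" "D x = D y"
    then have "x - y = 0" by (intro injR[OF span_diff]) (simp_all add: D.diff)
    then show "x = y" by simp
  qed
  show ind: "independent (D ` ?R)"
    by (rule D.independent_injective_image[OF indR inj])
  have decomp: "D x = (\<Sum>b\<in>?R. representation B x b *s D b)" if "x \<in> span B" for x
  proof -
    have "D x = D (\<Sum>b\<in>B. representation B x b *s b)"
      using sum_representation_eq[OF B(1) that B(2) subset_refl] by simp
    also have "\<dots> = (\<Sum>b\<in>B. representation B x b *s D b)"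
      by (simp add: D.sum D.scale)
    also have "\<dots> = (\<Sum>b\<in>?R. representation B x b *s D b)"
      by (rule sum.mono_neutral_right) (use B(2) ker0 span_base in auto)
    finally show ?thesis .
  qed
  show sp: "span (D ` ?R) = D ` span B"
  proof
    show "span (D ` ?R) \<subseteq> D ` span B"
      using D.span_image[of ?R] span_mono[of ?R B] by auto
    show "D ` span B \<subseteq> span (D ` ?R)"
      using decomp by (auto intro!: span_sum span_scale intro: span_base)
  qed
  have injR': "inj_on D ?R" using inj inj_on_subset span_superset by blast
  have "basis_trace representation T B = (\<Sum>b\<in>B0. representation B (T b) b) + (\<Sum>b\<in>?R. representation B (T b) b)"
    using sum.subset_diff[OF B(3,2), of "\<lambda>b. representation B (T b) b"] by (simp add: basis_trace_def add.commute)
  also have "(\<Sum>b\<in>B0. representation B (T b) b) = basis_trace representation T B0"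
    unfolding basis_trace_def
  proof (rule sum.cong[OF refl])
    fix b assume b: "b \<in> B0"
    show "representation B (T b) b = representation B0 (T b) b"
      using representation_extend[OF B(1) T(3)[OF span_base[OF b]] B(3)] by simp
  qed
  also have "(\<Sum>b\<in>?R. representation B (T b) b) = (\<Sum>b\<in>?R. representation (D ` ?R) (T (D b)) (D b))"
  proof (rule sum.cong[OF refl])
    fix b assume b: "b \<in> ?R"
    then have Tb: "T b \<in> span B" using T(2) span_base by blast
    have "representation (D ` ?R) (T (D b)) (D b) = representation (D ` ?R) (\<Sum>x\<in>?R. representation B (T b) x *s D x) (D b)"
      using decomp[OF Tb] D(2) by simp
    also have "\<dots> = (\<Sum>x\<in>?R. representation (D ` ?R) (representation B (T b) x *s D x) (D b))"
      by (subst representation_sum[OF ind]) (rule span_scale, rule span_base, erule imageI, rule refl)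
    also have "\<dots> = (\<Sum>x\<in>?R. if x = b then representation B (T b) b else 0)"
    proof (rule sum.cong[OF refl])
      fix x assume x: "x \<in> ?R"
      have "representation (D ` ?R) (representation B (T b) x *s D x) (D b) =
          representation B (T b) x * representation (D ` ?R) (D x) (D b)"
        by (subst representation_scale[OF ind]) (use x in \<open>auto intro: span_base\<close>)
      also have "representation (D ` ?R) (D x) (D b) = (if D x = D b then 1 else 0)"
        by (subst representation_basis[OF ind]) (use x in auto)
      also have "D x = D b \<longleftrightarrow> x = b" using injR' x b by (auto dest: inj_onD)
      finally show "representation (D ` ?R) (representation B (T b) x *s D x) (D b) = (if x = b then representation B (T b) b else 0)"
        by simp
    qed
    also have "\<dots> = representation B (T b) b" using b finR by simp
    finally show "representation B (T b) b = representation (D ` ?R) (T (D b)) (D b)" by simp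
  qed
  also have "\<dots> = basis_trace representation T (D ` ?R)"
    unfolding basis_trace_def by (subst sum.reindex[OF injR']) simp
  finally show "basis_trace representation T B = basis_trace representation T B0 + basis_trace representation T (D ` ?R)" .
qed

end

section \<open>Linear extension of maps on words\<close>

text \<open>The boundary and the group action are both of this form, so linearity and composition
  are settled once for all.\<close>

definition lext :: "(int list \<Rightarrow> chain) \<Rightarrow> chain \<Rightarrow> chain" where
  "lext f c = (\<Sum>u\<in>Poly_Mapping.keys c. chain_scale (Poly_Mapping.lookup c u) (f u))"

lemma lext_superset:
  assumes "finite S" "Poly_Mapping.keys c \<subseteq> S"
  shows "lext f c = (\<Sum>u\<in>S. chain_scale (Poly_Mapping.lookup c u) (f u))"
  unfolding lext_def using assms by (intro sum.mono_neutral_left) (auto simp: in_keys_iff)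

lemma lext_add: "lext f (a + b) = lext f a + lext f b"
proof -
  let ?S = "Poly_Mapping.keys a \<union> Poly_Mapping.keys b"
  have "lext f (a + b) = (\<Sum>u\<in>?S. chain_scale (Poly_Mapping.lookup (a + b) u) (f u))"
    by (rule lext_superset) (auto simp: Poly_Mapping.keys_add)
  also have "\<dots> = lext f a + lext f b"
    by (simp add: lext_superset[of ?S] lookup_add chain.scale_left_distrib sum.distrib)
  finally show ?thesis .
qed

lemma lext_scale: "lext f (chain_scale r a) = chain_scale r (lext f a)"
proof -
  have "lext f (chain_scale r a) = (\<Sum>u\<in>Poly_Mapping.keys a. chain_scale (Poly_Mapping.lookup (chain_scale r a) u) (f u))"
    by (rule lext_superset) (auto simp: in_keys_iff lookup_chain_scale)
  then show ?thesis
    by (simp add: lext_def lookup_chain_scale chain.scale_sum_right)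
qed

lemma lext_zero [simp]: "lext f 0 = 0"
  by (simp add: lext_def)

lemma lext_sum: "lext f (sum g I) = (\<Sum>i\<in>I. lext f (g i))"
  by (induction I rule: infinite_finite_induct) (auto simp: lext_add)

lemma lext_diff: "lext f (a - b) = lext f a - lext f b"
  by (metis add_diff_cancel_right' diff_add_cancel lext_add)

lemma lext_single: "lext f (Poly_Mapping.single u r) = chain_scale r (f u)"
  by (cases "r = 0") (auto simp: lext_def)

lemma lext_lext: "lext f (lext g c) = lext (\<lambda>u. lext f (g u)) c"
  unfolding lext_def[of g] lext_def[of "\<lambda>u. lext f (g u)"] by (simp add: lext_sum lext_scale)

lemma lext_cong: "(\<And>u. u \<in> Poly_Mapping.keys c \<Longrightarrow> f u = g u) \<Longrightarrow> lext f c = lext g c"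
  by (auto simp: lext_def intro: sum.cong)

lemma lext_fun_add: "lext (\<lambda>u. f u + g u) c = lext f c + lext g c"
  by (simp add: lext_def chain.scale_right_distrib sum.distrib)

lemma lext_fun_diff: "lext (\<lambda>u. f u - g u) c = lext f c - lext g c"
  by (simp add: lext_def chain.scale_right_diff_distrib sum_subtractf)

lemma lext_fun_scale: "lext (\<lambda>u. chain_scale r (f u)) c = chain_scale r (lext f c)"
  by (simp add: lext_def chain.scale_sum_right mult.commute)

lemma scale_single: "chain_scale r (Poly_Mapping.single u s) = Poly_Mapping.single u (r * s)"
  by (rule poly_mapping_eqI) (simp add: lookup_chain_scale lookup_single when_def)

lemma lext_single_id: "lext (\<lambda>u. Poly_Mapping.single u 1) c = c"
proof (rule poly_mapping_eqI)
  fix u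
  have "Poly_Mapping.lookup (lext (\<lambda>u. Poly_Mapping.single u 1) c) u =
      (\<Sum>v\<in>Poly_Mapping.keys c. if v = u then Poly_Mapping.lookup c u else 0)"
    by (auto simp: lext_def lookup_sum scale_single lookup_single when_def intro!: sum.cong)
  then show "Poly_Mapping.lookup (lext (\<lambda>u. Poly_Mapping.single u 1) c) u = Poly_Mapping.lookup c u"
    by (simp add: in_keys_iff)
qed

lemma keys_lext: "Poly_Mapping.keys (lext f c) \<subseteq> (\<Union>u\<in>Poly_Mapping.keys c. Poly_Mapping.keys (f u))"
proof
  fix v assume "v \<in> Poly_Mapping.keys (lext f c)"
  then have "(\<Sum>u\<in>Poly_Mapping.keys c. Poly_Mapping.lookup c u * Poly_Mapping.lookup (f u) v) \<noteq> 0"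
    by (simp add: in_keys_iff lext_def lookup_sum lookup_chain_scale)
  then obtain u where "u \<in> Poly_Mapping.keys c" "Poly_Mapping.lookup c u * Poly_Mapping.lookup (f u) v \<noteq> 0"
    by (meson sum.not_neutral_contains_not_neutral)
  then show "v \<in> (\<Union>u\<in>Poly_Mapping.keys c. Poly_Mapping.keys (f u))"
    by (auto simp: in_keys_iff)
qed

section \<open>The boundary map and prefixes of words\<close>

definition del :: "nat \<Rightarrow> int list \<Rightarrow> int list" where
  "del i u = take i u @ drop (Suc i) u"

definition bd :: "int list \<Rightarrow> chain" where
  "bd u = (\<Sum>i<length u. Poly_Mapping.single (del i u) ((-1) ^ i))"

definition pre :: "int list \<Rightarrow> chain \<Rightarrow> chain" where
  "pre p = lext (\<lambda>u. Poly_Mapping.single (p @ u) 1)"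

lemma boundary_lext: "boundary = lext bd"
  by (simp add: fun_eq_iff boundary_def lext_def bd_def del_def)

lemma word_action_lext: "word_action w = lext (\<lambda>u. Poly_Mapping.single (map w u) 1)"
  by (simp add: fun_eq_iff word_action_def lext_def scale_single)

lemma keys_bd: "Poly_Mapping.keys (bd u) \<subseteq> (\<lambda>i. del i u) ` {..<length u}"
  unfolding bd_def by (rule order_trans[OF Poly_Mapping.keys_sum]) auto

lemma lookup_pre: "Poly_Mapping.lookup (pre p c) (p @ v) = Poly_Mapping.lookup c v"
proof -
  have "Poly_Mapping.lookup (pre p c) (p @ v) =
      (\<Sum>u\<in>Poly_Mapping.keys c. if u = v then Poly_Mapping.lookup c v else 0)"
    by (auto simp: pre_def lext_def lookup_sum scale_single lookup_single when_def intro!: sum.cong)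
  then show ?thesis by (simp add: in_keys_iff)
qed

lemma keys_pre: "Poly_Mapping.keys (pre p c) \<subseteq> (\<lambda>u. p @ u) ` Poly_Mapping.keys c"
  unfolding pre_def by (rule order_trans[OF keys_lext]) auto

text \<open>Deletions inside the prefix are kept apart from those behind it; the latter form the
  boundary of u, with a sign from the shift of positions by \<open>length p\<close>. For a single
  letter this is the boundary formula of a cone.\<close>

lemma bd_append:
  "bd (p @ u) = (\<Sum>i<length p. Poly_Mapping.single (del i p @ u) ((-1) ^ i)) +
    chain_scale ((-1) ^ length p) (pre p (bd u))"
proof -
  have "{..<length (p @ u)} = {..<length p} \<union> (\<lambda>i. length p + i) ` {..<length u}"
  proof (intro equalityI subsetI)
    fix i assume "i \<in> {..<length (p @ u)}"
    then show "i \<in> {..<length p} \<union> (\<lambda>i. length p + i) ` {..<length u}"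
      by (cases "i < length p") (auto intro!: image_eqI[of _ _ "i - length p"])
  qed auto
  then have "bd (p @ u) = (\<Sum>i<length p. Poly_Mapping.single (del i (p @ u)) ((-1) ^ i)) +
      (\<Sum>i\<in>(\<lambda>i. length p + i) ` {..<length u}. Poly_Mapping.single (del i (p @ u)) ((-1) ^ i))"
    unfolding bd_def by (subst sum.union_disjoint[symmetric]) auto
  also have "(\<Sum>i<length p. Poly_Mapping.single (del i (p @ u)) ((-1) ^ i)) =
      (\<Sum>i<length p. Poly_Mapping.single (del i p @ u) ((-1) ^ i :: complex))"
    by (rule sum.cong) (auto simp: del_def)
  also have "(\<Sum>i\<in>(\<lambda>i. length p + i) ` {..<length u}. Poly_Mapping.single (del i (p @ u)) ((-1) ^ i)) =
      (\<Sum>i<length u. Poly_Mapping.single (p @ del i u) ((-1) ^ length p * (-1) ^ i :: complex))"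
    by (subst sum.reindex) (auto simp: del_def power_add intro!: sum.cong)
  also have "\<dots> = chain_scale ((-1) ^ length p) (pre p (bd u))"
    by (simp add: bd_def pre_def lext_sum lext_single scale_single chain.scale_sum_right)
  finally show ?thesis .
qed

lemma bd_Cons: "bd (a # u) = Poly_Mapping.single u 1 - pre [a] (bd u)"
  using bd_append[of "[a]" u] by (simp add: del_def chain.scale_minus_left)

lemma boundary_pre_single_letter: "boundary (pre [a] c) = c - pre [a] (boundary c)"
proof -
  have "boundary (pre [a] c) = lext (\<lambda>u. Poly_Mapping.single u 1 - pre [a] (bd u)) c"
    by (simp add: boundary_lext pre_def[of "[a]"] lext_lext lext_single bd_Cons)
  also have "\<dots> = c - pre [a] (boundary c)"
    by (simp add: lext_fun_diff lext_single_id boundary_lext pre_def lext_lext)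
  finally show ?thesis .
qed

text \<open>By the cone formula, the boundary of \<open>bd (a # u)\<close> contains
  \<open>bd u\<close> twice with opposite signs, and what is left is the same expression for u
  behind the letter a.\<close>

lemma boundary_boundary: "boundary (boundary c) = 0"
proof -
  have "boundary (bd u) = 0" for u
  proof (induction u)
    case (Cons a u)
    have "boundary (bd (a # u)) = boundary (Poly_Mapping.single u 1) - boundary (pre [a] (bd u))"
      by (simp add: bd_Cons boundary_lext lext_diff)
    also have "\<dots> = pre [a] (boundary (bd u))"
      unfolding boundary_pre_single_letter by (simp add: boundary_lext lext_single)
    finally show ?case by (simp add: Cons pre_def)
  qed (simp add: bd_def boundary_lext)
  then have "lext (\<lambda>u. boundary (bd u)) c = lext (\<lambda>u. 0) c"
    by simp
  then show ?thesis
    by (simp add: boundary_lext lext_lext) (simp add: lext_def)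
qed

section \<open>Acyclicity below the top degree\<close>

definition words :: "int set \<Rightarrow> int list set" where
  "words S = {u. abs ` set u \<subseteq> S \<and> distinct (map abs u)}"

definition chains :: "int set \<Rightarrow> nat \<Rightarrow> chain set" where
  "chains S k = {c. Poly_Mapping.keys c \<subseteq> {u \<in> words S. length u = k}}"

lemma chains_add: "a \<in> chains S k \<Longrightarrow> b \<in> chains S k \<Longrightarrow> a + b \<in> chains S k"
  using Poly_Mapping.keys_add[of a b] by (auto simp: chains_def)

lemma chains_scale: "a \<in> chains S k \<Longrightarrow> chain_scale r a \<in> chains S k"
  by (auto simp: chains_def in_keys_iff lookup_chain_scale)

lemma chains_diff: "a \<in> chains S k \<Longrightarrow> b \<in> chains S k \<Longrightarrow> a - b \<in> chains S k"
  using chains_add[of a S k "chain_scale (-1) b"] chains_scale[of b S k "-1"] by simp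

lemma chains_zero: "0 \<in> chains S k"
  by (simp add: chains_def)

lemma chains_sum: "(\<And>i. i \<in> I \<Longrightarrow> f i \<in> chains S k) \<Longrightarrow> sum f I \<in> chains S k"
  by (induction I rule: infinite_finite_induct) (auto simp: chains_zero chains_add)

lemma length_del: "i < length u \<Longrightarrow> length (del i u) = length u - 1"
  by (simp add: del_def)

lemma nth_del: "i < length u \<Longrightarrow> a < length u - 1 \<Longrightarrow> del i u ! a = (if a < i then u ! a else u ! Suc a)"
  by (auto simp: del_def nth_append min_def)

lemma del_words:
  assumes "u \<in> words S" "i < length u"
  shows "del i u \<in> words S"
proof -
  have u: "u = take i u @ [u ! i] @ drop (Suc i) u"
    using id_take_nth_drop[OF assms(2)] by simp
  have "map abs u = map abs (take i u) @ [\<bar>u ! i\<bar>] @ map abs (drop (Suc i) u)"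
    by (subst u) simp
  then have "distinct (map abs (take i u) @ [\<bar>u ! i\<bar>] @ map abs (drop (Suc i) u))"
    using assms(1) by (simp add: words_def)
  then have "distinct (map abs (del i u))"
    by (auto simp: del_def)
  moreover have "set (del i u) \<subseteq> set u"
    using set_take_subset[of i u] set_drop_subset[of "Suc i" u] by (auto simp: del_def)
  ultimately show ?thesis
    using assms(1) by (auto simp: words_def)
qed

lemma boundary_chains: "c \<in> chains S (Suc k) \<Longrightarrow> boundary c \<in> chains S k"
proof -
  assume c: "c \<in> chains S (Suc k)"
  have "Poly_Mapping.keys (bd u) \<subseteq> {u \<in> words S. length u = k}" if "u \<in> Poly_Mapping.keys c" for u
  proof -
    have "u \<in> words S" "length u = Suc k" using c that by (auto simp: chains_def)
    then show ?thesis
      using keys_bd[of u] del_words[of u S] length_del[of _ u] by fastforce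
  qed
  then show ?thesis
    using keys_lext[of bd c] by (fastforce simp: chains_def boundary_lext)
qed

lemma pre_chains:
  assumes "p \<in> words S" "c \<in> chains (S - abs ` set p) k"
  shows "pre p c \<in> chains S (length p + k)"
proof -
  have "p @ u \<in> words S \<and> length (p @ u) = length p + k" if "u \<in> Poly_Mapping.keys c" for u
  proof -
    have "u \<in> words (S - abs ` set p)" "length u = k" using assms(2) that by (auto simp: chains_def)
    then show ?thesis
      using assms(1) by (auto simp: words_def)
  qed
  then show ?thesis
    using keys_pre[of p c] unfolding chains_def by blast
qed

definition below :: "int \<Rightarrow> nat \<Rightarrow> int list \<Rightarrow> bool" where
  "below s j u \<longleftrightarrow> (\<forall>i<length u. \<bar>u ! i\<bar> = s \<longrightarrow> i < j)"

lemma below_del: "below s j u \<Longrightarrow> i < length u \<Longrightarrow> below s j (del i u)"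
proof -
  assume b: "below s j u" and i: "i < length u"
  have "a < j" if a: "a < length u - 1" "\<bar>del i u ! a\<bar> = s" for a
  proof (cases "a < i")
    case True
    then show ?thesis
      using b a i by (auto simp: nth_del below_def)
  next
    case False
    then have "Suc a < j"
      using b a i by (auto simp: nth_del below_def)
    then show ?thesis by simp
  qed
  then show ?thesis
    using i by (simp add: below_def length_del)
qed

text \<open>Induction on the size of \<open>S\<close> and on a bound \<open>j\<close> for the positions of the letters \<open>\<plusminus>s\<close> in the cycle.
  If \<open>\<plusminus>s\<close> does not occur, prefixing \<open>s\<close> is a contracting homotopy. Otherwise, for each prefix \<open>p\<close> that ends
  with \<open>\<plusminus>s\<close> at the last possible position, the words following \<open>p\<close> form a cycle over a smaller set; a chain
  bounding it, prefixed by \<open>p\<close>, removes \<open>p\<close> from the cycle at the cost of terms with smaller \<open>j\<close>.\<close>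

lemma acyclic_chains:
  assumes "finite S" "S \<subseteq> {0<..}" "k < card S" "c \<in> chains S k" "boundary c = 0"
  shows "\<exists>d\<in>chains S (Suc k). boundary d = c"
  using assms
proof (induction "card S" arbitrary: S k c rule: less_induct)
  case less
  then obtain s where s: "s \<in> S" by fastforce
  then have s0: "0 < s" using less.prems by auto
  have "\<exists>d\<in>chains S (Suc k). boundary d = c"
    if "\<forall>u\<in>Poly_Mapping.keys c. below s j u" "c \<in> chains S k" "boundary c = 0" for j c
    using that
  proof (induction j arbitrary: c)
    case 0
    have "u \<in> words (S - {s})" if u: "u \<in> Poly_Mapping.keys c" for u
    proof -
      have "s \<notin> abs ` set u"
      proof
        assume "s \<in> abs ` set u"
        then obtain i where "i < length u" "\<bar>u ! i\<bar> = s"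
          by (metis imageE in_set_conv_nth)
        then show False using 0(1) u by (auto simp: below_def)
      qed
      moreover have "u \<in> words S" using 0(2) u by (auto simp: chains_def)
      ultimately show ?thesis by (auto simp: words_def)
    qed
    then have "c \<in> chains (S - abs ` set [s]) k"
      using 0(2) s0 by (auto simp: chains_def)
    moreover have "[s] \<in> words S" using s s0 by (simp add: words_def)
    ultimately have "pre [s] c \<in> chains S (Suc k)"
      using pre_chains[of "[s]" S c k] by simp
    moreover have "boundary (pre [s] c) = c"
      using 0(3) by (simp add: boundary_pre_single_letter) (simp add: pre_def)
    ultimately show ?case by blast
  next
    case (Suc j)
    define P where "P = take (Suc j) ` {u \<in> Poly_Mapping.keys c. j < length u \<and> \<bar>u ! j\<bar> = s}"
    have finP: "finite P" by (simp add: P_def)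
    have keysc: "u \<in> words S" "length u = k" if "u \<in> Poly_Mapping.keys c" for u
      using Suc.prems(2) that by (auto simp: chains_def)
    have P: "length p = Suc j" "\<bar>p ! j\<bar> = s" "p \<in> words S" "Suc j \<le> k" if pP: "p \<in> P" for p
    proof -
      obtain u where u: "u \<in> Poly_Mapping.keys c" "j < length u" "\<bar>u ! j\<bar> = s" "p = take (Suc j) u"
        using pP by (auto simp: P_def)
      show "length p = Suc j" "\<bar>p ! j\<bar> = s" "Suc j \<le> k" using u keysc[OF u(1)] by auto
      show "p \<in> words S"
        using keysc(1)[OF u(1)] set_take_subset[of "Suc j" u] distinct_take[of "map abs u" "Suc j"]
        unfolding u(4) words_def by (auto simp: take_map)
    qed
    have uniq: "\<not> below s j (p @ v)" if "p \<in> P" for p v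
      using P[OF that] by (auto simp: below_def nth_append intro!: exI[of _ j])
    \<comment> \<open>The coefficients of the words of c that begin with p, as a chain in the
      remaining letters.\<close>
    define z where "z p = Abs_poly_mapping (\<lambda>v. Poly_Mapping.lookup c (p @ v))" for p
    have look: "Poly_Mapping.lookup (z p) v = Poly_Mapping.lookup c (p @ v)" for p v
    proof -
      have "{v. Poly_Mapping.lookup c (p @ v) \<noteq> 0} = (\<lambda>v. p @ v) -` Poly_Mapping.keys c"
        by (auto simp: in_keys_iff)
      then have "finite {v. Poly_Mapping.lookup c (p @ v) \<noteq> 0}"
        by (auto intro: finite_vimageI simp: inj_def)
      then show ?thesis
        by (simp add: z_def Abs_poly_mapping_inverse)
    qed
    have zc: "z p \<in> chains (S - abs ` set p) (k - Suc j)" if p: "p \<in> P" for p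
    proof -
      have "v \<in> words (S - abs ` set p) \<and> length v = k - Suc j" if "v \<in> Poly_Mapping.keys (z p)" for v
      proof -
        have "p @ v \<in> Poly_Mapping.keys c" using that by (simp add: in_keys_iff look)
        from keysc[OF this] show ?thesis
          using P[OF p] by (auto simp: words_def)
      qed
      then show ?thesis by (auto simp: chains_def)
    qed
    \<comment> \<open>What is left of c once all words with \<plusminus>s at position j are removed:
      here these letters occur only before position j.\<close>
    define c0 where "c0 = c - (\<Sum>p\<in>P. pre p (z p))"
    have lookP: "Poly_Mapping.lookup (\<Sum>p\<in>P. pre p (f p)) (q @ v) = Poly_Mapping.lookup (f q) v"
      if "q \<in> P" for f :: "int list \<Rightarrow> chain" and q v
    proof -
      have "Poly_Mapping.lookup (pre p (f p)) (q @ v) = (if p = q then Poly_Mapping.lookup (f q) v else 0)"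
        if "p \<in> P" for p
      proof (cases "p = q")
        case False
        have "q @ v \<notin> (\<lambda>u. p @ u) ` Poly_Mapping.keys (f p)"
          using False P(1)[OF that] P(1)[OF \<open>q \<in> P\<close>] by auto
        then show ?thesis
          using keys_pre[of p "f p"] False by (auto simp: in_keys_iff)
      qed (simp add: lookup_pre)
      then show ?thesis
        using finP that by (simp add: lookup_sum)
    qed
    have c0: "below s j u" if u: "u \<in> Poly_Mapping.keys c0" for u
    proof (rule ccontr)
      assume nb: "\<not> below s j u"
      have "u \<in> Poly_Mapping.keys c \<or> u \<in> Poly_Mapping.keys (\<Sum>p\<in>P. pre p (z p))"
        using u by (auto simp: c0_def in_keys_iff lookup_minus)
      then have uc: "u \<in> Poly_Mapping.keys c"
      proof
        assume "u \<in> Poly_Mapping.keys (\<Sum>p\<in>P. pre p (z p))"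
        then obtain p where "u \<in> Poly_Mapping.keys (pre p (z p))"
          using Poly_Mapping.keys_sum[of "\<lambda>p. pre p (z p)" P] by blast
        then obtain v where "u = p @ v" "v \<in> Poly_Mapping.keys (z p)"
          using keys_pre by blast
        then show ?thesis by (simp add: in_keys_iff look)
      qed
      then have "below s (Suc j) u" using Suc.prems(1) by blast
      then have "j < length u" "\<bar>u ! j\<bar> = s"
        using nb by (auto simp: below_def less_Suc_eq)
      then have q: "take (Suc j) u \<in> P"
        using uc by (auto simp: P_def)
      have "Poly_Mapping.lookup c0 (take (Suc j) u @ drop (Suc j) u) = 0"
        unfolding c0_def lookup_minus lookP[OF q] look by simp
      then show False
        using u by (simp add: in_keys_iff)
    qed
    \<comment> \<open>The boundary terms in which a letter of the prefix is deleted. The shortened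
      prefix has length j and u avoids \<plusminus>s, so these terms satisfy the smaller bound on
      the positions of \<plusminus>s.\<close>
    define r where "r p u = (\<Sum>i<length p. Poly_Mapping.single (del i p @ u) ((-1) ^ i :: complex))" for p u
    have bpre: "boundary (pre p y) = lext (r p) y + chain_scale ((-1) ^ length p) (pre p (boundary y))" for p y
    proof -
      have "boundary (pre p y) = lext (\<lambda>u. r p u + chain_scale ((-1) ^ length p) (pre p (bd u))) y"
        by (simp add: boundary_lext pre_def lext_lext lext_single bd_append r_def[symmetric])
      then show ?thesis
        by (simp add: lext_fun_add lext_fun_scale boundary_lext pre_def lext_lext)
    qed
    have rb: "below s j v" if p: "p \<in> P" and y: "y \<in> chains (S - abs ` set p) m" and v: "v \<in> Poly_Mapping.keys (lext (r p) y)"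
      for p y m v
    proof -
      obtain u where u: "u \<in> Poly_Mapping.keys y" "v \<in> Poly_Mapping.keys (r p u)"
        using v keys_lext by blast
      then obtain i where i: "i < length p" "v = del i p @ u"
        using Poly_Mapping.keys_sum[of "\<lambda>i. Poly_Mapping.single (del i p @ u) ((-1) ^ i :: complex)" "{..<length p}"]
        by (auto simp: r_def)
      have "u \<in> words (S - abs ` set p)" using y u(1) by (auto simp: chains_def)
      moreover have "s \<in> abs ` set p" using P[OF p] by (metis imageI lessI nth_mem)
      ultimately have "s \<notin> abs ` set u"
        unfolding words_def by blast
      then have us: "\<bar>u ! a\<bar> \<noteq> s" if "a < length u" for a
        using nth_mem[OF that] by blast
      show ?thesis
        unfolding below_def
      proof (intro allI impI)
        fix a assume a: "a < length v" "\<bar>v ! a\<bar> = s"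
        have l: "length (del i p) = j" using length_del[OF i(1)] P(1)[OF p] by simp
        show "a < j"
        proof (rule ccontr)
          assume "\<not> a < j"
          then have "v ! a = u ! (a - j)" "a - j < length u"
            using a l unfolding i(2) by (auto simp: nth_append)
          then show False using us a(2) by auto
        qed
      qed
    qed
    \<comment> \<open>Coefficients at the words \<open>p @ v\<close> are compared in the boundary of
      c, which is zero. The boundary of \<open>c0\<close> and the terms \<open>r\<close> have
      \<plusminus>s only before position j and so contribute nothing there; only the boundary of
      \<open>z p\<close> is left.\<close>
    have bz: "boundary (z p) = 0" if p: "p \<in> P" for p
    proof (rule poly_mapping_eqI)
      fix v
      have c: "c = c0 + (\<Sum>p\<in>P. pre p (z p))" by (simp add: c0_def)
      have "0 = boundary c0 + (\<Sum>p\<in>P. lext (r p) (z p) + chain_scale ((-1) ^ length p) (pre p (boundary (z p))))"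
        using Suc.prems(3) by (subst (asm) c) (simp add: boundary_lext[of] lext_add lext_sum bpre[unfolded boundary_lext])
      also have "\<dots> = boundary c0 + (\<Sum>p\<in>P. lext (r p) (z p)) + chain_scale ((-1) ^ Suc j) (\<Sum>p\<in>P. pre p (boundary (z p)))"
      proof -
        have "(\<Sum>p\<in>P. chain_scale ((-1) ^ length p) (pre p (boundary (z p)))) =
            chain_scale ((-1) ^ Suc j) (\<Sum>p\<in>P. pre p (boundary (z p)))"
          unfolding chain.scale_sum_right by (rule sum.cong) (simp_all only: P(1))
        then show ?thesis
          by (simp only: sum.distrib add.assoc)
      qed
      finally have e: "0 = boundary c0 + (\<Sum>p\<in>P. lext (r p) (z p)) + chain_scale ((-1) ^ Suc j) (\<Sum>p\<in>P. pre p (boundary (z p)))" .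
      have 1: "Poly_Mapping.lookup (boundary c0) (p @ v) = 0"
      proof (rule ccontr)
        assume "Poly_Mapping.lookup (boundary c0) (p @ v) \<noteq> 0"
        then have "p @ v \<in> Poly_Mapping.keys (lext bd c0)" by (simp add: in_keys_iff boundary_lext)
        then obtain u where u: "u \<in> Poly_Mapping.keys c0" "p @ v \<in> Poly_Mapping.keys (bd u)"
          using keys_lext by blast
        then obtain i where "i < length u" "p @ v = del i u"
          using keys_bd by blast
        then have "below s j (p @ v)"
          using below_del[OF c0[OF u(1)]] by simp
        then show False using uniq[OF p] by blast
      qed
      have 2: "Poly_Mapping.lookup (lext (r q) (z q)) (p @ v) = 0" if q: "q \<in> P" for q
        using rb[OF q zc[OF q], of "p @ v"] uniq[OF p, of v] by (auto simp: in_keys_iff)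
      have "0 = Poly_Mapping.lookup (boundary c0) (p @ v) + Poly_Mapping.lookup (\<Sum>p\<in>P. lext (r p) (z p)) (p @ v) +
          (-1) ^ Suc j * Poly_Mapping.lookup (\<Sum>p\<in>P. pre p (boundary (z p))) (p @ v)"
        using arg_cong[OF e, of "\<lambda>c. Poly_Mapping.lookup c (p @ v)"] by (simp only: lookup_add lookup_chain_scale lookup_zero)
      moreover have "Poly_Mapping.lookup (\<Sum>p\<in>P. lext (r p) (z p)) (p @ v) = 0"
        by (simp add: lookup_sum 2)
      ultimately show "Poly_Mapping.lookup (boundary (z p)) v = Poly_Mapping.lookup 0 v"
        unfolding 1 lookP[OF p, of "\<lambda>p. boundary (z p)"] by simp
    qed
    have "\<exists>y. y \<in> chains (S - abs ` set p) (k - j) \<and> boundary y = z p" if p: "p \<in> P" for p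
    proof -
      have "abs ` set p \<subseteq> S" "card (abs ` set p) = Suc j"
        using P[OF p] distinct_card[of "map abs p"] by (auto simp: words_def)
      then have "card (S - abs ` set p) = card S - Suc j"
        using less.prems(1) by (simp add: card_Diff_subset finite_subset)
      then have "\<exists>y\<in>chains (S - abs ` set p) (Suc (k - Suc j)). boundary y = z p"
        using less.prems(1-3) P(4)[OF p] zc[OF p] bz[OF p]
        by (intro less.hyps) auto
      then show ?thesis
        using P(4)[OF p] by (auto simp: Suc_diff_Suc)
    qed
    then obtain y where y: "\<And>p. p \<in> P \<Longrightarrow> y p \<in> chains (S - abs ` set p) (k - j) \<and> boundary (y p) = z p"
      by metis
    \<comment> \<open>The sign cancels the one that arises when the boundary is moved past a prefix
      of length \<open>Suc j\<close>.\<close>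
    define D where "D = chain_scale ((-1) ^ Suc j) (\<Sum>p\<in>P. pre p (y p))"
    have D: "D \<in> chains S (Suc k)"
    proof -
      have "pre p (y p) \<in> chains S (Suc k)" if "p \<in> P" for p
        using pre_chains[OF P(3)[OF that], of "y p" "k - j"] y[OF that] P[OF that] by simp
      then show ?thesis
        unfolding D_def by (intro chains_scale chains_sum)
    qed
    have bD: "boundary D = (\<Sum>p\<in>P. pre p (z p)) + chain_scale ((-1) ^ Suc j) (\<Sum>p\<in>P. lext (r p) (y p))"
    proof -
      have "boundary D = chain_scale ((-1) ^ Suc j) (\<Sum>p\<in>P. boundary (pre p (y p)))"
        by (simp only: D_def boundary_lext lext_scale lext_sum)
      also have "(\<Sum>p\<in>P. boundary (pre p (y p))) = (\<Sum>p\<in>P. lext (r p) (y p) + chain_scale ((-1) ^ Suc j) (pre p (z p)))"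
        by (rule sum.cong) (simp_all only: bpre y P(1))
      also have "\<dots> = (\<Sum>p\<in>P. lext (r p) (y p)) + chain_scale ((-1) ^ Suc j) (\<Sum>p\<in>P. pre p (z p))"
        by (simp only: sum.distrib chain.scale_sum_right)
      finally have "boundary D = chain_scale ((-1) ^ Suc j) (\<Sum>p\<in>P. lext (r p) (y p)) +
          chain_scale ((-1) ^ Suc j * (-1) ^ Suc j) (\<Sum>p\<in>P. pre p (z p))"
        by (simp only: chain.scale_right_distrib chain.scale_scale)
      moreover have "(-1) ^ Suc j * (-1) ^ Suc j = (1 :: complex)"
        by (simp flip: power_mult_distrib)
      ultimately show ?thesis
        by (simp only: chain.scale_one add.commute)
    qed
    define c' where "c' = c - boundary D"
    have c': "c' = c0 - chain_scale ((-1) ^ Suc j) (\<Sum>p\<in>P. lext (r p) (y p))"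
      by (simp add: c'_def c0_def bD)
    have "\<exists>d\<in>chains S (Suc k). boundary d = c'"
    proof (rule Suc.IH)
      show "\<forall>u\<in>Poly_Mapping.keys c'. below s j u"
      proof
        fix u assume u: "u \<in> Poly_Mapping.keys c'"
        show "below s j u"
        proof (rule ccontr)
          assume nb: "\<not> below s j u"
          have "Poly_Mapping.lookup c0 u = 0"
            using c0[of u] nb by (auto simp: in_keys_iff)
          moreover have "Poly_Mapping.lookup (lext (r p) (y p)) u = 0" if "p \<in> P" for p
            using rb[OF that conjunct1[OF y[OF that]], of u] nb by (auto simp: in_keys_iff)
          ultimately have "Poly_Mapping.lookup c' u = 0"
            unfolding c' lookup_minus lookup_chain_scale lookup_sum by simp
          then show False
            using u by (simp add: in_keys_iff)
        qed
      qed
      show "c' \<in> chains S k"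
        unfolding c'_def using Suc.prems(2) boundary_chains[OF D] by (rule chains_diff)
      show "boundary c' = 0"
        using Suc.prems(3) boundary_boundary[of D] by (simp add: c'_def boundary_lext lext_diff)
    qed
    then obtain d where "d \<in> chains S (Suc k)" "boundary d = c'" by blast
    then have "d + D \<in> chains S (Suc k)" "boundary (d + D) = c"
      using D by (auto simp: chains_add c'_def boundary_lext lext_add)
    then show ?case by blast
  qed
  \<comment> \<open>Words of length k have all their positions below k, so the bound holds initially
    with j = k.\<close>
  from this[of c k] show ?case
    using less.prems by (auto simp: below_def chains_def)
qed

section \<open>The character of the top homology\<close>

lemma linear_lext: "Vector_Spaces.linear chain_scale chain_scale (lext f)"
  by unfold_locales (simp_all add: lext_add lext_scale)

lemma words_inj_words: "words {1..int n} = inj_words n"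
proof -
  have "a \<in> Omega n \<longleftrightarrow> \<bar>a\<bar> \<in> {1..int n}" for a
    by (auto simp: Omega_def)
  then show ?thesis
    by (auto simp: words_def inj_words_def)
qed

lemma chain_space_chains: "chain_space n k = chains {1..int n} k"
  by (simp add: chain_space_def chains_def words_inj_words)

lemma finite_inj_words: "finite {u \<in> inj_words n. length u = k}"
  by (rule finite_subset[OF _ finite_lists_length_eq[OF finite_Omega[of n], of k]]) (auto simp: inj_words_def)

lemma subspace_chain_space: "chain.subspace (chain_space n k)"
  unfolding chain_space_chains by (auto simp: chain.subspace_def chains_zero chains_add chains_scale)

definition word_basis :: "nat \<Rightarrow> nat \<Rightarrow> chain set" where
  "word_basis n k = (\<lambda>u. Poly_Mapping.single u 1) ` {u \<in> inj_words n. length u = k}"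

lemma inj_single: "inj (\<lambda>u. Poly_Mapping.single u (1 :: complex))"
  by (rule injI) (metis lookup_single_eq lookup_single_not_eq zero_neq_one)

lemma finite_word_basis: "finite (word_basis n k)"
  by (simp add: word_basis_def finite_inj_words)

lemma span_word_basis: "chain.span (word_basis n k) = chain_space n k"
proof
  show "chain.span (word_basis n k) \<subseteq> chain_space n k"
    by (rule chain.span_minimal[OF _ subspace_chain_space]) (auto simp: word_basis_def chain_space_def)
  show "chain_space n k \<subseteq> chain.span (word_basis n k)"
  proof
    fix c assume c: "c \<in> chain_space n k"
    have "c = (\<Sum>u\<in>Poly_Mapping.keys c. chain_scale (Poly_Mapping.lookup c u) (Poly_Mapping.single u 1))"
      using lext_single_id[of c] by (simp add: lext_def)
    also have "\<dots> \<in> chain.span (word_basis n k)"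
      by (intro chain.span_sum chain.span_scale chain.span_base)
        (use c in \<open>auto simp: word_basis_def chain_space_def\<close>)
    finally show "c \<in> chain.span (word_basis n k)" .
  qed
qed

lemma independent_word_basis: "chain.independent (word_basis n k)"
proof
  assume "chain.dependent (word_basis n k)"
  then obtain a where a: "\<exists>v\<in>word_basis n k. a v \<noteq> 0" "(\<Sum>v\<in>word_basis n k. chain_scale (a v) v) = 0"
    using chain.dependent_finite[OF finite_word_basis] by blast
  then obtain u where u: "u \<in> inj_words n" "length u = k" "a (Poly_Mapping.single u 1) \<noteq> 0"
    by (auto simp: word_basis_def)
  let ?W = "{u \<in> inj_words n. length u = k}"
  have "(\<Sum>v\<in>word_basis n k. chain_scale (a v) v) =
      (\<Sum>v\<in>?W. chain_scale (a (Poly_Mapping.single v 1)) (Poly_Mapping.single v 1))"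
    unfolding word_basis_def by (subst sum.reindex) (auto intro: inj_on_subset[OF inj_single])
  then have "0 = Poly_Mapping.lookup (\<Sum>v\<in>?W. chain_scale (a (Poly_Mapping.single v 1)) (Poly_Mapping.single v 1)) u"
    using a(2) by simp
  also have "\<dots> = (\<Sum>v\<in>?W. if v = u then a (Poly_Mapping.single u 1) else 0)"
    by (auto simp: lookup_sum lookup_chain_scale lookup_single when_def intro!: sum.cong)
  also have "\<dots> = a (Poly_Mapping.single u 1)"
    using u finite_inj_words by simp
  finally show False using u(3) by simp
qed

lemma map_inj_words:
  assumes "w \<in> B_group n" "u \<in> inj_words n"
  shows "map w u \<in> inj_words n"
proof -
  have "distinct (map (\<lambda>a. \<bar>w a\<bar>) u)"
    using assms(2) B_group_abs_inj[OF assms(1)] by (auto simp: inj_words_def distinct_map inj_on_def)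
  then show ?thesis
    using assms(2) B_group_mem[OF assms(1)] by (auto simp: inj_words_def o_def)
qed

lemma word_action_chain_space:
  assumes "w \<in> B_group n" "c \<in> chain_space n k"
  shows "word_action w c \<in> chain_space n k"
proof -
  have "Poly_Mapping.keys (word_action w c) \<subseteq> map w ` Poly_Mapping.keys c"
    unfolding word_action_lext by (rule order_trans[OF keys_lext]) auto
  then show ?thesis
    using assms map_inj_words[OF assms(1)] by (force simp: chain_space_def)
qed

lemma boundary_word_action: "boundary (word_action w c) = word_action w (boundary c)"
proof -
  have "bd (map w u) = lext (\<lambda>u. Poly_Mapping.single (map w u) 1) (bd u)" for u
    by (simp add: bd_def lext_sum lext_single scale_single del_def take_map drop_map)
  then show ?thesis
    by (simp add: boundary_lext word_action_lext lext_lext lext_single)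
qed

section \<open>Traces on chains and cycles\<close>

definition fixed_words :: "nat \<Rightarrow> nat \<Rightarrow> (int \<Rightarrow> int) \<Rightarrow> int list set" where
  "fixed_words n k w = {u \<in> inj_words n. length u = k \<and> map w u = u}"

text \<open>The group permutes the basis of words, so the trace counts the fixed ones. No signs
  occur, because a letterwise map keeps the order of the letters and with it the orientation of each
  simplex.\<close>

lemma trace_chain_space:
  assumes w: "w \<in> B_group n" and B: "chain.independent B" "finite B" "chain.span B = chain_space n k"
  shows "basis_trace chain.representation (word_action w) B = of_nat (card (fixed_words n k w))"
proof -
  let ?W = "{u \<in> inj_words n. length u = k}"
  have "basis_trace chain.representation (word_action w) B = basis_trace chain.representation (word_action w) (word_basis n k)"
  proof (rule chain.basis_trace_unique[OF B(1,2) independent_word_basis finite_word_basis])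
    show "chain.span B = chain.span (word_basis n k)" by (simp add: B(3) span_word_basis)
    show "Vector_Spaces.linear chain_scale chain_scale (word_action w)"
      unfolding word_action_lext by (rule linear_lext)
    show "word_action w x \<in> chain.span B" if "x \<in> chain.span B" for x
      using that word_action_chain_space[OF w] by (simp add: B(3))
  qed
  also have "\<dots> = (\<Sum>u\<in>?W. chain.representation (word_basis n k) (word_action w (Poly_Mapping.single u 1)) (Poly_Mapping.single u 1))"
    unfolding basis_trace_def by (subst word_basis_def, subst sum.reindex) (auto intro: inj_on_subset[OF inj_single])
  also have "\<dots> = (\<Sum>u\<in>?W. if map w u = u then 1 else 0)"
  proof (rule sum.cong[OF refl])
    fix u assume u: "u \<in> ?W"
    have "word_action w (Poly_Mapping.single u 1) = Poly_Mapping.single (map w u) 1"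
      by (simp add: word_action_lext lext_single)
    moreover have "Poly_Mapping.single (map w u) 1 \<in> word_basis n k"
      using u map_inj_words[OF w] by (auto simp: word_basis_def)
    ultimately have "chain.representation (word_basis n k) (word_action w (Poly_Mapping.single u 1)) =
        (\<lambda>v. if v = Poly_Mapping.single (map w u) 1 then 1 else 0)"
      using chain.representation_basis[OF independent_word_basis] by simp
    then show "chain.representation (word_basis n k) (word_action w (Poly_Mapping.single u 1)) (Poly_Mapping.single u 1) =
        (if map w u = u then 1 else 0)"
      using injD[OF inj_single, of u "map w u"] by auto
  qed
  also have "\<dots> = of_nat (card {u \<in> ?W. map w u = u})"
    using finite_inj_words by (simp add: sum.If_cases Int_def)
  also have "{u \<in> ?W. map w u = u} = fixed_words n k w"
    by (auto simp: fixed_words_def)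
  finally show ?thesis .
qed

lemma subspace_cycle_space: "chain.subspace (cycle_space n k)"
  using subspace_chain_space[of n k]
  by (auto simp: chain.subspace_def cycle_space_def boundary_lext lext_add lext_scale)

lemma finite_independent_chains:
  "chain.independent B \<Longrightarrow> B \<subseteq> chain_space n k \<Longrightarrow> finite B"
  using chain.independent_span_bound[OF finite_word_basis, of B n k] by (simp add: span_word_basis)

text \<open>As long as \<open>Suc k\<close> is at most n, the chains with \<open>Suc k\<close>
  letters map onto the cycles with k letters, by acyclicity, and the kernel consists of the cycles
  with \<open>Suc k\<close> letters. So the trace on cycles is the trace on chains minus the trace
  on cycles with one letter less.\<close>

lemma trace_cycle_space:
  assumes w: "w \<in> B_group n" and "k \<le> n" and "chain.independent B" "chain.span B = cycle_space n k"
  shows "basis_trace chain.representation (word_action w) B =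
    (\<Sum>i\<le>k. (-1) ^ (k - i) * of_nat (card (fixed_words n i w)))"
  using assms(2-)
proof (induction k arbitrary: B)
  case 0
  have "boundary c = 0" if "c \<in> chain_space n 0" for c
  proof -
    have "lext bd c = lext (\<lambda>_. 0) c"
      by (rule lext_cong) (use that in \<open>auto simp: chain_space_def bd_def\<close>)
    then show ?thesis by (simp add: boundary_lext lext_def)
  qed
  then have "cycle_space n 0 = chain_space n 0" by (auto simp: cycle_space_def)
  moreover have "finite B"
    using 0 calculation chain.span_superset[of B] by (intro finite_independent_chains) auto
  ultimately show ?case
    using trace_chain_space[OF w 0(2)] 0(3) by simp
next
  case (Suc k)
  have Bsub: "B \<subseteq> chain_space n (Suc k)"
    using Suc.prems(3) chain.span_superset[of B] by (auto simp: cycle_space_def)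
  obtain B1 where B1: "B \<subseteq> B1" "B1 \<subseteq> chain_space n (Suc k)" "chain.independent B1" "chain_space n (Suc k) \<subseteq> chain.span B1"
    using chain.maximal_independent_subset_extend[OF Bsub Suc.prems(2)] by blast
  have sp: "chain.span B1 = chain_space n (Suc k)"
    using B1(2,4) chain.span_minimal[OF _ subspace_chain_space] by blast
  have fin: "finite B1" by (rule finite_independent_chains[OF B1(3,2)])
  have lin: "Vector_Spaces.linear chain_scale chain_scale (word_action w)" "Vector_Spaces.linear chain_scale chain_scale boundary"
    unfolding word_action_lext boundary_lext by (rule linear_lext)+
  have pres: "word_action w x \<in> chain.span B1" if "x \<in> chain.span B1" for x
    using that word_action_chain_space[OF w] by (simp add: sp)
  have pres0: "word_action w x \<in> chain.span B" if "x \<in> chain.span B" for x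
    using that word_action_chain_space[OF w]
    by (auto simp: Suc.prems(3) cycle_space_def boundary_word_action) (simp add: word_action_lext)
  have ker: "chain.span B = {x \<in> chain.span B1. boundary x = 0}"
    by (simp add: Suc.prems(3) sp cycle_space_def)
  note ex = chain.basis_trace_exact[OF B1(3) fin B1(1) lin(1) pres pres0 lin(2) boundary_word_action ker]
  have im: "boundary ` chain_space n (Suc k) = cycle_space n k"
  proof
    show "boundary ` chain_space n (Suc k) \<subseteq> cycle_space n k"
      using boundary_chains boundary_boundary by (auto simp: cycle_space_def chain_space_chains)
    show "cycle_space n k \<subseteq> boundary ` chain_space n (Suc k)"
    proof
      fix c assume c: "c \<in> cycle_space n k"
      have "\<exists>d\<in>chains {1..int n} (Suc k). boundary d = c"
        by (rule acyclic_chains) (use c Suc.prems(1) in \<open>auto simp: cycle_space_def chain_space_chains\<close>)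
      then show "c \<in> boundary ` chain_space n (Suc k)"
        by (auto simp: chain_space_chains)
    qed
  qed
  have "basis_trace chain.representation (word_action w) (boundary ` (B1 - B)) =
      (\<Sum>i\<le>k. (-1) ^ (k - i) * of_nat (card (fixed_words n i w)))"
    by (rule Suc.IH) (use Suc.prems(1) ex(2,3) in \<open>simp_all add: sp im\<close>)
  moreover have "basis_trace chain.representation (word_action w) B1 = of_nat (card (fixed_words n (Suc k) w))"
    by (rule trace_chain_space[OF w B1(3) fin sp])
  ultimately have "basis_trace chain.representation (word_action w) B = of_nat (card (fixed_words n (Suc k) w)) -
      (\<Sum>i\<le>k. (-1) ^ (k - i) * of_nat (card (fixed_words n i w)))"
    using ex(1) by (simp add: algebra_simps)
  then show ?case
    by (simp add: Suc_diff_le sum_negf)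
qed

text \<open>No injective word has n + 1 letters, so nothing is divided out and the top homology is
  the space of top cycles itself.\<close>

lemma psi_fixed_words:
  assumes w: "w \<in> B_group n"
  shows "psi n w = (\<Sum>i\<le>n. (-1) ^ (n - i) * of_nat (card (fixed_words n i w)))"
proof -
  have "chain_space n (Suc n) = {0}"
  proof -
    have "\<not> length u = Suc n" if "u \<in> words {1..int n}" for u
    proof
      assume l: "length u = Suc n"
      have "card (abs ` set u) \<le> card {1..int n}"
        using that by (intro card_mono) (auto simp: words_def)
      moreover have "card (abs ` set u) = length u"
        using that distinct_card[of "map abs u"] by (simp add: words_def)
      ultimately show False using l by simp
    qed
    then have "{u \<in> words {1..int n}. length u = Suc n} = {}"
      by blast
    then show ?thesis
      unfolding chain_space_chains chains_def by (simp only: subset_empty keys_eq_empty singleton_conv)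
  qed
  then have U: "boundary_space n n = {0}"
    by (simp add: boundary_space_def boundary_lext)
  \<comment> \<open>The condition on the pair chosen in \<open>quotient_trace\<close>. The first
    component spans the zero space and lies in an independent set, hence is empty; the quotient
    trace becomes a trace over a basis of the cycles.\<close>
  define Q where "Q x = (case x of (B0, B) \<Rightarrow> B0 \<subseteq> B \<and> chain.independent B \<and> chain.span B0 = boundary_space n n \<and>
      chain.span B = cycle_space n n)" for x
  obtain B where B: "B \<subseteq> cycle_space n n" "chain.independent B" "cycle_space n n \<subseteq> chain.span B"
    using chain.maximal_independent_subset[of "cycle_space n n"] by blast
  have "chain.span B = cycle_space n n"
    using B chain.span_minimal[OF B(1) subspace_cycle_space] by blast
  then have "Q ({}, B)" using B(2) U by (simp add: Q_def)
  then have Q: "Q (SOME x. Q x)" by (rule someI)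
  obtain B0 B1 where x: "(SOME x. Q x) = (B0, B1)" by fastforce
  have "Q (B0, B1)"
    using Q unfolding x .
  then have Q': "B0 \<subseteq> B1" "chain.independent B1" "chain.span B0 = {0}" "chain.span B1 = cycle_space n n"
    by (simp_all add: Q_def U)
  have "B0 = {}"
  proof (rule ccontr)
    assume "B0 \<noteq> {}"
    then obtain b where b: "b \<in> B0" by auto
    then have "b \<in> {0}"
      unfolding Q'(3)[symmetric] by (rule chain.span_base)
    then have "0 \<in> B1"
      using b Q'(1) by auto
    from chain.dependent_zero[OF this] show False
      using Q'(2) by (rule notE[rotated])
  qed
  have "psi n w = (let (B\<^sub>0, B) = (SOME x. Q x) in \<Sum>b\<in>B - B\<^sub>0. chain.representation B (word_action w b) b)"
    unfolding psi_def homology_character_def chain.quotient_trace_def Q_def by (rule refl)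
  then have "psi n w = basis_trace chain.representation (word_action w) B1"
    unfolding x Let_def prod.case \<open>B0 = {}\<close> Diff_empty basis_trace_def .
  also have "\<dots> = (\<Sum>i\<le>n. (-1) ^ (n - i) * of_nat (card (fixed_words n i w)))"
    by (rule trace_cycle_space[OF w order_refl Q'(2,4)])
  finally show ?thesis .
qed

section \<open>Power sums indexed by the signed cycle type\<close>

lemma abs_perm_permutes:
  assumes "w \<in> B_group n"
  shows "abs_perm w permutes {1..n}"
proof (rule bij_imp_permutes[OF abs_perm_bij[OF assms]])
  fix a assume "a \<notin> {1..n}"
  then have "int a \<notin> Omega n" by (auto simp: Omega_def)
  then show "abs_perm w a = a" using B_group_outside[OF assms] by (simp add: abs_perm_def)
qed

lemma B_group_permutation: "w \<in> B_group n \<Longrightarrow> permutation w"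
  using B_group_permutes finite_Omega permutation_permutes by blast

lemma abs_perm_permutation: "w \<in> B_group n \<Longrightarrow> permutation (abs_perm w)"
  using abs_perm_permutes permutation_permutes by blast

lemma abs_B_group: "w \<in> B_group n \<Longrightarrow> \<bar>w \<bar>x\<bar>\<bar> = \<bar>w x\<bar>"
  by (cases "0 \<le> x") (simp_all add: B_group_uminus)

lemma abs_perm_nat_abs: "w \<in> B_group n \<Longrightarrow> abs_perm w (nat \<bar>x\<bar>) = nat \<bar>w x\<bar>"
  by (simp add: abs_perm_def abs_B_group)

lemma abs_funpow: "w \<in> B_group n \<Longrightarrow> nat \<bar>(w ^^ t) x\<bar> = (abs_perm w ^^ t) (nat \<bar>x\<bar>)"
  by (induction t) (simp_all flip: abs_perm_nat_abs)

lemma funpow_uminus: "w \<in> B_group n \<Longrightarrow> (w ^^ t) (- x) = - (w ^^ t) x"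
  by (induction t) (simp_all add: B_group_uminus)

text \<open>Passes from letters to absolute values. It identifies a cycle with its negative, while a
  set closed under negation can be recovered from it.\<close>

definition shadow :: "int set \<Rightarrow> nat set" where
  "shadow C = (\<lambda>x. nat \<bar>x\<bar>) ` C"

lemma shadow_orbit:
  assumes "w \<in> B_group n"
  shows "shadow (orbit w x) = orbit (abs_perm w) (nat \<bar>x\<bar>)"
  unfolding shadow_def orbit_altdef using abs_funpow[OF assms] by (auto simp: image_iff) metis

lemma uminus_orbit:
  assumes "w \<in> B_group n"
  shows "uminus ` orbit w x = orbit w (- x)"
  unfolding orbit_altdef using funpow_uminus[OF assms] by (auto simp: image_iff)

lemma shadow_Un_uminus: "shadow (C \<union> uminus ` C) = shadow C"
  by (auto simp: shadow_def)

lemma symmetric_shadow: "uminus ` C = C \<Longrightarrow> C = {x. nat \<bar>x\<bar> \<in> shadow C}"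
proof (intro equalityI subsetI)
  fix x assume C: "uminus ` C = C" and "x \<in> {x. nat \<bar>x\<bar> \<in> shadow C}"
  then obtain y where "y \<in> C" "nat \<bar>x\<bar> = nat \<bar>y\<bar>" by (auto simp: shadow_def)
  then have "x = y \<or> x = - y" by linarith
  then show "x \<in> C" using C \<open>y \<in> C\<close> by auto
qed (auto simp: shadow_def)

lemma card_symmetric:
  assumes "uminus ` C = C" "0 \<notin> C"
  shows "card C div 2 = card (shadow C)"
proof (cases "finite C")
  case True
  have fin: "finite (shadow C)" using True by (simp add: shadow_def)
  have pos: "0 \<notin> shadow C" using assms(2) by (auto simp: shadow_def)
  have C: "C = int ` shadow C \<union> (\<lambda>i. - int i) ` shadow C"
  proof (intro equalityI subsetI)
    fix x assume "x \<in> C"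
    then have "nat \<bar>x\<bar> \<in> shadow C" by (auto simp: shadow_def)
    moreover have "x = int (nat \<bar>x\<bar>) \<or> x = - int (nat \<bar>x\<bar>)" by linarith
    ultimately show "x \<in> int ` shadow C \<union> (\<lambda>i. - int i) ` shadow C" by blast
  next
    fix x assume "x \<in> int ` shadow C \<union> (\<lambda>i. - int i) ` shadow C"
    then have "nat \<bar>x\<bar> \<in> shadow C" by auto
    then show "x \<in> C" by (subst symmetric_shadow[OF assms(1)]) simp
  qed
  have "int ` shadow C \<inter> (\<lambda>i. - int i) ` shadow C = {}"
  proof -
    have "int i \<noteq> - int j" if "i \<in> shadow C" for i j
      using that pos by (cases i) auto
    then show ?thesis by blast
  qed
  then have "card (int ` shadow C \<union> (\<lambda>i. - int i) ` shadow C) = card (shadow C) + card (shadow C)"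
    using fin by (subst card_Un_disjoint) (auto simp: card_image inj_on_def)
  then have "card C = card (shadow C) + card (shadow C)"
    using C by simp
  then show ?thesis by simp
next
  case False
  have "infinite (shadow C)"
  proof
    assume fin: "finite (shadow C)"
    have "C \<subseteq> int ` shadow C \<union> (\<lambda>i. - int i) ` shadow C"
    proof
      fix x assume "x \<in> C"
      then have "nat \<bar>x\<bar> \<in> shadow C" by (auto simp: shadow_def)
      moreover have "x = int (nat \<bar>x\<bar>) \<or> x = - int (nat \<bar>x\<bar>)" by linarith
      ultimately show "x \<in> int ` shadow C \<union> (\<lambda>i. - int i) ` shadow C" by blast
    qed
    then show False using False fin by (meson finite_UnI finite_imageI finite_subset)
  qed
  then show ?thesis using False by simp
qed

definition pos_cycles :: "nat \<Rightarrow> (int \<Rightarrow> int) \<Rightarrow> int set set" where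
  "pos_cycles n w = {c \<union> uminus ` c | c. c \<in> signed_cycles n w \<and> c \<inter> uminus ` c = {}}"

definition neg_cycles :: "nat \<Rightarrow> (int \<Rightarrow> int) \<Rightarrow> int set set" where
  "neg_cycles n w = {c \<in> signed_cycles n w. uminus ` c = c}"

definition blocks :: "nat \<Rightarrow> (int \<Rightarrow> int) \<Rightarrow> nat set set" where
  "blocks n w = orbit (abs_perm w) ` {1..n}"

lemma orbit_eq: "permutation f \<Longrightarrow> y \<in> orbit f x \<Longrightarrow> orbit f y = orbit f x"
  using orbit_cyclic_eq3[OF cyclic_on_orbit'] by metis

text \<open>Orbits are equal or disjoint, and the negative of an orbit is again an orbit.\<close>

lemma orbit_symmetric_or_disjoint:
  assumes w: "w \<in> B_group n" and "orbit w x \<inter> uminus ` orbit w x \<noteq> {}"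
  shows "uminus ` orbit w x = orbit w x"
proof -
  obtain y where "y \<in> orbit w x" "y \<in> orbit w (- x)"
    using assms(2) uminus_orbit[OF w] by auto
  then show ?thesis
    using orbit_eq[OF B_group_permutation[OF w]] uminus_orbit[OF w] by metis
qed

lemma symmetric_cycles:
  assumes "C \<in> pos_cycles n w \<union> neg_cycles n w"
  shows "uminus ` C = C"
proof -
  have "uminus ` uminus ` c = c" for c :: "int set" by (simp add: image_image)
  then show ?thesis
    using assms by (auto simp: pos_cycles_def neg_cycles_def image_Un Un_commute)
qed

lemma cycles_nonzero:
  assumes "w \<in> B_group n" "C \<in> pos_cycles n w \<union> neg_cycles n w"
  shows "0 \<notin> C"
proof -
  have "0 \<notin> c" "0 \<notin> uminus ` c" if c: "c \<in> signed_cycles n w" for c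
  proof -
    have "c \<subseteq> Omega n"
      using c permutes_orbit_subset[OF B_group_permutes[OF assms(1)]] by (auto simp: signed_cycles_def)
    then show "0 \<notin> c" "0 \<notin> uminus ` c" by (auto simp: Omega_def)
  qed
  then show ?thesis
    using assms(2) by (auto simp: pos_cycles_def neg_cycles_def)
qed

lemma inj_on_shadow: "inj_on shadow (pos_cycles n w \<union> neg_cycles n w)"
proof (rule inj_onI)
  fix C D assume "C \<in> pos_cycles n w \<union> neg_cycles n w" "D \<in> pos_cycles n w \<union> neg_cycles n w" "shadow C = shadow D"
  then show "C = D"
    using symmetric_shadow[OF symmetric_cycles] by metis
qed

text \<open>A union of two disjoint nonempty orbits is not itself an orbit.\<close>

lemma pos_neg_disjoint:
  assumes w: "w \<in> B_group n"
  shows "pos_cycles n w \<inter> neg_cycles n w = {}"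
proof (rule ccontr)
  assume "pos_cycles n w \<inter> neg_cycles n w \<noteq> {}"
  then obtain C where C: "C \<in> pos_cycles n w" "C \<in> neg_cycles n w" by blast
  then obtain y where y: "C = orbit w y" by (auto simp: neg_cycles_def signed_cycles_def)
  obtain x where x: "orbit w x \<inter> uminus ` orbit w x = {}" "orbit w x \<union> uminus ` orbit w x = orbit w y"
    using C(1) unfolding pos_cycles_def signed_cycles_def y by auto
  obtain t where t: "t \<in> orbit w x" using orbit_nonempty[of w x] by blast
  then have "orbit w x = orbit w y"
    using x(2) orbit_eq[OF B_group_permutation[OF w]] by (metis UnI1)
  then show False using x t by blast
qed

text \<open>Every cycle of \<open>abs_perm w\<close> lifts either to one negative cycle or to a pair
  of opposite cycles, so the signed cycle type is the cycle type of \<open>abs_perm w\<close> with a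
  sign attached to each block.\<close>

lemma shadow_cycles:
  assumes w: "w \<in> B_group n"
  shows "shadow ` pos_cycles n w \<union> shadow ` neg_cycles n w = blocks n w"
proof (intro equalityI subsetI)
  fix b assume "b \<in> shadow ` pos_cycles n w \<union> shadow ` neg_cycles n w"
  then obtain x where "x \<in> Omega n" "b = shadow (orbit w x)"
    by (auto simp: pos_cycles_def neg_cycles_def signed_cycles_def shadow_Un_uminus)
  then show "b \<in> blocks n w"
    using shadow_orbit[OF w] by (auto simp: blocks_def Omega_nat_abs)
next
  fix b assume "b \<in> blocks n w"
  then obtain i where i: "i \<in> {1..n}" "b = orbit (abs_perm w) i" by (auto simp: blocks_def)
  define c where "c = orbit w (int i)"
  have c: "c \<in> signed_cycles n w" "shadow c = b"
    using i Omega_int shadow_orbit[OF w, of "int i"] by (auto simp: c_def signed_cycles_def)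
  show "b \<in> shadow ` pos_cycles n w \<union> shadow ` neg_cycles n w"
  proof (cases "c \<inter> uminus ` c = {}")
    case True
    then have "c \<union> uminus ` c \<in> pos_cycles n w" using c by (auto simp: pos_cycles_def)
    then show ?thesis using c shadow_Un_uminus by blast
  next
    case False
    then have "c \<in> neg_cycles n w"
      using c orbit_symmetric_or_disjoint[OF w] by (auto simp: neg_cycles_def c_def)
    then show ?thesis using c by blast
  qed
qed

lemma finite_cycles:
  assumes w: "w \<in> B_group n"
  shows "finite (pos_cycles n w)" "finite (neg_cycles n w)"
proof -
  have f: "finite (signed_cycles n w)" by (simp add: signed_cycles_def finite_Omega)
  have "pos_cycles n w \<subseteq> (\<lambda>c. c \<union> uminus ` c) ` signed_cycles n w" by (auto simp: pos_cycles_def)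
  then show "finite (pos_cycles n w)" "finite (neg_cycles n w)"
    using f finite_subset[OF _ finite_imageI[OF f]] by (auto simp: neg_cycles_def)
qed

lemma cycle_type_prod:
  assumes w: "w \<in> B_group n"
  shows "(\<Prod>k\<in>#positive_cycle_type n w. f k) = (\<Prod>b\<in>shadow ` pos_cycles n w. f (card b))"
    and "(\<Prod>k\<in>#negative_cycle_type n w. f k) = (\<Prod>b\<in>shadow ` neg_cycles n w. (f (card b) :: 'a :: comm_monoid_mult))"
proof -
  have "(\<Prod>k\<in>#image_mset (\<lambda>C. card C div 2) (mset_set A). f k) = (\<Prod>b\<in>shadow ` A. f (card b))"
    if A: "A \<subseteq> pos_cycles n w \<union> neg_cycles n w" for A
  proof -
    have "(\<Prod>k\<in>#image_mset (\<lambda>C. card C div 2) (mset_set A). f k) = (\<Prod>C\<in>A. f (card C div 2))"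
      by (simp add: prod_unfold_prod_mset image_mset.compositionality o_def)
    also have "\<dots> = (\<Prod>C\<in>A. f (card (shadow C)))"
    proof (rule prod.cong[OF refl])
      fix C assume "C \<in> A"
      then have C: "C \<in> pos_cycles n w \<union> neg_cycles n w" using A by blast
      show "f (card C div 2) = f (card (shadow C))"
        using card_symmetric[OF symmetric_cycles[OF C] cycles_nonzero[OF w C]] by simp
    qed
    also have "\<dots> = (\<Prod>b\<in>shadow ` A. f (card b))"
      by (subst prod.reindex[OF inj_on_subset[OF inj_on_shadow A]]) simp
    finally show ?thesis .
  qed
  from this[of "pos_cycles n w"] this[of "neg_cycles n w"]
  show "(\<Prod>k\<in>#positive_cycle_type n w. f k) = (\<Prod>b\<in>shadow ` pos_cycles n w. f (card b))"
    "(\<Prod>k\<in>#negative_cycle_type n w. f k) = (\<Prod>b\<in>shadow ` neg_cycles n w. f (card b))"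
    by (simp_all add: positive_cycle_type_def negative_cycle_type_def pos_cycles_def neg_cycles_def)
qed

text \<open>Following w once around the block, the signs telescope to the sign of the value reached,
  which is i or its negative. It is i exactly if the cycle through i does not meet its
  negative.\<close>

lemma block_sign:
  assumes w: "w \<in> B_group n" and i: "i \<in> {1..n}" and b: "b = orbit (abs_perm w) i"
  shows "(\<Prod>j\<in>b. sgn (w (int j))) = (if b \<in> shadow ` pos_cycles n w then 1 else -1)"
proof -
  let ?p = "abs_perm w"
  define m where "m = funpow_dist1 ?p i i"
  have self: "i \<in> orbit ?p i" by (rule permutation_self_in_orbit[OF abs_perm_permutation[OF w]])
  have bim: "b = (\<lambda>t. (?p ^^ t) i) ` {0..<m}"
    unfolding b m_def by (rule orbit_conv_funpow_dist1[OF self])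
  have inj: "inj_on (\<lambda>t. (?p ^^ t) i) {0..<m}"
    unfolding m_def by (rule inj_on_funpow_dist1[OF self])
  have m0: "0 < m" by (simp add: m_def)
  have pm: "(?p ^^ m) i = i" unfolding m_def by (rule funpow_dist1_prop[OF self])
  define y where "y t = (w ^^ t) (int i)" for t
  have absy: "nat \<bar>y t\<bar> = (?p ^^ t) i" for t
    using abs_funpow[OF w, of t "int i"] by (simp add: y_def)
  have mem: "(?p ^^ t) i \<in> {1..n}" for t
    by (induction t) (use i abs_perm_mem[OF w] in auto)
  have ynz: "y t \<noteq> 0" for t
  proof
    assume "y t = 0"
    then have "(?p ^^ t) i = 0" using absy[of t] by simp
    then show False using mem[of t] by simp
  qed
  have sg: "sgn (w (int ((?p ^^ t) i))) = sgn (y (Suc t)) * sgn (y t)" for t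
  proof -
    have "int ((?p ^^ t) i) = \<bar>y t\<bar>" using absy[of t] by simp
    moreover have "w \<bar>y t\<bar> = sgn (y t) * y (Suc t)"
      using B_group_uminus[OF w, of "y t"] ynz[of t] by (auto simp: abs_if sgn_if y_def)
    ultimately show ?thesis
      using ynz[of t] by (auto simp: sgn_mult sgn_if)
  qed
  have tele: "(\<Prod>t<k. sgn (y (Suc t)) * sgn (y t)) = sgn (y k) * sgn (y 0)" for k
  proof (induction k)
    case 0
    then show ?case using ynz[of 0] by (simp add: sgn_if)
  next
    case (Suc k)
    have "sgn (y k) * sgn (y k) = 1" using ynz[of k] by (simp add: sgn_if)
    then show ?case using Suc by (simp add: mult_ac)
  qed
  have "(\<Prod>j\<in>b. sgn (w (int j))) = (\<Prod>t\<in>{0..<m}. sgn (w (int ((?p ^^ t) i))))"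
    unfolding bim by (subst prod.reindex[OF inj]) simp
  also have "\<dots> = sgn (y m)"
    using tele[of m] i by (simp add: sg atLeast0LessThan y_def)
  finally have prod: "(\<Prod>j\<in>b. sgn (w (int j))) = sgn (y m)" .
  have ym: "y m = int i \<or> y m = - int i"
    using absy[of m] pm by linarith
  define c where "c = orbit w (int i)"
  have ic: "int i \<in> c"
    unfolding c_def by (rule permutation_self_in_orbit[OF B_group_permutation[OF w]])
  have yc: "y t \<in> c" for t
    unfolding c_def y_def by (rule funpow_in_orbit) (use ic c_def in simp)
  have sc: "shadow c = b" "c \<in> signed_cycles n w"
    using shadow_orbit[OF w, of "int i"] i Omega_int by (auto simp: c_def b signed_cycles_def)
  show ?thesis
  proof (cases "c \<inter> uminus ` c = {}")
    case True
    then have "c \<union> uminus ` c \<in> pos_cycles n w" using sc by (auto simp: pos_cycles_def)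
    then have "b \<in> shadow ` pos_cycles n w" using sc(1) shadow_Un_uminus by blast
    moreover have "y m \<noteq> - int i"
      using yc[of m] ic True by force
    ultimately show ?thesis using prod ym i by auto
  next
    case False
    then have sym: "uminus ` c = c" unfolding c_def by (rule orbit_symmetric_or_disjoint[OF w])
    then have "c \<in> neg_cycles n w" using sc by (simp add: neg_cycles_def)
    then have "b \<notin> shadow ` pos_cycles n w"
      using sc(1) pos_neg_disjoint[OF w] inj_on_shadow[of n w] by (auto dest: inj_onD)
    \<comment> \<open>If the walk closed after m steps, the cycle would contain only one letter for
      each absolute value, and not the negative of i as well.\<close>
    moreover have "y m \<noteq> int i"
    proof
      assume "y m = int i"
      then have "c = {(w ^^ t) (int i) | t. t < m}"
        unfolding c_def by (intro orbit_altdef_bounded) (auto simp: y_def m0)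
      moreover have "- int i \<in> c" using ic sym by blast
      ultimately obtain t where t: "t < m" "y t = - int i" by (auto simp: y_def)
      then have "(?p ^^ t) i = (?p ^^ 0) i" using absy[of t] by simp
      then have "t = 0" using inj_onD[OF inj, of t 0] t(1) m0 by simp
      then show False using t(2) i by (simp add: y_def)
    qed
    ultimately show ?thesis using prod ym i by auto
  qed
qed

section \<open>Colourings constant on cycles\<close>

definition colour_sign :: "(int \<Rightarrow> int) \<Rightarrow> nat \<Rightarrow> nat \<Rightarrow> series" where
  "colour_sign w c i = (if even c \<and> w (int i) < 0 then -1 else 1)"

definition invariant_colourings :: "nat \<Rightarrow> nat \<Rightarrow> (int \<Rightarrow> int) \<Rightarrow> (nat \<Rightarrow> nat) set" where
  "invariant_colourings n K w = {g \<in> seqs n K. \<forall>i\<in>{1..n}. g (abs_perm w i) = g i}"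

text \<open>A letter y, that is, an even code, collects a sign for every barred value in the block.
  The product is -1 exactly on a negative cycle, which is the sign of the y in
  \<open>p_minus\<close>.\<close>

lemma block_product:
  assumes w: "w \<in> B_group n" and b: "b \<in> blocks n w"
  shows "(\<Prod>i\<in>b. colour_sign w c i * z c) =
    (if even c \<and> b \<notin> shadow ` pos_cycles n w then -1 else 1) * z c ^ card b"
proof -
  obtain i where i: "i \<in> {1..n}" "b = orbit (abs_perm w) i" using b by (auto simp: blocks_def)
  have sub: "b \<subseteq> {1..n}" unfolding i(2) by (rule permutes_orbit_subset[OF abs_perm_permutes[OF w] i(1)])
  have "(\<Prod>i\<in>b. colour_sign w c i) = (if even c then of_int (\<Prod>i\<in>b. sgn (w (int i))) else 1)"
  proof (cases "even c")
    case True
    have "colour_sign w c i = of_int (sgn (w (int i)))" if "i \<in> b" for i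
      using True B_group_nonzero[OF w, of i] that sub by (auto simp: colour_sign_def sgn_if)
    then show ?thesis using True by simp
  qed (simp add: colour_sign_def)
  then show ?thesis
    using block_sign[OF w i] by (simp add: prod.distrib)
qed

lemma block_const:
  assumes "\<And>i. i \<in> {1..n} \<Longrightarrow> g (abs_perm w i) = g i" "w \<in> B_group n" "i \<in> {1..n}" "j \<in> orbit (abs_perm w) i"
  shows "g j = g i"
proof -
  have "j \<in> {1..n} \<and> g j = g i"
    using assms(4)
  proof induction
    case base
    then show ?case using assms abs_perm_mem by auto
  next
    case (step y)
    then show ?case using assms(1,2) abs_perm_mem by auto
  qed
  then show ?thesis by simp
qed

lemma power_sum_letters:
  "(\<Sum>c<2*N. (if even c then s else 1) * mfps_var (letter c) ^ m :: series) = (\<Sum>i<N. x_var i ^ m + s * y_var i ^ m)"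
  by (induction N) (auto simp: letter_def add_ac)

text \<open>Multiplying out the product of power sums chooses one letter per cycle, that is, a
  colouring constant on cycles. In this form w enters only through invariance and signs, so that
  later the sum over w can be taken for a fixed colouring.\<close>

lemma agree_cycle_type:
  assumes w: "w \<in> B_group n"
  shows "agree N ((\<Prod>k\<in>#positive_cycle_type n w. p_plus k) * (\<Prod>k\<in>#negative_cycle_type n w. p_minus k))
    (\<Sum>g\<in>invariant_colourings n (2 * N) w. \<Prod>i\<in>{1..n}. colour_sign w (g i) i * mfps_var (letter (g i)))"
proof -
  let ?p = "abs_perm w" and ?z = "\<lambda>c. mfps_var (letter c) :: series"
  define F where "F b c = (\<Prod>i\<in>b. colour_sign w c i * ?z c)" for b c
  have Fb: "F b c = (if even c \<and> b \<notin> shadow ` pos_cycles n w then -1 else 1) * ?z c ^ card b"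
    if "b \<in> blocks n w" for b c
    unfolding F_def by (rule block_product[OF w that])
  have perm: "permutation ?p" by (rule abs_perm_permutation[OF w])
  have finbl: "finite (blocks n w)" by (simp add: blocks_def)
  have sub: "b \<subseteq> {1..n}" if "b \<in> blocks n w" for b
    using that permutes_orbit_subset[OF abs_perm_permutes[OF w]] unfolding blocks_def by blast
  have ne: "b \<noteq> {}" if "b \<in> blocks n w" for b
    using that orbit_nonempty[of ?p] unfolding blocks_def by blast
  have cardpos: "0 < card b" if "b \<in> blocks n w" for b
    using ne[OF that] sub[OF that] finite_subset card_gt_0_iff by blast
  have inbl: "b \<in> shadow ` pos_cycles n w \<Longrightarrow> b \<in> blocks n w" "b \<in> shadow ` neg_cycles n w \<Longrightarrow> b \<in> blocks n w" for b
    using shadow_cycles[OF w] by auto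
  have disj: "shadow ` pos_cycles n w \<inter> shadow ` neg_cycles n w = {}"
    using pos_neg_disjoint[OF w] inj_on_shadow[of n w] by (auto dest: inj_onD)
  have P: "agree N (p_plus (card b)) (\<Sum>c<2*N. F b c)" if b: "b \<in> shadow ` pos_cycles n w" for b
  proof -
    have "(\<Sum>c<2*N. F b c) = (\<Sum>c<2*N. (if even c then 1 else 1) * ?z c ^ card b)"
      unfolding Fb[OF inbl(1)[OF b]] using b by simp
    also have "\<dots> = (\<Sum>i<N. x_var i ^ card b + 1 * y_var i ^ card b)"
      by (rule power_sum_letters)
    finally show ?thesis
      using agree_p_plus[OF cardpos[OF inbl(1)[OF b]], of N] by simp
  qed
  have Q: "agree N (p_minus (card b)) (\<Sum>c<2*N. F b c)" if b: "b \<in> shadow ` neg_cycles n w" for b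
  proof -
    have "b \<notin> shadow ` pos_cycles n w" using b disj by blast
    then have "(\<Sum>c<2*N. F b c) = (\<Sum>c<2*N. (if even c then -1 else 1) * ?z c ^ card b)"
      unfolding Fb[OF inbl(2)[OF b]] by simp
    also have "\<dots> = (\<Sum>i<N. x_var i ^ card b + (-1) * y_var i ^ card b)"
      by (rule power_sum_letters)
    finally show ?thesis
      using agree_p_minus[OF cardpos[OF inbl(2)[OF b]], of N] by simp
  qed
  have "agree N ((\<Prod>k\<in>#positive_cycle_type n w. p_plus k) * (\<Prod>k\<in>#negative_cycle_type n w. p_minus k))
      ((\<Prod>b\<in>shadow ` pos_cycles n w. \<Sum>c<2*N. F b c) * (\<Prod>b\<in>shadow ` neg_cycles n w. \<Sum>c<2*N. F b c))"
    unfolding cycle_type_prod[OF w] by (intro agree_mult agree_prod P Q)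
  also have "(\<Prod>b\<in>shadow ` pos_cycles n w. \<Sum>c<2*N. F b c) * (\<Prod>b\<in>shadow ` neg_cycles n w. \<Sum>c<2*N. F b c) =
      (\<Prod>b\<in>blocks n w. \<Sum>c<2*N. F b c)"
    unfolding shadow_cycles[OF w, symmetric]
    by (rule prod.union_disjoint[symmetric]) (use disj finite_cycles[OF w] in auto)
  also have "\<dots> = (\<Sum>h\<in>blocks n w \<rightarrow>\<^sub>E {..<2*N}. \<Prod>b\<in>blocks n w. F b (h b))"
    by (rule prod_sum_PiE[OF finbl]) simp
  also have "\<dots> = (\<Sum>g\<in>invariant_colourings n (2 * N) w. \<Prod>i\<in>{1..n}. colour_sign w (g i) i * ?z (g i))"
  proof (rule sum.reindex_bij_witness[where i = "\<lambda>g. \<lambda>b\<in>blocks n w. g (SOME i. i \<in> b)" and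
        j = "\<lambda>h. \<lambda>i\<in>{1..n}. h (orbit ?p i)"])
    fix h assume h: "h \<in> blocks n w \<rightarrow>\<^sub>E {..<2*N}"
    let ?g = "\<lambda>i\<in>{1..n}. h (orbit ?p i)"
    have some: "(SOME i. i \<in> b) \<in> b" if "b \<in> blocks n w" for b
      using ne[OF that] by (simp add: some_in_eq)
    show "(\<lambda>b\<in>blocks n w. ?g (SOME i. i \<in> b)) = h"
    proof
      fix b
      show "(\<lambda>b\<in>blocks n w. ?g (SOME i. i \<in> b)) b = h b"
      proof (cases "b \<in> blocks n w")
        case True
        then obtain i where "b = orbit ?p i" by (auto simp: blocks_def)
        then have "orbit ?p (SOME i. i \<in> b) = b"
          using orbit_eq[OF perm] some[OF True] by metis
        then show ?thesis using True some[OF True] sub[OF True] by auto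
      next
        case False
        then show ?thesis using h by (auto simp: PiE_def extensional_def)
      qed
    qed
    have "orbit ?p (?p i) = orbit ?p i" for i by (rule permutation_orbit_step[OF perm])
    moreover have "?p i \<in> {1..n}" if "i \<in> {1..n}" for i using abs_perm_mem[OF w that] .
    moreover have "h (orbit ?p i) < 2 * N" if "i \<in> {1..n}" for i
      using h that by (auto simp: blocks_def PiE_def Pi_def)
    ultimately show "?g \<in> invariant_colourings n (2 * N) w"
      by (auto simp: invariant_colourings_def seqs_def)
    have "(\<Prod>i\<in>{1..n}. colour_sign w (?g i) i * ?z (?g i)) =
        (\<Prod>b\<in>blocks n w. \<Prod>i\<in>{i \<in> {1..n}. orbit ?p i = b}. colour_sign w (?g i) i * ?z (?g i))"
      by (rule prod.group[symmetric]) (auto simp: finbl blocks_def)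
    also have "\<dots> = (\<Prod>b\<in>blocks n w. F b (h b))"
      unfolding F_def
    proof (rule prod.cong[OF refl])
      fix b assume b: "b \<in> blocks n w"
      then obtain k where k: "b = orbit ?p k" by (auto simp: blocks_def)
      have e1: "orbit ?p i = b" if "i \<in> b" for i
        using that orbit_eq[OF perm] unfolding k by blast
      have e2: "i \<in> b" if "orbit ?p i = b" for i
        using permutation_self_in_orbit[OF perm, of i] that by blast
      have eq: "{i \<in> {1..n}. orbit ?p i = b} = b"
        using sub[OF b] e1 e2 by blast
      have "?g i = h b" if "i \<in> b" for i
        using e1[OF that] that sub[OF b] by auto
      then show "(\<Prod>i\<in>{i \<in> {1..n}. orbit ?p i = b}. colour_sign w (?g i) i * ?z (?g i)) =
          (\<Prod>i\<in>b. colour_sign w (h b) i * ?z (h b))"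
        unfolding eq by simp
    qed
    finally show "(\<Prod>i\<in>{1..n}. colour_sign w (?g i) i * ?z (?g i)) = (\<Prod>b\<in>blocks n w. F b (h b))" .
  next
    fix g assume "g \<in> invariant_colourings n (2 * N) w"
    then have g: "g \<in> seqs n (2 * N)" "\<And>i. i \<in> {1..n} \<Longrightarrow> g (?p i) = g i"
      by (auto simp: invariant_colourings_def)
    have some: "(SOME i. i \<in> b) \<in> b" if "b \<in> blocks n w" for b
      using ne[OF that] by (simp add: some_in_eq)
    show "(\<lambda>i\<in>{1..n}. (\<lambda>b\<in>blocks n w. g (SOME i. i \<in> b)) (orbit ?p i)) = g"
    proof
      fix i show "(\<lambda>i\<in>{1..n}. (\<lambda>b\<in>blocks n w. g (SOME i. i \<in> b)) (orbit ?p i)) i = g i"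
      proof (cases "i \<in> {1..n}")
        case True
        then have b: "orbit ?p i \<in> blocks n w" by (simp add: blocks_def)
        have "g (SOME j. j \<in> orbit ?p i) = g i"
          by (rule block_const[of n g w]) (use g(2) w True some[OF b] in auto)
        then show ?thesis
          using b True by simp
      next
        case False
        then show ?thesis using g(1) by (auto simp: seqs_def PiE_def extensional_def)
      qed
    qed
    show "(\<lambda>b\<in>blocks n w. g (SOME i. i \<in> b)) \<in> blocks n w \<rightarrow>\<^sub>E {..<2*N}"
    proof (rule PiE_I)
      fix b assume b: "b \<in> blocks n w"
      then have "(SOME i. i \<in> b) \<in> {1..n}" using some[OF b] sub[OF b] by blast
      then show "(\<lambda>b\<in>blocks n w. g (SOME i. i \<in> b)) b \<in> {..<2*N}"
        using b g(1) by (auto simp: seqs_def PiE_def Pi_def)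
    qed simp
  qed
  finally show ?thesis .
qed

section \<open>Averaging over the hyperoctahedral group\<close>

definition signed_perm :: "nat \<Rightarrow> nat set \<Rightarrow> (nat \<Rightarrow> nat) \<Rightarrow> int \<Rightarrow> int" where
  "signed_perm n s \<pi> x = (if x \<in> Omega n
     then sgn x * (if nat \<bar>x\<bar> \<in> s then -1 else 1) * int (\<pi> (nat \<bar>x\<bar>)) else x)"

lemma abs_signed_perm: "x \<in> Omega n \<Longrightarrow> \<bar>signed_perm n s \<pi> x\<bar> = int (\<pi> (nat \<bar>x\<bar>))"
  by (auto simp: signed_perm_def abs_mult Omega_def abs_sgn_eq)

lemma signed_perm_B_group:
  assumes "\<pi> permutes {1..n}"
  shows "signed_perm n s \<pi> \<in> B_group n"
proof -
  have mem: "signed_perm n s \<pi> x \<in> Omega n" if "x \<in> Omega n" for x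
    using permutes_in_image[OF assms, of "nat \<bar>x\<bar>"] that by (simp add: Omega_nat_abs abs_signed_perm)
  have "x = y" if xy: "x \<in> Omega n" "y \<in> Omega n" "signed_perm n s \<pi> x = signed_perm n s \<pi> y" for x y
  proof -
    have "\<pi> (nat \<bar>x\<bar>) = \<pi> (nat \<bar>y\<bar>)"
      using xy abs_signed_perm by (metis of_nat_eq_iff)
    then have "nat \<bar>x\<bar> = nat \<bar>y\<bar>"
      using permutes_inj[OF assms] by (simp add: inj_eq)
    then have "x = y \<or> x = - y" by linarith
    moreover have "signed_perm n s \<pi> y \<noteq> - signed_perm n s \<pi> y"
      using mem[OF xy(2)] by (auto simp: Omega_def)
    moreover have "signed_perm n s \<pi> (- y) = - signed_perm n s \<pi> y"
      using xy(2) by (simp add: signed_perm_def)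
    ultimately show ?thesis
      using xy(3) by auto
  qed
  then have "inj_on (signed_perm n s \<pi>) (Omega n)"
    by (auto intro: inj_onI)
  then have "bij_betw (signed_perm n s \<pi>) (Omega n) (Omega n)"
    unfolding bij_betw_def using endo_inj_surj[OF finite_Omega] mem by blast
  then have "signed_perm n s \<pi> permutes Omega n"
    by (rule bij_imp_permutes) (simp add: signed_perm_def)
  then show ?thesis
    by (auto simp: B_group_def) (simp add: signed_perm_def)
qed

lemma abs_perm_signed_perm:
  assumes "\<pi> permutes {1..n}"
  shows "abs_perm (signed_perm n s \<pi>) = \<pi>"
proof
  fix a show "abs_perm (signed_perm n s \<pi>) a = \<pi> a"
  proof (cases "a \<in> {1..n}")
    case True
    then show ?thesis
      using abs_signed_perm[OF Omega_int[OF True], of s \<pi>] by (simp add: abs_perm_def)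
  next
    case False
    then show ?thesis
      using abs_perm_permutes[OF signed_perm_B_group[OF assms]] assms by (simp add: permutes_def)
  qed
qed

definition negs :: "nat \<Rightarrow> (int \<Rightarrow> int) \<Rightarrow> nat set" where
  "negs n w = {i \<in> {1..n}. w (int i) < 0}"

lemma negs_signed_perm:
  assumes "\<pi> permutes {1..n}" "s \<subseteq> {1..n}"
  shows "negs n (signed_perm n s \<pi>) = s"
proof -
  have "signed_perm n s \<pi> (int i) < 0 \<longleftrightarrow> i \<in> s" if i: "i \<in> {1..n}" for i
  proof -
    have "0 < \<pi> i" using permutes_in_image[OF assms(1), of i] i by simp
    then show ?thesis using i Omega_int[OF i] by (simp add: signed_perm_def)
  qed
  then show ?thesis using assms(2) by (auto simp: negs_def)
qed

lemma signed_perm_decompose: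
  assumes w: "w \<in> B_group n"
  shows "signed_perm n (negs n w) (abs_perm w) = w"
proof (rule B_group_eqI[OF signed_perm_B_group[OF abs_perm_permutes[OF w]] w])
  fix a assume a: "a \<in> {1..n}"
  then show "signed_perm n (negs n w) (abs_perm w) (int a) = w (int a)"
    using Omega_int[OF a] by (auto simp: signed_perm_def negs_def)
qed

text \<open>An element fixing all letters outside J is given by a permutation of J and,
  independently, a set of sign changes in J; the two sums can then be evaluated separately.\<close>

lemma sum_parabolic:
  assumes J: "J \<subseteq> {1..n}"
  shows "(\<Sum>w\<in>{w \<in> B_group n. \<forall>i\<in>{1..n} - J. w (int i) = int i}. F (abs_perm w) (negs n w)) =
    (\<Sum>\<pi> | \<pi> permutes J. \<Sum>s\<in>Pow J. F \<pi> s)"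
proof -
  have "(\<Sum>w\<in>{w \<in> B_group n. \<forall>i\<in>{1..n} - J. w (int i) = int i}. F (abs_perm w) (negs n w)) =
    (\<Sum>(\<pi>, s)\<in>{\<pi>. \<pi> permutes J} \<times> Pow J. F \<pi> s)"
  proof (rule sum.reindex_bij_witness[where i = "\<lambda>(\<pi>, s). signed_perm n s \<pi>" and j = "\<lambda>w. (abs_perm w, negs n w)"])
    fix w assume "w \<in> {w \<in> B_group n. \<forall>i\<in>{1..n} - J. w (int i) = int i}"
    then have w: "w \<in> B_group n" "\<And>i. i \<in> {1..n} - J \<Longrightarrow> w (int i) = int i" by auto
    show "(case (abs_perm w, negs n w) of (\<pi>, s) \<Rightarrow> signed_perm n s \<pi>) = w"
      using signed_perm_decompose[OF w(1)] by simp
    have "abs_perm w a = a" if "a \<in> {1..n} - J" for a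
      using w(2)[OF that] by (simp add: abs_perm_def)
    then have "abs_perm w permutes J"
      using permutes_superset[OF abs_perm_permutes[OF w(1)]] by blast
    moreover have "i \<in> J" if i: "i \<in> negs n w" for i
    proof (rule ccontr)
      assume "i \<notin> J"
      then have "w (int i) = int i" using i w(2) by (auto simp: negs_def)
      then show False using i by (simp add: negs_def)
    qed
    ultimately show "(abs_perm w, negs n w) \<in> {\<pi>. \<pi> permutes J} \<times> Pow J" by auto
    show "(case (abs_perm w, negs n w) of (\<pi>, s) \<Rightarrow> F \<pi> s) = F (abs_perm w) (negs n w)" by simp
  next
    fix x assume "x \<in> {\<pi>. \<pi> permutes J} \<times> Pow J"
    then obtain \<pi> s where x: "x = (\<pi>, s)" "\<pi> permutes J" "s \<subseteq> J" by auto
    have pn: "\<pi> permutes {1..n}" using permutes_subset[OF x(2) J] .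
    have sn: "s \<subseteq> {1..n}" using x(3) J by blast
    show "(abs_perm (case x of (\<pi>, s) \<Rightarrow> signed_perm n s \<pi>), negs n (case x of (\<pi>, s) \<Rightarrow> signed_perm n s \<pi>)) = x"
      using abs_perm_signed_perm[OF pn] negs_signed_perm[OF pn sn] by (simp add: x(1))
    have "signed_perm n s \<pi> (int i) = int i" if "i \<in> {1..n} - J" for i
      using that x(2,3) Omega_int[of i n] by (auto simp: signed_perm_def permutes_def)
    then show "(case x of (\<pi>, s) \<Rightarrow> signed_perm n s \<pi>) \<in> {w \<in> B_group n. \<forall>i\<in>{1..n} - J. w (int i) = int i}"
      using signed_perm_B_group[OF pn] by (simp add: x(1))
  qed
  then show ?thesis by (simp add: sum.cartesian_product)
qed

section \<open>Orbits of colourings under permutations\<close>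

definition stab :: "nat set \<Rightarrow> (nat \<Rightarrow> nat) \<Rightarrow> (nat \<Rightarrow> nat) set" where
  "stab J g = {\<pi>. \<pi> permutes J \<and> (\<forall>i\<in>J. g (\<pi> i) = g i)}"

definition msets_below :: "nat \<Rightarrow> nat \<Rightarrow> nat multiset set" where
  "msets_below m K = {M. size M = m \<and> set_mset M \<subseteq> {..<K}}"

lemma finite_msets_below: "finite (msets_below m K)"
proof (rule finite_subset)
  show "msets_below m K \<subseteq> mset ` {xs. set xs \<subseteq> {..<K} \<and> length xs = m}"
  proof
    fix M assume M: "M \<in> msets_below m K"
    obtain xs where "mset xs = M" using ex_mset by blast
    then show "M \<in> mset ` {xs. set xs \<subseteq> {..<K} \<and> length xs = m}"
      using M by (intro image_eqI[of _ _ xs]) (auto simp: msets_below_def)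
  qed
qed (simp add: finite_lists_length_eq)

text \<open>The colourings with content M form one orbit under the permutations of J. Each
  permutation carries a reference colouring to exactly one of them, and those leading to the same
  colouring g are as many as the elements of \<open>stab J g\<close>.\<close>

lemma card_stab_fibre:
  assumes fin: "finite J" and M: "size M = card J"
  shows "(\<Sum>g\<in>{g \<in> extensional J. image_mset g (mset_set J) = M}. card (stab J g)) = fact (card J)"
proof -
  let ?G = "{g \<in> extensional J. image_mset g (mset_set J) = M}"
  obtain xs where xs: "mset xs = M" using ex_mset by blast
  obtain e where e: "bij_betw e J {0..<card J}" using ex_bij_betw_finite_nat[OF fin] by blast
  \<comment> \<open>A reference colouring with content M, obtained by listing M; the permutations
    that turn it into g form a coset of the stabilizer of g.\<close>
  define g0 where "g0 = (\<lambda>i\<in>J. xs ! e i)"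
  have len: "length xs = card J" using xs M by auto
  have "image_mset g0 (mset_set J) = image_mset (\<lambda>i. xs ! e i) (mset_set J)"
    by (rule image_mset_cong) (use fin in \<open>auto simp: g0_def\<close>)
  also have "\<dots> = image_mset ((!) xs) (image_mset e (mset_set J))"
    by (simp add: image_mset.compositionality o_def)
  also have "image_mset e (mset_set J) = mset_set {0..<card J}"
    using e by (metis bij_betw_def image_mset_mset_set)
  also have "image_mset ((!) xs) (mset_set {0..<card J}) = M"
    by (metis len map_nth mset_map mset_upt xs)
  finally have g0: "image_mset g0 (mset_set J) = M" .
  have fibre: "card {\<pi>. \<pi> permutes J \<and> (\<forall>i\<in>J. g i = g0 (\<pi> i))} = card (stab J g)" if g: "g \<in> ?G" for g
  proof -
    obtain \<pi> where p: "\<pi> permutes J" "\<forall>i\<in>J. g i = g0 (\<pi> i)"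
      using image_mset_eq_implies_permutes[OF fin, of g g0] g g0 by auto
    have "bij_betw (\<lambda>\<sigma>. \<pi> \<circ> \<sigma>) (stab J g) {\<pi>. \<pi> permutes J \<and> (\<forall>i\<in>J. g i = g0 (\<pi> i))}"
    proof (rule bij_betw_byWitness[where f' = "\<lambda>\<tau>. inv \<pi> \<circ> \<tau>"])
      show "\<forall>\<sigma>\<in>stab J g. inv \<pi> \<circ> (\<pi> \<circ> \<sigma>) = \<sigma>"
        using permutes_inverses[OF p(1)] by (auto simp: fun_eq_iff)
      show "\<forall>\<tau>\<in>{\<pi>. \<pi> permutes J \<and> (\<forall>i\<in>J. g i = g0 (\<pi> i))}. \<pi> \<circ> (inv \<pi> \<circ> \<tau>) = \<tau>"
        using permutes_inverses[OF p(1)] by (auto simp: fun_eq_iff)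
      show "(\<lambda>\<sigma>. \<pi> \<circ> \<sigma>) ` stab J g \<subseteq> {\<pi>. \<pi> permutes J \<and> (\<forall>i\<in>J. g i = g0 (\<pi> i))}"
      proof clarify
        fix \<sigma> assume "\<sigma> \<in> stab J g"
        then have "\<sigma> permutes J" "\<And>i. i \<in> J \<Longrightarrow> g (\<sigma> i) = g i" by (auto simp: stab_def)
        then show "\<pi> \<circ> \<sigma> permutes J \<and> (\<forall>i\<in>J. g i = g0 ((\<pi> \<circ> \<sigma>) i))"
          using p permutes_compose[of \<sigma> J \<pi>] permutes_in_image[of \<sigma> J] by (metis comp_apply)
      qed
      show "(\<lambda>\<tau>. inv \<pi> \<circ> \<tau>) ` {\<pi>. \<pi> permutes J \<and> (\<forall>i\<in>J. g i = g0 (\<pi> i))} \<subseteq> stab J g"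
      proof clarify
        fix \<tau> assume t: "\<tau> permutes J" "\<forall>i\<in>J. g i = g0 (\<tau> i)"
        have "inv \<pi> \<circ> \<tau> permutes J"
          using permutes_compose[OF t(1) permutes_inv[OF p(1)]] .
        moreover have "g ((inv \<pi> \<circ> \<tau>) i) = g i" if "i \<in> J" for i
        proof -
          have "(inv \<pi> \<circ> \<tau>) i \<in> J"
            using permutes_in_image[OF \<open>inv \<pi> \<circ> \<tau> permutes J\<close>] that by blast
          then have "g ((inv \<pi> \<circ> \<tau>) i) = g0 (\<pi> ((inv \<pi> \<circ> \<tau>) i))" using p(2) by blast
          also have "\<dots> = g0 (\<tau> i)" using permutes_inverses[OF p(1)] by simp
          finally show ?thesis using t(2) that by simp
        qed
        ultimately show "inv \<pi> \<circ> \<tau> \<in> stab J g" by (simp add: stab_def)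
      qed
    qed
    then show ?thesis by (simp add: bij_betw_same_card)
  qed
  have finP: "finite {\<pi>. \<pi> permutes J}" by (rule finite_permutations[OF fin])
  have finG: "finite ?G"
    by (rule finite_subset[OF _ finite_PiE[OF fin, of "\<lambda>_. set_mset M"]]) (use fin in \<open>auto simp: PiE_def\<close>)
  have "(\<Sum>g\<in>?G. card (stab J g)) = (\<Sum>g\<in>?G. card {\<pi>. \<pi> permutes J \<and> (\<forall>i\<in>J. g i = g0 (\<pi> i))})"
    using fibre by simp
  also have "\<dots> = card (\<Union>g\<in>?G. {\<pi>. \<pi> permutes J \<and> (\<forall>i\<in>J. g i = g0 (\<pi> i))})"
  proof (rule card_UN_disjoint[symmetric, OF finG])
    show "\<forall>g\<in>?G. finite {\<pi>. \<pi> permutes J \<and> (\<forall>i\<in>J. g i = g0 (\<pi> i))}"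
      using finP by (auto intro: finite_subset[of _ "{\<pi>. \<pi> permutes J}"])
    show "\<forall>g\<in>?G. \<forall>h\<in>?G. g \<noteq> h \<longrightarrow> {\<pi>. \<pi> permutes J \<and> (\<forall>i\<in>J. g i = g0 (\<pi> i))} \<inter> {\<pi>. \<pi> permutes J \<and> (\<forall>i\<in>J. h i = g0 (\<pi> i))} = {}"
    proof (intro ballI impI, rule ccontr)
      fix g h assume gh: "g \<in> ?G" "h \<in> ?G" "g \<noteq> h"
        "{\<pi>. \<pi> permutes J \<and> (\<forall>i\<in>J. g i = g0 (\<pi> i))} \<inter> {\<pi>. \<pi> permutes J \<and> (\<forall>i\<in>J. h i = g0 (\<pi> i))} \<noteq> {}"
      then have "\<forall>i\<in>J. g i = h i" by auto
      then have "g = h" using gh(1,2) by (intro extensionalityI[of g J h]) auto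
      then show False using gh(3) by simp
    qed
  qed
  also have "(\<Union>g\<in>?G. {\<pi>. \<pi> permutes J \<and> (\<forall>i\<in>J. g i = g0 (\<pi> i))}) = {\<pi>. \<pi> permutes J}"
  proof (intro equalityI subsetI)
    fix \<pi> assume "\<pi> \<in> {\<pi>. \<pi> permutes J}"
    then have p: "\<pi> permutes J" by simp
    define g where "g = (\<lambda>i\<in>J. g0 (\<pi> i))"
    have "image_mset g (mset_set J) = image_mset (\<lambda>i. g0 (\<pi> i)) (mset_set J)"
      by (rule image_mset_cong) (use fin in \<open>auto simp: g_def\<close>)
    also have "\<dots> = image_mset g0 (image_mset \<pi> (mset_set J))"
      by (simp add: image_mset.compositionality o_def)
    also have "image_mset \<pi> (mset_set J) = mset_set J"
      using permutes_image[OF p] permutes_inj_on[OF p] by (simp add: image_mset_mset_set)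
    finally have "image_mset g (mset_set J) = M" using g0 by (simp only:)
    then have "g \<in> ?G" by (simp add: g_def)
    then show "\<pi> \<in> (\<Union>g\<in>?G. {\<pi>. \<pi> permutes J \<and> (\<forall>i\<in>J. g i = g0 (\<pi> i))})"
      using p by (intro UN_I[of g]) (auto simp: g_def)
  qed auto
  also have "card {\<pi>. \<pi> permutes J} = fact (card J)"
    by (rule card_permutations[OF refl fin])
  finally show ?thesis .
qed

text \<open>Grouped by content, each monomial of degree \<open>card J\<close> receives the same
  total weight, which leaves a multiple of the complete homogeneous symmetric polynomial.\<close>

lemma sum_stab:
  fixes y :: "nat \<Rightarrow> 'a :: comm_ring_1"
  assumes fin: "finite J"
  shows "(\<Sum>g\<in>J \<rightarrow>\<^sub>E {..<K}. of_nat (card (stab J g)) * (\<Prod>i\<in>J. y (g i))) =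
    of_nat (fact (card J)) * (\<Sum>M\<in>msets_below (card J) K. \<Prod>c\<in>#M. y c)"
proof -
  have "(\<Sum>g\<in>J \<rightarrow>\<^sub>E {..<K}. of_nat (card (stab J g)) * (\<Prod>i\<in>J. y (g i))) =
      (\<Sum>M\<in>msets_below (card J) K. \<Sum>g\<in>{g \<in> J \<rightarrow>\<^sub>E {..<K}. image_mset g (mset_set J) = M}.
        of_nat (card (stab J g)) * (\<Prod>i\<in>J. y (g i)))"
    by (rule sum.group[symmetric, OF finite_PiE[OF fin] finite_msets_below])
      (use fin in \<open>auto simp: msets_below_def\<close>)
  also have "\<dots> = (\<Sum>M\<in>msets_below (card J) K. of_nat (fact (card J)) * (\<Prod>c\<in>#M. y c))"
  proof (rule sum.cong[OF refl])
    fix M assume M: "M \<in> msets_below (card J) K"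
    have e: "{g \<in> J \<rightarrow>\<^sub>E {..<K}. image_mset g (mset_set J) = M} = {g \<in> extensional J. image_mset g (mset_set J) = M}"
    proof (intro equalityI subsetI)
      fix g assume g: "g \<in> {g \<in> extensional J. image_mset g (mset_set J) = M}"
      then have "set_mset M = g ` J" using fin by auto
      then show "g \<in> {g \<in> J \<rightarrow>\<^sub>E {..<K}. image_mset g (mset_set J) = M}"
        using g M by (auto simp: msets_below_def PiE_def)
    qed (auto simp: PiE_def)
    have "(\<Sum>g\<in>{g \<in> J \<rightarrow>\<^sub>E {..<K}. image_mset g (mset_set J) = M}. of_nat (card (stab J g)) * (\<Prod>i\<in>J. y (g i))) =
        (\<Sum>g\<in>{g \<in> extensional J. image_mset g (mset_set J) = M}. of_nat (card (stab J g)) * (\<Prod>c\<in>#M. y c))"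
      unfolding e by (rule sum.cong) (auto simp: prod_unfold_prod_mset image_mset.compositionality o_def)
    also have "\<dots> = of_nat (\<Sum>g\<in>{g \<in> extensional J. image_mset g (mset_set J) = M}. card (stab J g)) * (\<Prod>c\<in>#M. y c)"
      by (simp add: sum_distrib_right)
    also have "\<dots> = of_nat (fact (card J)) * (\<Prod>c\<in>#M. y c)"
      using card_stab_fibre[OF fin, of M] M by (simp add: msets_below_def)
    finally show "(\<Sum>g\<in>{g \<in> J \<rightarrow>\<^sub>E {..<K}. image_mset g (mset_set J) = M}. of_nat (card (stab J g)) * (\<Prod>i\<in>J. y (g i))) =
        of_nat (fact (card J)) * (\<Prod>c\<in>#M. y c)" .
  qed
  finally show ?thesis by (simp add: sum_distrib_left)
qed

lemma diagram_row_shape: "diagram (conjugate (replicate m (Suc 0))) = {0} \<times> {..<m}"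
  by (simp add: diagram_conjugate is_partition_column diagram_column) auto

text \<open>A row is a weakly increasing sequence, hence the same as a multiset: the Schur
  polynomial is h_m.\<close>

lemma schurN_row_shape:
  "schurN N z (conjugate (replicate m (Suc 0))) = (\<Sum>M\<in>msets_below m N. \<Prod>c\<in>#M. z c)"
proof -
  let ?s = "conjugate (replicate m (Suc 0))"
  define row_of where "row_of T = map (\<lambda>j. T (0::nat, j)) [0..<m]" for T :: "nat \<times> nat \<Rightarrow> nat"
  have memT: "T \<in> ssytN N ?s \<longleftrightarrow> T \<in> extensional ({0} \<times> {..<m}) \<and> (\<forall>j. Suc j < m \<longrightarrow> T (0, j) \<le> T (0, Suc j)) \<and>
      (\<forall>j<m. T (0, j) < N)" for T
    unfolding ssytN_def ssyt_def diagram_row_shape by auto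
  have sorted: "sorted (row_of T)" if "T \<in> ssytN N ?s" for T
    using that unfolding memT row_of_def sorted_iff_nth_Suc by simp
  have ms: "image_mset T (mset_set ({0} \<times> {..<m})) = mset (row_of T)" for T :: "nat \<times> nat \<Rightarrow> nat"
  proof -
    have "mset_set ({0::nat} \<times> {..<m}) = image_mset (Pair 0) (mset_set {..<m})"
      by (subst image_mset_mset_set) (auto simp: inj_on_def)
    then show ?thesis
      by (simp add: row_of_def image_mset.compositionality o_def lessThan_atLeast0)
  qed
  show ?thesis
    unfolding schurN_def diagram_row_shape
  proof (rule sum.reindex_bij_witness[where
        i = "\<lambda>M. \<lambda>c\<in>{0} \<times> {..<m}. sorted_list_of_multiset M ! snd c" and
        j = "\<lambda>T. image_mset T (mset_set ({0} \<times> {..<m}))"])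
    fix T assume T: "T \<in> ssytN N ?s"
    have "sorted_list_of_multiset (mset (row_of T)) = row_of T"
      using sorted[OF T] by (simp add: sorted_sort_id)
    then show "(\<lambda>c\<in>{0} \<times> {..<m}. sorted_list_of_multiset (image_mset T (mset_set ({0} \<times> {..<m}))) ! snd c) = T"
      unfolding ms using T by (auto simp: memT fun_eq_iff row_of_def restrict_def extensional_def)
    show "image_mset T (mset_set ({0} \<times> {..<m})) \<in> msets_below m N"
      unfolding ms using T by (auto simp: memT msets_below_def row_of_def)
    show "(\<Prod>c\<in>#image_mset T (mset_set ({0} \<times> {..<m})). z c) = (\<Prod>c\<in>{0} \<times> {..<m}. z (T c))"
      by (simp add: prod_unfold_prod_mset image_mset.compositionality o_def)
  next
    fix M assume M: "M \<in> msets_below m N"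
    let ?T = "\<lambda>c\<in>{0::nat} \<times> {..<m}. sorted_list_of_multiset M ! snd c"
    have len: "length (sorted_list_of_multiset M) = m"
      using M size_mset[of "sorted_list_of_multiset M"] by (simp add: msets_below_def)
    have "row_of ?T = sorted_list_of_multiset M"
      unfolding row_of_def using len by (intro nth_equalityI) auto
    then show "image_mset ?T (mset_set ({0} \<times> {..<m})) = M"
      unfolding ms by simp
    have lt: "sorted_list_of_multiset M ! j < N" if "j < m" for j
    proof -
      have "sorted_list_of_multiset M ! j \<in> set (sorted_list_of_multiset M)" using that len by (intro nth_mem) simp
      then show ?thesis using M by (auto simp: msets_below_def)
    qed
    have "sorted_list_of_multiset M ! j \<le> sorted_list_of_multiset M ! Suc j" if "Suc j < m" for j
      using sorted_sorted_list_of_multiset[of M] that len unfolding sorted_iff_nth_Suc by simp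
    then show "?T \<in> ssytN N ?s"
      unfolding memT using lt by auto
  qed
qed

section \<open>Words fixed by signed permutations and averages over parabolic subgroups\<close>

lemma inj_words_Suc:
  "{u \<in> inj_words n. length u = Suc k} = (\<lambda>(u, a). u @ [a]) `
    Sigma {u \<in> inj_words n. length u = k} (\<lambda>u. {a \<in> Omega n. \<bar>a\<bar> \<notin> abs ` set u})" (is "?L = ?R")
proof (intro equalityI subsetI)
  fix v assume "v \<in> ?L"
  then obtain u a where v: "v = u @ [a]" "length u = k" "v \<in> inj_words n"
    by (cases v rule: rev_cases) auto
  then show "v \<in> ?R"
    by (intro image_eqI[of _ _ "(u, a)"]) (auto simp: inj_words_def)
next
  fix v assume "v \<in> ?R"
  then show "v \<in> ?L" by (auto simp: inj_words_def)
qed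

text \<open>Orbit and stabilizer in numbers: B_n is transitive on words of length k, with
  stabilizers of the order of B_(n-k). The proof counts the 2(n - k) ways to append a letter to a
  word of length k.\<close>

lemma card_inj_words:
  assumes "k \<le> n"
  shows "card {u \<in> inj_words n. length u = k} * (2 ^ (n - k) * fact (n - k)) = 2 ^ n * fact n"
  using assms
proof (induction k)
  case 0
  have "{u \<in> inj_words n. length u = 0} = {[]}" by (auto simp: inj_words_def)
  then show ?case by simp
next
  case (Suc k)
  have cnt: "card {a \<in> Omega n. \<bar>a\<bar> \<notin> abs ` set u} = 2 * (n - k)" if u: "u \<in> inj_words n" "length u = k" for u
  proof -
    define J where "J = {1..n} - (\<lambda>x. nat \<bar>x\<bar>) ` set u"
    have sub: "(\<lambda>x. nat \<bar>x\<bar>) ` set u \<subseteq> {1..n}"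
      using u Omega_nat_abs[of _ n] unfolding inj_words_def by blast
    have "card ((\<lambda>x. nat \<bar>x\<bar>) ` set u) = k"
    proof -
      have "distinct (map (\<lambda>x. nat \<bar>x\<bar>) u)"
        using u by (auto simp: inj_words_def distinct_map inj_on_def)
      from distinct_card[OF this] show ?thesis using u by simp
    qed
    then have J: "card J = n - k" "finite J"
      using sub by (simp_all add: J_def card_Diff_subset finite_subset)
    have "{a \<in> Omega n. \<bar>a\<bar> \<notin> abs ` set u} = int ` J \<union> (\<lambda>i. - int i) ` J"
    proof (intro equalityI subsetI)
      fix a assume a: "a \<in> {a \<in> Omega n. \<bar>a\<bar> \<notin> abs ` set u}"
      have "nat \<bar>a\<bar> \<in> J"
        using a unfolding J_def by (auto simp: Omega_nat_abs) (metis abs_ge_zero eq_nat_nat_iff imageI)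
      moreover have "a = int (nat \<bar>a\<bar>) \<or> a = - int (nat \<bar>a\<bar>)" by linarith
      ultimately show "a \<in> int ` J \<union> (\<lambda>i. - int i) ` J" by blast
    next
      fix a assume "a \<in> int ` J \<union> (\<lambda>i. - int i) ` J"
      then have j: "nat \<bar>a\<bar> \<in> J" by auto
      then have "a \<in> Omega n" by (simp add: J_def Omega_nat_abs)
      moreover have "\<bar>a\<bar> \<notin> abs ` set u" using j unfolding J_def by force
      ultimately show "a \<in> {a \<in> Omega n. \<bar>a\<bar> \<notin> abs ` set u}" by simp
    qed
    moreover have "int ` J \<inter> (\<lambda>i. - int i) ` J = {}"
    proof -
      have "int i \<noteq> - int j" if "i \<in> J" for i j
        using that by (cases i) (auto simp: J_def)
      then show ?thesis by blast
    qed
    ultimately show ?thesis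
      using J by (simp add: card_Un_disjoint card_image inj_on_def)
  qed
  have "card {u \<in> inj_words n. length u = Suc k} =
      card (Sigma {u \<in> inj_words n. length u = k} (\<lambda>u. {a \<in> Omega n. \<bar>a\<bar> \<notin> abs ` set u}))"
    unfolding inj_words_Suc by (rule card_image) (auto simp: inj_on_def)
  also have "\<dots> = (\<Sum>u\<in>{u \<in> inj_words n. length u = k}. card {a \<in> Omega n. \<bar>a\<bar> \<notin> abs ` set u})"
    by (rule card_SigmaI) (auto simp: finite_inj_words finite_Omega)
  also have "\<dots> = card {u \<in> inj_words n. length u = k} * (2 * (n - k))"
    using cnt by simp
  finally have "card {u \<in> inj_words n. length u = Suc k} * (2 ^ (n - Suc k) * fact (n - Suc k)) =
      card {u \<in> inj_words n. length u = k} * ((2 * 2 ^ (n - Suc k)) * ((n - k) * fact (n - Suc k)))"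
    by (simp add: mult_ac)
  also have "\<dots> = card {u \<in> inj_words n. length u = k} * (2 ^ (n - k) * fact (n - k))"
  proof -
    have "n - k = Suc (n - Suc k)" using Suc.prems by simp
    then show ?thesis by (simp only: power_Suc fact_Suc of_nat_id)
  qed
  also have "\<dots> = 2 ^ n * fact n" using Suc by simp
  finally show ?case .
qed

lemma fixed_word_iff:
  assumes "w \<in> B_group n"
  shows "map w u = u \<longleftrightarrow> (\<forall>i\<in>(\<lambda>x. nat \<bar>x\<bar>) ` set u. w (int i) = int i)"
proof -
  have "map w u = u \<longleftrightarrow> (\<forall>x\<in>set u. w x = x)"
    using map_eq_conv[of w u "\<lambda>x. x"] by simp
  moreover have "w x = x \<longleftrightarrow> w \<bar>x\<bar> = \<bar>x\<bar>" for x
    using B_group_uminus[OF assms, of x] by (cases "0 \<le> x") auto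
  ultimately show ?thesis by simp
qed

text \<open>An element fixing u fixes its k letters and is arbitrary on the others. The k fixed
  positions may carry any letters, which gives the k-th power; on the rest, summing over sign
  changes cancels every y, and summing over permutations leaves a complete homogeneous
  polynomial.\<close>

lemma fixed_word_sum:
  fixes z :: "nat \<Rightarrow> series"
  assumes u: "u \<in> inj_words n" "length u = k"
  shows "(\<Sum>w\<in>{w \<in> B_group n. map w u = u}. \<Sum>g\<in>invariant_colourings n K w.
      \<Prod>i\<in>{1..n}. colour_sign w (g i) i * z (g i)) =
    (\<Sum>c<K. z c) ^ k * (of_nat (fact (n - k)) *
      (\<Sum>M\<in>msets_below (n - k) K. \<Prod>c\<in>#M. z c * (if odd c then 2 else 0)))"
proof -
  define I where "I = (\<lambda>x. nat \<bar>x\<bar>) ` set u"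
  define J where "J = {1..n} - I"
  have I: "I \<subseteq> {1..n}" using u Omega_nat_abs[of _ n] unfolding I_def inj_words_def by blast
  have cI: "card I = k"
  proof -
    have "distinct (map (\<lambda>x. nat \<bar>x\<bar>) u)"
      using u by (auto simp: inj_words_def distinct_map inj_on_def)
    from distinct_card[OF this] show ?thesis using u by (simp add: I_def)
  qed
  have fin: "finite I" "finite J" using I finite_subset by (auto simp: J_def)
  have J: "J \<subseteq> {1..n}" "{1..n} - J = I" "I \<union> J = {1..n}" "I \<inter> J = {}" using I by (auto simp: J_def)
  have cJ: "card J = n - k" using I cI fin by (simp add: J_def card_Diff_subset)
  define sg where "sg g s = (\<Prod>i\<in>s. if even (g i) then -1 else 1 :: series)" for g :: "nat \<Rightarrow> nat" and s
  define F where "F g \<pi> s = (if \<forall>i\<in>{1..n}. g (\<pi> i) = g i then sg g s * (\<Prod>i\<in>{1..n}. z (g i)) else 0)"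
    for g :: "nat \<Rightarrow> nat" and \<pi> s
  have "(\<Sum>g\<in>invariant_colourings n K w. \<Prod>i\<in>{1..n}. colour_sign w (g i) i * z (g i)) =
      (\<Sum>g\<in>seqs n K. F g (abs_perm w) (negs n w))" for w
  proof -
    have "(\<Prod>i\<in>{1..n}. colour_sign w (g i) i) = sg g (negs n w)" for g
      unfolding sg_def by (rule prod.mono_neutral_cong_right) (auto simp: negs_def colour_sign_def)
    then have "(\<Sum>g\<in>invariant_colourings n K w. \<Prod>i\<in>{1..n}. colour_sign w (g i) i * z (g i)) =
        (\<Sum>g\<in>invariant_colourings n K w. sg g (negs n w) * (\<Prod>i\<in>{1..n}. z (g i)))"
      by (simp add: prod.distrib)
    also have "\<dots> = (\<Sum>g\<in>seqs n K. F g (abs_perm w) (negs n w))"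
      unfolding invariant_colourings_def F_def by (rule sum.inter_filter[OF finite_seqs])
    finally show ?thesis .
  qed
  moreover have "{w \<in> B_group n. map w u = u} = {w \<in> B_group n. \<forall>i\<in>{1..n} - J. w (int i) = int i}"
    unfolding J(2) I_def using fixed_word_iff by blast
  ultimately have "(\<Sum>w\<in>{w \<in> B_group n. map w u = u}. \<Sum>g\<in>invariant_colourings n K w.
      \<Prod>i\<in>{1..n}. colour_sign w (g i) i * z (g i)) =
      (\<Sum>w\<in>{w \<in> B_group n. \<forall>i\<in>{1..n} - J. w (int i) = int i}. \<Sum>g\<in>seqs n K. F g (abs_perm w) (negs n w))"
    by (simp only:)
  also have "\<dots> = (\<Sum>g\<in>seqs n K. \<Sum>w\<in>{w \<in> B_group n. \<forall>i\<in>{1..n} - J. w (int i) = int i}. F g (abs_perm w) (negs n w))"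
    by (rule sum.swap)
  also have "\<dots> = (\<Sum>g\<in>seqs n K. \<Sum>\<pi> | \<pi> permutes J. \<Sum>s\<in>Pow J. F g \<pi> s)"
    by (simp only: sum_parabolic[OF J(1)])
  also have "\<dots> = (\<Sum>g\<in>seqs n K. (\<Prod>i\<in>I. z (g i)) * (of_nat (card (stab J g)) * (\<Prod>i\<in>J. z (g i) * (if odd (g i) then 2 else 0))))"
  proof (rule sum.cong[OF refl])
    fix g :: "nat \<Rightarrow> nat"
    \<comment> \<open>Each position of J contributes 1 + 1 for an odd and -1 + 1 for an even label,
      so colourings using a y on J cancel.\<close>
    have "(\<Sum>s\<in>Pow J. sg g s) = (\<Prod>i\<in>J. (if even (g i) then -1 else 1) + 1)"
      using prod_add[OF fin(2), of "\<lambda>i. if even (g i) then -1 else 1 :: series" "\<lambda>_. 1"] by (simp add: sg_def)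
    also have "\<dots> = (\<Prod>i\<in>J. if odd (g i) then 2 else 0)"
      by (rule prod.cong) auto
    finally have ssum: "(\<Sum>s\<in>Pow J. sg g s) = (\<Prod>i\<in>J. if odd (g i) then 2 else 0)" .
    have inv: "(\<forall>i\<in>{1..n}. g (\<pi> i) = g i) \<longleftrightarrow> \<pi> \<in> stab J g" if "\<pi> permutes J" for \<pi>
      using that J(1) unfolding stab_def permutes_def by (simp, metis subsetD atLeastAtMost_iff)
    have "(\<Sum>\<pi> | \<pi> permutes J. \<Sum>s\<in>Pow J. F g \<pi> s) =
        (\<Sum>\<pi> | \<pi> permutes J. if \<pi> \<in> stab J g then (\<Sum>s\<in>Pow J. sg g s) * (\<Prod>i\<in>{1..n}. z (g i)) else 0)"
    proof (rule sum.cong[OF refl])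
      fix \<pi> assume "\<pi> \<in> {\<pi>. \<pi> permutes J}"
      then have "\<pi> permutes J" by simp
      from inv[OF this] show "(\<Sum>s\<in>Pow J. F g \<pi> s) =
          (if \<pi> \<in> stab J g then (\<Sum>s\<in>Pow J. sg g s) * (\<Prod>i\<in>{1..n}. z (g i)) else 0)"
        by (simp add: F_def sum_distrib_right)
    qed
    also have "\<dots> = of_nat (card (stab J g)) * ((\<Sum>s\<in>Pow J. sg g s) * (\<Prod>i\<in>{1..n}. z (g i)))"
    proof -
      have "{\<pi>. \<pi> permutes J} \<inter> {\<pi>. \<pi> \<in> stab J g} = stab J g" by (auto simp: stab_def)
      then show ?thesis
        using finite_permutations[OF fin(2)] by (simp add: sum.If_cases)
    qed
    also have "(\<Prod>i\<in>{1..n}. z (g i)) = (\<Prod>i\<in>I. z (g i)) * (\<Prod>i\<in>J. z (g i))"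
      unfolding J(3)[symmetric] by (rule prod.union_disjoint[OF fin J(4)])
    finally show "(\<Sum>\<pi> | \<pi> permutes J. \<Sum>s\<in>Pow J. F g \<pi> s) =
        (\<Prod>i\<in>I. z (g i)) * (of_nat (card (stab J g)) * (\<Prod>i\<in>J. z (g i) * (if odd (g i) then 2 else 0)))"
      unfolding ssum by (simp add: prod.distrib mult_ac)
  qed
  \<comment> \<open>A colouring is split into its restrictions to the fixed positions and to J,
    which vary independently.\<close>
  also have "\<dots> = (\<Sum>(a, b)\<in>(I \<rightarrow>\<^sub>E {..<K}) \<times> (J \<rightarrow>\<^sub>E {..<K}).
      (\<Prod>i\<in>I. z (a i)) * (of_nat (card (stab J b)) * (\<Prod>i\<in>J. z (b i) * (if odd (b i) then 2 else 0))))"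
  proof (rule sum.reindex_bij_witness[where i = "\<lambda>(a, b). \<lambda>i\<in>{1..n}. if i \<in> J then b i else a i" and
        j = "\<lambda>g. (restrict g I, restrict g J)"])
    fix g assume g: "g \<in> seqs n K"
    have ext: "g i = undefined" if "i \<notin> {1..n}" for i
      using g that by (auto simp: seqs_def PiE_def extensional_def)
    show "(case (restrict g I, restrict g J) of (a, b) \<Rightarrow> \<lambda>i\<in>{1..n}. if i \<in> J then b i else a i) = g"
    proof
      fix i show "(case (restrict g I, restrict g J) of (a, b) \<Rightarrow> \<lambda>i\<in>{1..n}. if i \<in> J then b i else a i) i = g i"
        using ext[of i] J(3) by (cases "i \<in> {1..n}") (auto simp del: atLeastAtMost_iff)
    qed
    show "(restrict g I, restrict g J) \<in> (I \<rightarrow>\<^sub>E {..<K}) \<times> (J \<rightarrow>\<^sub>E {..<K})"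
      using g I J(1) by (auto simp: seqs_def PiE_def Pi_def)
    have "stab J (restrict g J) = stab J g"
      using permutes_in_image[of _ J] by (auto simp: stab_def)
    then show "(case (restrict g I, restrict g J) of (a, b) \<Rightarrow>
        (\<Prod>i\<in>I. z (a i)) * (of_nat (card (stab J b)) * (\<Prod>i\<in>J. z (b i) * (if odd (b i) then 2 else 0)))) =
        (\<Prod>i\<in>I. z (g i)) * (of_nat (card (stab J g)) * (\<Prod>i\<in>J. z (g i) * (if odd (g i) then 2 else 0)))"
      by simp
  next
    fix x assume "x \<in> (I \<rightarrow>\<^sub>E {..<K}) \<times> (J \<rightarrow>\<^sub>E {..<K})"
    then obtain a b where x: "x = (a, b)" "a \<in> I \<rightarrow>\<^sub>E {..<K}" "b \<in> J \<rightarrow>\<^sub>E {..<K}" by auto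
    let ?g = "\<lambda>i\<in>{1..n}. if i \<in> J then b i else a i"
    have gI: "?g i = a i" if "i \<in> I" for i using that I J(4) by auto
    have gJ: "?g i = b i" if "i \<in> J" for i using that J(1) by auto
    have "restrict ?g I = a"
      using x(2) gI unfolding PiE_def by (intro extensionalityI[of _ I]) (simp_all only: restrict_extensional restrict_apply' Int_iff)
    moreover have "restrict ?g J = b"
      using x(3) gJ unfolding PiE_def by (intro extensionalityI[of _ J]) (simp_all only: restrict_extensional restrict_apply' Int_iff)
    ultimately show "(restrict (case x of (a, b) \<Rightarrow> \<lambda>i\<in>{1..n}. if i \<in> J then b i else a i) I,
        restrict (case x of (a, b) \<Rightarrow> \<lambda>i\<in>{1..n}. if i \<in> J then b i else a i) J) = x"
      by (simp add: x(1))
    have "?g i < K" if "i \<in> {1..n}" for i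
      using that x(2,3) J(3) by (cases "i \<in> J") (auto simp: PiE_def Pi_def J_def)
    then show "(case x of (a, b) \<Rightarrow> \<lambda>i\<in>{1..n}. if i \<in> J then b i else a i) \<in> seqs n K"
      by (simp add: x(1) seqs_def PiE_iff)
  qed
  also have "\<dots> = (\<Sum>a\<in>I \<rightarrow>\<^sub>E {..<K}. \<Prod>i\<in>I. z (a i)) *
      (\<Sum>b\<in>J \<rightarrow>\<^sub>E {..<K}. of_nat (card (stab J b)) * (\<Prod>i\<in>J. z (b i) * (if odd (b i) then 2 else 0)))"
    by (simp add: sum.cartesian_product[symmetric] sum_product)
  also have "(\<Sum>a\<in>I \<rightarrow>\<^sub>E {..<K}. \<Prod>i\<in>I. z (a i)) = (\<Sum>c<K. z c) ^ k"
    using prod_sum_PiE[OF fin(1), of "\<lambda>_. {..<K}" "\<lambda>_. z"] by (simp add: cI)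
  also have "(\<Sum>b\<in>J \<rightarrow>\<^sub>E {..<K}. of_nat (card (stab J b)) * (\<Prod>i\<in>J. z (b i) * (if odd (b i) then 2 else 0))) =
      of_nat (fact (card J)) * (\<Sum>M\<in>msets_below (card J) K. \<Prod>c\<in>#M. z c * (if odd c then 2 else 0))"
    by (rule sum_stab[OF fin(2)])
  finally show ?thesis by (simp only: cJ)
qed

text \<open>Multisets with an even label contribute zero; in the others, rounding down half of each
  label gives the indices of the x.\<close>

lemma sum_odd_msets:
  fixes z :: "nat \<Rightarrow> 'a :: comm_ring_1"
  shows "(\<Sum>M\<in>msets_below m (2 * N). \<Prod>c\<in>#M. z c * (if odd c then 2 else 0)) =
    2 ^ m * (\<Sum>M\<in>msets_below m N. \<Prod>i\<in>#M. z (2 * i + 1))"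
proof -
  let ?f = "image_mset (\<lambda>i::nat. 2 * i + 1)"
  have inj: "inj_on ?f (msets_below m N)"
    by (rule inj_on_inverseI[of _ "image_mset (\<lambda>c. c div 2)"]) (simp add: image_mset.compositionality o_def)
  have sub: "?f ` msets_below m N \<subseteq> msets_below m (2 * N)"
    by (fastforce simp: msets_below_def)
  have zero: "(\<Prod>c\<in>#M. z c * (if odd c then 2 else 0)) = 0" if M: "M \<in> msets_below m (2 * N) - ?f ` msets_below m N" for M
  proof -
    have "\<exists>c\<in>#M. even c"
    proof (rule ccontr)
      assume "\<not> (\<exists>c\<in>#M. even c)"
      then have odd: "\<forall>c\<in>#M. odd c" by blast
      define M' where "M' = image_mset (\<lambda>c. c div 2) M"
      have "?f M' = image_mset (\<lambda>c. c) M"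
        unfolding M'_def image_mset.compositionality by (rule image_mset_cong) (use odd in auto)
      moreover have "M' \<in> msets_below m N"
        using M by (auto simp: M'_def msets_below_def)
      ultimately have "M \<in> ?f ` msets_below m N" by (intro image_eqI[of _ _ M']) simp_all
      then show False using M by blast
    qed
    then obtain c where "c \<in># M" "even c" by blast
    then show ?thesis
      by (auto simp: prod_mset_zero_iff image_iff dest!: multi_member_split)
  qed
  have "(\<Sum>M\<in>msets_below m (2 * N). \<Prod>c\<in>#M. z c * (if odd c then 2 else 0)) =
      (\<Sum>M\<in>?f ` msets_below m N. \<Prod>c\<in>#M. z c * (if odd c then 2 else 0))"
    by (rule sum.mono_neutral_right[OF finite_msets_below sub]) (intro ballI, rule zero)
  also have "\<dots> = (\<Sum>M\<in>msets_below m N. \<Prod>c\<in>#?f M. z c * (if odd c then 2 else 0))"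
    by (subst sum.reindex[OF inj]) (simp add: o_def)
  also have "\<dots> = (\<Sum>M\<in>msets_below m N. 2 ^ m * (\<Prod>i\<in>#M. z (2 * i + 1)))"
  proof (rule sum.cong[OF refl])
    fix M assume M: "M \<in> msets_below m N"
    have "(\<Prod>c\<in>#?f M. z c * (if odd c then 2 else 0)) = 2 ^ size M * (\<Prod>i\<in>#M. z (2 * i + 1))"
      by (induction M) (auto simp: mult_ac)
    then show "(\<Prod>c\<in>#?f M. z c * (if odd c then 2 else 0)) = 2 ^ m * (\<Prod>i\<in>#M. z (2 * i + 1))"
      using M by (simp add: msets_below_def)
  qed
  finally show ?thesis by (simp add: sum_distrib_left)
qed

lemma ch_psi:
  "ch n (psi n) = (\<Sum>k\<le>n. (-1) ^ k * (schur x_var (conjugate (replicate k (Suc 0))) * p_plus 1 ^ (n - k)))"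
proof (rule series_eqI_agree)
  fix N
  define z where "z c = (mfps_var (letter c) :: series)" for c
  define CS where "CS w = (\<Sum>g\<in>invariant_colourings n (2 * N) w. \<Prod>i\<in>{1..n}. colour_sign w (g i) i * z (g i))" for w
  define p where "p = (\<Sum>c<2*N. z c)"
  define h where "h m = schurN N x_var (conjugate (replicate m (Suc 0)))" for m
  define W where "W k = {u \<in> inj_words n. length u = k}" for k
  have x: "z (2 * i + 1) = x_var i" for i by (simp add: z_def letter_def)
  have word: "(\<Sum>w\<in>{w \<in> B_group n. map w u = u}. CS w) = of_nat (2 ^ (n - k) * fact (n - k)) * (p ^ k * h (n - k))"
    if "u \<in> W k" for u k
  proof -
    have "(\<Sum>w\<in>{w \<in> B_group n. map w u = u}. CS w) =
        p ^ k * (of_nat (fact (n - k)) * (2 ^ (n - k) * (\<Sum>M\<in>msets_below (n - k) N. \<Prod>i\<in>#M. z (2 * i + 1))))"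
      unfolding CS_def p_def sum_odd_msets[symmetric] by (rule fixed_word_sum) (use that in \<open>auto simp: W_def\<close>)
    then show ?thesis
      unfolding x h_def schurN_row_shape by (simp add: mult_ac)
  qed
  have "agree N (ch n (psi n)) (mfps_const (1 / (2 ^ n * fact n)) * (\<Sum>w\<in>B_group n. mfps_const (psi n w) * CS w))"
    unfolding ch_def CS_def z_def by (intro agree_mult agree_refl agree_sum agree_cycle_type)
  also have "(\<Sum>w\<in>B_group n. mfps_const (psi n w) * CS w) =
      (\<Sum>w\<in>B_group n. \<Sum>k\<le>n. (-1) ^ (n - k) * (\<Sum>u\<in>W k. if map w u = u then CS w else 0))"
  proof (rule sum.cong[OF refl])
    fix w assume w: "w \<in> B_group n"
    have "(\<Sum>u\<in>W k. if map w u = u then CS w else 0) = of_nat (card (fixed_words n k w)) * CS w" for k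
    proof -
      have "W k \<inter> {u. map w u = u} = fixed_words n k w" by (auto simp: W_def fixed_words_def)
      then show ?thesis using finite_inj_words by (simp add: W_def sum.If_cases)
    qed
    moreover have "mfps_const (psi n w) = (\<Sum>k\<le>n. (-1) ^ (n - k) * of_nat (card (fixed_words n k w)) :: series)"
      unfolding psi_fixed_words[OF w] const_sum const_mult const_power const_of_nat const_uminus const_1 ..
    ultimately show "mfps_const (psi n w) * CS w =
        (\<Sum>k\<le>n. (-1) ^ (n - k) * (\<Sum>u\<in>W k. if map w u = u then CS w else 0))"
      by (simp add: sum_distrib_right mult.assoc)
  qed
  also have "\<dots> = (\<Sum>k\<le>n. (-1) ^ (n - k) * (\<Sum>u\<in>W k. \<Sum>w\<in>B_group n. if map w u = u then CS w else 0))"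
    by (subst sum.swap) (simp only: sum_distrib_left[symmetric] sum.swap[of _ "B_group n" "W _"])
  \<comment> \<open>All words of length k contribute equally. Their number times the order of
    B_(n-k) is the order of B_n, which the normalization of \<open>ch\<close> removes.\<close>
  also have "\<dots> = (\<Sum>k\<le>n. (-1) ^ (n - k) * (of_nat (2 ^ n * fact n) * (p ^ k * h (n - k))))"
  proof (rule sum.cong[OF refl])
    fix k assume k: "k \<in> {..n}"
    have "(\<Sum>u\<in>W k. \<Sum>w\<in>B_group n. if map w u = u then CS w else 0) =
        (\<Sum>u\<in>W k. of_nat (2 ^ (n - k) * fact (n - k)) * (p ^ k * h (n - k)))"
    proof (rule sum.cong[OF refl])
      fix u assume u: "u \<in> W k"
      show "(\<Sum>w\<in>B_group n. if map w u = u then CS w else 0) = of_nat (2 ^ (n - k) * fact (n - k)) * (p ^ k * h (n - k))"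
        using sum.inter_filter[OF finite_B_group[of n], where P = "\<lambda>w. map w u = u" and g = CS] word[OF u] by (rule trans[OF sym])
    qed
    also have "\<dots> = of_nat (card (W k) * (2 ^ (n - k) * fact (n - k))) * (p ^ k * h (n - k))"
      by (simp only: sum_constant of_nat_mult mult.assoc)
    also have "card (W k) * (2 ^ (n - k) * fact (n - k)) = 2 ^ n * fact n"
      unfolding W_def by (rule card_inj_words) (use k in simp)
    finally show "(-1) ^ (n - k) * (\<Sum>u\<in>W k. \<Sum>w\<in>B_group n. if map w u = u then CS w else 0) =
        (-1) ^ (n - k) * (of_nat (2 ^ n * fact n) * (p ^ k * h (n - k)))"
      by (simp only:)
  qed
  also have "\<dots> = of_nat (2 ^ n * fact n) * (\<Sum>k\<le>n. (-1) ^ (n - k) * (p ^ k * h (n - k)))"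
    by (simp only: sum_distrib_left mult.left_commute)
  also have "mfps_const (1 / (2 ^ n * fact n)) * (of_nat (2 ^ n * fact n) * (\<Sum>k\<le>n. (-1) ^ (n - k) * (p ^ k * h (n - k)))) =
      (\<Sum>k\<le>n. (-1) ^ (n - k) * (p ^ k * h (n - k)))"
  proof -
    have "mfps_const (1 / (2 ^ n * fact n)) * of_nat (2 ^ n * fact n) = (1 :: series)"
      unfolding const_of_nat[symmetric] const_mult[symmetric] by simp
    then show ?thesis by (simp only: mult.assoc[symmetric] mult_1_left)
  qed
  \<comment> \<open>From here on k counts the letters missing from the word, as in the expression on
    which \<omega>_x is evaluated.\<close>
  also have "\<dots> = (\<Sum>k\<le>n. (-1) ^ k * (h k * p ^ (n - k)))"
    by (rule sum.reindex_bij_witness[where i = "\<lambda>k. n - k" and j = "\<lambda>k. n - k"]) (auto simp: mult.commute)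
  also have "agree N \<dots> (\<Sum>k\<le>n. (-1) ^ k * (schur x_var (conjugate (replicate k (Suc 0))) * p_plus 1 ^ (n - k)))"
  proof -
    have "p = (\<Sum>i<N. x_var i ^ 1 + y_var i ^ 1)"
      using power_sum_letters[of 1 1 N] by (simp add: p_def z_def)
    then have "agree N p (p_plus 1)"
      using agree_sym[OF agree_p_plus[of 1 N]] by simp
    then show ?thesis
      unfolding h_def by (intro agree_sum agree_mult agree_power agree_refl agree_sym[OF agree_schur_x])
  qed
  finally show "agree N (ch n (psi n)) (\<Sum>k\<le>n. (-1) ^ k * (schur x_var (conjugate (replicate k (Suc 0))) * p_plus 1 ^ (n - k)))" .
qed

theorem theorem7p3:
  fixes n :: nat
  assumes "n > 0"
  shows "omega_x (ch n (psi n)) = (\<Sum>w\<in>D_set n. F_sig n (sDes n w)) \<and>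
    (\<Sum>w\<in>D_set n. F_sig n (sDes n w)) = (\<Sum>w\<in>E_set n. F_sig n (sDes n (inv w))) \<and>
    (\<Sum>w\<in>E_set n. F_sig n (sDes n (inv w))) =
      (\<Sum>(lam, mu)\<in>bipartitions n. of_nat (c_coeff lam mu) * (schur x_var lam * schur y_var mu)) \<and>
    (\<forall>\<sigma>\<in>Sigma_B n. card {w \<in> D_set n. sDes n w = \<sigma>} = card {w \<in> E_set n. sDes n (inv w) = \<sigma>})"
proof -
  let ?G = "\<Sum>k\<le>n. (-1) ^ k * (schur x_var (replicate k (Suc 0)) * p_plus 1 ^ (n - k))"
  have c: "(\<Sum>(lam, mu)\<in>bipartitions n. of_nat (c_coeff lam mu) * (schur x_var lam * schur y_var mu)) = ?G"
    by (rule c_coeff_expansion[of "\<lambda>x. x"]) auto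
  have "omega_x (ch n (psi n)) =
      (\<Sum>(lam, mu)\<in>bipartitions n. of_nat (c_coeff lam mu) * (schur x_var lam * schur y_var mu))"
    unfolding ch_psi by (rule omega_x_alternating)
  then show ?thesis
    using sum_F_sig_D_set[of n] sum_F_sig_E_set[of n] card_sDes_D_E[OF assms] c by simp
qed

end
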